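(* Suppose that $P\subset p\Sigma\subset\mathbb{R}^m$ is a convex integral polytope ($p$ a positive integer) such that $P\not\subset\partial(p\Sigma)$. Then the expected mass density of random $L^2$-normalized polynomials with Newton polytope $NP$ is given, as $N\to\infty$, by the asymptotic formulas: (1) for $z\in\mathcal{A}_P$, $$\mathbf{E}_{\nu_{NP}}\big(|f(z)|_{FS}^2\big)\sim c_0+c_1N^{-1}+c_2N^{-2}+\cdots;$$ (2) for $z\in\mathcal{R}_F^\circ$, where $F$ is a face of $P$ with $F\subset p\Sigma^\circ$, $$\mathbf{E}_{\nu_{NP}}\big(|f(z)|_{FS}^2\big)=N^{-s/2}e^{-Nb_P(z)}\big[c_0^F(z)+O(N^{-1})\big].$$ Here $c_0=\frac{p^m}{\mathrm{Vol}(P)}$, $s=\operatorname{codim}F$, $c_0^F\in C^\infty(\mathcal{R}_F^\circ)$, and $b_P$ is a positive $C^1$ function on $(\mathbb{C}^* )^m\setminus\overline{\mathcal{A}_P}$. Furthermore, the remainder estimates are uniform on compact subsets of the open regions $\mathcal{R}_F^\circ$ and of $\mathcal{A}_P$.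
   Context: $\Sigma=\{x\in\mathbb{R}^m: x_j\ge 0,\ \sum_j x_j\le 1\}$, with interior $\Sigma^\circ$; $\mathbb{C}^*=\mathbb{C}\setminus\{0\}$. A convex integral polytope is the convex hull of a finite set of points of $\mathbb{Z}^m$; $P^\circ$ is its interior in $\mathbb{R}^m$ (possibly empty), and $\mathrm{Vol}(P)$ its Euclidean volume. The moment map is $\mu(z)=\left(\frac{|z_1|^2}{1+\|z\|^2},\dots,\frac{|z_m|^2}{1+\|z\|^2}\right)$ on $(\mathbb{C}^* )^m$, and $\mathcal{A}_P=\mu^{-1}(\frac1pP^\circ)$ (empty if $P^\circ=\emptyset$, in which case (1) does not occur). For $\tau\in\mathbb{R}^m$, $e^\tau\cdot z=(e^{\tau_1}z_1,\dots,e^{\tau_m}z_m)$. Faces: the normal cone at $x\in P$ is $C_x=\{u\in\mathbb{R}^m:\langle u,x\rangle=\sup_{y\in P}\langle u,y\rangle\}$. The faces of $P$ are the equivalence classes of $x\sim y\iff C_x=C_y$ (so faces are disjoint and relatively open, and the relative interior of $P$ is a face); $C_F=C_x$ for $x\in F$; $\operatorname{codim}F=m-\dim F$. For a face $F\not\subset\partial(p\Sigma)$, $\mathcal{R}_F=\{e^\tau\cdot z:\tau\in C_F,\ z\in(\mathbb{C}^* )^m,\ p\mu(z)\in F\}$, and $\mathcal{R}_F^\circ$ is its interior. Decay function: for each $z\in(\mathbb{C}^* )^m$ there are unique $q(z)\in P$, $\tau_z\in C_{q(z)}$ with $p\mu(e^{-\tau_z/2}\cdot z)=q(z)$, and $b_P(z)=-\langle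 q(z),\tau_z\rangle+p\log\left(\frac{1+\|z\|^2}{1+\|e^{-\tau_z/2}\cdot z\|^2}\right)$. Mass: $\mathrm{Poly}(NP)$ is the space of polynomials $\sum_{\alpha\in NP\cap\mathbb{Z}^m}a_\alpha z^\alpha$, with the inner product for which the monomials $\chi_\alpha(z)=z^\alpha$ are orthogonal with $\|\chi_\alpha\|^2=\frac{(Np-|\alpha|)!\,\alpha_1!\cdots\alpha_m!}{(Np+m)!}$, $|\alpha|=\sum_j\alpha_j$. $\nu_{NP}$ is the Haar (uniform) probability measure on the unit sphere of $\mathrm{Poly}(NP)$, $\mathbf{E}_{\nu_{NP}}$ is expectation with respect to it, and for $f\in\mathrm{Poly}(NP)$, $|f(z)|_{FS}^2=\frac{|f(z)|^2}{(1+\|z\|^2)^{Np}}$.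
   Formalization: Formula (2) and the positivity of b_P are proved for P with non-empty interior P°; when P° is empty both fail (e.g. m=1, p=2, P={1}, |z|=1: b_P=0 and the expected mass grows like N^{1/2}). *)

theory Defs
  imports "HOL-Probability.Probability"
begin

section \<open>Polytopes and their faces\<close>

definition std_simplex :: "(real ^ 'n) set" where
  "std_simplex = {x. (\<forall>j. 0 \<le> x $ j) \<and> (\<Sum>j\<in>UNIV. x $ j) \<le> 1}"

definition scaled_simplex :: "nat \<Rightarrow> (real ^ 'n) set" where
  "scaled_simplex p = (\<lambda>x. real p *\<^sub>R x) ` std_simplex"

definition integral_polytope :: "(real ^ 'n) set \<Rightarrow> bool" where
  "integral_polytope P \<longleftrightarrow>
     (\<exists>V. finite V \<and> (\<forall>v\<in>V. \<forall>j. v $ j \<in> \<int>) \<and> P = convex hull V)"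

definition normal_cone :: "(real ^ 'n) set \<Rightarrow> real ^ 'n \<Rightarrow> (real ^ 'n) set" where
  "normal_cone P x = {u. u \<bullet> x = (SUP y\<in>P. u \<bullet> y)}"

text \<open>
  These are the relatively open faces: they partition \<open>P\<close>, and the relative interior of \<open>P\<close> is
  one of them.  They are not the closed faces described by the library constant \<open>face_of\<close>.
\<close>

definition open_faces :: "(real ^ 'n) set \<Rightarrow> (real ^ 'n) set set" where
  "open_faces P = P // {(x, y). x \<in> P \<and> y \<in> P \<and> normal_cone P x = normal_cone P y}"

text \<open>All the sets in the following union are equal when \<open>F\<close> is a face of \<open>P\<close>.\<close>

definition face_cone :: "(real ^ 'n) set \<Rightarrow> (real ^ 'n) set \<Rightarrow> (real ^ 'n) set" where
  "face_cone P F = (\<Union>x\<in>F. normal_cone P x)"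

definition codim :: "(real ^ 'n) set \<Rightarrow> int" where
  "codim (F :: (real ^ 'n) set) = int CARD('n) - aff_dim F"


section \<open>The moment map and the regions\<close>

definition ctorus :: "(complex ^ 'n) set" where
  "ctorus = {z. \<forall>j. z $ j \<noteq> 0}"

definition moment_map :: "complex ^ 'n \<Rightarrow> real ^ 'n" where
  "moment_map z = (\<chi> j. (cmod (z $ j))\<^sup>2 / (1 + (norm z)\<^sup>2))"

definition exp_act :: "real ^ 'n \<Rightarrow> complex ^ 'n \<Rightarrow> complex ^ 'n" where
  "exp_act \<tau> z = (\<chi> j. of_real (exp (\<tau> $ j)) * z $ j)"

definition allowed_region :: "nat \<Rightarrow> (real ^ 'n) set \<Rightarrow> (complex ^ 'n) set" where
  "allowed_region p P =
     {z \<in> ctorus. moment_map z \<in> (\<lambda>x. (1 / real p) *\<^sub>R x) ` interior P}"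

definition face_region ::
    "nat \<Rightarrow> (real ^ 'n) set \<Rightarrow> (real ^ 'n) set \<Rightarrow> (complex ^ 'n) set" where
  "face_region p P F =
     {exp_act \<tau> z | \<tau> z. \<tau> \<in> face_cone P F \<and> z \<in> ctorus \<and> real p *\<^sub>R moment_map z \<in> F}"


section \<open>The decay function\<close>

definition decay_pair :: "nat \<Rightarrow> (real ^ 'n) set \<Rightarrow> complex ^ 'n \<Rightarrow> (real ^ 'n) \<times> (real ^ 'n)" where
  "decay_pair p P z =
     (THE (q, \<tau>). q \<in> P \<and> \<tau> \<in> normal_cone P q \<and>
        real p *\<^sub>R moment_map (exp_act (- (1 / 2) *\<^sub>R \<tau>) z) = q)"

definition decay_fun :: "nat \<Rightarrow> (real ^ 'n) set \<Rightarrow> complex ^ 'n \<Rightarrow> real" where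
  "decay_fun p P z =
     (let (q, \<tau>) = decay_pair p P z
      in - (q \<bullet> \<tau>) +
         real p * ln ((1 + (norm z)\<^sup>2) / (1 + (norm (exp_act (- (1 / 2) *\<^sub>R \<tau>) z))\<^sup>2)))"


section \<open>Random polynomials with a prescribed Newton polytope\<close>

text \<open>
  Exponents are taken in \<open>nat ^ 'n\<close>, which loses no lattice points because \<open>P\<close> will always lie
  in a multiple of the standard simplex.  A polynomial in \<open>Poly(NP)\<close> is represented by its
  coefficient vector, an extensional function on \<open>exponents N P\<close>.
\<close>

definition exponents :: "nat \<Rightarrow> (real ^ 'n) set \<Rightarrow> (nat ^ 'n) set" where
  "exponents N P = {\<alpha>. (\<chi> j. real (\<alpha> $ j)) \<in> (\<lambda>x. real N *\<^sub>R x) ` P}"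

definition monomial :: "nat ^ 'n \<Rightarrow> complex ^ 'n \<Rightarrow> complex" where
  "monomial \<alpha> z = (\<Prod>j\<in>UNIV. (z $ j) ^ (\<alpha> $ j))"

definition poly_eval ::
    "nat \<Rightarrow> (real ^ 'n) set \<Rightarrow> (nat ^ 'n \<Rightarrow> complex) \<Rightarrow> complex ^ 'n \<Rightarrow> complex" where
  "poly_eval N P a z = (\<Sum>\<alpha>\<in>exponents N P. a \<alpha> * monomial \<alpha> z)"

definition monomial_norm2 :: "nat \<Rightarrow> nat \<Rightarrow> nat ^ 'n \<Rightarrow> real" where
  "monomial_norm2 p N (\<alpha> :: nat ^ 'n) =
     fact (N * p - (\<Sum>j\<in>UNIV. \<alpha> $ j)) * (\<Prod>j\<in>UNIV. fact (\<alpha> $ j)) / fact (N * p + CARD('n))"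

definition poly_inner ::
    "nat \<Rightarrow> nat \<Rightarrow> (real ^ 'n) set \<Rightarrow> (nat ^ 'n \<Rightarrow> complex) \<Rightarrow> (nat ^ 'n \<Rightarrow> complex) \<Rightarrow> complex" where
  "poly_inner p N P a b =
     (\<Sum>\<alpha>\<in>exponents N P. of_real (monomial_norm2 p N \<alpha>) * a \<alpha> * cnj (b \<alpha>))"

definition poly_norm :: "nat \<Rightarrow> nat \<Rightarrow> (real ^ 'n) set \<Rightarrow> (nat ^ 'n \<Rightarrow> complex) \<Rightarrow> real" where
  "poly_norm p N P a = sqrt (Re (poly_inner p N P a a))"

definition poly_lebesgue :: "nat \<Rightarrow> (real ^ 'n) set \<Rightarrow> (nat ^ 'n \<Rightarrow> complex) measure" where
  "poly_lebesgue N P = PiM (exponents N P) (\<lambda>_. lborel)"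

definition poly_ball :: "nat \<Rightarrow> nat \<Rightarrow> (real ^ 'n) set \<Rightarrow> (nat ^ 'n \<Rightarrow> complex) set" where
  "poly_ball p N P = {a \<in> space (poly_lebesgue N P). poly_norm p N P a \<le> 1}"

definition poly_sphere :: "nat \<Rightarrow> nat \<Rightarrow> (real ^ 'n) set \<Rightarrow> (nat ^ 'n \<Rightarrow> complex) set" where
  "poly_sphere p N P = {a \<in> space (poly_lebesgue N P). poly_norm p N P a = 1}"

definition poly_normalize ::
    "nat \<Rightarrow> nat \<Rightarrow> (real ^ 'n) set \<Rightarrow> (nat ^ 'n \<Rightarrow> complex) \<Rightarrow> (nat ^ 'n \<Rightarrow> complex)" where
  "poly_normalize p N P a = (\<lambda>\<alpha>\<in>exponents N P. a \<alpha> / of_real (poly_norm p N P a))"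

text \<open>
  The Haar probability measure on the unit sphere is the radial projection of the uniform
  distribution on the unit ball: the set \<open>E\<close> in the sphere receives the proportion of the ball
  filled by the cone over \<open>E\<close>.  A linear map preserving \<open>poly_inner\<close> preserves the ball and the
  norm, and it preserves Lebesgue measure because its determinant has modulus 1; hence this
  measure is unitarily invariant.
\<close>

definition poly_haar :: "nat \<Rightarrow> nat \<Rightarrow> (real ^ 'n) set \<Rightarrow> (nat ^ 'n \<Rightarrow> complex) measure" where
  "poly_haar p N P =
     restrict_space
       (distr (uniform_measure (poly_lebesgue N P) (poly_ball p N P))
              (poly_lebesgue N P) (poly_normalize p N P))
       (poly_sphere p N P)"

definition expected_mass :: "nat \<Rightarrow> nat \<Rightarrow> (real ^ 'n) set \<Rightarrow> complex ^ 'n \<Rightarrow> real" where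
  "expected_mass p N P z =
     (LINT a|poly_haar p N P. (cmod (poly_eval N P a z))\<^sup>2 / (1 + (norm z)\<^sup>2) ^ (N * p))"

text \<open>
  A pitfall: \<open>expected_mass\<close> is the sum of the squared moduli of the normalized monomials (with
  the factor for the metric) divided by the number of exponents, and that number grows like
  \<open>N\<close> to the power \<open>aff_dim P\<close>.  If \<open>P\<close> has empty interior, the order of growth on the region of
  a face of codimension \<open>s\<close> is therefore not \<open>N\<close> to the power \<open>- s / 2\<close> but greater by the factor
  \<open>N\<close> to the power \<open>codim P\<close>.  Moreover \<open>decay_fun p P\<close> vanishes wherever \<open>p\<close> times the moment
  map lies in \<open>P\<close>, although \<open>allowed_region p P\<close> is then empty.
\<close>


section \<open>Differentiability classes\<close>

text \<open>
  Intended for open \<open>S\<close>.  In finite dimension, continuity of all directional derivatives is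
  continuity of the derivative in operator norm, so \<open>Ck_on k f S\<close> says that \<open>f\<close> is \<open>k\<close> times
  continuously (real) differentiable on \<open>S\<close>.
\<close>

fun Ck_on :: "nat \<Rightarrow> ('a::euclidean_space \<Rightarrow> real) \<Rightarrow> 'a set \<Rightarrow> bool" where
  "Ck_on 0 f S \<longleftrightarrow> continuous_on S f"
| "Ck_on (Suc k) f S \<longleftrightarrow>
     (\<forall>x\<in>S. f differentiable (at x)) \<and>
     (\<forall>v. Ck_on k (\<lambda>x. frechet_derivative f (at x) v) S)"

definition smooth_on :: "('a::euclidean_space \<Rightarrow> real) \<Rightarrow> 'a set \<Rightarrow> bool" where
  "smooth_on f S \<longleftrightarrow> (\<forall>k. Ck_on k f S)"

end

theory Submission imports Defs
begin

text \<open>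
  Averaging over the sphere turns the expected mass into a constant times the sum of the
  multinomial weights with parameters \<open>moment_map z\<close> over the lattice points of \<open>N P\<close>. The
  constant is a ratio of two polynomials in \<open>N\<close>, by Ehrhart's theorem, and this gives the whole
  expansion on the allowed region, since there the lattice points outside \<open>N P\<close> carry an
  exponentially small weight.

  On the region of a face the multinomial law is tilted by the multiplier \<open>\<tau>\<close>. The tilt extracts
  the factor \<open>exp (- N b)\<close> and moves the mean to the point \<open>q\<close> of the face, and a tangent cone
  may then replace \<open>P\<close>. The lattice points of the cone are grouped by their values on a basis of
  the integral normal directions of the face. A local limit theorem, proved by Fourier inversion,
  shows that every group has weight \<open>N powr (- s / 2)\<close> times a Gaussian integral depending on
  \<open>q\<close>, and the tilt makes the sum over the groups converge geometrically. The point \<open>q\<close> and \<open>\<tau>\<close>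
  are smooth functions of \<open>z\<close> because the pair is the inverse of an explicit smooth map with
  positive derivative. In the coordinates \<open>ln \<bar>z\<^sub>j\<bar>\<^sup>2\<close> the decay function has
  gradient \<open>p * moment_map z - q\<close>, an envelope formula for the maximiser \<open>q\<close> of a concave function;
  since \<open>q\<close> is a Lipschitz function, the decay function is of class \<open>C\<^sup>1\<close>.
\<close>


section \<open>Differentiability classes\<close>

text \<open>The relative error \<open>1 / N\<close>, rather than an inverse square root, shapes the
  local limit theorem: the imaginary part of the centred characteristic function is of third order
  and would cost half a power, but only real parts are compared, where it appears multiplied by a
  sine of first order. The error bound is uniform in the target lattice point and grows only
  quadratically with the distance from the mean in the normal directions, so that it can be summed
  against the tilt over an infinite cone.

  The normal directions must be a basis of all integral vectors in their span. For a proper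
  sublattice of the same rank the characteristic function would have modulus one at further points
  of the period box.

  An expansion to all orders needs the lattice count to be exactly polynomial; convergence to the
  volume yields only the leading coefficient. The strong concavity of the entropy whose maximiser is
  \<open>q\<close> gives uniqueness, the Lipschitz bound and the constancy of \<open>q\<close> under
  shifts in normal directions.\<close>

lemma has_derivative_cong_open:
  assumes "open S" "x \<in> S" "\<And>y. y \<in> S \<Longrightarrow> f y = g y"
  shows "(f has_derivative f') (at x) \<longleftrightarrow> (g has_derivative f') (at x)"
proof
  show "(g has_derivative f') (at x)" if "(f has_derivative f') (at x)"
    by (rule has_derivative_transform_within_open[OF that assms])
  show "(f has_derivative f') (at x)" if "(g has_derivative f') (at x)"
    by (rule has_derivative_transform_within_open[OF that assms(1,2)]) (simp add: assms(3))
qed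

lemma Ck_on_cong:
  assumes "open S" "\<And>x. x \<in> S \<Longrightarrow> f x = g x"
  shows "Ck_on k f S \<longleftrightarrow> Ck_on k g S"
  using assms(2)
proof (induction k arbitrary: f g)
  case 0
  then show ?case by (simp cong: continuous_on_cong)
next
  case (Suc k)
  have d: "(f has_derivative f') (at x) \<longleftrightarrow> (g has_derivative f') (at x)" if "x \<in> S" for x f'
    using has_derivative_cong_open[OF assms(1) that] Suc.prems by blast
  have "frechet_derivative f (at x) = frechet_derivative g (at x)" if "x \<in> S" for x
    unfolding frechet_derivative_def using d[OF that] by simp
  then have "Ck_on k (\<lambda>x. frechet_derivative f (at x) v) S \<longleftrightarrow>
      Ck_on k (\<lambda>x. frechet_derivative g (at x) v) S" for v
    by (intro Suc.IH) auto
  moreover have "f differentiable (at x) \<longleftrightarrow> g differentiable (at x)" if "x \<in> S" for x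
    unfolding differentiable_def using d[OF that] by simp
  ultimately show ?case by auto
qed

text \<open>Derivatives at points of an open set are unique, so any explicitly known derivative may
  stand in for the choice made by \<open>frechet_derivative\<close>.\<close>

lemma Ck_on_SucI:
  assumes "open S" "\<And>x. x \<in> S \<Longrightarrow> (f has_derivative D x) (at x)" "\<And>v. Ck_on k (\<lambda>x. D x v) S"
  shows "Ck_on (Suc k) f S"
proof -
  have "frechet_derivative f (at x) = D x" if "x \<in> S" for x
    using frechet_derivative_at[OF assms(2)[OF that]] by simp
  then have "Ck_on k (\<lambda>x. frechet_derivative f (at x) v) S" for v
    using Ck_on_cong[OF assms(1), of "\<lambda>x. frechet_derivative f (at x) v" "\<lambda>x. D x v"] assms(3)
    by auto
  then show ?thesis using assms(2) by (auto simp: differentiable_def)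
qed

lemma Ck_on_subset: "Ck_on k f S \<Longrightarrow> T \<subseteq> S \<Longrightarrow> Ck_on k f T"
  by (induction k arbitrary: f) (auto intro: continuous_on_subset)

lemma Ck_on_imp_continuous: "Ck_on k f S \<Longrightarrow> continuous_on S f"
  by (cases k) (simp_all add: continuous_on_eq_continuous_within continuous_at_imp_continuous_within
      differentiable_imp_continuous_within)

lemma Ck_on_Suc_imp: "Ck_on (Suc k) f S \<Longrightarrow> Ck_on k f S"
proof (induction k arbitrary: f)
  case 0
  then show ?case using Ck_on_imp_continuous by (metis Ck_on.simps(1))
next
  case (Suc k)
  then show ?case by (metis Ck_on.simps(2))
qed

lemma Ck_on_const: "Ck_on k (\<lambda>x. c) S"
  by (induction k arbitrary: c) auto

lemma Ck_on_linear:
  assumes "bounded_linear f" "open S"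
  shows "Ck_on k f S"
proof (cases k)
  case 0
  then show ?thesis using assms linear_continuous_on by auto
next
  case (Suc j)
  show ?thesis unfolding Suc
    by (rule Ck_on_SucI[OF assms(2), where D = "\<lambda>x. f"])
      (use assms in \<open>auto intro: bounded_linear_imp_has_derivative Ck_on_const\<close>)
qed

lemma differentiable_onD:
  assumes "\<forall>x\<in>S. f differentiable (at x)" "x \<in> S"
  shows "(f has_derivative frechet_derivative f (at x)) (at x)"
  using assms by (simp add: frechet_derivative_works)

lemma Ck_on_add:
  assumes "open S" "Ck_on k f S" "Ck_on k g S"
  shows "Ck_on k (\<lambda>x. f x + g x) S"
  using assms(2,3)
proof (induction k arbitrary: f g)
  case 0
  then show ?case by (auto intro: continuous_intros)
next
  case (Suc k)
  show ?case
    by (rule Ck_on_SucI[OF assms(1), where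
          D = "\<lambda>x v. frechet_derivative f (at x) v + frechet_derivative g (at x) v"])
      (use Suc in \<open>auto intro!: has_derivative_add simp: frechet_derivative_works[symmetric]\<close>)
qed

lemma Ck_on_mult:
  assumes "open S" "Ck_on k f S" "Ck_on k g S"
  shows "Ck_on k (\<lambda>x. f x * g x) S"
  using assms(2,3)
proof (induction k arbitrary: f g)
  case 0
  then show ?case by (auto intro: continuous_intros)
next
  case (Suc k)
  have "Ck_on k (\<lambda>x. f x * frechet_derivative g (at x) v + frechet_derivative f (at x) v * g x) S" for v
    by (intro Ck_on_add[OF assms(1)] Suc.IH)
      (use Suc.prems Ck_on_Suc_imp in auto)
  moreover have "((\<lambda>x. f x * g x) has_derivative
      (\<lambda>v. f x * frechet_derivative g (at x) v + frechet_derivative f (at x) v * g x)) (at x)"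
    if "x \<in> S" for x
    using Suc.prems that by (intro has_derivative_mult differentiable_onD[of S]) auto
  ultimately show ?case
    by (intro Ck_on_SucI[OF assms(1), where
          D = "\<lambda>x v. f x * frechet_derivative g (at x) v + frechet_derivative f (at x) v * g x"])
qed

lemma Ck_on_sum:
  assumes "open S" "\<And>i. i \<in> I \<Longrightarrow> Ck_on k (f i) S"
  shows "Ck_on k (\<lambda>x. \<Sum>i\<in>I. f i x) S"
  using assms(2)
proof (induction I rule: infinite_finite_induct)
  case (insert i I)
  then show ?case using Ck_on_add[OF assms(1), of k "f i" "\<lambda>x. \<Sum>i\<in>I. f i x"] by auto
qed (auto intro: Ck_on_const)

lemma Ck_on_prod:
  assumes "open S" "\<And>i. i \<in> I \<Longrightarrow> Ck_on k (f i) S"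
  shows "Ck_on k (\<lambda>x. \<Prod>i\<in>I. f i x) S"
  using assms(2)
proof (induction I rule: infinite_finite_induct)
  case (insert i I)
  then show ?case using Ck_on_mult[OF assms(1), of k "f i" "\<lambda>x. \<Prod>i\<in>I. f i x"] by auto
qed (auto intro: Ck_on_const)

lemma Ck_on_compose:
  fixes f :: "'b::euclidean_space \<Rightarrow> real" and g :: "'a::euclidean_space \<Rightarrow> 'b"
  assumes "open S" "open T" "g ` S \<subseteq> T" "Ck_on k f T" "\<And>i. i \<in> Basis \<Longrightarrow> Ck_on k (\<lambda>x. g x \<bullet> i) S"
  shows "Ck_on k (\<lambda>x. f (g x)) S"
  using assms(4,5)
proof (induction k arbitrary: f)
  case 0
  then have "continuous_on S g"
    by (simp add: continuous_on_componentwise[of S g])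
  then show ?case using 0 assms(3) continuous_on_compose2[of T f S g] by auto
next
  case (Suc k)
  define Dg where "Dg x v = (\<Sum>i\<in>Basis. frechet_derivative (\<lambda>x. g x \<bullet> i) (at x) v *\<^sub>R i)" for x v
  have Dg: "(g has_derivative Dg x) (at x)" if "x \<in> S" for x
  proof (subst has_derivative_componentwise_within, intro ballI)
    fix i :: 'b assume i: "i \<in> Basis"
    have "Dg x v \<bullet> i = frechet_derivative (\<lambda>x. g x \<bullet> i) (at x) v" for v
      unfolding Dg_def using i by (simp add: inner_sum_left inner_Basis if_distrib sum.delta cong: if_cong)
    then show "((\<lambda>x. g x \<bullet> i) has_derivative (\<lambda>v. Dg x v \<bullet> i)) (at x)"
      using differentiable_onD[of S "\<lambda>x. g x \<bullet> i", OF _ that] Suc.prems(2)[OF i] by simp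
  qed
  have D: "((\<lambda>x. f (g x)) has_derivative (\<lambda>v. frechet_derivative f (at (g x)) (Dg x v))) (at x)"
    if "x \<in> S" for x
  proof -
    have "(f has_derivative frechet_derivative f (at (g x))) (at (g x))"
      using differentiable_onD[of T f] Suc.prems(1) that assms(3) by auto
    from has_derivative_compose[OF Dg[OF that] this] show ?thesis .
  qed
  \<comment> \<open>The direction \<open>Dg x v\<close> moves with \<open>x\<close>, while the
    induction hypothesis covers derivatives in a fixed direction only; expanding over
    \<open>Basis\<close> separates the two.\<close>
  have "frechet_derivative f (at (g x)) (Dg x v) =
      (\<Sum>i\<in>Basis. frechet_derivative (\<lambda>x. g x \<bullet> i) (at x) v * frechet_derivative f (at (g x)) i)"
    if "x \<in> S" for x v
  proof -
    have "(f has_derivative frechet_derivative f (at (g x))) (at (g x))"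
      using differentiable_onD[of T f] Suc.prems(1) that assms(3) by auto
    then have "linear (frechet_derivative f (at (g x)))"
      by (rule has_derivative_linear)
    then show ?thesis unfolding Dg_def by (simp add: linear_sum linear_scale)
  qed
  moreover have "Ck_on k (\<lambda>x. \<Sum>i\<in>Basis. frechet_derivative (\<lambda>x. g x \<bullet> i) (at x) v *
      frechet_derivative f (at (g x)) i) S" for v
  proof (intro Ck_on_sum Ck_on_mult assms(1))
    fix i :: 'b assume i: "i \<in> Basis"
    show "Ck_on k (\<lambda>x. frechet_derivative (\<lambda>x. g x \<bullet> i) (at x) v) S"
      using Suc.prems(2)[OF i] by simp
    show "Ck_on k (\<lambda>x. frechet_derivative f (at (g x)) i) S"
    proof (rule Suc.IH)
      show "Ck_on k (\<lambda>y. frechet_derivative f (at y) i) T"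
        using Suc.prems(1) by simp
      show "Ck_on k (\<lambda>x. g x \<bullet> i) S" if "i \<in> Basis" for i
        by (rule Ck_on_Suc_imp[OF Suc.prems(2)[OF that]])
    qed
  qed
  ultimately have "Ck_on k (\<lambda>x. frechet_derivative f (at (g x)) (Dg x v)) S" for v
    using Ck_on_cong[OF assms(1), of "\<lambda>x. frechet_derivative f (at (g x)) (Dg x v)"
      "\<lambda>x. \<Sum>i\<in>Basis. frechet_derivative (\<lambda>x. g x \<bullet> i) (at x) v * frechet_derivative f (at (g x)) i" k]
    by simp
  then show ?case using D by (intro Ck_on_SucI[OF assms(1),
        where D = "\<lambda>x v. frechet_derivative f (at (g x)) (Dg x v)"])
qed

text \<open>The derivative is a product of copies of \<open>inverse\<close> itself, so each
  differentiability class follows from the one below.\<close>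

lemma Ck_on_inverse_real: "Ck_on k (inverse :: real \<Rightarrow> real) (- {0})"
proof (induction k)
  case 0
  then show ?case by (auto intro: continuous_intros)
next
  case (Suc k)
  have o: "open (- {0::real})" by auto
  have "Ck_on k (\<lambda>x::real. (- inverse x) * (v * inverse x)) (- {0})" for v
    using Ck_on_mult[OF o Ck_on_mult[OF o Ck_on_const[of k "- v"] Suc] Suc]
    by (simp add: mult_ac)
  then have "Ck_on k (\<lambda>x::real. - (inverse x * v * inverse x)) (- {0})" for v
    by (simp add: mult_ac)
  then show ?case
    by (intro Ck_on_SucI[OF o, where D = "\<lambda>x h. - (inverse x * h * inverse x)"] has_derivative_inverse') auto
qed

lemma Ck_on_ln_real: "Ck_on k (ln :: real \<Rightarrow> real) {0<..}"
proof (cases k)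
  case 0
  then show ?thesis by (auto intro!: continuous_intros)
next
  case (Suc j)
  have o: "open ({0<..} :: real set)" by auto
  have "Ck_on j (\<lambda>x::real. v * inverse x) {0<..}" for v
    by (intro Ck_on_mult[OF o] Ck_on_const Ck_on_subset[OF Ck_on_inverse_real]) auto
  moreover have "(ln has_derivative (\<lambda>h. h * inverse x)) (at x)" if "x \<in> {0<..}" for x :: real
    using DERIV_ln[of x] that by (simp add: has_field_derivative_def mult.commute[of _ "inverse x"])
  ultimately show ?thesis unfolding Suc
    using Ck_on_SucI[OF o, where D = "\<lambda>x h. h * inverse x"] by blast
qed

lemma smooth_on_subset: "smooth_on f S \<Longrightarrow> T \<subseteq> S \<Longrightarrow> smooth_on f T"
  by (simp add: smooth_on_def Ck_on_subset[of _ _ S])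

lemma smooth_on_cong: "open S \<Longrightarrow> (\<And>x. x \<in> S \<Longrightarrow> f x = g x) \<Longrightarrow> smooth_on f S \<longleftrightarrow> smooth_on g S"
  by (simp add: smooth_on_def Ck_on_cong[of S f g])

lemma smooth_on_const: "smooth_on (\<lambda>x. c) S"
  by (simp add: smooth_on_def Ck_on_const)

lemma smooth_on_linear: "bounded_linear f \<Longrightarrow> open S \<Longrightarrow> smooth_on f S"
  by (simp add: smooth_on_def Ck_on_linear)

lemma smooth_on_add: "open S \<Longrightarrow> smooth_on f S \<Longrightarrow> smooth_on g S \<Longrightarrow> smooth_on (\<lambda>x. f x + g x) S"
  by (simp add: smooth_on_def Ck_on_add)

lemma smooth_on_mult: "open S \<Longrightarrow> smooth_on f S \<Longrightarrow> smooth_on g S \<Longrightarrow> smooth_on (\<lambda>x. f x * g x) S"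
  by (simp add: smooth_on_def Ck_on_mult)

lemma smooth_on_minus: "open S \<Longrightarrow> smooth_on f S \<Longrightarrow> smooth_on (\<lambda>x. - f x) S"
  using smooth_on_mult[of S "\<lambda>x. - 1" f, OF _ smooth_on_const] by simp

lemma smooth_on_diff: "open S \<Longrightarrow> smooth_on f S \<Longrightarrow> smooth_on g S \<Longrightarrow> smooth_on (\<lambda>x. f x - g x) S"
  using smooth_on_add[of S f "\<lambda>x. - g x"] smooth_on_minus[of S g] by simp

lemma smooth_on_sum: "open S \<Longrightarrow> (\<And>i. i \<in> I \<Longrightarrow> smooth_on (f i) S) \<Longrightarrow> smooth_on (\<lambda>x. \<Sum>i\<in>I. f i x) S"
  by (simp add: smooth_on_def Ck_on_sum)

lemma smooth_on_prod: "open S \<Longrightarrow> (\<And>i. i \<in> I \<Longrightarrow> smooth_on (f i) S) \<Longrightarrow> smooth_on (\<lambda>x. \<Prod>i\<in>I. f i x) S"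
  by (simp add: smooth_on_def Ck_on_prod)

lemma smooth_on_compose:
  fixes f :: "'b::euclidean_space \<Rightarrow> real" and g :: "'a::euclidean_space \<Rightarrow> 'b"
  assumes "open S" "open T" "g ` S \<subseteq> T" "smooth_on f T" "\<And>i. i \<in> Basis \<Longrightarrow> smooth_on (\<lambda>x. g x \<bullet> i) S"
  shows "smooth_on (\<lambda>x. f (g x)) S"
  unfolding smooth_on_def
proof
  fix k
  have "Ck_on k f T" using assms(4) by (simp add: smooth_on_def)
  moreover have "Ck_on k (\<lambda>x. g x \<bullet> i) S" if "i \<in> Basis" for i
    using assms(5)[OF that] by (simp add: smooth_on_def)
  ultimately show "Ck_on k (\<lambda>x. f (g x)) S" by (rule Ck_on_compose[OF assms(1-3)])
qed

lemma smooth_on_inverse: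
  assumes "open S" "smooth_on f S" "\<And>x. x \<in> S \<Longrightarrow> f x \<noteq> 0"
  shows "smooth_on (\<lambda>x. inverse (f x)) S"
proof (rule smooth_on_compose[OF assms(1), of "-{0}" f inverse])
  show "smooth_on (inverse :: real \<Rightarrow> real) (-{0})"
    using Ck_on_inverse_real by (simp add: smooth_on_def)
qed (use assms in auto)

lemma smooth_on_ln:
  assumes "open S" "smooth_on f S" "\<And>x. x \<in> S \<Longrightarrow> f x > 0"
  shows "smooth_on (\<lambda>x. ln (f x)) S"
proof (rule smooth_on_compose[OF assms(1), of "{0<..}" f ln])
  show "smooth_on (ln :: real \<Rightarrow> real) {0<..}"
    using Ck_on_ln_real by (simp add: smooth_on_def)
qed (use assms in auto)

lemma smooth_on_divide:
  "open S \<Longrightarrow> smooth_on f S \<Longrightarrow> smooth_on g S \<Longrightarrow> (\<And>x. x \<in> S \<Longrightarrow> g x \<noteq> 0) \<Longrightarrow>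
    smooth_on (\<lambda>x. f x / g x :: real) S"
  using smooth_on_mult[of S f "\<lambda>x. inverse (g x)"] smooth_on_inverse[of S g]
  by (simp add: divide_inverse)

lemma smooth_on_det:
  fixes A :: "'a::euclidean_space \<Rightarrow> real^'n^'n"
  assumes "open S" "\<And>i j. smooth_on (\<lambda>x. A x $ i $ j) S"
  shows "smooth_on (\<lambda>x. det (A x)) S"
  unfolding det_def by (intro smooth_on_sum smooth_on_mult smooth_on_prod smooth_on_const assms)

section \<open>Lattice point counting\<close>

text \<open>Agreement for large arguments is all that survives the operations used below: shifts by
  truncated subtraction and the empty index set spoil small arguments.\<close>

definition eventually_poly :: "(nat \<Rightarrow> real) \<Rightarrow> bool" where
  "eventually_poly h \<longleftrightarrow> (\<exists>Q. \<forall>\<^sub>F N in sequentially. h N = poly Q (real N))"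

lemma eventually_poly_add:
  assumes "eventually_poly f" "eventually_poly g"
  shows "eventually_poly (\<lambda>N. f N + g N)"
proof -
  obtain Q R where "\<forall>\<^sub>F N in sequentially. f N = poly Q (real N)"
    "\<forall>\<^sub>F N in sequentially. g N = poly R (real N)"
    using assms unfolding eventually_poly_def by blast
  then have "\<forall>\<^sub>F N in sequentially. f N + g N = poly (Q + R) (real N)"
    by eventually_elim simp
  then show ?thesis unfolding eventually_poly_def by blast
qed

lemma eventually_poly_sum:
  assumes "\<And>i. i \<in> I \<Longrightarrow> eventually_poly (f i)"
  shows "eventually_poly (\<lambda>N. \<Sum>i\<in>I. f i N)"
proof -
  have zero: "eventually_poly (\<lambda>N. 0)"
    unfolding eventually_poly_def by (rule exI[of _ 0]) simp
  show ?thesis using assms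
    by (induction I rule: infinite_finite_induct) (simp_all add: zero eventually_poly_add)
qed

lemma eventually_poly_cong:
  assumes "\<forall>\<^sub>F N in sequentially. f N = g N" "eventually_poly f"
  shows "eventually_poly g"
proof -
  obtain Q where "\<forall>\<^sub>F N in sequentially. f N = poly Q (real N)"
    using assms(2) unfolding eventually_poly_def by blast
  with assms(1) have "\<forall>\<^sub>F N in sequentially. g N = poly Q (real N)"
    by eventually_elim simp
  then show ?thesis unfolding eventually_poly_def by blast
qed

lemma eventually_poly_shift:
  assumes "eventually_poly f"
  shows "eventually_poly (\<lambda>N. f (N - c))"
proof -
  obtain Q N0 where Q: "\<And>N. N \<ge> N0 \<Longrightarrow> f N = poly Q (real N)"
    using assms unfolding eventually_poly_def eventually_sequentially by blast
  have "f (N - c) = poly (pcompose Q [:- real c, 1:]) (real N)" if "N \<ge> N0 + c" for N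
    using Q[of "N - c"] that by (simp add: poly_pcompose of_nat_diff)
  then show ?thesis unfolding eventually_poly_def eventually_sequentially by blast
qed

text \<open>Telescoping \<open>(1 + i) ^ Suc k - i ^ Suc k\<close> and expanding by the binomial
  theorem expresses the sum of \<open>k\<close>-th powers through sums of lower powers;
  \<open>S\<close> is the solution of that relation.\<close>

lemma sum_power_poly: "\<exists>R :: real poly. \<forall>n. (\<Sum>i\<le>n. real i ^ k) = poly R (real n)"
proof (induction k rule: less_induct)
  case (less k)
  then obtain R :: "nat \<Rightarrow> real poly"
    where R: "\<And>j n. j < k \<Longrightarrow> (\<Sum>i\<le>n. real i ^ j) = poly (R j) (real n)"
    by metis
  define S where "S = smult (1 / real (Suc k)) ([:1, 1:] ^ Suc k -
    (\<Sum>j<k. smult (real (Suc k choose j)) (R j)))"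
  have "(\<Sum>i\<le>n. real i ^ k) = poly S (real n)" for n
  proof -
    have step: "(1 + real i) ^ Suc k = real i ^ Suc k + real (Suc k) * real i ^ k +
        (\<Sum>j<k. real (Suc k choose j) * real i ^ j)" for i
    proof -
      have "(1 + real i) ^ Suc k = (\<Sum>j\<le>Suc k. real (Suc k choose j) * real i ^ j)"
        using binomial_ring[of "real i" 1 "Suc k"] by (simp add: add.commute)
      also have "\<dots> = (\<Sum>j<k. real (Suc k choose j) * real i ^ j) + real (Suc k) * real i ^ k
          + real i ^ Suc k"
        by (simp only: lessThan_Suc_atMost[symmetric] sum.lessThan_Suc binomial_n_n binomial_Suc_n
            of_nat_1 mult_1_left)
      finally show ?thesis by simp
    qed
    have "(\<Sum>i\<le>n. (1 + real i) ^ Suc k - real i ^ Suc k) = (1 + real n) ^ Suc k"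
      using sum_lessThan_telescope[of "\<lambda>i. real i ^ Suc k" "Suc n"]
      by (simp add: lessThan_Suc_atMost add.commute)
    moreover have "(\<Sum>i\<le>n. (1 + real i) ^ Suc k - real i ^ Suc k) =
        real (Suc k) * (\<Sum>i\<le>n. real i ^ k) + (\<Sum>j<k. real (Suc k choose j) * poly (R j) (real n))"
    proof -
      have "(\<Sum>i\<le>n. (1 + real i) ^ Suc k - real i ^ Suc k) =
          (\<Sum>i\<le>n. real (Suc k) * real i ^ k + (\<Sum>j<k. real (Suc k choose j) * real i ^ j))"
        by (rule sum.cong) (use step in \<open>simp_all del: power_Suc\<close>)
      also have "\<dots> = real (Suc k) * (\<Sum>i\<le>n. real i ^ k) +
          (\<Sum>j<k. \<Sum>i\<le>n. real (Suc k choose j) * real i ^ j)"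
        by (subst sum.swap) (simp add: sum.distrib sum_distrib_left)
      also have "(\<Sum>j<k. \<Sum>i\<le>n. real (Suc k choose j) * real i ^ j) =
          (\<Sum>j<k. real (Suc k choose j) * poly (R j) (real n))"
        by (rule sum.cong) (use R in \<open>simp_all add: sum_distrib_left[symmetric]\<close>)
      finally show ?thesis .
    qed
    ultimately have "real (Suc k) * (\<Sum>i\<le>n. real i ^ k) =
      (1 + real n) ^ Suc k - (\<Sum>j<k. real (Suc k choose j) * poly (R j) (real n))"
      by linarith
    moreover have "real (Suc k) * poly S (real n) =
      (1 + real n) ^ Suc k - (\<Sum>j<k. real (Suc k choose j) * poly (R j) (real n))"
      by (simp add: S_def poly_sum del: power_Suc of_nat_Suc)
    ultimately have "real (Suc k) * (\<Sum>i\<le>n. real i ^ k) = real (Suc k) * poly S (real n)"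
      by (rule trans[OF _ sym])
    then show ?thesis by (simp only: mult_left_cancel of_nat_neq_0 not_False_eq_True)
  qed
  then show ?case by blast
qed

lemma sum_poly: "\<exists>R :: real poly. \<forall>n. (\<Sum>i\<le>n. poly Q (real i)) = poly R (real n)"
proof -
  obtain R where R: "\<And>k n. (\<Sum>i\<le>n. real i ^ k) = poly (R k) (real n)"
    using sum_power_poly by metis
  have "(\<Sum>i\<le>n. poly Q (real i)) = poly (\<Sum>k\<le>degree Q. smult (coeff Q k) (R k)) (real n)" for n
    by (simp add: poly_altdef[of Q] poly_sum sum.swap[of _ _ "{..n}"] sum_distrib_left[symmetric] R)
  then show ?thesis by blast
qed

lemma eventually_poly_cumulative:
  assumes "eventually_poly f"
  shows "eventually_poly (\<lambda>N. \<Sum>i\<le>N. f i)"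
proof -
  obtain Q N0 where Q: "\<And>N. N \<ge> N0 \<Longrightarrow> f N = poly Q (real N)"
    using assms unfolding eventually_poly_def eventually_sequentially by blast
  obtain R where R: "\<And>n. (\<Sum>i\<le>n. poly Q (real i)) = poly R (real n)"
    using sum_poly by metis
  \<comment> \<open>The finitely many early terms need not follow the polynomial; their total defect
    enters as a constant.\<close>
  define d where "d = (\<Sum>i<N0. f i - poly Q (real i))"
  have "(\<Sum>i\<le>N. f i) = poly (R + [:d:]) (real N)" if "N \<ge> N0" for N
  proof -
    have "(\<Sum>i\<le>N. f i - poly Q (real i)) = d"
      unfolding d_def by (rule sum.mono_neutral_right) (use that Q in auto)
    then show ?thesis by (simp add: sum_subtractf R)
  qed
  then show ?thesis unfolding eventually_poly_def eventually_sequentially by blast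
qed

section \<open>Dickson's lemma and down-closed sets of exponents\<close>

lemma incseq_subseq_nat: "\<exists>r. strict_mono r \<and> incseq (\<lambda>n. (s :: nat \<Rightarrow> nat) (r n))"
proof -
  obtain r where r: "strict_mono r" "monoseq (\<lambda>n. s (r n))" using seq_monosub by blast
  show ?thesis
  proof (cases "incseq (\<lambda>n. s (r n))")
    case False
    then have dec: "decseq (\<lambda>n. s (r n))" using r(2) by (simp add: monoseq_iff)
    \<comment> \<open>A decreasing sequence of naturals is constant after it reaches its minimum,
      and a constant tail is weakly increasing.\<close>
    obtain n0 where n0: "\<And>n. s (r n0) \<le> s (r n)"
      using ex_has_least_nat[of "\<lambda>n. True" _ "\<lambda>n. s (r n)"] by auto
    have "s (r (n0 + n)) = s (r n0)" for n
      using decseqD[OF dec, of n0 "n0 + n"] n0[of "n0 + n"] by simp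
    moreover have "strict_mono (\<lambda>n. r (n0 + n))"
      using r(1) by (simp add: strict_mono_def)
    ultimately show ?thesis by (intro exI[of _ "\<lambda>n. r (n0 + n)"]) (auto simp: incseq_def)
  qed (use r in blast)
qed

text \<open>Monotone subsequences are extracted one coordinate at a time; coordinates treated
  earlier stay monotone along a further subsequence. The use is that some earlier term lies below a
  later one in all coordinates.\<close>

lemma dickson:
  fixes x :: "nat \<Rightarrow> 'i \<Rightarrow> nat"
  assumes "finite I"
  shows "\<exists>r. strict_mono r \<and> (\<forall>i\<in>I. incseq (\<lambda>n. x (r n) i))"
  using assms
proof (induction I)
  case empty
  then show ?case by (intro exI[of _ id]) (simp add: strict_mono_id)
next
  case (insert i I)
  then obtain r where r: "strict_mono r" "\<And>i. i \<in> I \<Longrightarrow> incseq (\<lambda>n. x (r n) i)" by blast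
  obtain t where t: "strict_mono t" "incseq (\<lambda>n. x (r (t n)) i)"
    using incseq_subseq_nat[of "\<lambda>n. x (r n) i"] by blast
  have "incseq (\<lambda>n. x (r (t n)) j)" if "j \<in> I" for j
    using r(2)[OF that] t(1) by (simp add: incseq_def strict_mono_less_eq)
  then show ?case using t r(1) strict_mono_o[OF r(1) t(1)]
    by (intro exI[of _ "\<lambda>n. r (t n)"]) (auto simp: o_def)
qed

text \<open>Vanishing outside \<open>I\<close> makes the family finite and lets the index set grow
  by a function update.\<close>

definition compositions :: "'i set \<Rightarrow> nat \<Rightarrow> ('i \<Rightarrow> nat) set" where
  "compositions I d = {f. (\<forall>i. i \<notin> I \<longrightarrow> f i = 0) \<and> sum f I = d}"

lemma finite_compositions:
  assumes "finite I"
  shows "finite (compositions I d)"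
proof (rule finite_subset)
  show "compositions I d \<subseteq> {f. \<forall>i. (i \<in> I \<longrightarrow> f i \<in> {..d}) \<and> (i \<notin> I \<longrightarrow> f i = 0)}"
  proof (clarsimp simp: compositions_def)
    fix f :: "'a \<Rightarrow> nat" and i assume "i \<in> I"
    then show "f i \<le> sum f I" using member_le_sum[of i I f] assms by simp
  qed
  show "finite {f. \<forall>i. (i \<in> I \<longrightarrow> f i \<in> {..d}) \<and> (i \<notin> I \<longrightarrow> f i = (0::nat))}"
    by (rule finite_set_of_finite_funs) (use assms in auto)
qed

text \<open>Splits off the value at \<open>a\<close>. The set \<open>D\<close> is carried along so
  that one bijection serves both the counting inside down-closed sets and, with
  \<open>D = UNIV\<close>, the multinomial theorem.\<close>

lemma bij_betw_compositions_insert: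
  assumes "finite I" "a \<notin> I"
  shows "bij_betw (\<lambda>(c, f). f(a := c)) (SIGMA c:{..N}. compositions I (N - c) \<inter> {f. f(a := c) \<in> D})
    (compositions (insert a I) N \<inter> D)"
proof (rule bij_betwI[where g = "\<lambda>f. (f a, f(a := 0))"])
  show "(\<lambda>(c, f). f(a := c)) \<in> (SIGMA c:{..N}. compositions I (N - c) \<inter> {f. f(a := c) \<in> D})
      \<rightarrow> compositions (insert a I) N \<inter> D"
  proof (rule Pi_I)
    fix x assume x: "x \<in> (SIGMA c:{..N}. compositions I (N - c) \<inter> {f. f(a := c) \<in> D})"
    obtain c f where [simp]: "x = (c, f)" by fastforce
    have "sum (f(a := c)) I = sum f I" using assms by (intro sum.cong) auto
    then show "(\<lambda>(c, f). f(a := c)) x \<in> compositions (insert a I) N \<inter> D"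
      using x assms by (auto simp: compositions_def)
  qed
  show "(\<lambda>f. (f a, f(a := 0))) \<in> compositions (insert a I) N \<inter> D
      \<rightarrow> (SIGMA c:{..N}. compositions I (N - c) \<inter> {f. f(a := c) \<in> D})"
  proof (rule Pi_I)
    fix f assume f: "f \<in> compositions (insert a I) N \<inter> D"
    have "sum (f(a := 0)) I = sum f I" using assms by (intro sum.cong) auto
    then show "(f a, f(a := 0)) \<in> (SIGMA c:{..N}. compositions I (N - c) \<inter> {f. f(a := c) \<in> D})"
      using f assms by (auto simp: compositions_def)
  qed
  show "(\<lambda>f. (f a, f(a := 0))) ((\<lambda>(c, f). f(a := c)) x) = x"
    if "x \<in> (SIGMA c:{..N}. compositions I (N - c) \<inter> {f. f(a := c) \<in> D})" for x
    using that assms by (auto simp: compositions_def fun_eq_iff)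
  show "(\<lambda>(c, f). f(a := c)) ((\<lambda>f. (f a, f(a := 0))) y) = y" for y :: "'a \<Rightarrow> nat" by simp
qed

definition down_closed :: "('i \<Rightarrow> nat) set \<Rightarrow> bool" where
  "down_closed D \<longleftrightarrow> (\<forall>f\<in>D. \<forall>g\<le>f. g \<in> D)"

text \<open>If the chain kept shrinking, there would be points \<open>g c\<close> that lie in
  \<open>D c\<close> and are lost later. Dickson's lemma finds one of them below another that is
  still present after the first was lost; downward closure then keeps the first one in, a
  contradiction. The index \<open>c0\<close> does not depend on the degree \<open>d\<close>.\<close>

lemma down_closed_chain_stable:
  fixes D :: "nat \<Rightarrow> ('i \<Rightarrow> nat) set"
  assumes I: "finite I" and down: "\<And>c. down_closed (D c)" and anti: "antimono D"
  shows "\<exists>c0. \<forall>c\<ge>c0. \<forall>d. compositions I d \<inter> D c = compositions I d \<inter> D c0"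
proof (rule ccontr)
  assume "\<not> ?thesis"
  then have "\<exists>c g. c0 \<le> c \<and> (\<forall>i. i \<notin> I \<longrightarrow> g i = 0) \<and> g \<in> D c0 \<and> g \<notin> D c" for c0
    using antimonoD[OF anti, of c0] unfolding compositions_def by blast
  then obtain nxt g where nxt: "\<And>c. c \<le> nxt c" and g: "\<And>c i. i \<notin> I \<Longrightarrow> g c i = 0"
    "\<And>c. g c \<in> D c" "\<And>c. g c \<notin> D (nxt c)"
    by metis
  define s where "s n = (nxt ^^ n) 0" for n
  have s_Suc: "s (Suc n) = nxt (s n)" for n by (simp add: s_def)
  have "incseq s" by (rule incseq_SucI) (simp add: s_Suc nxt)
  obtain r where r: "strict_mono r" "\<forall>i\<in>I. incseq (\<lambda>n. g (s (r n)) i)"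
    using dickson[OF I, of "\<lambda>n. g (s n)"] by blast
  have "g (s (r 0)) \<le> g (s (r 1))"
  proof (rule le_funI)
    fix i show "g (s (r 0)) i \<le> g (s (r 1)) i"
      using r(2) g(1) by (cases "i \<in> I") (auto simp: incseq_def)
  qed
  moreover have "Suc (r 0) \<le> r 1" using r(1) by (simp add: strict_mono_def Suc_le_eq)
  then have "s (Suc (r 0)) \<le> s (r 1)" using \<open>incseq s\<close> by (simp add: incseq_def)
  then have "g (s (r 1)) \<in> D (s (Suc (r 0)))" using g(2) antimonoD[OF anti] by blast
  ultimately have "g (s (r 0)) \<in> D (s (Suc (r 0)))" using down unfolding down_closed_def by blast
  then show False using g(3) s_Suc by simp
qed

text \<open>This is the Hilbert function of the monomials outside a monomial ideal. The slices by
  the value \<open>c\<close> at the new index decrease with \<open>c\<close> and are constant from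
  some \<open>c0\<close> on, so the count is a finite sum of shifted counts plus one cumulative
  sum.\<close>

lemma card_down_closed_eventually_poly:
  assumes "finite I" "down_closed D"
  shows "eventually_poly (\<lambda>N. real (card (compositions I N \<inter> D)))"
  using assms
proof (induction I arbitrary: D)
  case empty
  have "compositions {} N \<inter> D = {}" if "N \<ge> 1" for N :: nat
    using that by (auto simp: compositions_def)
  then have "real (card (compositions {} N \<inter> D)) = poly 0 (real N)" if "N \<ge> 1" for N :: nat
    by (simp only: that card.empty of_nat_0 poly_0)
  then show ?case unfolding eventually_poly_def eventually_sequentially
    by (intro exI[of _ 0] exI[of _ 1]) simp
next
  case (insert a I)
  define E where "E c = {f. f(a := c) \<in> D}" for c
  have le: "f(a := b) \<le> g(a := c)" if "f \<le> g" "b \<le> c" for f g :: "'a \<Rightarrow> nat" and b c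
    using that by (simp add: le_fun_def)
  have "down_closed (E c)" for c
    unfolding down_closed_def E_def
  proof (intro ballI allI impI CollectI)
    fix f g :: "'a \<Rightarrow> nat" assume "f \<in> {f. f(a := c) \<in> D}" "g \<le> f"
    then have "f(a := c) \<in> D" "g(a := c) \<le> f(a := c)" using le[of g f c c] by simp_all
    then show "g(a := c) \<in> D" using insert.prems unfolding down_closed_def by blast
  qed
  moreover have "antimono E"
  proof (rule antimonoI, rule subsetI)
    fix b c :: nat and f assume "b \<le> c" "f \<in> E c"
    then have "f(a := c) \<in> D" "f(a := b) \<le> f(a := c)" using le[of f f b c] by (simp_all add: E_def)
    then show "f \<in> E b" using insert.prems unfolding down_closed_def E_def by blast
  qed
  ultimately obtain c0 where c0: "\<And>c d. c \<ge> c0 \<Longrightarrow> compositions I d \<inter> E c = compositions I d \<inter> E c0"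
    using down_closed_chain_stable[OF insert.hyps(1), of E] by blast
  define h where "h c N = real (card (compositions I N \<inter> E c))" for c N
  have ev: "eventually_poly (h c)" for c
    unfolding h_def by (rule insert.IH) fact
  have "real (card (compositions (insert a I) N \<inter> D)) =
      (\<Sum>c<c0. h c (N - c)) + (\<Sum>i\<le>N - c0. h c0 i)" if "N \<ge> c0" for N
  proof -
    have "card (compositions (insert a I) N \<inter> D) = card (SIGMA c:{..N}. compositions I (N - c) \<inter> E c)"
      unfolding E_def by (rule bij_betw_same_card[OF bij_betw_compositions_insert[OF insert.hyps(1,2)], symmetric])
    also have "\<dots> = (\<Sum>c\<le>N. card (compositions I (N - c) \<inter> E c))"
      using finite_compositions[OF insert.hyps(1)] by (subst card_SigmaI) auto
    finally have "real (card (compositions (insert a I) N \<inter> D)) = (\<Sum>c\<le>N. h c (N - c))"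
      by (simp add: h_def)
    also have "{..N} = {..<c0} \<union> {c0..N}" using that by auto
    also have "(\<Sum>c\<in>{..<c0} \<union> {c0..N}. h c (N - c)) = (\<Sum>c<c0. h c (N - c)) + (\<Sum>c=c0..N. h c (N - c))"
      by (rule sum.union_disjoint) auto
    also have "(\<Sum>c=c0..N. h c (N - c)) = (\<Sum>i\<le>N - c0. h c0 i)"
    proof (rule sum.reindex_bij_witness[of _ "\<lambda>i. N - i" "\<lambda>c. N - c"])
      show "h c0 (N - c) = h c (N - c)" if "c \<in> {c0..N}" for c
        unfolding h_def using c0[of c] that by simp
    qed (use that in auto)
    finally show ?thesis .
  qed
  then have "\<forall>\<^sub>F N in sequentially. (\<Sum>c<c0. h c (N - c)) + (\<Sum>i\<le>N - c0. h c0 i) =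
      real (card (compositions (insert a I) N \<inter> D))"
    unfolding eventually_sequentially by (intro exI[of _ c0] allI impI) (rule sym)
  moreover have "eventually_poly (\<lambda>N. (\<Sum>c<c0. h c (N - c)) + (\<Sum>i\<le>N - c0. h c0 i))"
    by (intro eventually_poly_add eventually_poly_sum eventually_poly_shift[OF ev]
        eventually_poly_shift[OF eventually_poly_cumulative[OF ev]])
  ultimately show ?case by (rule eventually_poly_cong)
qed

section \<open>Integral vectors and representations of lattice points\<close>

definition int_vecs :: "(real ^ 'n) set" where
  "int_vecs = {x. \<forall>j. x $ j \<in> \<int>}"

lemma int_vecs_add: "x \<in> int_vecs \<Longrightarrow> y \<in> int_vecs \<Longrightarrow> x + y \<in> int_vecs"
  and int_vecs_diff: "x \<in> int_vecs \<Longrightarrow> y \<in> int_vecs \<Longrightarrow> x - y \<in> int_vecs"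
  and int_vecs_scale: "a \<in> \<int> \<Longrightarrow> x \<in> int_vecs \<Longrightarrow> a *\<^sub>R x \<in> int_vecs"
  and int_vecs_0: "0 \<in> int_vecs"
  by (auto simp: int_vecs_def)

lemma int_vecs_sum: "(\<And>i. i \<in> I \<Longrightarrow> f i \<in> int_vecs) \<Longrightarrow> (\<Sum>i\<in>I. f i) \<in> int_vecs"
  by (induction I rule: infinite_finite_induct) (auto simp: int_vecs_add int_vecs_0)

lemma finite_int_vecs_bounded:
  assumes "bounded (S :: (real ^ 'n) set)"
  shows "finite (int_vecs \<inter> S)"
proof -
  obtain R where R: "\<And>x. x \<in> S \<Longrightarrow> norm x \<le> R" using assms bounded_iff by blast
  define h where "h x j = \<lfloor>x $ j\<rfloor>" for x :: "real^'n" and j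
  have "inj_on h int_vecs"
  proof (rule inj_onI)
    fix x y :: "real^'n" assume xy: "x \<in> int_vecs" "y \<in> int_vecs" "h x = h y"
    have "x $ j = y $ j" for j
    proof -
      have "of_int \<lfloor>x $ j\<rfloor> = x $ j" "of_int \<lfloor>y $ j\<rfloor> = y $ j"
        using xy(1,2) by (auto simp: int_vecs_def)
      moreover have "\<lfloor>x $ j\<rfloor> = \<lfloor>y $ j\<rfloor>" using fun_cong[OF xy(3), of j] by (simp add: h_def)
      ultimately show ?thesis by metis
    qed
    then show "x = y" by (simp add: vec_eq_iff)
  qed
  moreover have "h ` (int_vecs \<inter> S) \<subseteq> Pi\<^sub>E UNIV (\<lambda>_. {\<lfloor>-R\<rfloor>..\<lfloor>R\<rfloor>})"
  proof (rule image_subsetI, rule PiE_I)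
    fix x :: "real^'n" and j assume "x \<in> int_vecs \<inter> S"
    then have "\<bar>x $ j\<bar> \<le> R" using R component_le_norm_cart[of x j] order_trans by blast
    then have "\<lfloor>- R\<rfloor> \<le> \<lfloor>x $ j\<rfloor>" "\<lfloor>x $ j\<rfloor> \<le> \<lfloor>R\<rfloor>"
      by (auto intro!: floor_mono)
    then show "h x j \<in> {\<lfloor>- R\<rfloor>..\<lfloor>R\<rfloor>}" by (simp only: h_def atLeastAtMost_iff)
  qed simp
  moreover have "finite (Pi\<^sub>E (UNIV :: 'n set) (\<lambda>_. {\<lfloor>-R\<rfloor>..\<lfloor>R\<rfloor>}))"
    by (intro finite_PiE) auto
  ultimately show ?thesis
    by (meson finite_imageD finite_subset inj_on_subset Int_lower1)
qed

text \<open>\<open>rk\<close> serves as an enumeration of \<open>V\<close>. A lexicographic order is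
  chosen because adding one vector to both sides preserves it, which makes the exponents of least
  representations downward closed.\<close>

definition lex_less :: "('v \<Rightarrow> nat) \<Rightarrow> 'v set \<Rightarrow> ('v \<Rightarrow> nat) \<Rightarrow> ('v \<Rightarrow> nat) \<Rightarrow> bool" where
  "lex_less rk V m n \<longleftrightarrow> (\<exists>v\<in>V. m v < n v \<and> (\<forall>w\<in>V. rk w < rk v \<longrightarrow> m w = n w))"

lemma lex_less_trans:
  assumes inj: "inj_on rk V" and "lex_less rk V x y" "lex_less rk V y z"
  shows "lex_less rk V x z"
proof -
  obtain v where v: "v \<in> V" "x v < y v" "\<And>w. w \<in> V \<Longrightarrow> rk w < rk v \<Longrightarrow> x w = y w"
    using assms(2) unfolding lex_less_def by blast
  obtain u where u: "u \<in> V" "y u < z u" "\<And>w. w \<in> V \<Longrightarrow> rk w < rk u \<Longrightarrow> y w = z w"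
    using assms(3) unfolding lex_less_def by blast
  show ?thesis
  proof (cases "rk v < rk u")
    case True
    then show ?thesis unfolding lex_less_def
      using v u(3) by (intro bexI[of _ v]) auto
  next
    case False
    then have "rk u < rk v \<or> u = v" using inj u(1) v(1) by (meson inj_onD linorder_neqE_nat)
    then show ?thesis unfolding lex_less_def
    proof
      assume "rk u < rk v"
      then show "\<exists>v\<in>V. x v < z v \<and> (\<forall>w\<in>V. rk w < rk v \<longrightarrow> x w = z w)"
        using v u by (intro bexI[of _ u]) auto
    next
      assume "u = v"
      then show "\<exists>v\<in>V. x v < z v \<and> (\<forall>w\<in>V. rk w < rk v \<longrightarrow> x w = z w)"
        using v u by (intro bexI[of _ u]) auto
    qed
  qed
qed

lemma lex_less_total:
  assumes inj: "inj_on rk V" and "\<exists>v\<in>V. m v \<noteq> n v"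
  shows "lex_less rk V m n \<or> lex_less rk V n m"
proof -
  obtain v where v: "v \<in> V" "m v \<noteq> n v" "\<And>w. w \<in> V \<Longrightarrow> m w \<noteq> n w \<Longrightarrow> rk v \<le> rk w"
    using ex_has_least_nat[of "\<lambda>v. v \<in> V \<and> m v \<noteq> n v" _ rk] assms(2) by blast
  then have "\<forall>w\<in>V. rk w < rk v \<longrightarrow> m w = n w" by force
  then show ?thesis using v(1,2) unfolding lex_less_def by (metis linorder_neqE_nat)
qed

text \<open>The first component of \<open>b\<close> is the degree of the base point. It does not
  affect the value, but together with the sum of \<open>n\<close> it must give the dilation factor
  \<open>N\<close>.\<close>

definition rep_val :: "(real^'n) set \<Rightarrow> nat \<times> (real^'n) \<Rightarrow> (real^'n \<Rightarrow> nat) \<Rightarrow> real^'n" where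
  "rep_val V b n = snd b + (\<Sum>v\<in>V. real (n v) *\<^sub>R v)"

text \<open>The scaled barycentric coordinates sum to \<open>N\<close> and their integer parts to an
  integer, so the fractional parts sum to an integer \<open>r\<close>, and being at most one each
  they give \<open>r \<le> card V\<close>. This bound, independent of \<open>N\<close>, leaves only
  finitely many base points.\<close>

lemma lattice_point_rep:
  assumes V: "finite V" "V \<subseteq> int_vecs" and x: "x \<in> int_vecs" "x \<in> (\<lambda>x. real N *\<^sub>R x) ` (convex hull V)"
  shows "\<exists>r \<beta> n. r \<le> card V \<and> r \<le> N \<and> \<beta> \<in> int_vecs \<and>
    \<beta> \<in> (\<lambda>x. real r *\<^sub>R x) ` (convex hull V) \<and> n \<in> compositions V (N - r) \<and> x = rep_val V (r, \<beta>) n"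
proof -
  obtain u where u: "\<And>v. v \<in> V \<Longrightarrow> 0 \<le> u v" "sum u V = 1" "x = real N *\<^sub>R (\<Sum>v\<in>V. u v *\<^sub>R v)"
    using x(2) unfolding convex_hull_finite[OF V(1)] by auto
  define l where "l v = real N * u v" for v
  have l: "l v \<ge> 0" if "v \<in> V" for v using u(1) that by (simp add: l_def)
  have suml: "sum l V = real N" using u(2) by (simp add: l_def sum_distrib_left[symmetric])
  define n where "n v = (if v \<in> V then nat \<lfloor>l v\<rfloor> else 0)" for v
  have n: "real (n v) = of_int \<lfloor>l v\<rfloor>" if "v \<in> V" for v using l[OF that] that by (simp add: n_def)
  have nle: "real (n v) \<le> l v" "l v \<le> real (n v) + 1" if "v \<in> V" for v
    using n[OF that] by linarith+
  have "real (sum n V) \<le> real N" unfolding suml[symmetric] using nle by (simp add: sum_mono)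
  then have sumn: "sum n V \<le> N" by linarith
  define r where "r = N - sum n V"
  have rr: "real r = (\<Sum>v\<in>V. l v - real (n v))"
    using sumn suml by (simp add: r_def sum_subtractf of_nat_diff)
  also have "\<dots> \<le> (\<Sum>v\<in>V. 1)"
    by (rule sum_mono) (use nle in \<open>simp add: algebra_simps\<close>)
  finally have rle: "r \<le> card V" by simp
  define \<beta> where "\<beta> = (\<Sum>v\<in>V. (l v - real (n v)) *\<^sub>R v)"
  have xl: "x = (\<Sum>v\<in>V. l v *\<^sub>R v)" unfolding u(3) by (simp add: l_def scaleR_sum_right)
  have \<beta>x: "\<beta> = x - (\<Sum>v\<in>V. real (n v) *\<^sub>R v)"
    by (simp add: \<beta>_def xl sum_subtractf[symmetric] algebra_simps)
  have "\<beta> \<in> int_vecs" unfolding \<beta>x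
    using V x(1) by (intro int_vecs_diff int_vecs_sum int_vecs_scale) auto
  moreover have "\<beta> \<in> (\<lambda>x. real r *\<^sub>R x) ` (convex hull V)"
  proof (cases "r = 0")
    case True
    have "\<forall>v\<in>V. l v - real (n v) = 0"
    proof (subst sum_nonneg_eq_0_iff[symmetric])
      show "(\<Sum>v\<in>V. l v - real (n v)) = 0" using rr True by simp
    qed (use nle V in auto)
    then have "\<beta> = 0" by (simp add: \<beta>_def)
    moreover obtain y where "y \<in> convex hull V" using x by auto
    ultimately show ?thesis using True by (intro image_eqI[of _ _ y]) simp_all
  next
    case False
    have "\<beta> = real r *\<^sub>R (\<Sum>v\<in>V. ((l v - real (n v)) / real r) *\<^sub>R v)"
      using False by (simp add: \<beta>_def scaleR_sum_right)
    moreover have "(\<Sum>v\<in>V. ((l v - real (n v)) / real r) *\<^sub>R v) \<in> convex hull V"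
      unfolding convex_hull_finite[OF V(1)]
      using False nle rr by (auto intro!: exI[of _ "\<lambda>v. (l v - real (n v)) / real r"]
          simp: sum_divide_distrib[symmetric])
    ultimately show ?thesis by blast
  qed
  moreover have "n \<in> compositions V (N - r)"
    using sumn by (simp add: compositions_def r_def n_def)
  moreover have "x = rep_val V (r, \<beta>) n" by (simp add: rep_val_def \<beta>x)
  ultimately show ?thesis using rle by (intro exI[of _ r] exI[of _ \<beta>] exI[of _ n]) (simp add: r_def)
qed

lemma rep_val_in_hull:
  assumes V: "finite V" "V \<subseteq> int_vecs" and r: "r \<le> N" "\<beta> \<in> int_vecs"
    "\<beta> \<in> (\<lambda>x. real r *\<^sub>R x) ` (convex hull V)" and n: "n \<in> compositions V (N - r)"
  shows "rep_val V (r, \<beta>) n \<in> int_vecs \<inter> (\<lambda>x. real N *\<^sub>R x) ` (convex hull V)"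
proof -
  obtain u where u: "\<And>v. v \<in> V \<Longrightarrow> 0 \<le> u v" "sum u V = 1" "\<beta> = real r *\<^sub>R (\<Sum>v\<in>V. u v *\<^sub>R v)"
    using r(3) unfolding convex_hull_finite[OF V(1)] by auto
  have eq: "rep_val V (r, \<beta>) n = (\<Sum>v\<in>V. (real r * u v + real (n v)) *\<^sub>R v)"
    by (simp add: rep_val_def u(3) scaleR_sum_right algebra_simps sum.distrib)
  have sn: "sum n V = N - r" using n by (simp add: compositions_def)
  have tot: "(\<Sum>v\<in>V. real r * u v + real (n v)) = real N"
    using r(1) by (simp add: sum.distrib sum_distrib_left[symmetric] u(2) of_nat_sum[symmetric] sn
        del: of_nat_sum)
  have "rep_val V (r, \<beta>) n \<in> int_vecs" unfolding rep_val_def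
    using V r by (auto intro!: int_vecs_add int_vecs_sum int_vecs_scale)
  moreover have "rep_val V (r, \<beta>) n \<in> (\<lambda>x. real N *\<^sub>R x) ` (convex hull V)"
  proof (cases "N = 0")
    case True
    then have "\<beta> = 0" using r u by simp
    moreover have "\<forall>v\<in>V. n v = 0" using sn V True by simp
    ultimately have "rep_val V (r, \<beta>) n = 0" by (simp add: rep_val_def)
    then show ?thesis using True r by auto
  next
    case False
    have "rep_val V (r, \<beta>) n = real N *\<^sub>R (\<Sum>v\<in>V. ((real r * u v + real (n v)) / real N) *\<^sub>R v)"
      using False by (simp add: eq scaleR_sum_right)
    moreover have "(\<Sum>v\<in>V. ((real r * u v + real (n v)) / real N) *\<^sub>R v) \<in> convex hull V"
      unfolding convex_hull_finite[OF V(1)]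
      using False tot u(1) by (auto intro!: exI[of _ "\<lambda>v. (real r * u v + real (n v)) / real N"]
          simp: sum_divide_distrib[symmetric])
    ultimately show ?thesis by blast
  qed
  ultimately show ?thesis by blast
qed

text \<open>
  Ehrhart's theorem without a triangulation: taking integer parts of barycentric coordinates
  writes a lattice point of \<open>N P\<close> as one of finitely many base points plus a sum of vertices.
  Of all such representations of a point only the least is kept; for a fixed base point the
  exponents of the least representations form a downward closed set.
\<close>

theorem lattice_points_eventually_poly:
  assumes V: "finite (V :: (real^'n) set)" "V \<subseteq> int_vecs"
  shows "eventually_poly (\<lambda>N. real (card (int_vecs \<inter> (\<lambda>x. real N *\<^sub>R x) ` (convex hull V))))"
proof -
  define B where "B = (SIGMA r:{..card V}. int_vecs \<inter> (\<lambda>x. real r *\<^sub>R x) ` (convex hull V))"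
  have bdd: "bounded ((\<lambda>x. real r *\<^sub>R x) ` (convex hull V))" for r
    using V(1) by (simp add: bounded_scaling bounded_convex_hull finite_imp_bounded)
  have "finite B" unfolding B_def using finite_int_vecs_bounded[OF bdd] by blast
  obtain idx :: "nat \<times> (real^'n) \<Rightarrow> nat" where idx: "inj_on idx B"
    using finite_imp_inj_to_nat_seg[OF \<open>finite B\<close>] by blast
  obtain rk :: "real^'n \<Rightarrow> nat" where rk: "inj_on rk V"
    using finite_imp_inj_to_nat_seg[OF V(1)] by blast
  define lt where "lt x y \<longleftrightarrow> idx (fst x) < idx (fst y) \<or>
      fst x = fst y \<and> lex_less rk V (snd x) (snd y)" for x y :: "(nat \<times> (real^'n)) \<times> (real^'n \<Rightarrow> nat)"
  \<comment> \<open>Exponents over the base \<open>b\<close> for which a smaller representation of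
    the same degree and the same value exists. Only the complement is counted.\<close>
  define U where "U b = {n. \<exists>b' n'. b' \<in> B \<and> (\<forall>v. v \<notin> V \<longrightarrow> n' v = 0) \<and> fst b' + sum n' V = fst b + sum n V \<and>
      rep_val V b' n' = rep_val V b n \<and> lt (b', n') (b, n)}" for b
  define R where "R N = (SIGMA b:B. compositions V (N - fst b) \<inter> (- U b))" for N
  have U_I: "n \<in> U b" if "b' \<in> B" "\<forall>v. v \<notin> V \<longrightarrow> n' v = 0" "fst b' + sum n' V = fst b + sum n V"
    "rep_val V b' n' = rep_val V b n" "lt (b', n') (b, n)" for b b' n n'
    unfolding U_def using that by blast
  have trans_eq: "a = b" if "a = N" "b = N" for a b N :: nat using that by simp
  have irr: "\<not> lt x x" for x unfolding lt_def lex_less_def by auto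
  have trans: "lt x z" if "lt x y" "lt y z" for x y z
    using that lex_less_trans[OF rk, of "snd x" "snd y" "snd z"] unfolding lt_def by auto
  have down: "down_closed (- U b)" for b
    unfolding down_closed_def
  proof (intro ballI allI impI)
    fix f g :: "real^'n \<Rightarrow> nat" assume f: "f \<in> - U b" and gf: "g \<le> f"
    show "g \<in> - U b"
    proof
      assume "g \<in> U b"
      then obtain b' n' where n': "b' \<in> B" "\<forall>v. v \<notin> V \<longrightarrow> n' v = 0" "fst b' + sum n' V = fst b + sum g V"
        "rep_val V b' n' = rep_val V b g" "lt (b', n') (b, g)"
        unfolding U_def by blast
      \<comment> \<open>The difference \<open>f - g\<close> is added to both representations:
        degrees and values stay equal and the order is preserved, so a smaller competitor of
        \<open>g\<close> yields one of \<open>f\<close>.\<close>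
      define m where "m v = (if v \<in> V then n' v + (f v - g v) else 0)" for v
      have fg: "g v + (f v - g v) = f v" for v using le_funD[OF gf, of v] by simp
      have "sum m V = sum n' V + (\<Sum>v\<in>V. f v - g v)"
        unfolding m_def sum.distrib[symmetric] by (rule sum.cong) auto
      moreover have "sum f V = sum g V + (\<Sum>v\<in>V. f v - g v)"
        unfolding sum.distrib[symmetric] by (rule sum.cong[OF refl]) (rule fg[symmetric])
      ultimately have s: "fst b' + sum m V = fst b + sum f V" using n'(3) by simp
      have "(\<Sum>v\<in>V. real (m v) *\<^sub>R v) = (\<Sum>v\<in>V. real (n' v) *\<^sub>R v) + (\<Sum>v\<in>V. real (f v - g v) *\<^sub>R v)"
        unfolding m_def sum.distrib[symmetric] by (rule sum.cong) (auto simp: algebra_simps)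
      moreover have "(\<Sum>v\<in>V. real (f v) *\<^sub>R v) = (\<Sum>v\<in>V. real (g v) *\<^sub>R v) + (\<Sum>v\<in>V. real (f v - g v) *\<^sub>R v)"
        unfolding sum.distrib[symmetric] scaleR_add_left[symmetric] of_nat_add[symmetric] fg ..
      ultimately have v: "rep_val V b' m = rep_val V b f" using n'(4) by (simp add: rep_val_def add.assoc[symmetric])
      have "lex_less rk V m f" if "lex_less rk V n' g"
      proof -
        obtain v where v: "v \<in> V" "n' v < g v" "\<And>w. w \<in> V \<Longrightarrow> rk w < rk v \<Longrightarrow> n' w = g w"
          using \<open>lex_less rk V n' g\<close> unfolding lex_less_def by blast
        have "m v < f v" using v(1,2) le_funD[OF gf, of v] by (simp add: m_def)
        moreover have "m w = f w" if "w \<in> V" "rk w < rk v" for w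
          using v(3)[OF that] le_funD[OF gf, of w] that by (simp add: m_def)
        ultimately show ?thesis unfolding lex_less_def using v(1) by blast
      qed
      then have "lt (b', m) (b, f)" using n'(5) by (auto simp: lt_def)
      moreover have "\<forall>v. v \<notin> V \<longrightarrow> m v = 0" by (simp add: m_def)
      ultimately have "f \<in> U b" using U_I[OF n'(1) _ s v] by blast
      then show False using f by simp
    qed
  qed
  have bij: "bij_betw (\<lambda>(b, n). rep_val V b n) (R N) (int_vecs \<inter> (\<lambda>x. real N *\<^sub>R x) ` (convex hull V))"
    if N: "N \<ge> card V" for N
  proof (rule bij_betw_imageI)
    \<comment> \<open>Base points have degree at most \<open>card V\<close>, so the truncated
      difference \<open>N - fst b\<close> is a true one.\<close>
    have fb: "fst b \<le> N" if "b \<in> B" for b using that N by (auto simp: B_def)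
    show "inj_on (\<lambda>(b, n). rep_val V b n) (R N)"
    proof (rule inj_onI, rule ccontr)
      fix x y assume xy: "x \<in> R N" "y \<in> R N" "(case x of (b, n) \<Rightarrow> rep_val V b n) = (case y of (b, n) \<Rightarrow> rep_val V b n)" "x \<noteq> y"
      obtain b n b' n' where [simp]: "x = (b, n)" "y = (b', n')" by (metis surj_pair)
      have b: "b \<in> B" "b' \<in> B" using xy by (auto simp: R_def)
      have n: "n \<in> compositions V (N - fst b)" "n \<notin> U b" "n' \<in> compositions V (N - fst b')" "n' \<notin> U b'"
        using xy by (auto simp: R_def)
      have s: "fst b + sum n V = N" "fst b' + sum n' V = N"
        using n fb b by (auto simp: compositions_def)
      have v: "rep_val V b n = rep_val V b' n'" using xy by simp
      have cases: "lt (b, n) (b', n') \<or> lt (b', n') (b, n)"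
      proof (cases "b = b'")
        case True
        then have "n \<noteq> n'" using xy(4) by simp
        then obtain v where v: "n v \<noteq> n' v" by blast
        then have "v \<in> V" using n unfolding compositions_def by (cases "v \<in> V") auto
        then show ?thesis using lex_less_total[OF rk, of n n'] True v unfolding lt_def by auto
      next
        case False
        then have "idx b \<noteq> idx b'" using inj_onD[OF idx _ b] by blast
        then show ?thesis by (auto simp: lt_def)
      qed
      have z: "\<forall>v. v \<notin> V \<longrightarrow> n v = 0" "\<forall>v. v \<notin> V \<longrightarrow> n' v = 0"
        using n by (auto simp: compositions_def)
      have "n' \<in> U b' \<or> n \<in> U b"
        using cases
      proof (elim disjE)
        assume "lt (b, n) (b', n')"
        then have "n' \<in> U b'" by (rule U_I[OF b(1) z(1) trans_eq[OF s] v])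
        then show ?thesis ..
      next
        assume "lt (b', n') (b, n)"
        then have "n \<in> U b" by (rule U_I[OF b(2) z(2) trans_eq[OF s(2,1)] v[symmetric]])
        then show ?thesis ..
      qed
      then show False using n by blast
    qed
    show "(\<lambda>(b, n). rep_val V b n) ` R N = int_vecs \<inter> (\<lambda>x. real N *\<^sub>R x) ` (convex hull V)"
    proof (rule equalityI; rule subsetI)
      fix x assume "x \<in> (\<lambda>(b, n). rep_val V b n) ` R N"
      then obtain r \<beta> n where x: "x = rep_val V (r, \<beta>) n" "(r, \<beta>) \<in> B" "n \<in> compositions V (N - r)"
        unfolding R_def by auto
      show "x \<in> int_vecs \<inter> (\<lambda>x. real N *\<^sub>R x) ` (convex hull V)" unfolding x(1)
        using x(2,3) fb[OF x(2)] by (intro rep_val_in_hull V) (auto simp: B_def)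
    next
      fix x assume "x \<in> int_vecs \<inter> (\<lambda>x. real N *\<^sub>R x) ` (convex hull V)"
      then have x: "x \<in> int_vecs" "x \<in> (\<lambda>x. real N *\<^sub>R x) ` (convex hull V)" by auto
      \<comment> \<open>All representations of \<open>x\<close>. The set is finite and nonempty, so
        the strict order \<open>lt\<close> has a minimal element in it, and minimality is exactly
        avoidance of \<open>U\<close>.\<close>
      define S where "S = {y \<in> SIGMA b:B. compositions V (N - fst b). rep_val V (fst y) (snd y) = x}"
      have "finite (SIGMA b:B. compositions V (N - fst b))"
        using \<open>finite B\<close> finite_compositions[OF V(1)] by (rule finite_SigmaI)
      moreover have "S \<subseteq> (SIGMA b:B. compositions V (N - fst b))" by (auto simp: S_def)
      ultimately have "finite S" by (rule finite_subset[rotated])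
      obtain r \<beta> n where "r \<le> card V" "\<beta> \<in> int_vecs"
        "\<beta> \<in> (\<lambda>x. real r *\<^sub>R x) ` (convex hull V)" "n \<in> compositions V (N - r)" "x = rep_val V (r, \<beta>) n"
        using lattice_point_rep[OF V x] by blast
      then have "((r, \<beta>), n) \<in> S" by (simp add: S_def B_def)
      then have "S \<noteq> {}" by blast
      have asym: "asymp_on S lt"
      proof (rule asymp_onI, rule notI)
        fix x y assume "lt x y" "lt y x"
        then have "lt x x" by (rule trans)
        then show False using irr by simp
      qed
      have "transp_on S lt" by (rule transp_onI) (rule trans)
      from Finite_Set.bex_min_element[OF \<open>finite S\<close> asym this \<open>S \<noteq> {}\<close>]
      obtain y where y: "y \<in> S" "\<And>z. z \<in> S \<Longrightarrow> z \<noteq> y \<Longrightarrow> \<not> lt z y"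
        by blast
      obtain b n where [simp]: "y = (b, n)" by fastforce
      have bn: "b \<in> B" "n \<in> compositions V (N - fst b)" "rep_val V b n = x" using y(1) by (auto simp: S_def)
      have "n \<notin> U b"
      proof
        assume "n \<in> U b"
        then obtain b' n' where n': "b' \<in> B" "\<forall>v. v \<notin> V \<longrightarrow> n' v = 0" "fst b' + sum n' V = fst b + sum n V"
        "rep_val V b' n' = rep_val V b n" "lt (b', n') (b, n)"
        unfolding U_def by blast
        have "sum n' V = N - fst b'" using n'(3) bn fb[OF bn(1)] by (auto simp: compositions_def)
        then have "(b', n') \<in> S" using n' bn(3) by (auto simp: S_def compositions_def)
        moreover have "(b', n') \<noteq> (b, n)"
        proof
          assume "(b', n') = (b, n)"
          then show False using n'(5) irr[of "(b, n)"] by simp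
        qed
        ultimately show False using y(2) n'(5) by simp
      qed
      then have "(b, n) \<in> R N" using bn by (auto simp: R_def)
      then show "x \<in> (\<lambda>(b, n). rep_val V b n) ` R N" using bn(3) by force
    qed
  qed
  have "real (card (int_vecs \<inter> (\<lambda>x. real N *\<^sub>R x) ` (convex hull V))) =
      (\<Sum>b\<in>B. real (card (compositions V (N - fst b) \<inter> - U b)))" if "N \<ge> card V" for N
  proof -
    have "card (int_vecs \<inter> (\<lambda>x. real N *\<^sub>R x) ` (convex hull V)) = card (R N)"
      using bij_betw_same_card[OF bij[OF that]] by simp
    also have "\<dots> = (\<Sum>b\<in>B. card (compositions V (N - fst b) \<inter> - U b))"
      unfolding R_def using \<open>finite B\<close> finite_compositions[OF V(1)] by (subst card_SigmaI) auto
    finally show ?thesis by simp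
  qed
  then have ev: "\<forall>\<^sub>F N in sequentially. (\<Sum>b\<in>B. real (card (compositions V (N - fst b) \<inter> - U b))) =
      real (card (int_vecs \<inter> (\<lambda>x. real N *\<^sub>R x) ` (convex hull V)))"
    unfolding eventually_sequentially by (intro exI[of _ "card V"] allI impI) (rule sym)
  have poly: "eventually_poly (\<lambda>N. \<Sum>b\<in>B. real (card (compositions V (N - fst b) \<inter> - U b)))"
  proof (rule eventually_poly_sum)
    fix b
    have "eventually_poly (\<lambda>N. real (card (compositions V N \<inter> - U b)))"
      by (rule card_down_closed_eventually_poly[OF V(1) down])
    from eventually_poly_shift[OF this, of "fst b"]
    show "eventually_poly (\<lambda>N. real (card (compositions V (N - fst b) \<inter> - U b)))" .
  qed
  show ?thesis using eventually_poly_cong[OF ev poly] .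
qed

section \<open>Lattice point counts and volume\<close>

definition floor_vec :: "real \<Rightarrow> real^'n \<Rightarrow> real^'n" where
  "floor_vec c x = (\<chi> j. of_int \<lfloor>c * x $ j\<rfloor>)"

text \<open>A half-open cube differs from the closed one by part of the frontier, which is null.
  Half-openness makes the cubes of different lattice points disjoint.\<close>

lemma half_open_cube:
  fixes a :: "real^'n"
  assumes "c > 0" "a \<in> int_vecs"
  shows "{x. floor_vec c x = a} \<in> lmeasurable"
    "measure lebesgue {x. floor_vec c x = a} = 1 / c ^ CARD('n)"
proof -
  let ?l = "(1 / c) *\<^sub>R a" and ?u = "(1 / c) *\<^sub>R (a + 1)"
  have eq: "floor_vec c x = a \<longleftrightarrow> (\<forall>j. a $ j \<le> c * x $ j \<and> c * x $ j < a $ j + 1)" for x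
  proof -
    have "of_int \<lfloor>c * x $ j\<rfloor> = a $ j \<longleftrightarrow> a $ j \<le> c * x $ j \<and> c * x $ j < a $ j + 1" for j
    proof -
      obtain k where "a $ j = of_int k" using assms(2) unfolding int_vecs_def by (auto elim!: Ints_cases)
      then show ?thesis by (simp add: floor_eq_iff)
    qed
    then show ?thesis by (simp add: floor_vec_def vec_eq_iff)
  qed
  have mem_box: "x \<in> box ?l ?u \<longleftrightarrow> (\<forall>j. a $ j < c * x $ j \<and> c * x $ j < a $ j + 1)"
    "x \<in> cbox ?l ?u \<longleftrightarrow> (\<forall>j. a $ j \<le> c * x $ j \<and> c * x $ j \<le> a $ j + 1)" for x
    using assms(1) by (simp_all add: mem_box_cart field_simps)
  have sub: "box ?l ?u \<subseteq> {x. floor_vec c x = a}" "{x. floor_vec c x = a} \<subseteq> cbox ?l ?u"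
    unfolding subset_iff mem_Collect_eq eq mem_box by (blast intro: less_imp_le)+
  have neg: "negligible ((cbox ?l ?u - {x. floor_vec c x = a}) \<union> ({x. floor_vec c x = a} - cbox ?l ?u))"
    by (rule negligible_subset[OF negligible_frontier_interval[of ?l ?u]]) (use sub in blast)
  show "{x. floor_vec c x = a} \<in> lmeasurable"
    by (rule lmeasurable_negligible_symdiff[OF _ neg]) simp
  have "measure lebesgue {x. floor_vec c x = a} = measure lebesgue (cbox ?l ?u)"
    by (rule measure_negligible_symdiff[OF _ neg]) simp
  also have "\<dots> = measure lborel (cbox ?l ?u)" by simp
  also have "\<dots> = (\<Prod>j\<in>UNIV. ?u $ j - ?l $ j)"
    by (rule content_cbox_cart) (use assms in \<open>auto simp: interval_ne_empty_cart field_simps\<close>)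
  also have "\<dots> = 1 / c ^ CARD('n)" by (simp add: algebra_simps power_one_over)
  finally show "measure lebesgue {x. floor_vec c x = a} = 1 / c ^ CARD('n)" .
qed

lemma norm_floor_vec_diff:
  fixes x :: "real^'n"
  assumes "c > 0"
  shows "norm ((1 / c) *\<^sub>R floor_vec c x - x) \<le> CARD('n) / c"
proof -
  have "norm ((1 / c) *\<^sub>R floor_vec c x - x) \<le> (\<Sum>j\<in>UNIV. \<bar>((1 / c) *\<^sub>R floor_vec c x - x) $ j\<bar>)"
    by (rule norm_le_l1_cart)
  also have "\<dots> \<le> (\<Sum>j\<in>(UNIV::'n set). 1 / c)"
  proof (rule sum_mono)
    fix j
    have "((1 / c) *\<^sub>R floor_vec c x - x) $ j = (of_int \<lfloor>c * x $ j\<rfloor> - c * x $ j) / c"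
      using assms by (simp add: floor_vec_def field_simps)
    moreover have "\<bar>of_int \<lfloor>c * x $ j\<rfloor> - c * x $ j\<bar> \<le> 1" by linarith
    ultimately show "\<bar>((1 / c) *\<^sub>R floor_vec c x - x) $ j\<bar> \<le> 1 / c"
      using assms by (simp add: divide_right_mono)
  qed
  finally show ?thesis by simp
qed

text \<open>Every lattice point of \<open>N P\<close> owns the half-open cube of points that round
  down to it, so the normalised count is exactly the measure of \<open>S N\<close>. Off the frontier
  of \<open>P\<close>, which is null by convexity, the indicators of these sets converge to that of
  \<open>P\<close>.\<close>

lemma lattice_count_tendsto_volume:
  fixes P :: "(real^'n) set"
  assumes P: "compact P" "convex P"
  shows "(\<lambda>N. real (card (int_vecs \<inter> (\<lambda>x. real N *\<^sub>R x) ` P)) / real N ^ CARD('n))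
    \<longlonglongrightarrow> measure lebesgue P"
proof -
  define S where "S N = {x. (1 / real N) *\<^sub>R floor_vec (real N) x \<in> P}" for N
  have fin: "finite (int_vecs \<inter> (\<lambda>x. real N *\<^sub>R x) ` P)" for N
    using P(1) by (intro finite_int_vecs_bounded bounded_scaling compact_imp_bounded)
  have SU: "S N = (\<Union>a\<in>int_vecs \<inter> (\<lambda>x. real N *\<^sub>R x) ` P. {x. floor_vec (real N) x = a})" if "N > 0" for N
  proof -
    have "floor_vec (real N) x \<in> int_vecs" for x :: "real^'n" by (simp add: floor_vec_def int_vecs_def)
    moreover have "(1 / real N) *\<^sub>R y \<in> P \<longleftrightarrow> y \<in> (\<lambda>x. real N *\<^sub>R x) ` P" for y
      using that by (auto simp: image_iff intro!: bexI[of _ "(1 / real N) *\<^sub>R y"])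
    ultimately show ?thesis by (auto simp: S_def)
  qed
  have Sm: "S N \<in> lmeasurable" if "N > 0" for N
    unfolding SU[OF that]
  proof (rule fmeasurable.finite_UN[OF fin])
    fix a :: "real^'n" assume "a \<in> int_vecs \<inter> (\<lambda>x. real N *\<^sub>R x) ` P"
    then show "{x. floor_vec (real N) x = a} \<in> lmeasurable"
      using that half_open_cube(1)[of "real N" a] by simp
  qed
  have meas: "measure lebesgue (S N) = real (card (int_vecs \<inter> (\<lambda>x. real N *\<^sub>R x) ` P)) / real N ^ CARD('n)"
    if "N > 0" for N
  proof -
    have "measure lebesgue (S N) =
        (\<Sum>a\<in>int_vecs \<inter> (\<lambda>x. real N *\<^sub>R x) ` P. measure lebesgue {x. floor_vec (real N) x = a})"
      unfolding SU[OF that]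
    proof (rule measure_negligible_finite_Union_image[OF fin])
      show "{x. floor_vec (real N) x = a} \<in> lmeasurable" if "a \<in> int_vecs \<inter> (\<lambda>x. real N *\<^sub>R x) ` P" for a
        using that \<open>N > 0\<close> half_open_cube(1)[of "real N" a] by simp
      show "pairwise (\<lambda>a b. negligible ({x. floor_vec (real N) x = a} \<inter> {x. floor_vec (real N) x = b}))
          (int_vecs \<inter> (\<lambda>x. real N *\<^sub>R x) ` P)"
      proof (rule pairwiseI)
        fix a b :: "real^'n" assume "a \<noteq> b"
        then have "{x. floor_vec (real N) x = a} \<inter> {x. floor_vec (real N) x = b} = {}" by auto
        then show "negligible ({x. floor_vec (real N) x = a} \<inter> {x. floor_vec (real N) x = b})" by simp
      qed
    qed
    also have "\<dots> = (\<Sum>a\<in>int_vecs \<inter> (\<lambda>x. real N *\<^sub>R x) ` P. 1 / real N ^ CARD('n))"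
      by (rule sum.cong) (use that half_open_cube(2)[of "real N"] in auto)
    finally show ?thesis by simp
  qed
  obtain R where R: "\<And>x. x \<in> P \<Longrightarrow> norm x \<le> R"
    using compact_imp_bounded[OF P(1)] bounded_iff by blast
  \<comment> \<open>Rounding moves a point by at most \<open>CARD('n) / Suc N\<close>, so all sets
    \<open>S (Suc N)\<close> lie in one ball.\<close>
  define w :: "real^'n \<Rightarrow> real" where "w = indicator (cball 0 (R + CARD('n)))"
  have "(\<lambda>N. integral\<^sup>L lebesgue (indicator (S (Suc N)))) \<longlonglongrightarrow> integral\<^sup>L lebesgue (indicator P :: real^'n \<Rightarrow> real)"
  proof (rule integral_dominated_convergence[where w = w])
    show "indicator P \<in> borel_measurable lebesgue"
      using fmeasurableD[OF lmeasurable_compact[OF P(1)]] by (rule borel_measurable_indicator)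
    show "indicator (S (Suc N)) \<in> borel_measurable lebesgue" for N
      using Sm[of "Suc N"] by (intro borel_measurable_indicator) (simp add: fmeasurableD)
    show "integrable lebesgue w" unfolding w_def
      using lmeasurable_cball[of "0::real^'n"] by (simp add: fmeasurable_def)
    show "AE x in lebesgue. norm (indicator (S (Suc N)) x :: real) \<le> w x" for N
    proof (rule AE_I2)
      fix x :: "real^'n"
      have "norm x \<le> R + CARD('n)" if "x \<in> S (Suc N)"
      proof -
        let ?y = "(1 / real (Suc N)) *\<^sub>R floor_vec (real (Suc N)) x"
        have "norm (?y - x) \<le> CARD('n) / real (Suc N)" by (rule norm_floor_vec_diff) simp
        also have "\<dots> \<le> CARD('n) / 1" by (intro divide_left_mono) auto
        finally have "norm (?y - x) \<le> CARD('n)" by simp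
        moreover have "norm ?y \<le> R" by (rule R) (use that in \<open>unfold S_def, blast\<close>)
        moreover have "norm x \<le> norm ?y + norm (?y - x)" using norm_triangle_sub[of x ?y] by (simp add: norm_minus_commute)
        ultimately show ?thesis by linarith
      qed
      then show "norm (indicator (S (Suc N)) x :: real) \<le> w x"
        by (auto simp: w_def indicator_def)
    qed
    have "frontier P \<in> null_sets lebesgue"
      using negligible_convex_frontier[OF P(2)] negligible_iff_null_sets by blast
    then have "AE x in lebesgue. x \<notin> frontier P" by (rule AE_not_in)
    then show "AE x in lebesgue. (\<lambda>N. indicator (S (Suc N)) x :: real) \<longlonglongrightarrow> indicator P x"
    proof (rule AE_mp, intro AE_I2 impI)
      fix x :: "real^'n" assume x: "x \<notin> frontier P"
      let ?y = "\<lambda>N. (1 / real (Suc N)) *\<^sub>R floor_vec (real (Suc N)) x"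
      have "(\<lambda>N. ?y N - x) \<longlonglongrightarrow> 0"
      proof (rule Lim_null_comparison)
        show "\<forall>\<^sub>F N in sequentially. norm (?y N - x) \<le> CARD('n) / real (Suc N)"
          using norm_floor_vec_diff[of "real (Suc _)" x] by (intro always_eventually allI) simp
        show "(\<lambda>N. CARD('n) / real (Suc N)) \<longlonglongrightarrow> 0"
          by (rule LIMSEQ_Suc[OF lim_const_over_n])
      qed
      then have lim: "?y \<longlonglongrightarrow> x" by (simp add: LIM_zero_iff)
      have "\<forall>\<^sub>F N in sequentially. indicator P x = (indicator (S (Suc N)) x :: real)"
      proof (cases "x \<in> P")
        case True
        then have "x \<in> interior P" using x P(1) by (simp add: frontier_def compact_imp_closed)
        then have "\<forall>\<^sub>F N in sequentially. ?y N \<in> interior P"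
          using lim open_interior by (rule_tac topological_tendstoD) auto
        then show ?thesis by eventually_elim (use True interior_subset[of P] in \<open>auto simp: S_def indicator_def\<close>)
      next
        case False
        have "open (- P)" using P(1) by (simp add: compact_imp_closed open_Compl)
        then have "\<forall>\<^sub>F N in sequentially. ?y N \<in> - P"
          using lim False by (rule_tac topological_tendstoD) auto
        then show ?thesis by eventually_elim (use False in \<open>auto simp: S_def indicator_def\<close>)
      qed
      then show "(\<lambda>N. indicator (S (Suc N)) x :: real) \<longlonglongrightarrow> indicator P x"
        by (rule tendsto_eventually[OF eventually_mono]) simp
    qed
  qed
  then have "(\<lambda>N. measure lebesgue (S (Suc N))) \<longlonglongrightarrow> measure lebesgue P"
    by simp
  then have "(\<lambda>N. real (card (int_vecs \<inter> (\<lambda>x. real (Suc N) *\<^sub>R x) ` P)) / real (Suc N) ^ CARD('n))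
      \<longlonglongrightarrow> measure lebesgue P"
    by (simp only: meas zero_less_Suc)
  then show ?thesis by (rule LIMSEQ_imp_Suc)
qed

section \<open>Quotients of polynomials in \<open>1 / N\<close>\<close>

lemma poly_over_power_tendsto:
  fixes Q :: "real poly"
  assumes "(\<lambda>N. poly Q (real N) / real N ^ m) \<longlonglongrightarrow> L" "L \<noteq> 0"
  shows "degree Q = m" "lead_coeff Q = L"
proof -
  have inf: "filterlim real at_infinity sequentially" by (rule tendsto_of_nat)
  have lc: "(\<lambda>N. poly Q (real N) / real N ^ degree Q) \<longlonglongrightarrow> lead_coeff Q"
    using filterlim_compose[OF poly_divide_tendsto_aux inf] by simp
  have pw: "(\<lambda>N. 1 / real N ^ d) \<longlonglongrightarrow> 0" if "d > 0" for d
    using tendsto_power[OF lim_1_over_n, of d] that by (simp add: power_one_over power_0_left)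
  show deg: "degree Q = m"
  proof (rule ccontr)
    assume "degree Q \<noteq> m"
    then consider "degree Q < m" | "degree Q > m" by linarith
    then show False
    proof cases
      case 1
      have "(\<lambda>N. poly Q (real N) / real N ^ degree Q * (1 / real N ^ (m - degree Q))) \<longlonglongrightarrow> lead_coeff Q * 0"
        using 1 by (intro tendsto_mult lc pw) simp
      then have "(\<lambda>N. poly Q (real N) / real N ^ m) \<longlonglongrightarrow> 0"
        using 1 by (simp add: power_add[symmetric])
      then show False using assms LIMSEQ_unique by blast
    next
      case 2
      have "(\<lambda>N. poly Q (real N) / real N ^ m * (1 / real N ^ (degree Q - m))) \<longlonglongrightarrow> L * 0"
        using 2 by (intro tendsto_mult assms pw) simp
      then have "(\<lambda>N. poly Q (real N) / real N ^ degree Q) \<longlonglongrightarrow> 0"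
        using 2 by (simp add: power_add[symmetric])
      then have "lead_coeff Q = 0" using lc LIMSEQ_unique by blast
      then show False using 2 by simp
    qed
  qed
  show "lead_coeff Q = L" using lc assms LIMSEQ_unique unfolding deg by blast
qed

text \<open>With \<open>x = 1 / N\<close> and equal degrees the quotient is that of the reflected
  polynomials, whose denominator does not vanish at 0. The coefficients are those of the formal
  power series quotient; its truncation \<open>s\<close> leaves a numerator divisible by
  \<open>x ^ (k + 1)\<close>, so convergence of the series never enters.\<close>

lemma poly_ratio_expansion:
  fixes R Q :: "real poly"
  assumes deg: "degree R = degree Q" and Q: "Q \<noteq> 0"
  shows "\<exists>c :: nat \<Rightarrow> real. c 0 = lead_coeff R / lead_coeff Q \<and>
    (\<forall>k. \<exists>C. \<forall>\<^sub>F N in sequentially.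
      \<bar>poly R (real N) / poly Q (real N) - (\<Sum>j\<le>k. c j / real N ^ j)\<bar> \<le> C / real N ^ (k + 1))"
proof -
  define r q where "r = reflect_poly R" and "q = reflect_poly Q"
  define F where "F = fps_of_poly r / fps_of_poly q"
  define c where "c = fps_nth F"
  have q0: "coeff q 0 \<noteq> 0" using Q by (simp add: q_def)
  then have unit: "fps_nth (fps_of_poly q) 0 \<noteq> 0" by simp
  have Fq: "F * fps_of_poly q = fps_of_poly r"
    unfolding F_def using unit by (simp add: fps_divide_unit mult.assoc inverse_mult_eq_1)
  have "coeff r 0 = c 0 * coeff q 0"
    using arg_cong[OF Fq, of "\<lambda>f. fps_nth f 0"] by (simp add: c_def)
  then have c0: "c 0 = lead_coeff R / lead_coeff Q"
    using q0 by (simp add: r_def q_def field_simps)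
  have inv: "(\<lambda>N. 1 / real N) \<longlonglongrightarrow> 0" by (rule lim_1_over_n)
  have "\<exists>C. \<forall>\<^sub>F N in sequentially.
      \<bar>poly R (real N) / poly Q (real N) - (\<Sum>j\<le>k. c j / real N ^ j)\<bar> \<le> C / real N ^ (k + 1)" for k
  proof -
    define s where "s = (\<Sum>j\<le>k. monom (c j) j)"
    have cs: "coeff s i = c i" if "i \<le> k" for i
      using that by (simp add: s_def coeff_sum sum.delta)
    have "coeff (r - s * q) i = 0" if "i < k + 1" for i
    proof -
      have "coeff (s * q) i = (\<Sum>j\<le>i. c j * coeff q (i - j))"
        unfolding coeff_mult by (rule sum.cong) (use that cs in auto)
      also have "\<dots> = fps_nth (F * fps_of_poly q) i"
        by (simp add: fps_mult_nth c_def atLeast0AtMost)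
      also have "\<dots> = coeff r i" unfolding Fq by simp
      finally show ?thesis by simp
    qed
    then have "monom 1 (k + 1) dvd r - s * q" by (simp add: monom_1_dvd_iff')
    then obtain t where t: "r - s * q = monom 1 (k + 1) * t" by (elim dvdE)
    have "(\<lambda>N. \<bar>poly t (1 / real N) / poly q (1 / real N)\<bar>) \<longlonglongrightarrow> \<bar>poly t 0 / poly q 0\<bar>"
      using q0 by (intro tendsto_intros inv) (simp add: poly_0_coeff_0)
    then have "\<forall>\<^sub>F N in sequentially. \<bar>poly t (1 / real N) / poly q (1 / real N)\<bar> < \<bar>poly t 0 / poly q 0\<bar> + 1"
      by (rule order_tendstoD) simp
    moreover have "(\<lambda>N. poly q (1 / real N)) \<longlonglongrightarrow> poly q 0"
      by (intro tendsto_intros inv)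
    then have "\<forall>\<^sub>F N in sequentially. poly q (1 / real N) \<noteq> 0"
      by (rule tendsto_imp_eventually_ne) (use q0 in \<open>simp add: poly_0_coeff_0\<close>)
    ultimately have "\<forall>\<^sub>F N in sequentially. 
      \<bar>poly R (real N) / poly Q (real N) - (\<Sum>j\<le>k. c j / real N ^ j)\<bar> \<le> (\<bar>poly t 0 / poly q 0\<bar> + 1) / real N ^ (k + 1)"
      using eventually_gt_at_top[of 0]
    proof eventually_elim
      case (elim N)
      define x where "x = 1 / real N"
      have x: "x > 0" using elim by (simp add: x_def)
      have "poly r x = x ^ degree R * poly R (real N)" "poly q x = x ^ degree R * poly Q (real N)"
        using x by (simp_all add: r_def q_def poly_reflect_poly_nz deg) (simp_all add: x_def)
      then have "poly R (real N) / poly Q (real N) = poly r x / poly q x"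
        using x by simp
      moreover have "(\<Sum>j\<le>k. c j / real N ^ j) = poly s x"
        by (simp add: s_def poly_sum poly_monom x_def power_one_over)
      moreover have "poly r x / poly q x - poly s x = poly (r - s * q) x / poly q x"
        using elim by (simp add: field_simps x_def)
      moreover have "poly (r - s * q) x = x ^ (k + 1) * poly t x"
        unfolding t by (simp add: poly_monom)
      ultimately have "\<bar>poly R (real N) / poly Q (real N) - (\<Sum>j\<le>k. c j / real N ^ j)\<bar> =
          x ^ (k + 1) * \<bar>poly t x / poly q x\<bar>"
        using x by (simp add: abs_mult)
      also have "\<dots> \<le> x ^ (k + 1) * (\<bar>poly t 0 / poly q 0\<bar> + 1)"
        using elim x by (intro mult_left_mono) (simp_all add: x_def)
      finally show ?case by (simp add: x_def power_one_over)
    qed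
    then show ?thesis by blast
  qed
  then show ?thesis using c0 by blast
qed

section \<open>Multinomial weights\<close>

text \<open>After division by factorials the binomial step is a convolution over the value at the
  new index, which is how \<open>compositions\<close> decomposes.\<close>

lemma multinomial_compositions:
  fixes x :: "'i \<Rightarrow> 'a::field_char_0"
  assumes "finite I"
  shows "(\<Sum>i\<in>I. x i) ^ n / fact n = (\<Sum>f\<in>compositions I n. \<Prod>i\<in>I. x i ^ f i / fact (f i))"
  using assms
proof (induction I arbitrary: n)
  case empty
  have "compositions {} n = (if n = 0 then {\<lambda>_. 0} else {} :: ('i \<Rightarrow> nat) set)"
    by (auto simp: compositions_def)
  then show ?case by (simp add: power_0_left)
next
  case (insert a I)
  let ?F = "\<lambda>f. \<Prod>i\<in>insert a I. x i ^ f i / fact (f i)"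
  let ?c = "\<lambda>c. x a ^ c / fact c"
  have upd: "?F (f(a := c)) = ?c c * (\<Prod>i\<in>I. x i ^ f i / fact (f i))" for f c
    using insert.hyps by (simp, intro disjI2 prod.cong) auto
  have "(\<Sum>f\<in>compositions (insert a I) n. ?F f) =
      (\<Sum>(c, f)\<in>(SIGMA c:{..n}. compositions I (n - c)). ?F (f(a := c)))"
    using sum.reindex_bij_betw[OF bij_betw_compositions_insert[OF insert.hyps(1,2), of n UNIV], of ?F]
    by (simp add: case_prod_unfold)
  also have "\<dots> = (\<Sum>c\<le>n. \<Sum>f\<in>compositions I (n - c). ?F (f(a := c)))"
    using finite_compositions[OF insert.hyps(1)] by (subst sum.Sigma) auto
  also have "\<dots> = (\<Sum>c\<le>n. ?c c * ((\<Sum>i\<in>I. x i) ^ (n - c) / fact (n - c)))"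
    unfolding upd insert.IH by (simp add: sum_distrib_left)
  also have "\<dots> = (\<Sum>c\<le>n. of_nat (n choose c) * x a ^ c * (\<Sum>i\<in>I. x i) ^ (n - c)) / fact n"
    unfolding sum_divide_distrib by (rule sum.cong) (simp_all add: binomial_fact)
  also have "\<dots> = (x a + (\<Sum>i\<in>I. x i)) ^ n / fact n"
    by (simp add: binomial_ring)
  finally show ?case using insert.hyps by simp
qed

definition mexps :: "nat \<Rightarrow> (nat ^ 'n) set" where
  "mexps n = {\<alpha>. (\<Sum>j\<in>UNIV. \<alpha> $ j) \<le> n}"

definition mcoef :: "nat \<Rightarrow> nat ^ 'n \<Rightarrow> real" where
  "mcoef n \<alpha> = fact n / (fact (n - (\<Sum>j\<in>UNIV. \<alpha> $ j)) * (\<Prod>j\<in>UNIV. fact (\<alpha> $ j)))"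

text \<open>The multinomial probability of \<alpha> after \<open>n\<close> trials, with a further
  cell of probability \<open>1 - (\<Sum>j\<in>UNIV. y $ j)\<close> that absorbs the remaining
  trials.\<close>

definition mweight :: "nat \<Rightarrow> real ^ 'n \<Rightarrow> nat ^ 'n \<Rightarrow> real" where
  "mweight n y \<alpha> = mcoef n \<alpha> * (\<Prod>j\<in>UNIV. y $ j ^ \<alpha> $ j) * (1 - (\<Sum>j\<in>UNIV. y $ j)) ^ (n - (\<Sum>j\<in>UNIV. \<alpha> $ j))"

definition rvec :: "nat ^ 'n \<Rightarrow> real ^ 'n" where
  "rvec \<alpha> = (\<chi> j. real (\<alpha> $ j))"

lemma rvec_nth [simp]: "rvec \<alpha> $ j = real (\<alpha> $ j)" by (simp add: rvec_def)

text \<open>The index \<open>None\<close> carries the remaining degree and turns the inequality in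
  \<open>mexps\<close> into the equality in \<open>compositions\<close>.\<close>

lemma bij_betw_mexps:
  "bij_betw (\<lambda>f. \<chi> j. f (Some j)) (compositions (UNIV :: 'n::finite option set) n) (mexps n :: (nat ^ 'n) set)"
proof (rule bij_betwI[where g = "\<lambda>\<alpha> k. case k of None \<Rightarrow> n - (\<Sum>j\<in>UNIV. \<alpha> $ j) | Some j \<Rightarrow> \<alpha> $ j"])
  have split: "sum f UNIV = f None + (\<Sum>j\<in>UNIV. f (Some j))" for f :: "'n option \<Rightarrow> nat"
    by (simp add: UNIV_option_conv sum.reindex)
  show "(\<lambda>f. \<chi> j. f (Some j)) \<in> compositions (UNIV :: 'n option set) n \<rightarrow> (mexps n :: (nat ^ 'n) set)"
    by (auto simp: compositions_def mexps_def split)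
  show "(\<lambda>\<alpha> k. case k of None \<Rightarrow> n - (\<Sum>j\<in>UNIV. \<alpha> $ j) | Some j \<Rightarrow> \<alpha> $ j)
      \<in> (mexps n :: (nat ^ 'n) set) \<rightarrow> compositions UNIV n"
    by (auto simp: compositions_def mexps_def split)
  show "(\<lambda>k. case k of None \<Rightarrow> n - (\<Sum>j\<in>UNIV. (\<chi> j. f (Some j)) $ j) | Some j \<Rightarrow> (\<chi> j. f (Some j)) $ j) = f"
    if "f \<in> compositions (UNIV :: 'n option set) n" for f
  proof
    fix k show "(case k of None \<Rightarrow> n - (\<Sum>j\<in>UNIV. (\<chi> j. f (Some j)) $ j) | Some j \<Rightarrow> (\<chi> j. f (Some j)) $ j) = f k"
      using that by (cases k) (auto simp: compositions_def split)
  qed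
  show "(\<chi> j. case Some j of None \<Rightarrow> n - (\<Sum>j\<in>UNIV. \<alpha> $ j) | Some j \<Rightarrow> \<alpha> $ j) = \<alpha>" for \<alpha> :: "nat ^ 'n"
    by (simp add: vec_eq_iff)
qed

lemma finite_mexps [simp]: "finite (mexps n :: (nat ^ 'n) set)"
  by (rule bij_betw_finite[OF bij_betw_mexps, THEN iffD1]) (simp add: finite_compositions)

lemma multinomial_theorem:
  fixes x :: "'n::finite \<Rightarrow> 'a::real_normed_field" and x0 :: 'a
  shows "(\<Sum>\<alpha>\<in>mexps n. of_real (mcoef n \<alpha>) * (\<Prod>j\<in>UNIV. x j ^ \<alpha> $ j) * x0 ^ (n - (\<Sum>j\<in>UNIV. \<alpha> $ j))) =
    (x0 + (\<Sum>j\<in>UNIV. x j)) ^ n"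
proof -
  define z where "z k = (case k of None \<Rightarrow> x0 | Some j \<Rightarrow> x j)" for k
  have splits: "sum f UNIV = f None + (\<Sum>j\<in>UNIV. f (Some j))" for f :: "'n option \<Rightarrow> 'b::comm_monoid_add"
    by (simp add: UNIV_option_conv sum.reindex)
  have splitp: "prod f UNIV = f None * (\<Prod>j\<in>UNIV. f (Some j))" for f :: "'n option \<Rightarrow> 'b::comm_monoid_mult"
    by (simp add: UNIV_option_conv prod.reindex)
  let ?G = "\<lambda>\<alpha>. of_real (mcoef n \<alpha>) * (\<Prod>j\<in>UNIV. x j ^ \<alpha> $ j) * x0 ^ (n - (\<Sum>j\<in>UNIV. \<alpha> $ j))"
  have "(\<Sum>\<alpha>\<in>mexps n. ?G \<alpha>) = (\<Sum>f\<in>compositions UNIV n. ?G (\<chi> j. f (Some j)))"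
    using sum.reindex_bij_betw[OF bij_betw_mexps, of ?G n] by simp
  also have "\<dots> = (\<Sum>f\<in>compositions UNIV n. fact n * (\<Prod>k\<in>UNIV. z k ^ f k / fact (f k)))"
  proof (rule sum.cong[OF refl])
    fix f :: "'n option \<Rightarrow> nat" assume "f \<in> compositions UNIV n"
    then have "f None + (\<Sum>j\<in>UNIV. f (Some j)) = n" by (simp add: compositions_def splits)
    then have "n - (\<Sum>j\<in>UNIV. f (Some j)) = f None" by linarith
    then show "?G (\<chi> j. f (Some j)) = fact n * (\<Prod>k\<in>UNIV. z k ^ f k / fact (f k))"
      by (simp add: mcoef_def splitp z_def prod_dividef field_simps)
  qed
  also have "\<dots> = fact n * ((\<Sum>k\<in>UNIV. z k) ^ n / fact n)"
    by (simp add: multinomial_compositions sum_distrib_left)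
  also have "\<dots> = (x0 + (\<Sum>j\<in>UNIV. x j)) ^ n"
    by (simp add: splits z_def)
  finally show ?thesis .
qed

text \<open>A general field is used because real \<open>t\<close> gives the moment generating
  function behind the tail bounds, and \<open>t\<close> on the unit circle gives the characteristic
  function.\<close>

lemma mweight_generating:
  fixes t :: "'n::finite \<Rightarrow> 'a::real_normed_field"
  shows "(\<Sum>\<alpha>\<in>mexps n. of_real (mweight n y \<alpha>) * (\<Prod>j\<in>UNIV. t j ^ \<alpha> $ j)) =
    (of_real (1 - (\<Sum>j\<in>UNIV. y $ j)) + (\<Sum>j\<in>UNIV. of_real (y $ j) * t j)) ^ n"
  unfolding multinomial_theorem[symmetric]
  by (rule sum.cong) (simp_all add: mweight_def power_mult_distrib prod.distrib mult_ac)

lemma mweight_sum: "(\<Sum>\<alpha>\<in>mexps n. mweight n y \<alpha>) = 1"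
  using mweight_generating[of n y "\<lambda>_. 1 :: real"] by simp

lemma mcoef_nonneg: "mcoef n \<alpha> \<ge> 0"
  by (simp add: mcoef_def prod_nonneg)

lemma mweight_nonneg:
  assumes "\<And>j. y $ j \<ge> 0" "(\<Sum>j\<in>UNIV. y $ j) \<le> 1"
  shows "mweight n y \<alpha> \<ge> 0"
  unfolding mweight_def using assms by (intro mult_nonneg_nonneg prod_nonneg mcoef_nonneg) auto

text \<open>A single coordinate of a multinomial vector is binomial, so only the factor of the cell
  \<open>j\<close> changes.\<close>

lemma mweight_mgf_coordinate:
  fixes y :: "real ^ 'n" and s :: real
  shows "(\<Sum>\<alpha>\<in>mexps n. mweight n y \<alpha> * exp (s * \<alpha> $ j)) = (1 - y $ j + y $ j * exp s) ^ n"
proof -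
  define t where "t i = (if i = j then exp s else 1)" for i
  have pr: "(\<Prod>i\<in>UNIV. t i ^ \<alpha> $ i) = exp (s * \<alpha> $ j)" for \<alpha> :: "nat ^ 'n"
  proof -
    have "(\<Prod>i\<in>UNIV. t i ^ \<alpha> $ i) = (\<Prod>i\<in>UNIV. if i = j then exp s ^ \<alpha> $ j else 1)"
      by (rule prod.cong) (auto simp: t_def)
    then show ?thesis by (simp add: exp_of_nat2_mult mult.commute)
  qed
  have "(\<Sum>i\<in>UNIV. y $ i * t i) = (\<Sum>i\<in>UNIV. y $ i) + y $ j * (exp s - 1)"
  proof -
    have "(\<Sum>i\<in>UNIV. y $ i * t i) = (\<Sum>i\<in>UNIV. y $ i + (if i = j then y $ j * (exp s - 1) else 0))"
      by (rule sum.cong) (auto simp: t_def algebra_simps)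
    then show ?thesis by (simp add: sum.distrib)
  qed
  then have base: "1 - (\<Sum>i\<in>UNIV. y $ i) + (\<Sum>i\<in>UNIV. y $ i * t i) = 1 - y $ j + y $ j * exp s"
    by (simp add: algebra_simps)
  have "(\<Sum>\<alpha>\<in>mexps n. mweight n y \<alpha> * (\<Prod>i\<in>UNIV. t i ^ \<alpha> $ i)) =
      (1 - (\<Sum>i\<in>UNIV. y $ i) + (\<Sum>i\<in>UNIV. y $ i * t i)) ^ n"
    using mweight_generating[of n y t] by simp
  then show ?thesis unfolding pr base .
qed

section \<open>Exponential tail bounds\<close>

lemma exp_le_quadratic:
  assumes "\<bar>u\<bar> \<le> (1::real)"
  shows "exp u \<le> 1 + u + u\<^sup>2"
proof (cases "u \<ge> 0")
  case True
  then show ?thesis using exp_bound[of u] assms by simp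
next
  case False
  define w where "w = - u"
  have w: "w > 0" "u = - w" using False by (auto simp: w_def)
  have "1 + w + w\<^sup>2 / 2 \<le> exp w" using w exp_lower_Taylor_quadratic by simp
  moreover have "1 \<le> (1 + u + u\<^sup>2) * (1 + w + w\<^sup>2 / 2)"
  proof -
    have "(1 + u + u\<^sup>2) * (1 + w + w\<^sup>2 / 2) = 1 + w\<^sup>2 / 2 + w ^ 3 / 2 + w ^ 4 / 2"
      unfolding w(2) by (simp add: field_simps power2_eq_square power3_eq_cube power4_eq_xxxx)
    then show ?thesis using w(1) by simp
  qed
  moreover have "0 \<le> 1 + u + u\<^sup>2"
    using zero_le_power2[of "u + 1/2"] by (simp add: power2_eq_square algebra_simps)
  ultimately have "1 \<le> (1 + u + u\<^sup>2) * exp w"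
    by (meson mult_left_mono order_trans)
  then show ?thesis by (simp add: w_def exp_minus field_simps)
qed

text \<open>Centring at the mean cancels the linear terms of the quadratic bound for
  \<open>exp\<close>; the variance \<open>y * (1 - y)\<close> that is left is at most one.\<close>

lemma bernoulli_centered_mgf:
  fixes s y :: real
  assumes "0 \<le> y" "y \<le> 1" "\<bar>s\<bar> \<le> 1"
  shows "exp (- s * y) * (1 - y + y * exp s) \<le> exp (s\<^sup>2)"
proof -
  have ab: "\<bar>- s * y\<bar> \<le> 1" "\<bar>s * (1 - y)\<bar> \<le> 1"
    using assms mult_le_one[of "\<bar>s\<bar>" y] mult_le_one[of "\<bar>s\<bar>" "1 - y"] by (auto simp: abs_mult)
  have "exp (- s * y) * (1 - y + y * exp s) = (1 - y) * exp (- s * y) + y * exp (s * (1 - y))"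
    by (simp add: algebra_simps exp_add[symmetric] flip: exp_diff exp_minus)
  also have "\<dots> \<le> (1 - y) * (1 + (- s * y) + (- s * y)\<^sup>2) + y * (1 + s * (1 - y) + (s * (1 - y))\<^sup>2)"
    using assms ab by (intro add_mono mult_left_mono exp_le_quadratic) auto
  also have "\<dots> = 1 + s\<^sup>2 * (y * (1 - y))" by (simp add: algebra_simps power2_eq_square)
  also have "\<dots> \<le> 1 + s\<^sup>2"
    using assms by (simp add: mult_left_le mult_le_one)
  also have "\<dots> \<le> exp (s\<^sup>2)" by simp
  finally show ?thesis .
qed

lemma sum_UN_le:
  fixes f :: "'a \<Rightarrow> real"
  assumes "finite I" "\<And>i. i \<in> I \<Longrightarrow> finite (A i)" "\<And>x. f x \<ge> 0"
  shows "sum f (\<Union>i\<in>I. A i) \<le> (\<Sum>i\<in>I. sum f (A i))"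
  using assms(1,2)
proof (induction I)
  case (insert i I)
  have "sum f (\<Union>k\<in>insert i I. A k) = sum f (A i) + sum f (\<Union>k\<in>I. A k) - sum f (A i \<inter> (\<Union>k\<in>I. A k))"
    using insert by (simp add: sum_Un)
  also have "\<dots> \<le> sum f (A i) + (\<Sum>k\<in>I. sum f (A k))"
    using insert.IH insert.prems assms(3) sum_nonneg[of "A i \<inter> (\<Union>k\<in>I. A k)" f] by simp
  finally show ?case using insert.hyps by simp
qed simp

text \<open>Chernoff's bound; the sign of \<open>s\<close> selects the upper or the lower
  tail.\<close>

lemma mweight_tail_coordinate:
  fixes y :: "real ^ 'n" and s d :: real
  assumes y: "\<And>j. y $ j \<ge> 0" "(\<Sum>j\<in>UNIV. y $ j) \<le> 1" and s: "\<bar>s\<bar> \<le> 1"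
  shows "(\<Sum>\<alpha> | \<alpha> \<in> mexps n \<and> s * (real (\<alpha> $ j) - n * y $ j) \<ge> d. mweight n y \<alpha>) \<le> exp (n * s\<^sup>2 - d)"
proof -
  have y1: "y $ j \<le> 1" using y member_le_sum[of j UNIV "\<lambda>j. y $ j"] by auto
  have "(\<Sum>\<alpha> | \<alpha> \<in> mexps n \<and> s * (real (\<alpha> $ j) - n * y $ j) \<ge> d. mweight n y \<alpha>) \<le>
      (\<Sum>\<alpha> | \<alpha> \<in> mexps n \<and> s * (real (\<alpha> $ j) - n * y $ j) \<ge> d.
        mweight n y \<alpha> * exp (s * (real (\<alpha> $ j) - n * y $ j) - d))"
  proof (rule sum_mono)
    fix \<alpha> assume "\<alpha> \<in> {\<alpha>. \<alpha> \<in> mexps n \<and> s * (real (\<alpha> $ j) - n * y $ j) \<ge> d}"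
    then have "1 \<le> exp (s * (real (\<alpha> $ j) - n * y $ j) - d)" by simp
    then show "mweight n y \<alpha> \<le> mweight n y \<alpha> * exp (s * (real (\<alpha> $ j) - n * y $ j) - d)"
      using mult_left_mono[OF _ mweight_nonneg[OF y], of 1] by simp
  qed
  also have "\<dots> \<le> (\<Sum>\<alpha>\<in>mexps n. mweight n y \<alpha> * exp (s * (real (\<alpha> $ j) - n * y $ j) - d))"
    by (rule sum_mono2) (auto simp: mweight_nonneg[OF y])
  also have "\<dots> = (\<Sum>\<alpha>\<in>mexps n. mweight n y \<alpha> * exp (s * \<alpha> $ j)) * exp (- s * y $ j * n - d)"
    unfolding sum_distrib_right by (rule sum.cong) (simp_all add: exp_add[symmetric] algebra_simps)
  also have "\<dots> = (exp (- s * y $ j) * (1 - y $ j + y $ j * exp s)) ^ n * exp (- d)"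
  proof -
    have "exp (- s * y $ j * n - d) = exp (- s * y $ j) ^ n * exp (- d)"
      by (simp only: exp_of_nat_mult[symmetric] exp_add[symmetric]) (simp add: algebra_simps)
    then show ?thesis unfolding mweight_mgf_coordinate power_mult_distrib by simp
  qed
  also have "\<dots> \<le> exp (s\<^sup>2) ^ n * exp (- d)"
    using y y1 s by (intro mult_right_mono power_mono bernoulli_centered_mgf) (auto intro!: mult_nonneg_nonneg add_nonneg_nonneg)
  also have "\<dots> = exp (n * s\<^sup>2 - d)" by (simp add: exp_of_nat_mult[symmetric] exp_add[symmetric] algebra_simps exp_diff exp_minus field_simps)
  finally show ?thesis .
qed

text \<open>A deviation of \<open>\<delta> * n\<close> in norm forces one of
  \<open>\<epsilon> * n\<close> in some coordinate, where
  \<open>\<epsilon> = \<delta> / CARD('n)\<close>. This covers the event by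
  \<open>2 * CARD('n)\<close> half-spaces, and the choice \<open>\<epsilon> / 2\<close> for the size
  of \<open>s\<close> minimises the Chernoff exponent, with value
  \<open>- (n * \<epsilon>\<^sup>2 / 4)\<close>.\<close>

lemma mweight_tail:
  fixes y :: "real ^ 'n"
  assumes y: "\<And>j. y $ j \<ge> 0" "(\<Sum>j\<in>UNIV. y $ j) \<le> 1" and \<delta>: "0 < \<delta>" "\<delta> \<le> 1"
  shows "(\<Sum>\<alpha> | \<alpha> \<in> mexps n \<and> norm (rvec \<alpha> - n *\<^sub>R y) \<ge> \<delta> * n. mweight n y \<alpha>)
    \<le> 2 * CARD('n) * exp (- (n * (\<delta> / CARD('n))\<^sup>2 / 4))"
proof -
  define \<epsilon> where "\<epsilon> = \<delta> / CARD('n)"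
  have c: "1 \<le> real CARD('n)" using zero_less_card_finite[where 'a = 'n] by linarith
  then have e: "0 < \<epsilon>" "\<epsilon> \<le> 1" using \<delta> order_trans[OF \<delta>(2) c] by (auto simp: \<epsilon>_def divide_le_eq)
  define A where "A s j = {\<alpha> \<in> mexps n. s * (real (\<alpha> $ j) - n * y $ j) \<ge> n * \<epsilon>\<^sup>2 / 2}" for s j
  have cover: "{\<alpha>. \<alpha> \<in> mexps n \<and> norm (rvec \<alpha> - n *\<^sub>R y) \<ge> \<delta> * n} \<subseteq> (\<Union>(s, j)\<in>{\<epsilon> / 2, - \<epsilon> / 2} \<times> UNIV. A s j)"
  proof (rule subsetI, rule ccontr)
    fix \<alpha> :: "nat ^ 'n"
    assume a: "\<alpha> \<in> {\<alpha>. \<alpha> \<in> mexps n \<and> norm (rvec \<alpha> - n *\<^sub>R y) \<ge> \<delta> * n}"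
      and not: "\<alpha> \<notin> (\<Union>(s, j)\<in>{\<epsilon> / 2, - \<epsilon> / 2} \<times> UNIV. A s j)"
    have "\<bar>(rvec \<alpha> - n *\<^sub>R y) $ j\<bar> < \<epsilon> * n" for j
    proof -
      have "(\<epsilon> / 2) * (real (\<alpha> $ j) - n * y $ j) < (\<epsilon> / 2) * (\<epsilon> * n)"
        "(\<epsilon> / 2) * - (real (\<alpha> $ j) - n * y $ j) < (\<epsilon> / 2) * (\<epsilon> * n)"
        using not a by (auto simp: A_def power2_eq_square not_le algebra_simps)
      then have "real (\<alpha> $ j) - n * y $ j < \<epsilon> * n" "- (real (\<alpha> $ j) - n * y $ j) < \<epsilon> * n"
        using e by (simp_all only: mult_less_cancel_left_pos half_gt_zero)
      then show ?thesis by simp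
    qed
    then have "(\<Sum>j\<in>UNIV. \<bar>(rvec \<alpha> - n *\<^sub>R y) $ j\<bar>) < (\<Sum>j\<in>(UNIV::'n set). \<epsilon> * n)"
      by (intro sum_strict_mono) auto
    also have "\<dots> = \<delta> * n" using c by (simp add: \<epsilon>_def)
    finally show False using a norm_le_l1_cart[of "rvec \<alpha> - n *\<^sub>R y"] by simp
  qed
  have fin: "finite (A s j)" for s j by (simp add: A_def)
  have "(\<Sum>\<alpha> | \<alpha> \<in> mexps n \<and> norm (rvec \<alpha> - n *\<^sub>R y) \<ge> \<delta> * n. mweight n y \<alpha>) \<le>
      (\<Sum>\<alpha>\<in>(\<Union>(s, j)\<in>{\<epsilon> / 2, - \<epsilon> / 2} \<times> UNIV. A s j). mweight n y \<alpha>)"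
    by (rule sum_mono2[OF _ cover]) (auto simp: fin mweight_nonneg[OF y])
  also have "\<dots> \<le> (\<Sum>(s, j)\<in>{\<epsilon> / 2, - \<epsilon> / 2} \<times> UNIV. \<Sum>\<alpha>\<in>A s j. mweight n y \<alpha>)"
    using sum_UN_le[of "{\<epsilon> / 2, - \<epsilon> / 2} \<times> UNIV" "\<lambda>(s, j). A s j" "mweight n y"]
    by (simp add: fin mweight_nonneg[OF y] case_prod_unfold)
  also have "\<dots> \<le> (\<Sum>(s, j)\<in>{\<epsilon> / 2, - \<epsilon> / 2} \<times> (UNIV :: 'n set). exp (- (n * \<epsilon>\<^sup>2 / 4)))"
  proof (rule sum_mono, clarify)
    fix s and j :: 'n assume s: "s \<in> {\<epsilon> / 2, - \<epsilon> / 2}"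
    have "(\<Sum>\<alpha>\<in>A s j. mweight n y \<alpha>) \<le> exp (n * s\<^sup>2 - n * \<epsilon>\<^sup>2 / 2)"
      unfolding A_def using s e by (intro mweight_tail_coordinate y) auto
    also have "n * s\<^sup>2 - n * \<epsilon>\<^sup>2 / 2 = - (n * \<epsilon>\<^sup>2 / 4)"
      using s by (auto simp: power_divide)
    finally show "(\<Sum>\<alpha>\<in>A s j. mweight n y \<alpha>) \<le> exp (- (n * \<epsilon>\<^sup>2 / 4))" .
  qed
  also have "\<dots> = 2 * CARD('n) * exp (- (n * \<epsilon>\<^sup>2 / 4))"
    using e by (simp add: card_cartesian_product)
  finally show ?thesis by (simp add: \<epsilon>_def)
qed

section \<open>Expectation over the sphere\<close>

lemma product_sigma_finite_lborel: "product_sigma_finite (\<lambda>_::'i. lborel :: 'b::euclidean_space measure)"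
  by standard

lemma emeasure_lborel_complex_scale:
  fixes c :: real
  assumes "c \<noteq> 0" "A \<in> sets borel"
  shows "emeasure lborel {x :: complex. c *\<^sub>R x \<in> A} = ennreal (1 / c\<^sup>2) * emeasure lborel A"
proof -
  have "lborel = density (distr lborel borel (\<lambda>x::complex. 0 + c *\<^sub>R x)) (\<lambda>_. \<bar>c\<bar> ^ DIM(complex))"
    using lborel_affine[of c "0::complex"] assms(1) by simp
  then have "emeasure lborel A = emeasure (density (distr lborel borel (\<lambda>x::complex. c *\<^sub>R x)) (\<lambda>_. ennreal (c\<^sup>2))) A"
    by (simp add: power2_eq_square)
  also have "\<dots> = ennreal (c\<^sup>2) * emeasure (distr lborel borel (\<lambda>x::complex. c *\<^sub>R x)) A"
    using assms by (intro emeasure_density_const) auto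
  also have "emeasure (distr lborel borel (\<lambda>x::complex. c *\<^sub>R x)) A = emeasure lborel {x. c *\<^sub>R x \<in> A}"
    using assms by (subst emeasure_distr) (auto simp: vimage_def)
  finally have "ennreal (1 / c\<^sup>2) * emeasure lborel A =
      ennreal (1 / c\<^sup>2) * ennreal (c\<^sup>2) * emeasure lborel {x. c *\<^sub>R x \<in> A}"
    by (simp add: mult.assoc)
  also have "ennreal (1 / c\<^sup>2) * ennreal (c\<^sup>2) = 1"
    using assms by (simp add: ennreal_mult[symmetric])
  finally show ?thesis by simp
qed

text \<open>Preimages of boxes are boxes with permuted and rescaled sides. Scaling a complex
  coordinate multiplies area by the square of the factor, so the hypothesis on the product says that
  the real Jacobian is one.\<close>

lemma distr_PiM_permute_scale:
  fixes c :: "'i \<Rightarrow> real"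
  assumes I: "finite I" and \<pi>: "bij_betw \<pi> I I" and c: "\<And>i. i \<in> I \<Longrightarrow> c i \<noteq> 0" "(\<Prod>i\<in>I. (c i)\<^sup>2) = 1"
  shows "distr (PiM I (\<lambda>_. lborel)) (PiM I (\<lambda>_. lborel)) (\<lambda>a. \<lambda>i\<in>I. c i *\<^sub>R (a (\<pi> i) :: complex)) = PiM I (\<lambda>_. lborel)"
proof -
  interpret product_sigma_finite "\<lambda>_::'i. lborel :: complex measure"
    by (rule product_sigma_finite_lborel)
  let ?M = "PiM I (\<lambda>_. lborel :: complex measure)"
  let ?T = "\<lambda>a. \<lambda>i\<in>I. c i *\<^sub>R (a (\<pi> i) :: complex)"
  have \<pi>I: "\<pi> i \<in> I" if "i \<in> I" for i using \<pi> that by (auto dest: bij_betwE)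
  have T: "?T \<in> measurable ?M ?M"
    using \<pi>I by (intro measurable_restrict) (auto intro!: measurable_component_singleton borel_measurable_scaleR)
  define \<rho> where "\<rho> = the_inv_into I \<pi>"
  have \<rho>: "\<rho> i \<in> I" "\<pi> (\<rho> i) = i" if "i \<in> I" for i
    using \<pi> that bij_betw_the_inv_into[OF \<pi>] f_the_inv_into_f_bij_betw[OF \<pi>]
    by (auto simp: \<rho>_def dest: bij_betwE)
  have \<rho>\<pi>: "\<rho> (\<pi> i) = i" if "i \<in> I" for i
    using \<pi> that by (simp add: \<rho>_def bij_betw_def the_inv_into_f_f)
  show ?thesis
  proof (rule PiM_eqI[OF I])
    fix A :: "'i \<Rightarrow> complex set" assume A: "\<And>i. i \<in> I \<Longrightarrow> A i \<in> sets lborel"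
    have "?T -` Pi\<^sub>E I A \<inter> space ?M = Pi\<^sub>E I (\<lambda>i. {x. c (\<rho> i) *\<^sub>R x \<in> A (\<rho> i)})" (is "?L = ?R")
    proof (intro equalityI subsetI)
      fix a assume a: "a \<in> ?L"
      then have "a \<in> extensional I" by (auto simp: space_PiM PiE_def)
      moreover have "c (\<rho> i) *\<^sub>R a i \<in> A (\<rho> i)" if "i \<in> I" for i
      proof -
        have "?T a (\<rho> i) \<in> A (\<rho> i)" using a \<rho>(1)[OF that] by (auto simp: PiE_def Pi_def)
        then show ?thesis using \<rho>[OF that] by simp
      qed
      ultimately show "a \<in> ?R" by (auto simp: PiE_def)
    next
      fix a assume a: "a \<in> ?R"
      have "c i *\<^sub>R a (\<pi> i) \<in> A i" if "i \<in> I" for i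
        using a \<pi>I[OF that] \<rho>\<pi>[OF that] by (auto simp: PiE_def Pi_def)
      then show "a \<in> ?L" using a by (auto simp: space_PiM PiE_def)
    qed
    then have "emeasure (distr ?M ?M ?T) (Pi\<^sub>E I A) = emeasure ?M ?R"
      using A I by (subst emeasure_distr[OF T]) (auto intro!: sets_PiM_I_finite)
    also have "\<dots> = (\<Prod>i\<in>I. emeasure lborel {x. c (\<rho> i) *\<^sub>R x \<in> A (\<rho> i)})"
    proof (rule emeasure_PiM[OF I])
      fix i assume "i \<in> I"
      have "(\<lambda>x. c (\<rho> i) *\<^sub>R x) -` A (\<rho> i) \<inter> space lborel \<in> sets (lborel :: complex measure)"
        using A \<rho>(1)[OF \<open>i \<in> I\<close>] by (intro measurable_sets[where A = "borel" ]) auto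
      then show "{x. c (\<rho> i) *\<^sub>R x \<in> A (\<rho> i)} \<in> sets lborel" by (simp add: vimage_def)
    qed
    also have "\<dots> = (\<Prod>i\<in>I. ennreal (1 / (c (\<rho> i))\<^sup>2) * emeasure lborel (A (\<rho> i)))"
      using A \<rho>(1) c(1) by (intro prod.cong refl emeasure_lborel_complex_scale) auto
    also have "\<dots> = (\<Prod>i\<in>I. ennreal (1 / (c i)\<^sup>2) * emeasure lborel (A i))"
      by (rule prod.reindex_bij_witness[of _ \<pi> \<rho>]) (use \<rho> \<rho>\<pi> \<pi>I in auto)
    also have "\<dots> = ennreal (\<Prod>i\<in>I. 1 / (c i)\<^sup>2) * (\<Prod>i\<in>I. emeasure lborel (A i))"
      by (simp add: prod.distrib prod_ennreal)
    also have "(\<Prod>i\<in>I. 1 / (c i)\<^sup>2) = 1" using c(2) by (simp add: prod_dividef)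
    finally show "emeasure (distr ?M ?M ?T) (Pi\<^sub>E I A) = (\<Prod>i\<in>I. emeasure lborel (A i))"
      by (simp only: ennreal_1 mult_1_left)
  qed simp
qed

text \<open>
  The sphere average of \<open>cmod (\<Sum> a \<alpha> e \<alpha>)\<^sup>2\<close> is computed from two kinds of isometries of the
  coefficient space: the sign change of one coefficient removes the mixed terms, and the
  rescaled transposition of two coefficients shows that the diagonal terms agree.
\<close>

locale coefficient_ball =
  fixes I :: "'i set" and w :: "'i \<Rightarrow> real"
  assumes I: "finite I" "I \<noteq> {}" and w: "\<And>i. i \<in> I \<Longrightarrow> w i > 0"
begin

abbreviation M :: "('i \<Rightarrow> complex) measure" where "M \<equiv> PiM I (\<lambda>_. lborel)"

definition wnorm2 :: "('i \<Rightarrow> complex) \<Rightarrow> real" where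
  "wnorm2 a = (\<Sum>i\<in>I. w i * (cmod (a i))\<^sup>2)"

definition B :: "('i \<Rightarrow> complex) set" where "B = {a \<in> space M. wnorm2 a \<le> 1}"

text \<open>Division by \<open>wnorm2\<close> makes a quadratic \<open>f\<close> constant along
  rays, so the integral over the ball is its volume times the average over the sphere. No
  normalisation is built in, and the quotient is 0 at the origin.\<close>

definition mean :: "(('i \<Rightarrow> complex) \<Rightarrow> complex) \<Rightarrow> complex" where
  "mean f = (\<integral>a. indicator B a * f a / wnorm2 a \<partial>M)"

lemma component_measurable: "i \<in> I \<Longrightarrow> (\<lambda>a. a i) \<in> borel_measurable M"
  using measurable_component_singleton[of i I "\<lambda>_. lborel"] by simp

lemma wnorm2_measurable: "wnorm2 \<in> borel_measurable M"
  unfolding wnorm2_def by (intro borel_measurable_sum borel_measurable_times borel_measurable_power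
      borel_measurable_const measurable_compose[OF component_measurable borel_measurable_norm])

lemma B_sets: "B \<in> sets M"
  unfolding B_def using wnorm2_measurable by measurable

lemma mixed_measurable: "i \<in> I \<Longrightarrow> j \<in> I \<Longrightarrow> (\<lambda>a. a i * cnj (a j)) \<in> borel_measurable M"
  by (intro borel_measurable_times component_measurable
      measurable_compose[OF component_measurable borel_measurable_continuous_onI] continuous_intros)

lemma weighted_measurable:
  "f \<in> borel_measurable M \<Longrightarrow> (\<lambda>a. indicator B a * f a / complex_of_real (wnorm2 a)) \<in> borel_measurable M"
  by (intro borel_measurable_divide borel_measurable_times borel_measurable_indicator B_sets
      measurable_compose[OF wnorm2_measurable borel_measurable_continuous_onI] continuous_intros)

lemma wnorm2_nonneg: "wnorm2 a \<ge> 0"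
  unfolding wnorm2_def by (intro sum_nonneg mult_nonneg_nonneg less_imp_le[OF w] zero_le_power2)

lemma component_le: "i \<in> I \<Longrightarrow> w i * (cmod (a i))\<^sup>2 \<le> wnorm2 a"
  unfolding wnorm2_def
  by (rule member_le_sum[where f = "\<lambda>i. w i * (cmod (a i))\<^sup>2"])
    (use I less_imp_le[OF w] in \<open>auto intro!: mult_nonneg_nonneg\<close>)

lemma emeasure_B_finite: "emeasure M B < \<infinity>"
proof -
  interpret product_sigma_finite "\<lambda>_::'i. lborel :: complex measure"
    by (rule product_sigma_finite_lborel)
  have "B \<subseteq> Pi\<^sub>E I (\<lambda>i. cball 0 (sqrt (1 / w i)))"
  proof
    fix a assume a: "a \<in> B"
    have "cmod (a i) \<le> sqrt (1 / w i)" if "i \<in> I" for i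
    proof -
      have "w i * (cmod (a i))\<^sup>2 \<le> 1" using component_le[OF that, of a] a by (auto simp: B_def)
      then show ?thesis using w[OF that] by (intro real_le_rsqrt) (simp add: field_simps)
    qed
    then show "a \<in> Pi\<^sub>E I (\<lambda>i. cball 0 (sqrt (1 / w i)))"
      using a by (auto simp: B_def space_PiM PiE_def)
  qed
  then have "emeasure M B \<le> emeasure M (Pi\<^sub>E I (\<lambda>i. cball 0 (sqrt (1 / w i))))"
    using I by (intro emeasure_mono sets_PiM_I_finite) auto
  also have "\<dots> = (\<Prod>i\<in>I. emeasure lborel (cball (0::complex) (sqrt (1 / w i))))"
    using I by (intro emeasure_PiM) auto
  also have "\<dots> = (\<Prod>i\<in>I. ennreal (measure lborel (cball (0::complex) (sqrt (1 / w i)))))"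
    using emeasure_lborel_cball_finite by (intro prod.cong refl emeasure_eq_ennreal_measure) (simp add: less_top[symmetric])
  also have "\<dots> < \<infinity>" by (simp add: prod_ennreal)
  finally show ?thesis .
qed

lemma emeasure_B_pos: "emeasure M B > 0"
proof -
  interpret product_sigma_finite "\<lambda>_::'i. lborel :: complex measure"
    by (rule product_sigma_finite_lborel)
  define r where "r i = sqrt (1 / (w i * card I))" for i
  have c: "card I > 0" using I by (simp add: card_gt_0_iff)
  have r: "r i > 0" if "i \<in> I" for i using w[OF that] c by (simp add: r_def)
  have "Pi\<^sub>E I (\<lambda>i. ball 0 (r i)) \<subseteq> B"
  proof
    fix a assume a: "a \<in> Pi\<^sub>E I (\<lambda>i. ball (0::complex) (r i))"
    have "wnorm2 a \<le> (\<Sum>i\<in>I. 1 / card I)"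
      unfolding wnorm2_def
    proof (rule sum_mono)
      fix i assume i: "i \<in> I"
      then have "cmod (a i) \<le> r i" using a by (force simp: PiE_def Pi_def)
      then have "(cmod (a i))\<^sup>2 \<le> (r i)\<^sup>2" by (intro power_mono) auto
      also have "(r i)\<^sup>2 = 1 / (w i * card I)" unfolding r_def using w[OF i] c by simp
      finally show "w i * (cmod (a i))\<^sup>2 \<le> 1 / card I" using w[OF i] c by (simp add: field_simps)
    qed
    then show "a \<in> B" using a c by (auto simp: B_def space_PiM PiE_def)
  qed
  have "0 < (\<Prod>i\<in>I. emeasure lborel (ball (0::complex) (r i)))"
  proof -
    have "emeasure lborel (ball (0::complex) (r i)) \<noteq> 0" if "i \<in> I" for i
      using content_ball_pos[OF r[OF that], of "0::complex"] by (auto simp: measure_def)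
    then have "(\<Prod>i\<in>I. emeasure lborel (ball (0::complex) (r i))) \<noteq> 0" using I by (simp add: prod_zero_iff)
    then show ?thesis by (simp add: zero_less_iff_neq_zero)
  qed
  also have "\<dots> = emeasure M (Pi\<^sub>E I (\<lambda>i. ball 0 (r i)))"
    using I by (intro emeasure_PiM[symmetric]) auto
  also have "\<dots> \<le> emeasure M B"
    using \<open>Pi\<^sub>E I (\<lambda>i. ball 0 (r i)) \<subseteq> B\<close> B_sets by (intro emeasure_mono)
  finally show ?thesis .
qed

lemma mean_invariant:
  assumes \<pi>: "bij_betw \<pi> I I" and c: "\<And>i. i \<in> I \<Longrightarrow> c i \<noteq> 0" "(\<Prod>i\<in>I. (c i)\<^sup>2) = 1"
    and iso: "\<And>a. wnorm2 (\<lambda>i\<in>I. c i *\<^sub>R a (\<pi> i)) = wnorm2 a"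
    and f: "f \<in> borel_measurable M"
  shows "mean f = mean (\<lambda>a. f (\<lambda>i\<in>I. c i *\<^sub>R a (\<pi> i)))"
proof -
  let ?T = "\<lambda>a. \<lambda>i\<in>I. c i *\<^sub>R (a (\<pi> i) :: complex)"
  have \<pi>I: "\<pi> i \<in> I" if "i \<in> I" for i using \<pi> that by (auto dest: bij_betwE)
  have T: "?T \<in> measurable M M"
    using \<pi>I by (intro measurable_restrict) (auto intro!: measurable_component_singleton borel_measurable_scaleR)
  note meas = weighted_measurable[OF f]
  have "mean f = (\<integral>a. indicator B a * f a / wnorm2 a \<partial>distr M M ?T)"
    unfolding mean_def using distr_PiM_permute_scale[OF I(1) \<pi> c] by simp
  also have "\<dots> = (\<integral>a. indicator B (?T a) * f (?T a) / wnorm2 (?T a) \<partial>M)"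
    by (rule integral_distr[OF T meas])
  also have "\<dots> = mean (\<lambda>a. f (?T a))"
    unfolding mean_def
  proof (rule Bochner_Integration.integral_cong[OF refl])
    fix a assume "a \<in> space M"
    then have "?T a \<in> B \<longleftrightarrow> a \<in> B" using iso[of a] measurable_space[OF T] by (auto simp: B_def)
    then show "indicator B (?T a) * f (?T a) / complex_of_real (wnorm2 (?T a)) =
        indicator B a * f (?T a) / complex_of_real (wnorm2 a)"
      by (simp add: iso indicator_def)
  qed
  finally show ?thesis .
qed

lemma mean_mixed:
  assumes "i \<in> I" "j \<in> I" "i \<noteq> j"
  shows "mean (\<lambda>a. a i * cnj (a j)) = 0"
proof -
  define c where "c k = (if k = i then -1 else 1 :: real)" for k
  note meas = mixed_measurable[OF assms(1,2)]
  have "mean (\<lambda>a. a i * cnj (a j)) = mean (\<lambda>a. (\<lambda>k\<in>I. c k *\<^sub>R a (id k)) i * cnj ((\<lambda>k\<in>I. c k *\<^sub>R a (id k)) j))"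
  proof (rule mean_invariant[OF _ _ _ _ meas])
    show "bij_betw id I I" by simp
    show "(\<Prod>i\<in>I. (c i)\<^sup>2) = 1" by (rule prod.neutral) (simp add: c_def)
    show "wnorm2 (\<lambda>k\<in>I. c k *\<^sub>R a (id k)) = wnorm2 a" for a
      unfolding wnorm2_def by (rule sum.cong) (auto simp: c_def)
  qed (simp add: c_def)
  also have "\<dots> = mean (\<lambda>a. - (a i * cnj (a j)))"
    using assms by (simp add: c_def)
  also have "\<dots> = - mean (\<lambda>a. a i * cnj (a j))"
    unfolding mean_def by (simp add: minus_divide_left[symmetric])
  finally show ?thesis by simp
qed

lemma mean_diag:
  assumes "i \<in> I" "j \<in> I"
  shows "w i * mean (\<lambda>a. a i * cnj (a i)) = w j * mean (\<lambda>a. a j * cnj (a j))"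
proof (cases "i = j")
  case False
  define \<pi> where "\<pi> = Transposition.transpose i j"
  \<comment> \<open>The square roots compensate the unequal weights: the rescaled transposition
    preserves \<open>wnorm2\<close>, and the two scaling factors multiply to one.\<close>
  define c where "c k = (if k = i then sqrt (w j / w i) else if k = j then sqrt (w i / w j) else 1)" for k
  have wij: "w i > 0" "w j > 0" using w assms by auto
  have \<pi>: "bij_betw \<pi> I I" unfolding \<pi>_def using assms
    by (intro bij_betwI[where g = "Transposition.transpose i j"]) (auto simp: Transposition.transpose_def)
  have c2: "(c k)\<^sup>2 = (if k = i then w j / w i else if k = j then w i / w j else 1)" for k
    using wij by (simp add: c_def)
  have cw: "w k * (c k)\<^sup>2 = w (\<pi> k)" for k
    using wij by (simp add: c2 \<pi>_def Transposition.transpose_def)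
  note meas = mixed_measurable[OF assms(1,1)]
  have "mean (\<lambda>a. a i * cnj (a i)) = mean (\<lambda>a. (\<lambda>k\<in>I. c k *\<^sub>R a (\<pi> k)) i * cnj ((\<lambda>k\<in>I. c k *\<^sub>R a (\<pi> k)) i))"
  proof (rule mean_invariant[OF \<pi> _ _ _ meas])
    show "c k \<noteq> 0" if "k \<in> I" for k using wij by (simp add: c_def)
    have "(\<Prod>k\<in>I. (c k)\<^sup>2) = (\<Prod>k\<in>{i, j}. (c k)\<^sup>2)"
      using I assms by (intro prod.mono_neutral_right) (auto simp: c_def)
    then show "(\<Prod>k\<in>I. (c k)\<^sup>2) = 1" using False wij by (simp add: c2)
    show "wnorm2 (\<lambda>k\<in>I. c k *\<^sub>R a (\<pi> k)) = wnorm2 a" for a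
    proof -
      have "wnorm2 (\<lambda>k\<in>I. c k *\<^sub>R a (\<pi> k)) = (\<Sum>k\<in>I. w (\<pi> k) * (cmod (a (\<pi> k)))\<^sup>2)"
        unfolding wnorm2_def by (rule sum.cong) (auto simp: power_mult_distrib cw[symmetric])
      also have "\<dots> = wnorm2 a" unfolding wnorm2_def by (rule sum.reindex_bij_betw[OF \<pi>])
      finally show ?thesis .
    qed
  qed
  also have "\<dots> = mean (\<lambda>a. of_real ((c i)\<^sup>2) * (a j * cnj (a j)))"
    using assms by (simp add: \<pi>_def scaleR_conv_of_real power2_eq_square mult_ac)
  also have "\<dots> = of_real ((c i)\<^sup>2) * mean (\<lambda>a. a j * cnj (a j))"
  proof -
    have "(\<lambda>a. indicator B a * (of_real ((c i)\<^sup>2) * (a j * cnj (a j))) / complex_of_real (wnorm2 a)) =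
        (\<lambda>a. of_real ((c i)\<^sup>2) * (indicator B a * (a j * cnj (a j)) / complex_of_real (wnorm2 a)))"
      by (simp add: mult_ac)
    then show ?thesis unfolding mean_def by (simp only: integral_mult_right_zero)
  qed
  finally have "mean (\<lambda>a. a i * cnj (a i)) = of_real (w j / w i) * mean (\<lambda>a. a j * cnj (a j))"
    unfolding c2 by simp
  then show ?thesis using wij by (simp add: field_simps)
qed simp

lemma integrable_mixed:
  assumes "i \<in> I" "j \<in> I"
  shows "integrable M (\<lambda>a. indicator B a * (a i * cnj (a j)) / complex_of_real (wnorm2 a))"
proof (rule Bochner_Integration.integrable_bound)
  \<comment> \<open>Each \<open>sqrt (w i) * cmod (a i)\<close> is at most
    \<open>sqrt (wnorm2 a)\<close>, which bounds the quotient; at the origin it is 0 by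
    convention.\<close>
  let ?K = "1 / (sqrt (w i) * sqrt (w j))"
  show "integrable M (\<lambda>a. ?K * indicator B a :: real)"
    using B_sets emeasure_B_finite by (intro integrable_mult_right integrable_real_indicator) auto
  show "(\<lambda>a. indicator B a * (a i * cnj (a j)) / complex_of_real (wnorm2 a)) \<in> borel_measurable M"
    by (rule weighted_measurable[OF mixed_measurable[OF assms]])
  have "cmod (a i) * cmod (a j) / wnorm2 a \<le> ?K" for a
  proof (cases "wnorm2 a = 0")
    case False
    then have p: "wnorm2 a > 0" using wnorm2_nonneg[of a] by simp
    have "sqrt (w i) * cmod (a i) \<le> sqrt (wnorm2 a)" "sqrt (w j) * cmod (a j) \<le> sqrt (wnorm2 a)"
      using component_le[OF assms(1), of a] component_le[OF assms(2), of a] w assms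
      by (auto intro!: real_le_rsqrt simp: power_mult_distrib less_imp_le)
    then have "(sqrt (w i) * cmod (a i)) * (sqrt (w j) * cmod (a j)) \<le> sqrt (wnorm2 a) * sqrt (wnorm2 a)"
      using w[OF assms(2)] p by (intro mult_mono) auto
    then have "(sqrt (w i) * sqrt (w j)) * (cmod (a i) * cmod (a j)) \<le> wnorm2 a"
      using p by (simp add: mult_ac)
    then show ?thesis using w[OF assms(1)] w[OF assms(2)] p by (simp add: field_simps)
  qed (use w assms in \<open>auto intro!: mult_nonneg_nonneg less_imp_le\<close>)
  then show "AE a in M. norm (indicator B a * (a i * cnj (a j)) / complex_of_real (wnorm2 a)) \<le>
      norm (?K * indicator B a :: real)"
    using wnorm2_nonneg w[OF assms(1)] w[OF assms(2)]
    by (intro AE_I2) (simp add: norm_mult norm_divide indicator_def abs_mult less_imp_le)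
qed

text \<open>The weighted sum of all diagonal terms has integrand 1 on the ball outside the null set
  where \<open>wnorm2\<close> vanishes, hence equals its volume. By \<open>mean_diag\<close> all
  summands are equal, so each is the share \<open>1 / card I\<close>.\<close>

lemma mean_diag_value:
  assumes "i \<in> I"
  shows "mean (\<lambda>a. a i * cnj (a i)) = of_real (measure M B / (card I * w i))"
proof -
  have null: "AE a in M. wnorm2 a \<noteq> 0"
  proof -
    interpret product_sigma_finite "\<lambda>_::'i. lborel :: complex measure"
      by (rule product_sigma_finite_lborel)
    have "{a \<in> space M. wnorm2 a = 0} \<subseteq> Pi\<^sub>E I (\<lambda>_. {0})"
    proof
      fix a assume a: "a \<in> {a \<in> space M. wnorm2 a = 0}"
      have "a i = 0" if "i \<in> I" for i
      proof -
        have "w i * (cmod (a i))\<^sup>2 \<le> 0" using component_le[OF that, of a] a by simp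
        then show ?thesis using w[OF that] by (simp add: mult_le_0_iff)
      qed
      then show "a \<in> Pi\<^sub>E I (\<lambda>_. {0})" unfolding PiE_iff using a by (auto simp: space_PiM PiE_def)
    qed
    moreover have "Pi\<^sub>E I (\<lambda>_. {0}) \<in> null_sets M"
    proof (rule null_setsI)
      have "emeasure M (Pi\<^sub>E I (\<lambda>_. {0})) = (\<Prod>i\<in>I. emeasure lborel {0::complex})"
        using I by (intro emeasure_PiM) auto
      then show "emeasure M (Pi\<^sub>E I (\<lambda>_. {0})) = 0" using I by (simp add: card_gt_0_iff)
      show "Pi\<^sub>E I (\<lambda>_. {0}) \<in> sets M" using I by (intro sets_PiM_I_finite) auto
    qed
    ultimately have "AE a in M. a \<notin> {a \<in> space M. wnorm2 a = 0}"
      by (intro AE_I'[of "Pi\<^sub>E I (\<lambda>_. {0})"]) auto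
    then show ?thesis by (auto elim!: AE_mp intro!: AE_I2)
  qed
  have sumw: "(\<Sum>k\<in>I. of_real (w k) * (a k * cnj (a k))) = complex_of_real (wnorm2 a)" for a
    unfolding wnorm2_def by (simp only: of_real_sum of_real_mult complex_norm_square)
  have "(\<Sum>k\<in>I. of_real (w k) * mean (\<lambda>a. a k * cnj (a k))) =
      (\<integral>a. (\<Sum>k\<in>I. of_real (w k) * (indicator B a * (a k * cnj (a k)) / complex_of_real (wnorm2 a))) \<partial>M)"
    unfolding mean_def
    by (subst Bochner_Integration.integral_sum)
      (intro integrable_mult_right integrable_mixed, assumption+, simp only: integral_mult_right_zero)
  also have "\<dots> = (\<integral>a. indicator B a \<partial>M)"
  proof (rule integral_cong_AE)
    show "(\<lambda>a. \<Sum>k\<in>I. of_real (w k) * (indicator B a * (a k * cnj (a k)) / complex_of_real (wnorm2 a))) \<in> borel_measurable M"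
      by (intro borel_measurable_sum borel_measurable_times borel_measurable_const
          borel_measurable_integrable[OF integrable_mixed])
    show "(\<lambda>a. indicator B a :: complex) \<in> borel_measurable M" using B_sets by measurable
    show "AE a in M. (\<Sum>k\<in>I. of_real (w k) * (indicator B a * (a k * cnj (a k)) / complex_of_real (wnorm2 a))) = indicator B a"
      using null
    proof (rule AE_mp, intro AE_I2 impI)
      fix a assume "wnorm2 a \<noteq> 0"
      have "(\<Sum>k\<in>I. of_real (w k) * (indicator B a * (a k * cnj (a k)) / complex_of_real (wnorm2 a))) =
          indicator B a * (\<Sum>k\<in>I. of_real (w k) * (a k * cnj (a k))) / complex_of_real (wnorm2 a)"
        unfolding sum_distrib_left sum_divide_distrib by (rule sum.cong) (simp_all add: mult_ac)
      then show "(\<Sum>k\<in>I. of_real (w k) * (indicator B a * (a k * cnj (a k)) / complex_of_real (wnorm2 a))) = indicator B a"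
        unfolding sumw using \<open>wnorm2 a \<noteq> 0\<close> by simp
    qed
  qed
  also have "\<dots> = of_real (measure M B)"
  proof -
    have "(\<lambda>a. indicator B a :: complex) = (\<lambda>a. complex_of_real (indicator B a))"
      by (simp add: indicator_def fun_eq_iff)
    then show ?thesis using B_sets by (simp add: sets.Int_space_eq2)
  qed
  finally have "of_real (card I * w i) * mean (\<lambda>a. a i * cnj (a i)) = complex_of_real (measure M B)"
    using mean_diag[OF _ assms] by (simp add: mult.assoc)
  moreover have "card I * w i > 0" using I w[OF assms] by (simp add: card_gt_0_iff)
  then have "complex_of_real (card I * w i) \<noteq> 0" by (simp only: of_real_eq_0_iff)
  ultimately show ?thesis unfolding of_real_divide by (intro eq_divide_imp) (simp_all only: mult.commute not_False_eq_True)
qed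

theorem ball_average_linear_form:
  "(\<integral>a. indicator B a * (cmod (\<Sum>i\<in>I. a i * e i))\<^sup>2 / wnorm2 a \<partial>M) =
    measure M B / card I * (\<Sum>i\<in>I. (cmod (e i))\<^sup>2 / w i)"
proof -
  have sq: "complex_of_real ((cmod (\<Sum>i\<in>I. a i * e i))\<^sup>2) =
      (\<Sum>i\<in>I. \<Sum>j\<in>I. (a i * cnj (a j)) * (e i * cnj (e j)))" for a
    unfolding complex_norm_square cnj_sum sum_product by (simp add: mult_ac)
  have "complex_of_real (\<integral>a. indicator B a * (cmod (\<Sum>i\<in>I. a i * e i))\<^sup>2 / wnorm2 a \<partial>M) =
      (\<integral>a. complex_of_real (indicator B a * (cmod (\<Sum>i\<in>I. a i * e i))\<^sup>2 / wnorm2 a) \<partial>M)"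
    by (rule integral_complex_of_real[symmetric])
  also have "\<dots> = (\<integral>a. (\<Sum>i\<in>I. \<Sum>j\<in>I. (e i * cnj (e j)) * (indicator B a * (a i * cnj (a j)) / complex_of_real (wnorm2 a))) \<partial>M)"
  proof (rule Bochner_Integration.integral_cong[OF refl])
    fix a
    have "complex_of_real (indicator B a * (cmod (\<Sum>i\<in>I. a i * e i))\<^sup>2 / wnorm2 a) =
       indicator B a * complex_of_real ((cmod (\<Sum>i\<in>I. a i * e i))\<^sup>2) / complex_of_real (wnorm2 a)"
      by (simp add: indicator_def)
    also have "\<dots> = (\<Sum>i\<in>I. \<Sum>j\<in>I. (e i * cnj (e j)) * (indicator B a * (a i * cnj (a j)) / complex_of_real (wnorm2 a)))"
      unfolding sq sum_distrib_left sum_divide_distrib by (intro sum.cong refl) (simp add: mult_ac)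
    finally show "complex_of_real (indicator B a * (cmod (\<Sum>i\<in>I. a i * e i))\<^sup>2 / wnorm2 a) = \<dots>" .
  qed
  also have "\<dots> = (\<Sum>i\<in>I. \<Sum>j\<in>I. (e i * cnj (e j)) * mean (\<lambda>a. a i * cnj (a j)))"
  proof -
    have int: "integrable M (\<lambda>a. (e i * cnj (e j)) * (indicator B a * (a i * cnj (a j)) / complex_of_real (wnorm2 a)))"
      if "i \<in> I" "j \<in> I" for i j
      by (intro integrable_mult_right integrable_mixed that)
    have inner: "(\<integral>a. (\<Sum>j\<in>I. (e i * cnj (e j)) * (indicator B a * (a i * cnj (a j)) / complex_of_real (wnorm2 a))) \<partial>M) =
        (\<Sum>j\<in>I. (e i * cnj (e j)) * mean (\<lambda>a. a i * cnj (a j)))" if "i \<in> I" for i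
      unfolding mean_def
      by (subst Bochner_Integration.integral_sum, rule int[OF that], assumption) (simp only: integral_mult_right_zero)
    show ?thesis
      by (subst Bochner_Integration.integral_sum, intro Bochner_Integration.integrable_sum int, assumption+)
        (rule sum.cong[OF refl inner])
  qed
  also have "\<dots> = (\<Sum>i\<in>I. (e i * cnj (e i)) * mean (\<lambda>a. a i * cnj (a i)))"
  proof (rule sum.cong[OF refl])
    fix i assume i: "i \<in> I"
    have "(\<Sum>j\<in>I. (e i * cnj (e j)) * mean (\<lambda>a. a i * cnj (a j))) = (\<Sum>j\<in>{i}. (e i * cnj (e j)) * mean (\<lambda>a. a i * cnj (a j)))"
      using I i mean_mixed by (intro sum.mono_neutral_right) auto
    then show "(\<Sum>j\<in>I. (e i * cnj (e j)) * mean (\<lambda>a. a i * cnj (a j))) = (e i * cnj (e i)) * mean (\<lambda>a. a i * cnj (a i))" by simp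
  qed
  also have "\<dots> = complex_of_real (measure M B / card I * (\<Sum>i\<in>I. (cmod (e i))\<^sup>2 / w i))"
    unfolding sum_distrib_left of_real_sum
  proof (rule sum.cong[OF refl])
    fix i assume i: "i \<in> I"
    show "(e i * cnj (e i)) * mean (\<lambda>a. a i * cnj (a i)) =
        complex_of_real (measure M B / card I * ((cmod (e i))\<^sup>2 / w i))"
      unfolding mean_diag_value[OF i] unfolding complex_norm_square[symmetric] of_real_mult[symmetric]
      by (simp add: mult_ac)
  qed
  finally show ?thesis by (simp only: of_real_eq_iff)
qed

end

lemma finite_exponents:
  assumes "P \<subseteq> scaled_simplex p"
  shows "exponents N P \<subseteq> mexps (N * p)" "finite (exponents N P)"
proof -
  show "exponents N P \<subseteq> mexps (N * p)"
  proof
    fix \<alpha> assume "\<alpha> \<in> exponents N P"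
    then obtain x where x: "x \<in> P" "(\<chi> j. real (\<alpha> $ j)) = real N *\<^sub>R x" by (auto simp: exponents_def)
    then obtain y where y: "y \<in> std_simplex" "x = real p *\<^sub>R y" using assms by (auto simp: scaled_simplex_def)
    have "real (\<alpha> $ j) = real (N * p) * y $ j" for j
      using arg_cong[OF x(2), of "\<lambda>v. v $ j"] y(2) by simp
    then have "real (\<Sum>j\<in>UNIV. \<alpha> $ j) = real (N * p) * (\<Sum>j\<in>UNIV. y $ j)"
      by (simp add: sum_distrib_left)
    also have "\<dots> \<le> real (N * p) * 1"
      using y(1) by (intro mult_left_mono) (auto simp: std_simplex_def)
    finally show "\<alpha> \<in> mexps (N * p)" by (simp only: mexps_def mem_Collect_eq mult_1_right of_nat_le_iff)
  qed
  then show "finite (exponents N P)" using finite_mexps finite_subset by blast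
qed

lemma monomial_norm2_pos: "monomial_norm2 p N \<alpha> > 0"
  by (simp add: monomial_norm2_def prod_pos)

lemma integral_uniform_measure_real:
  fixes f :: "'a \<Rightarrow> real"
  assumes f: "f \<in> borel_measurable M" and B: "B \<in> sets M" "emeasure M B > 0" "emeasure M B < \<infinity>"
  shows "(\<integral>x. f x \<partial>uniform_measure M B) = (\<integral>x. indicator B x * f x \<partial>M) / measure M B"
proof -
  have eB: "emeasure M B = ennreal (measure M B)" using B by (intro emeasure_eq_ennreal_measure) auto
  then have pos: "measure M B > 0" using B by simp
  have "(\<lambda>x. indicator B x / emeasure M B) = (\<lambda>x. ennreal (indicator B x / measure M B))"
    unfolding eB using pos by (auto simp: fun_eq_iff indicator_def divide_ennreal ennreal_1[symmetric] simp del: ennreal_1)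
  then have "uniform_measure M B = density M (\<lambda>x. ennreal (indicator B x / measure M B))"
    by (simp add: uniform_measure_def)
  then have "(\<integral>x. f x \<partial>uniform_measure M B) = (\<integral>x. (indicator B x / measure M B) *\<^sub>R f x \<partial>M)"
    using f B(1) by (simp add: integral_density)
  also have "\<dots> = (\<integral>x. (indicator B x * f x) / measure M B \<partial>M)" by simp
  also have "\<dots> = (\<integral>x. indicator B x * f x \<partial>M) / measure M B" by (rule integral_divide_zero)
  finally show ?thesis .
qed

text \<open>The sum is the reproducing kernel on the diagonal and the cardinality is the dimension
  of the polynomial space. Evaluating at a normalised coefficient vector divides the squared modulus
  by \<open>wnorm2\<close>, which brings the radial projection into the form of
  \<open>ball_average_linear_form\<close>.\<close>

theorem expected_mass_eq_sum:
  fixes P :: "(real ^ 'n) set"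
  assumes P: "P \<subseteq> scaled_simplex p" and ne: "exponents N P \<noteq> {}"
  shows "expected_mass p N P z =
    (\<Sum>\<alpha>\<in>exponents N P. (cmod (monomial \<alpha> z))\<^sup>2 / monomial_norm2 p N \<alpha>) /
      (1 + (norm z)\<^sup>2) ^ (N * p) / card (exponents N P)"
proof -
  define I where "I = exponents N P"
  interpret coefficient_ball I "monomial_norm2 p N"
    by standard (use finite_exponents(2)[OF P] ne monomial_norm2_pos in \<open>auto simp: I_def\<close>)
  have M: "poly_lebesgue N P = M" by (simp add: poly_lebesgue_def I_def)
  have inner: "Re (poly_inner p N P a a) = wnorm2 a" for a
    unfolding poly_inner_def wnorm2_def I_def[symmetric] Re_sum
    by (rule sum.cong) (simp_all add: mult.assoc complex_norm_square[symmetric] del: of_real_power)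
  have norm_eq: "poly_norm p N P a = sqrt (wnorm2 a)" for a by (simp add: poly_norm_def inner)
  have ball: "poly_ball p N P = B" by (simp add: poly_ball_def B_def M norm_eq)
  have sphere: "poly_sphere p N P = {a \<in> space M. wnorm2 a = 1}"
    by (simp add: poly_sphere_def M norm_eq real_sqrt_eq_1_iff)
  let ?nrm = "poly_normalize p N P" and ?S = "poly_sphere p N P"
  let ?d = "(1 + (norm z)\<^sup>2) ^ (N * p)"
  let ?U = "uniform_measure M B"
  have S: "?S \<in> sets M" unfolding sphere using wnorm2_measurable by measurable
  have nrm: "?nrm \<in> measurable M M"
    unfolding poly_normalize_def I_def[symmetric] norm_eq
  proof (rule measurable_restrict)
    fix i assume "i \<in> I"
    have "(\<lambda>a. complex_of_real (sqrt (wnorm2 a))) \<in> borel_measurable M"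
      by (rule measurable_compose[OF wnorm2_measurable borel_measurable_continuous_onI]) (intro continuous_intros)
    then have "(\<lambda>a. a i / complex_of_real (sqrt (wnorm2 a))) \<in> borel_measurable M"
      using component_measurable[OF \<open>i \<in> I\<close>] by (intro borel_measurable_divide)
    then show "(\<lambda>a. a i / complex_of_real (sqrt (wnorm2 a))) \<in> measurable M lborel" by simp
  qed
  define F where "F a = (cmod (poly_eval N P a z))\<^sup>2 / ?d" for a
  have F: "F \<in> borel_measurable M"
  proof -
    have "(\<lambda>a. poly_eval N P a z) \<in> borel_measurable M"
      unfolding poly_eval_def I_def[symmetric]
      by (intro borel_measurable_sum borel_measurable_times borel_measurable_const component_measurable)
    then have "(\<lambda>a. cmod (poly_eval N P a z)) \<in> borel_measurable M"
      by (rule measurable_compose[OF _ borel_measurable_norm])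
    then show ?thesis unfolding F_def
      by (intro borel_measurable_divide borel_measurable_power borel_measurable_const)
  qed
  have nrmU: "?nrm \<in> measurable ?U M" using nrm by simp
  have G: "(\<lambda>a. indicator ?S a *\<^sub>R F a) \<in> borel_measurable M" using S F by measurable
  have "expected_mass p N P z = (\<integral>a. F a \<partial>restrict_space (distr ?U M ?nrm) ?S)"
    by (simp add: expected_mass_def poly_haar_def M ball F_def)
  also have "\<dots> = (\<integral>a. indicator ?S a *\<^sub>R F a \<partial>distr ?U M ?nrm)"
    using S by (intro integral_restrict_space) (auto simp: sets.Int_space_eq2)
  also have "\<dots> = (\<integral>a. indicator ?S (?nrm a) *\<^sub>R F (?nrm a) \<partial>?U)"
    by (rule integral_distr[OF nrmU G])
  also have "\<dots> = (\<integral>a. indicator B a * (indicator ?S (?nrm a) *\<^sub>R F (?nrm a)) \<partial>M) / measure M B"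
    by (intro integral_uniform_measure_real B_sets emeasure_B_finite emeasure_B_pos
        measurable_compose[OF nrm G])
  also have "(\<integral>a. indicator B a * (indicator ?S (?nrm a) *\<^sub>R F (?nrm a)) \<partial>M) =
      (\<integral>a. indicator B a * (cmod (\<Sum>i\<in>I. a i * monomial i z))\<^sup>2 / wnorm2 a / ?d \<partial>M)"
  proof (rule Bochner_Integration.integral_cong[OF refl])
    fix a assume a: "a \<in> space M"
    have ev: "poly_eval N P (?nrm a) z = poly_eval N P a z / complex_of_real (sqrt (wnorm2 a))"
      unfolding poly_eval_def poly_normalize_def I_def[symmetric] norm_eq sum_divide_distrib
      by (rule sum.cong) auto
    have Fn: "F (?nrm a) = (cmod (\<Sum>i\<in>I. a i * monomial i z))\<^sup>2 / wnorm2 a / ?d"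
      unfolding F_def ev using wnorm2_nonneg[of a]
      by (simp add: norm_divide power_divide poly_eval_def I_def)
    show "indicator B a * (indicator ?S (?nrm a) *\<^sub>R F (?nrm a)) =
        indicator B a * (cmod (\<Sum>i\<in>I. a i * monomial i z))\<^sup>2 / wnorm2 a / ?d"
    proof (cases "wnorm2 a = 0")
      \<comment> \<open>Here \<open>poly_normalize\<close> divides by zero; both integrands are 0
        under the same convention.\<close>
      case True
      then show ?thesis unfolding Fn by simp
    next
      case False
      have "wnorm2 (?nrm a) = (\<Sum>i\<in>I. monomial_norm2 p N i * (cmod (a i))\<^sup>2 / wnorm2 a)"
        unfolding wnorm2_def[of "?nrm a"] using wnorm2_nonneg[of a]
        by (intro sum.cong refl) (simp add: poly_normalize_def norm_eq norm_divide power_divide I_def)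
      also have "\<dots> = 1" using False unfolding sum_divide_distrib[symmetric] wnorm2_def[symmetric] by simp
      finally have "?nrm a \<in> ?S" unfolding sphere using measurable_space[OF nrm a] by simp
      then show ?thesis unfolding Fn by simp
    qed
  qed
  also have "\<dots> = (\<integral>a. indicator B a * (cmod (\<Sum>i\<in>I. a i * monomial i z))\<^sup>2 / wnorm2 a \<partial>M) / ?d"
    by (rule integral_divide_zero)
  also have "\<dots> = measure M B / card I * (\<Sum>\<alpha>\<in>I. (cmod (monomial \<alpha> z))\<^sup>2 / monomial_norm2 p N \<alpha>) / ?d"
    by (simp only: ball_average_linear_form)
  also have "\<dots> / measure M B = (\<Sum>\<alpha>\<in>I. (cmod (monomial \<alpha> z))\<^sup>2 / monomial_norm2 p N \<alpha>) / ?d / card I"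
    using emeasure_B_pos emeasure_B_finite by (simp add: measure_def enn2real_eq_0_iff less_top[symmetric])
  finally show ?thesis by (simp add: I_def)
qed

text \<open>The denominator \<open>1 + (norm z)\<^sup>2\<close> is the reciprocal of the remaining
  cell probability, and the factorials of \<open>monomial_norm2\<close> are those of the multinomial
  coefficient except for a factor that does not depend on \<alpha>.\<close>

lemma mass_term_eq_mweight:
  fixes z :: "complex ^ 'n" and \<alpha> :: "nat ^ 'n"
  assumes "\<alpha> \<in> mexps (N * p)"
  shows "(cmod (monomial \<alpha> z))\<^sup>2 / monomial_norm2 p N \<alpha> / (1 + (norm z)\<^sup>2) ^ (N * p) =
    fact (N * p + CARD('n)) / fact (N * p) * mweight (N * p) (moment_map z) \<alpha>"
proof -
  let ?s = "\<Sum>j\<in>UNIV. \<alpha> $ j" and ?Z = "1 + (norm z)\<^sup>2"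
  have Z: "?Z > 0" by (simp add: add_pos_nonneg)
  have nz: "(norm z)\<^sup>2 = (\<Sum>j\<in>UNIV. (cmod (z $ j))\<^sup>2)"
    by (simp add: norm_vec_def L2_set_def sum_nonneg)
  have a: "1 - (\<Sum>j\<in>UNIV. moment_map z $ j) = 1 / ?Z"
    using Z by (simp add: moment_map_def sum_divide_distrib[symmetric] nz[symmetric] field_simps)
  have b: "(\<Prod>j\<in>UNIV. moment_map z $ j ^ \<alpha> $ j) = (cmod (monomial \<alpha> z))\<^sup>2 / ?Z ^ ?s"
    by (simp add: moment_map_def monomial_def power_divide prod_dividef prod_norm[symmetric]
        power_sum[symmetric] norm_power power_mult[symmetric] prod_power_distrib mult.commute)
  have c: "?Z ^ (N * p) = ?Z ^ ?s * ?Z ^ (N * p - ?s)"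
    using assms by (simp add: power_add[symmetric] mexps_def)
  show ?thesis
    unfolding mweight_def a b c
    using Z by (simp add: mcoef_def monomial_norm2_def power_one_over field_simps)
qed

theorem expected_mass_eq_mweight:
  fixes P :: "(real ^ 'n) set"
  assumes P: "P \<subseteq> scaled_simplex p" and ne: "exponents N P \<noteq> {}"
  shows "expected_mass p N P z =
    fact (N * p + CARD('n)) / fact (N * p) / card (exponents N P) *
    (\<Sum>\<alpha>\<in>exponents N P. mweight (N * p) (moment_map z) \<alpha>)"
proof -
  have "(\<Sum>\<alpha>\<in>exponents N P. (cmod (monomial \<alpha> z))\<^sup>2 / monomial_norm2 p N \<alpha>) / (1 + (norm z)\<^sup>2) ^ (N * p) =
      (\<Sum>\<alpha>\<in>exponents N P. fact (N * p + CARD('n)) / fact (N * p) * mweight (N * p) (moment_map z) \<alpha>)"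
    unfolding sum_divide_distrib
    by (rule sum.cong[OF refl], rule mass_term_eq_mweight) (use finite_exponents(1)[OF P] in blast)
  then show ?thesis
    unfolding expected_mass_eq_sum[OF P ne] by (simp only: sum_distrib_left sum_divide_distrib) (simp add: mult_ac)
qed

section \<open>The moment map and the decay function\<close>

definition osimplex :: "real \<Rightarrow> (real ^ 'n) set" where
  "osimplex c = {q. (\<forall>j. 0 < q $ j) \<and> (\<Sum>j\<in>UNIV. q $ j) < c}"

definition csimplex :: "real \<Rightarrow> (real ^ 'n) set" where
  "csimplex c = {q. (\<forall>j. 0 \<le> q $ j) \<and> (\<Sum>j\<in>UNIV. q $ j) \<le> c}"

definition partition_fun :: "real ^ 'n \<Rightarrow> real" where
  "partition_fun r = 1 + (\<Sum>j\<in>UNIV. exp (r $ j))"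

text \<open>The gradient of \<open>c * log_partition\<close>. At \<open>r = log_mod z\<close> it is
  \<open>c\<close> times the moment map, which thereby becomes a function on real vectors.\<close>

definition mom :: "real \<Rightarrow> real ^ 'n \<Rightarrow> real ^ 'n" where
  "mom c r = (\<chi> j. c * exp (r $ j) / partition_fun r)"

text \<open>The inverse of \<open>mom c\<close> on the open simplex, and minus the gradient of the
  entropy of the barycentric coordinates.\<close>

definition log_odds :: "real \<Rightarrow> real ^ 'n \<Rightarrow> real ^ 'n" where
  "log_odds c q = (\<chi> j. ln (q $ j) - ln (c - (\<Sum>j\<in>UNIV. q $ j)))"

definition log_mod :: "complex ^ 'n \<Rightarrow> real ^ 'n" where
  "log_mod z = (\<chi> j. ln ((cmod (z $ j))\<^sup>2))"

lemma osimplex_subset_csimplex: "osimplex c \<subseteq> csimplex c"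
  by (auto simp: osimplex_def csimplex_def less_imp_le)

lemma open_osimplex: "open (osimplex c :: (real ^ 'n) set)"
proof -
  have "osimplex c = (\<Inter>j. {q :: real ^ 'n. 0 < q $ j}) \<inter> {q. (\<Sum>j\<in>UNIV. q $ j) < c}"
    by (auto simp: osimplex_def)
  then show ?thesis
    by (auto intro!: open_Int open_INT open_Collect_less continuous_intros)
qed

lemma scaled_simplex_eq: "p > 0 \<Longrightarrow> scaled_simplex p = csimplex (real p)"
proof (intro equalityI subsetI)
  fix x :: "real ^ 'n" assume p: "p > 0"
  show "x \<in> csimplex (real p)" if "x \<in> scaled_simplex p"
    using that p by (auto simp: scaled_simplex_def std_simplex_def csimplex_def sum_distrib_left[symmetric])
  show "x \<in> scaled_simplex p" if "x \<in> csimplex (real p)"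
    unfolding scaled_simplex_def
  proof (rule image_eqI[of _ _ "(1 / real p) *\<^sub>R x"])
    show "(1 / real p) *\<^sub>R x \<in> std_simplex" using that p
      by (auto simp: std_simplex_def csimplex_def sum_divide_distrib[symmetric])
  qed (use p in simp)
qed

lemma interior_csimplex: "interior (csimplex c :: (real ^ 'n) set) = osimplex c"
proof
  show "osimplex c \<subseteq> interior (csimplex c :: (real ^ 'n) set)"
    by (rule interior_maximal[OF osimplex_subset_csimplex open_osimplex])
  show "interior (csimplex c) \<subseteq> (osimplex c :: (real ^ 'n) set)"
  proof
    fix x :: "real ^ 'n" assume "x \<in> interior (csimplex c)"
    then obtain e where e: "e > 0" "cball x e \<subseteq> csimplex c" using mem_interior_cball by blast
    have mem: "x + s *\<^sub>R axis j 1 \<in> csimplex c" if "\<bar>s\<bar> \<le> e" for s j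
      by (rule subsetD[OF e(2)]) (use that in \<open>simp add: dist_norm norm_axis_1\<close>)
    have "0 < x $ j" for j
      using mem[of "- e" j] e(1) by (auto simp: csimplex_def axis_def dest!: spec[of _ j])
    moreover have "(\<Sum>i\<in>UNIV. (x + e *\<^sub>R axis j 1) $ i) = (\<Sum>i\<in>UNIV. x $ i) + e" for j
      by (simp add: sum.distrib sum_distrib_left[symmetric] axis_def)
    then have "(\<Sum>i\<in>UNIV. x $ i) < c"
      using mem[of e undefined] e(1) by (simp add: csimplex_def)
    ultimately show "x \<in> osimplex c" by (simp add: osimplex_def)
  qed
qed

lemma partition_fun_pos: "partition_fun r > 0"
  unfolding partition_fun_def by (intro add_pos_nonneg sum_nonneg) auto

lemma mom_in_osimplex:
  assumes "c > 0" shows "mom c r \<in> osimplex c"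
proof -
  have "(\<Sum>j\<in>UNIV. exp (r $ j)) < partition_fun r" by (simp add: partition_fun_def)
  then have "c * (\<Sum>j\<in>UNIV. exp (r $ j)) / partition_fun r < c"
    using assms partition_fun_pos[of r] by (simp add: field_simps)
  then show ?thesis using assms partition_fun_pos[of r]
    by (simp add: osimplex_def mom_def sum_divide_distrib[symmetric] sum_distrib_left[symmetric])
qed

lemma mom_log_odds:
  assumes "q \<in> osimplex c" shows "mom c (log_odds c q) = q"
proof -
  let ?s = "\<Sum>j\<in>UNIV. q $ j"
  have q: "\<And>j. q $ j > 0" "?s < c" using assms by (auto simp: osimplex_def)
  have c: "c > 0" using q(2) sum_pos[of UNIV "\<lambda>j. q $ j"] q(1) by auto
  have e: "exp (log_odds c q $ j) = q $ j / (c - ?s)" for j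
    using q by (simp add: log_odds_def exp_diff)
  have "partition_fun (log_odds c q) = c / (c - ?s)"
    using q(2) by (simp add: partition_fun_def e sum_divide_distrib[symmetric] field_simps)
  then show ?thesis using q c by (simp add: mom_def e vec_eq_iff)
qed

lemma log_odds_mom:
  assumes "c > 0" shows "log_odds c (mom c r) = r"
proof -
  have Z: "partition_fun r > 0" by (rule partition_fun_pos)
  have "c - (\<Sum>j\<in>UNIV. mom c r $ j) = c / partition_fun r"
    using Z by (simp add: mom_def sum_divide_distrib[symmetric] sum_distrib_left[symmetric] field_simps)
      (simp add: partition_fun_def algebra_simps)
  then show ?thesis using assms Z
    by (simp add: log_odds_def vec_eq_iff) (simp add: mom_def ln_div ln_mult)
qed

lemma log_mod:
  fixes z :: "complex ^ 'n"
  assumes "z \<in> ctorus"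
  shows "exp (log_mod z $ j) = (cmod (z $ j))\<^sup>2" "partition_fun (log_mod z) = 1 + (norm z)\<^sup>2"
    "mom (real p) (log_mod z) = real p *\<^sub>R moment_map z"
proof -
  show e: "exp (log_mod z $ j) = (cmod (z $ j))\<^sup>2" for j
    using assms by (simp add: log_mod_def ctorus_def)
  show Z: "partition_fun (log_mod z) = 1 + (norm z)\<^sup>2"
    by (simp add: partition_fun_def e norm_vec_def L2_set_def sum_nonneg)
  show "mom (real p) (log_mod z) = real p *\<^sub>R moment_map z"
    unfolding mom_def Z moment_map_def e by (simp add: vec_eq_iff)
qed

lemma exp_act_ctorus: "exp_act \<tau> z \<in> ctorus \<longleftrightarrow> z \<in> ctorus"
  by (simp add: exp_act_def ctorus_def)

lemma log_mod_exp_act: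
  assumes "z \<in> ctorus" shows "log_mod (exp_act \<tau> z) = log_mod z + 2 *\<^sub>R \<tau>"
  using assms by (simp add: log_mod_def exp_act_def ctorus_def vec_eq_iff norm_mult power_mult_distrib
      ln_mult ln_realpow)

lemma exp_act_inverse: "exp_act \<tau> (exp_act (- \<tau>) z) = z"
  by (simp add: exp_act_def vec_eq_iff mult.assoc[symmetric] flip: of_real_mult exp_add)

lemma open_ctorus: "open (ctorus :: (complex ^ 'n) set)"
proof -
  have "ctorus = (\<Inter>j. {z :: complex ^ 'n. z $ j \<noteq> 0})" by (auto simp: ctorus_def)
  also have "open \<dots>"
    by (intro open_INT finite ballI open_Collect_neq continuous_intros)
  finally show ?thesis .
qed

lemma smooth_on_log_mod: "smooth_on (\<lambda>z :: complex ^ 'n. log_mod z $ j) ctorus"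
proof -
  have lin: "bounded_linear (\<lambda>z :: complex ^ 'n. Re (z $ j))" "bounded_linear (\<lambda>z :: complex ^ 'n. Im (z $ j))"
    by (auto intro: bounded_linear_compose[OF bounded_linear_Re] bounded_linear_compose[OF bounded_linear_Im]
        bounded_linear_vec_nth)
  have "smooth_on (\<lambda>z :: complex ^ 'n. ln (Re (z $ j) * Re (z $ j) + Im (z $ j) * Im (z $ j))) ctorus"
    by (intro smooth_on_ln smooth_on_add smooth_on_mult smooth_on_linear lin open_ctorus)
      (auto simp: ctorus_def complex_eq_iff sum_squares_gt_zero_iff)
  then show ?thesis by (simp add: log_mod_def cmod_def power2_eq_square[symmetric])
qed

section \<open>Strong monotonicity and the constrained maximiser\<close>

lemma ln_strongly_monotone:
  fixes a b c :: real
  assumes "0 < a" "a \<le> c" "0 < b" "b \<le> c"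
  shows "(a - b)\<^sup>2 / c \<le> (a - b) * (ln a - ln b)"
proof -
  have *: "(x - y)\<^sup>2 / c \<le> (x - y) * (ln x - ln y)" if "0 < y" "y \<le> x" "x \<le> c" for x y :: real
  proof -
    have "ln (y / x) \<le> y / x - 1" using that by (intro ln_le_minus_one) auto
    then have "(x - y) / x \<le> ln x - ln y" using that by (simp add: ln_div field_simps)
    moreover have "(x - y) / c \<le> (x - y) / x" using that by (intro divide_left_mono) auto
    ultimately have "(x - y) * ((x - y) / c) \<le> (x - y) * (ln x - ln y)"
      using that by (intro mult_left_mono) auto
    then show ?thesis by (simp add: power2_eq_square)
  qed
  show ?thesis
  proof (cases "b \<le> a")
    case True then show ?thesis using *[of b a] assms by simp
  next
    case False then show ?thesis using *[of a b] assms by (simp add: power2_commute algebra_simps)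
  qed
qed

text \<open>The logarithm has slope at least \<open>1 / c\<close> on the relevant interval. The
  coordinates give the whole left side; the slack \<open>c - (\<Sum>j\<in>UNIV. q $ j)\<close>
  contributes a further nonnegative term, which is dropped.\<close>

lemma log_odds_strongly_monotone:
  fixes q q' :: "real ^ 'n"
  assumes "q \<in> osimplex c" "q' \<in> osimplex c"
  shows "(norm (q - q'))\<^sup>2 / c \<le> (q - q') \<bullet> (log_odds c q - log_odds c q')"
proof -
  let ?s = "c - (\<Sum>j\<in>UNIV. q $ j)" and ?s' = "c - (\<Sum>j\<in>UNIV. q' $ j)"
  have pos: "\<And>j. q $ j > 0" "\<And>j. q' $ j > 0" "?s > 0" "?s' > 0"
    using assms by (auto simp: osimplex_def)
  have c: "c > 0" using pos sum_nonneg[of UNIV "\<lambda>j. q $ j"] by (smt (verit) less_imp_le)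
  have le: "q $ j \<le> c" "q' $ j \<le> c" for j
    using member_le_sum[of j UNIV "\<lambda>j. q $ j"] member_le_sum[of j UNIV "\<lambda>j. q' $ j"] pos
    by (auto simp: less_imp_le)
  have s: "?s \<le> c" "?s' \<le> c" using pos by (auto intro!: sum_nonneg simp: less_imp_le)
  have "(norm (q - q'))\<^sup>2 / c = (\<Sum>j\<in>UNIV. (q $ j - q' $ j)\<^sup>2 / c)"
    by (simp add: norm_vec_def L2_set_def sum_nonneg sum_divide_distrib)
  also have "\<dots> \<le> (\<Sum>j\<in>UNIV. (q $ j - q' $ j) * (ln (q $ j) - ln (q' $ j)))"
    by (intro sum_mono ln_strongly_monotone pos le)
  also have "\<dots> = (q - q') \<bullet> (log_odds c q - log_odds c q') - (?s - ?s') * (ln ?s - ln ?s')"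
    by (simp add: inner_vec_def log_odds_def algebra_simps sum.distrib sum_subtractf sum_distrib_right[symmetric])
  also have "\<dots> \<le> (q - q') \<bullet> (log_odds c q - log_odds c q')"
  proof -
    have "0 \<le> (?s - ?s')\<^sup>2 / c" using c by simp
    also have "\<dots> \<le> (?s - ?s') * (ln ?s - ln ?s')" by (intro ln_strongly_monotone pos s)
    finally show ?thesis by simp
  qed
  finally show ?thesis .
qed

lemma normal_cone_iff:
  assumes "compact P" "q \<in> P"
  shows "u \<in> normal_cone P q \<longleftrightarrow> (\<forall>y\<in>P. u \<bullet> y \<le> u \<bullet> q)"
proof -
  have "compact ((\<lambda>y. u \<bullet> y) ` P)" using assms(1) by (intro compact_continuous_image continuous_intros)
  then have bdd: "bdd_above ((\<lambda>y. u \<bullet> y) ` P)"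
    by (intro bounded_imp_bdd_above compact_imp_bounded)
  show ?thesis
  proof
    assume "u \<in> normal_cone P q"
    then have "u \<bullet> q = (SUP y\<in>P. u \<bullet> y)" by (simp add: normal_cone_def)
    then show "\<forall>y\<in>P. u \<bullet> y \<le> u \<bullet> q" using cSUP_upper[OF _ bdd] by simp
  next
    assume "\<forall>y\<in>P. u \<bullet> y \<le> u \<bullet> q"
    then have "(SUP y\<in>P. u \<bullet> y) = u \<bullet> q"
      using assms(2) by (intro cSup_eq_maximum) auto
    then show "u \<in> normal_cone P q" by (simp add: normal_cone_def)
  qed
qed

text \<open>The entropy summand. Its value 0 at 0 is also its limit there, so it is continuous up to
  the boundary.\<close>

definition xlnx :: "real \<Rightarrow> real" where "xlnx x = - (x * ln x)"

lemma continuous_on_xlnx: "continuous_on {0..} xlnx"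
proof (rule continuous_on_cong[THEN iffD1, OF refl])
  have "((\<lambda>x::real. x * ln x) \<longlongrightarrow> 0) (at_right 0)" by real_asymp
  then have "((\<lambda>x::real. x * ln x) \<longlongrightarrow> 0 * ln 0) (at 0 within {0..})"
    by (simp add: at_within_Ici_at_right)
  then have "continuous (at x within {0..}) (\<lambda>x::real. x * ln x)" if "x \<in> {0..}" for x
  proof (cases "x = 0")
    case True
    then show ?thesis using \<open>((\<lambda>x::real. x * ln x) \<longlongrightarrow> 0 * ln 0) (at 0 within {0..})\<close>
      by (simp add: continuous_within)
  next
    case False
    then show ?thesis using that by (intro continuous_intros) auto
  qed
  then show "continuous_on {0..} (\<lambda>x. - (x * ln x :: real))"
    by (intro continuous_on_minus) (simp add: continuous_on_eq_continuous_within)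
qed (simp add: xlnx_def)

text \<open>The extra term for \<open>a = 0\<close> is exact and expresses the infinite slope of the
  entropy at the boundary; for positive \<open>a\<close> the inequality follows from the tangent at
  the convex combination.\<close>

lemma xlnx_concave:
  assumes a: "a \<ge> 0" and b: "b > 0" and t: "0 < t" "t < 1"
  shows "(1 - t) * xlnx a + t * xlnx b + (if a = 0 then - t * b * ln t else 0) \<le> xlnx ((1 - t) * a + t * b)"
proof (cases "a = 0")
  case True
  then show ?thesis using b t by (simp add: xlnx_def ln_mult algebra_simps)
next
  case False
  define s where "s = (1 - t) * a + t * b"
  have s: "s > 0" unfolding s_def using False a b t by (intro add_pos_pos mult_pos_pos) auto
  have tangent: "xlnx x \<le> xlnx s + (- ln s - 1) * (x - s)" if "x > 0" for x
  proof -
    have "ln (s / x) \<le> s / x - 1" using that s by (intro ln_le_minus_one) auto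
    then have "x * (ln s - ln x) \<le> x * (s / x - 1)" using that s by (intro mult_left_mono) (auto simp: ln_div)
    then show ?thesis using that by (simp add: xlnx_def algebra_simps)
  qed
  have "(1 - t) * xlnx a + t * xlnx b \<le>
      (1 - t) * (xlnx s + (- ln s - 1) * (a - s)) + t * (xlnx s + (- ln s - 1) * (b - s))"
    using t a b False by (intro add_mono mult_left_mono tangent) auto
  also have "\<dots> = xlnx s + (- ln s - 1) * ((1 - t) * a + t * b - s)" by (simp add: algebra_simps)
  also have "\<dots> = xlnx s" by (simp add: s_def)
  finally show ?thesis using False by (simp add: s_def)
qed

text \<open>The index \<open>None\<close> puts the slack on the same footing as the coordinates, so
  that all faces of the simplex are treated alike.\<close>

definition bary :: "real \<Rightarrow> real ^ 'n \<Rightarrow> 'n option \<Rightarrow> real" where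
  "bary c q k = (case k of None \<Rightarrow> c - (\<Sum>j\<in>UNIV. q $ j) | Some j \<Rightarrow> q $ j)"

lemma bary_affine: "bary c (q + t *\<^sub>R (y - q)) k = bary c q k + t * (bary c y k - bary c q k)"
  by (cases k) (simp_all add: bary_def sum.distrib sum_subtractf sum_distrib_left[symmetric] algebra_simps)

lemma bary_osimplex: "q \<in> osimplex c \<longleftrightarrow> (\<forall>k. bary c q k > 0)"
  by (auto simp: osimplex_def bary_def split: option.split)

lemma bary_csimplex: "q \<in> csimplex c \<longleftrightarrow> (\<forall>k. bary c q k \<ge> 0)"
  by (auto simp: csimplex_def bary_def split: option.split)

lemma sum_option: "sum f (UNIV :: 'n::finite option set) = f None + (\<Sum>j\<in>UNIV. f (Some j) :: real)"
  by (simp add: UNIV_option_conv sum.reindex)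

locale moment_body =
  fixes c :: real and P :: "(real ^ 'n) set"
  assumes c: "c > 0" and P: "compact P" "convex P" "P \<subseteq> csimplex c" and inner: "P \<inter> osimplex c \<noteq> {}"
begin

text \<open>
  The point \<open>q\<close> is found as the maximiser over \<open>P\<close> of \<open>\<langle>r, q\<rangle>\<close> plus the entropy of the
  barycentric coordinates; the infinite slope of the entropy at the boundary keeps it inside
  the open simplex, and the first-order condition there says that \<open>r - log_odds c q\<close> is normal.
\<close>

lemma optimum_exists: "\<exists>q. q \<in> P \<and> q \<in> osimplex c \<and> r - log_odds c q \<in> normal_cone P q"
proof -
  define L where "L q = r \<bullet> q + (\<Sum>k\<in>UNIV. xlnx (bary c q k))" for q
  obtain q0 where q0: "q0 \<in> P" "q0 \<in> osimplex c" using inner by blast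
  have "continuous_on P L"
    unfolding L_def
  proof (intro continuous_intros continuous_on_compose2[OF continuous_on_xlnx])
    show "continuous_on P (\<lambda>q. bary c q k)" for k
      by (cases k) (simp_all add: bary_def continuous_intros)
    show "(\<lambda>q. bary c q k) ` P \<subseteq> {0..}" for k
      using P(3) bary_csimplex by auto
  qed
  then obtain q where q: "q \<in> P" "\<And>y. y \<in> P \<Longrightarrow> L y \<le> L q"
    using continuous_attains_sup[OF P(1)] q0 by blast
  have path: "q + t *\<^sub>R (y - q) \<in> P" if "y \<in> P" "0 \<le> t" "t \<le> 1" for y t
    using convexD_alt[OF P(2) q(1) that(1)] that by (simp add: algebra_simps)
  have nonneg: "bary c q k \<ge> 0" for k using q(1) P(3) bary_csimplex by blast
  have pos0: "bary c q0 k > 0" for k using q0 bary_osimplex by blast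
  have qo: "q \<in> osimplex c"
  proof (rule ccontr)
    assume "q \<notin> osimplex c"
    then obtain k0 where k0: "bary c q k0 = 0" using nonneg bary_osimplex by (metis order.order_iff_strict)
    define A where "A = r \<bullet> (q0 - q) + (\<Sum>k\<in>UNIV. xlnx (bary c q0 k) - xlnx (bary c q k))"
    define B where "B = (\<Sum>k\<in>UNIV. if bary c q k = 0 then bary c q0 k else 0)"
    have "B > 0" unfolding B_def
      by (rule sum_pos2[of _ k0]) (use k0 pos0 in \<open>auto simp: less_imp_le\<close>)
    \<comment> \<open>Along the segment to \<open>q0\<close> the functional gains at least
      \<open>t * (A - B * ln t)\<close>, the logarithm coming from the vanishing coordinates.
      Maximality of \<open>q\<close> forces the stated inequality for all \<open>t\<close> in the
      unit interval, although its right side is unbounded below as \<open>t\<close> tends to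
      0.\<close>
    have le: "A \<le> B * ln t" if t: "0 < t" "t < 1" for t
    proof -
      have "L q + t * (A - B * ln t) = r \<bullet> q + t * (r \<bullet> (q0 - q)) +
          (\<Sum>k\<in>UNIV. (1 - t) * xlnx (bary c q k) + t * xlnx (bary c q0 k) +
            (if bary c q k = 0 then - t * bary c q0 k * ln t else 0))"
        unfolding L_def A_def B_def sum_distrib_right right_diff_distrib distrib_left sum_distrib_left
          sum_subtractf[symmetric] sum.distrib[symmetric]
        by (simp add: sum.distrib[symmetric] sum_subtractf[symmetric] algebra_simps) (rule sum.cong, auto simp: algebra_simps)
      also have "\<dots> \<le> r \<bullet> q + t * (r \<bullet> (q0 - q)) + (\<Sum>k\<in>UNIV. xlnx ((1 - t) * bary c q k + t * bary c q0 k))"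
        by (intro add_left_mono sum_mono xlnx_concave nonneg pos0 t)
      also have "\<dots> = L (q + t *\<^sub>R (q0 - q))"
        unfolding L_def bary_affine by (simp add: inner_add_right) (simp add: algebra_simps)
      also have "\<dots> \<le> L q" using t by (intro q path q0) auto
      finally show ?thesis using t by (simp add: mult_le_0_iff)
    qed
    define t where "t = exp (- (\<bar>A\<bar> + 1) / B)"
    have "0 < t" "t < 1" using \<open>B > 0\<close> by (auto simp: t_def divide_neg_pos)
    from le[OF this] show False using \<open>B > 0\<close> by (simp add: t_def)
  qed
  have pos: "bary c q k > 0" for k using qo bary_osimplex by blast
  have "(r - log_odds c q) \<bullet> y \<le> (r - log_odds c q) \<bullet> q" if y: "y \<in> P" for y
  proof (rule ccontr)
    assume "\<not> ?thesis"
    then have dpos: "0 < (r - log_odds c q) \<bullet> (y - q)" by (simp add: inner_diff_right)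
    define g where "g t = L (q + t *\<^sub>R (y - q))" for t
    have "(g has_real_derivative r \<bullet> (y - q) +
        (\<Sum>k\<in>UNIV. (- ln (bary c q k) - 1) * (bary c y k - bary c q k))) (at 0)"
      unfolding g_def L_def bary_affine xlnx_def inner_add_right inner_scaleR_right
      using pos by (auto intro!: derivative_eq_intros sum.cong simp: algebra_simps less_imp_neq[THEN not_sym])
    moreover have "(\<Sum>k\<in>UNIV. (- ln (bary c q k) - 1) * (bary c y k - bary c q k)) =
        - (log_odds c q \<bullet> (y - q))"
      unfolding sum_option
      by (simp add: bary_def inner_vec_def log_odds_def algebra_simps sum.distrib sum_subtractf sum_distrib_right[symmetric])
    ultimately have "(g has_real_derivative (r - log_odds c q) \<bullet> (y - q)) (at 0)"
      by (simp add: inner_diff_left)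
    from DERIV_pos_inc_right[OF this dpos] obtain d where d: "d > 0" "\<And>h. 0 < h \<Longrightarrow> h < d \<Longrightarrow> g 0 < g h"
      by auto
    define h where "h = min (d / 2) 1"
    have h: "0 < h" "h < d" "h \<le> 1" using d(1) by (auto simp: h_def)
    have "g h \<le> L q" unfolding g_def using h by (intro q path y) auto
    then show False using d(2)[OF h(1,2)] by (simp add: g_def)
  qed
  then show ?thesis using q(1) qo normal_cone_iff[OF P(1) q(1)] by blast
qed

text \<open>Adding the two normal cone inequalities bounds the monotone pairing of the log-odds by
  that of \<open>q - q'\<close> with \<open>r - r'\<close>. The case \<open>r = r'\<close> is the
  uniqueness of the maximiser.\<close>

lemma optimum_monotone:
  assumes "q \<in> P" "q \<in> osimplex c" "r - log_odds c q \<in> normal_cone P q"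
    and "q' \<in> P" "q' \<in> osimplex c" "r' - log_odds c q' \<in> normal_cone P q'"
  shows "norm (q - q') \<le> c * norm (r - r')"
proof -
  have "(r - log_odds c q) \<bullet> (q' - q) \<le> 0" "(r' - log_odds c q') \<bullet> (q - q') \<le> 0"
    using assms normal_cone_iff[OF P(1)] by (auto simp: inner_diff_right)
  then have "(q - q') \<bullet> (log_odds c q - log_odds c q') \<le> (q - q') \<bullet> (r - r')"
    by (simp add: inner_diff_right inner_diff_left inner_commute)
  then have "(norm (q - q'))\<^sup>2 / c \<le> (q - q') \<bullet> (r - r')"
    using log_odds_strongly_monotone[OF assms(2,5)] by linarith
  also have "\<dots> \<le> norm (q - q') * norm (r - r')" by (rule norm_cauchy_schwarz)
  finally have "norm (q - q') * norm (q - q') \<le> norm (q - q') * (c * norm (r - r'))"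
    using c by (simp add: field_simps power2_eq_square)
  then show ?thesis using c by (cases "q = q'") (auto simp: mult_le_cancel_left)
qed

definition opt :: "real ^ 'n \<Rightarrow> real ^ 'n" where
  "opt r = (THE q. q \<in> P \<and> q \<in> osimplex c \<and> r - log_odds c q \<in> normal_cone P q)"

definition mult :: "real ^ 'n \<Rightarrow> real ^ 'n" where
  "mult r = r - log_odds c (opt r)"

lemma optimum_unique: "\<exists>!q. q \<in> P \<and> q \<in> osimplex c \<and> r - log_odds c q \<in> normal_cone P q"
  using optimum_exists[of r] optimum_monotone[of _ r _ r] by (metis diff_self eq_iff_diff_eq_0 mult_zero_right norm_le_zero_iff norm_zero)

lemma opt: "opt r \<in> P" "opt r \<in> osimplex c" "mult r \<in> normal_cone P (opt r)"
  using theI'[OF optimum_unique[of r]] by (auto simp: opt_def mult_def)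

lemma opt_eqI:
  assumes "q \<in> P" "q \<in> osimplex c" "r - log_odds c q \<in> normal_cone P q"
  shows "opt r = q"
  unfolding opt_def by (rule the1_equality[OF optimum_unique]) (use assms in blast)

lemma mom_mult: "mom c (r - mult r) = opt r"
  by (simp add: mult_def mom_log_odds[OF opt(2)])

lemma pair_unique:
  assumes "q \<in> P" "\<tau> \<in> normal_cone P q" "mom c (r - \<tau>) = q"
  shows "q = opt r" "\<tau> = mult r"
proof -
  have l: "log_odds c q = r - \<tau>" using assms(3) log_odds_mom[OF c] by auto
  have "q \<in> osimplex c" using assms(3) mom_in_osimplex[OF c] by auto
  then show q: "q = opt r" using assms l by (intro opt_eqI[symmetric]) auto
  show "\<tau> = mult r" using l by (simp add: mult_def q)
qed

lemma opt_lipschitz: "norm (opt r - opt r') \<le> c * norm (r - r')"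
  using optimum_monotone opt unfolding mult_def by blast

lemma continuous_on_opt: "continuous_on S opt"
proof (rule lipschitz_on_continuous_on[of c])
  show "c-lipschitz_on S opt" using c opt_lipschitz by (intro lipschitz_onI) (auto simp: dist_norm)
qed

end

text \<open>The increment lies between its linear predictions by the subgradients at the two ends,
  and these merge by continuity. Differentiability thus costs only a continuous choice of
  subgradients.\<close>

lemma has_derivative_of_subgradient:
  fixes f :: "'a::real_inner \<Rightarrow> real"
  assumes sub: "\<And>x y. f y \<ge> f x + G x \<bullet> (y - x)" and cont: "continuous (at x) G"
  shows "(f has_derivative (\<lambda>h. G x \<bullet> h)) (at x)"
proof (rule has_derivativeI_sandwich[where e = 1 and H = "\<lambda>y. norm (G y - G x)"])
  show "bounded_linear (\<lambda>h. G x \<bullet> h)" by (rule bounded_linear_inner_right)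
  show "((\<lambda>y. norm (G y - G x)) \<longlongrightarrow> 0) (at x)"
    using cont by (intro tendsto_norm_zero LIM_zero) (simp add: isCont_def)
  fix y assume "y \<noteq> x"
  have "0 \<le> f y - f x - G x \<bullet> (y - x)" using sub[where x = x and y = y] by simp
  moreover have "f y - f x - G x \<bullet> (y - x) \<le> (G y - G x) \<bullet> (y - x)"
    using sub[where x = y and y = x] by (simp add: inner_diff_left inner_diff_right)
  moreover have "(G y - G x) \<bullet> (y - x) \<le> norm (G y - G x) * norm (y - x)" by (rule norm_cauchy_schwarz)
  ultimately have "norm (f y - f x - G x \<bullet> (y - x)) \<le> norm (G y - G x) * norm (y - x)" by simp
  then show "norm (f y - f x - G x \<bullet> (y - x)) / norm (y - x) \<le> norm (G y - G x)"
    using \<open>y \<noteq> x\<close> by (simp add: divide_le_eq)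
qed simp

section \<open>Convexity of the log-partition function\<close>

lemma exp_strict_ge: "u \<noteq> 0 \<Longrightarrow> 1 + u < exp (u::real)"
proof (cases "1 + u > 0")
  case True
  assume "u \<noteq> 0"
  have "ln (1 + u) \<noteq> u" using ln_eq_minus_one[of "1 + u"] True \<open>u \<noteq> 0\<close> by auto
  then have "ln (1 + u) < u" using ln_le_minus_one[of "1 + u"] True by simp
  then show ?thesis using True by (metis exp_less_cancel_iff exp_ln)
next
  case False
  then show "1 + u < exp u" by (simp add: not_less less_le_trans) (meson exp_gt_zero not_less order_trans less_le_trans)
qed

lemma exp_le_of_one_le: "1 \<le> A * exp (- m) \<Longrightarrow> exp m \<le> (A::real)"
  and exp_less_of_one_less: "1 < A * exp (- m) \<Longrightarrow> exp m < (A::real)"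
  by (simp_all add: exp_minus field_simps)

definition log_partition :: "real ^ 'n \<Rightarrow> real" where "log_partition r = ln (partition_fun r)"

text \<open>The numbers \<open>x j\<close> and \<open>1 / ?Z\<close> are probabilities, and the
  exponents \<open>d $ j\<close> with 0 for the extra cell have mean \<open>m\<close>. Applying
  \<open>1 + u \<le> exp u\<close> to the centred exponents makes the linear terms cancel.
  Strictness comes from the extra cell if \<open>m \<noteq> 0\<close>, and otherwise from a
  coordinate in which \<open>r\<close> and \<open>s\<close> differ.\<close>

lemma log_partition_subgradient:
  fixes r s :: "real ^ 'n"
  assumes "c > 0"
  shows "c * log_partition r + mom c r \<bullet> (s - r) \<le> c * log_partition s"
    "r \<noteq> s \<Longrightarrow> c * log_partition r + mom c r \<bullet> (s - r) < c * log_partition s"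
proof -
  let ?Z = "partition_fun r"
  have Z: "?Z > 0" "partition_fun s > 0" by (rule partition_fun_pos)+
  define d where "d = s - r"
  define x where "x j = exp (r $ j) / ?Z" for j
  have x: "x j > 0" for j using Z by (simp add: x_def)
  have x0: "1 / ?Z + (\<Sum>j\<in>UNIV. x j) = 1"
    using Z by (simp add: x_def sum_divide_distrib[symmetric] add_divide_distrib[symmetric])
      (simp add: partition_fun_def)
  define m where "m = (\<Sum>j\<in>UNIV. x j * d $ j)"
  have md: "mom c r \<bullet> d = c * m"
    by (simp add: mom_def inner_vec_def m_def x_def sum_distrib_left mult_ac)
  have ratio: "partition_fun s / ?Z = 1 / ?Z + (\<Sum>j\<in>UNIV. x j * exp (d $ j))"
  proof -
    have "x j * exp (d $ j) = exp (s $ j) / ?Z" for j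
      by (simp add: x_def d_def exp_diff)
    then show ?thesis by (simp only: partition_fun_def[of s] add_divide_distrib sum_divide_distrib)
  qed
  have total: "1 / ?Z * (1 - m) + (\<Sum>j\<in>UNIV. x j * (1 + (d $ j - m))) = 1"
  proof -
    have "(\<Sum>j\<in>UNIV. x j * (1 + (d $ j - m))) = (\<Sum>j\<in>UNIV. (1 - m) * x j + x j * d $ j)"
      by (rule sum.cong) (simp_all add: algebra_simps)
    also have "\<dots> = (1 - m) * (\<Sum>j\<in>UNIV. x j) + m"
      by (simp only: sum.distrib sum_distrib_left[symmetric] m_def[symmetric])
    finally have "1 / ?Z * (1 - m) + (\<Sum>j\<in>UNIV. x j * (1 + (d $ j - m))) =
        (1 - m) * (1 / ?Z + (\<Sum>j\<in>UNIV. x j)) + m"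
      by (simp only: distrib_left mult.commute add.assoc)
    then show ?thesis by (simp add: x0)
  qed
  have e: "partition_fun s / ?Z * exp (- m) = 1 / ?Z * exp (- m) + (\<Sum>j\<in>UNIV. x j * exp (d $ j - m))"
    unfolding ratio distrib_right sum_distrib_right by (simp add: exp_diff exp_minus divide_inverse mult_ac)
  have "1 / ?Z * (1 - m) + (\<Sum>j\<in>UNIV. x j * (1 + (d $ j - m))) \<le> partition_fun s / ?Z * exp (- m)"
    unfolding e using Z x exp_ge_add_one_self[of "-m"]
    by (intro add_mono mult_left_mono sum_mono) (auto simp: less_imp_le)
  then have "1 \<le> partition_fun s / ?Z * exp (- m)" unfolding total .
  then have "exp m \<le> partition_fun s / ?Z" by (rule exp_le_of_one_le)
  then have "m \<le> ln (partition_fun s / ?Z)" using Z by (simp add: ln_ge_iff)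
  then have "m \<le> log_partition s - log_partition r" using Z by (simp add: log_partition_def ln_div)
  then have "c * m \<le> c * (log_partition s - log_partition r)" using assms by simp
  then show "c * log_partition r + mom c r \<bullet> (s - r) \<le> c * log_partition s"
    using md by (simp add: d_def algebra_simps)
  show "c * log_partition r + mom c r \<bullet> (s - r) < c * log_partition s" if neq: "r \<noteq> s"
  proof -
    have "1 / ?Z * (1 - m) + (\<Sum>j\<in>UNIV. x j * (1 + (d $ j - m))) < partition_fun s / ?Z * exp (- m)"
    proof (cases "m = 0")
      case False
      then have "1 / ?Z * (1 - m) < 1 / ?Z * exp (- m)"
        using exp_strict_ge[of "- m"] Z by (intro mult_strict_left_mono) auto
      moreover have "(\<Sum>j\<in>UNIV. x j * (1 + (d $ j - m))) \<le> (\<Sum>j\<in>UNIV. x j * exp (d $ j - m))"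
        using x by (intro sum_mono mult_left_mono exp_ge_add_one_self) (auto simp: less_imp_le)
      ultimately show ?thesis unfolding e by linarith
    next
      case True
      obtain i where "r $ i \<noteq> s $ i" using neq unfolding vec_eq_iff by blast
      then have i: "d $ i \<noteq> 0" by (simp add: d_def)
      have "(\<Sum>j\<in>UNIV. x j * (1 + (d $ j - m))) < (\<Sum>j\<in>UNIV. x j * exp (d $ j - m))"
      proof (rule sum_strict_mono_ex1)
        show "\<forall>j\<in>UNIV. x j * (1 + (d $ j - m)) \<le> x j * exp (d $ j - m)"
          using x by (intro ballI mult_left_mono exp_ge_add_one_self) (auto simp: less_imp_le)
        show "\<exists>j\<in>UNIV. x j * (1 + (d $ j - m)) < x j * exp (d $ j - m)"
          using x[of i] i True exp_strict_ge[of "d $ i"] by (intro bexI[of _ i] mult_strict_left_mono) auto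
      qed simp
      then show ?thesis unfolding e using True by simp
    qed
    then have "1 < partition_fun s / ?Z * exp (- m)" unfolding total .
    then have "exp m < partition_fun s / ?Z" by (rule exp_less_of_one_less)
    then have "m < ln (partition_fun s / ?Z)" using Z by (metis exp_less_cancel_iff exp_ln divide_pos_pos)
    then have "m < log_partition s - log_partition r" using Z by (simp add: log_partition_def ln_div)
    then have "c * m < c * (log_partition s - log_partition r)" using assms by simp
    then show ?thesis using md by (simp add: d_def algebra_simps)
  qed
qed

lemma continuous_on_mom: "continuous_on S (mom c)"
proof -
  have "partition_fun r \<noteq> 0" for r :: "real ^ 'a" using partition_fun_pos[of r] by simp
  moreover have "continuous_on S (partition_fun :: real ^ 'a \<Rightarrow> real)"
    unfolding partition_fun_def by (intro continuous_intros)
  ultimately show ?thesis unfolding mom_def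
    by (intro continuous_on_vec_lambda continuous_intros) auto
qed

lemma continuous_on_log_odds: "continuous_on (osimplex c) (log_odds c)"
  unfolding log_odds_def
  by (intro continuous_on_vec_lambda continuous_intros) (auto simp: osimplex_def, metis less_irrefl)

context moment_body
begin

text \<open>Both terms are maxima of the functional \<open>L\<close> from
  \<open>optimum_exists\<close>, up to the same constant \<open>c * ln c\<close>: the first over the
  whole simplex, the second over \<open>P\<close>. Each is convex in \<open>r\<close> and has its
  maximiser as gradient.\<close>

definition decay :: "real ^ 'n \<Rightarrow> real" where
  "decay r = c * log_partition r - (opt r \<bullet> mult r + c * log_partition (r - mult r))"

lemma decay_derivative:
  "(decay has_derivative (\<lambda>h. (mom c r - opt r) \<bullet> h)) (at r)"
proof -
  have "((\<lambda>r. c * log_partition r) has_derivative (\<lambda>h. mom c r \<bullet> h)) (at r)"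
    using log_partition_subgradient(1)[OF c] continuous_on_mom[of UNIV c]
    by (intro has_derivative_of_subgradient) (auto simp: continuous_on_eq_continuous_at)
  \<comment> \<open>The subgradient inequality adds two facts: the multiplier at \<open>y\<close> is
    maximal over \<open>P\<close> at \<open>opt y\<close>, and the log-partition function lies above
    its tangent at \<open>x - mult x\<close>, whose slope is \<open>opt x\<close>.\<close>
  moreover have "((\<lambda>r. opt r \<bullet> mult r + c * log_partition (r - mult r)) has_derivative (\<lambda>h. opt r \<bullet> h)) (at r)"
  proof (rule has_derivative_of_subgradient)
    show "continuous (at r) opt" using continuous_on_opt[of UNIV] by (simp add: continuous_on_eq_continuous_at)
    fix x y
    have "mult y \<bullet> opt x \<le> mult y \<bullet> opt y" using opt normal_cone_iff[OF P(1)] by blast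
    moreover have "c * log_partition (x - mult x) + opt x \<bullet> ((y - mult y) - (x - mult x)) \<le> c * log_partition (y - mult y)"
      using log_partition_subgradient(1)[OF c, of "x - mult x" "y - mult y"] unfolding mom_mult by simp
    ultimately show "opt x \<bullet> mult x + c * log_partition (x - mult x) + opt x \<bullet> (y - x) \<le>
        opt y \<bullet> mult y + c * log_partition (y - mult y)"
      by (simp add: inner_diff_right inner_commute[of "mult y"])
  qed
  ultimately show ?thesis unfolding decay_def
    by (rule has_derivative_diff[THEN has_derivative_eq_rhs]) (simp add: fun_eq_iff inner_diff_left)
qed

lemma decay_pos:
  assumes "mom c r \<notin> P"
  shows "decay r > 0"
proof -
  have "mult r \<noteq> 0" using mom_mult[of r] opt(1)[of r] assms by auto
  then have "c * log_partition (r - mult r) + mom c (r - mult r) \<bullet> (r - (r - mult r)) < c * log_partition r"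
    by (intro log_partition_subgradient(2)[OF c]) simp
  then show ?thesis by (simp add: decay_def mom_mult)
qed

end

lemma body_moment_body:
  fixes P :: "(real ^ 'n) set"
  assumes "p > 0" "integral_polytope P" "P \<subseteq> scaled_simplex p" "\<not> P \<subseteq> frontier (scaled_simplex p)"
  shows "moment_body (real p) P"
proof
  obtain V where V: "finite V" "P = convex hull V" using assms(2) by (auto simp: integral_polytope_def)
  show "compact P" "convex P" using V by (auto simp: finite_imp_compact_convex_hull)
  show "P \<subseteq> csimplex (real p)" using assms(1,3) scaled_simplex_eq by blast
  have "closure (csimplex (real p) :: (real ^ 'n) set) - interior (csimplex (real p)) \<supseteq> csimplex (real p) - osimplex (real p)"
    using closure_subset interior_csimplex by blast
  then show "P \<inter> osimplex (real p) \<noteq> {}"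
    using assms unfolding scaled_simplex_eq[OF assms(1)] frontier_def by blast
qed (use assms in simp)

text \<open>\<open>log_mod\<close> records squared moduli, so acting with minus one half of \<tau>
  subtracts exactly \<tau>, and the defining condition becomes that of
  \<open>pair_unique\<close>.\<close>

lemma decay_pair_eq:
  assumes "moment_body (real p) P" "z \<in> ctorus"
  shows "decay_pair p P z = (moment_body.opt (real p) P (log_mod z), moment_body.mult (real p) P (log_mod z))"
proof -
  interpret moment_body "real p" P by fact
  have mm: "real p *\<^sub>R moment_map (exp_act (- (1 / 2) *\<^sub>R \<tau>) z) = mom (real p) (log_mod z - \<tau>)" for \<tau>
    using assms(2) log_mod(3)[of "exp_act (- (1 / 2) *\<^sub>R \<tau>) z" p]
    by (simp add: log_mod_exp_act exp_act_ctorus)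
  show ?thesis
    unfolding decay_pair_def mm
  proof (rule the_equality)
    show "case (opt (log_mod z), mult (log_mod z)) of (q, \<tau>) \<Rightarrow>
        q \<in> P \<and> \<tau> \<in> normal_cone P q \<and> mom (real p) (log_mod z - \<tau>) = q"
      by (simp add: opt mom_mult)
    fix x assume "case x of (q, \<tau>) \<Rightarrow> q \<in> P \<and> \<tau> \<in> normal_cone P q \<and> mom (real p) (log_mod z - \<tau>) = q"
    then show "x = (opt (log_mod z), mult (log_mod z))"
      using pair_unique[of "fst x" "snd x" "log_mod z"] by (simp add: case_prod_unfold prod_eq_iff)
  qed
qed

lemma decay_fun_eq:
  assumes "moment_body (real p) P" "z \<in> ctorus"
  shows "decay_fun p P z = moment_body.decay (real p) P (log_mod z)"
proof -
  interpret moment_body "real p" P by fact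
  let ?r = "log_mod z"
  have 1: "1 + (norm z)\<^sup>2 = partition_fun ?r" using log_mod(2)[OF assms(2)] by simp
  have "log_mod (exp_act (- (1 / 2) *\<^sub>R mult ?r) z) = ?r - mult ?r"
    using log_mod_exp_act[OF assms(2), of "- (1 / 2) *\<^sub>R mult ?r"] by simp
  then have 2: "1 + (norm (exp_act (- (1 / 2) *\<^sub>R mult ?r) z))\<^sup>2 = partition_fun (?r - mult ?r)"
    using log_mod(2)[of "exp_act (- (1 / 2) *\<^sub>R mult ?r) z"] assms(2) exp_act_ctorus by metis
  show ?thesis
    unfolding decay_fun_def decay_pair_eq[OF assms] Let_def prod.case 1 2 decay_def log_partition_def
    by (simp add: ln_div partition_fun_pos less_imp_neq[THEN not_sym] right_diff_distrib)
qed

theorem decay_fun_C1: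
  fixes P :: "(real ^ 'n) set"
  assumes "moment_body (real p) P" "open S" "S \<subseteq> ctorus"
  shows "Ck_on 1 (decay_fun p P) S"
proof -
  interpret moment_body "real p" P by fact
  define L where "L z v = (\<chi> j. frechet_derivative (\<lambda>z :: complex ^ 'n. log_mod z $ j) (at z) v)" for z v
  have C1: "Ck_on (Suc 0) (\<lambda>z :: complex ^ 'n. log_mod z $ j) S" for j
    using smooth_on_log_mod smooth_on_subset[OF _ assms(3)] unfolding smooth_on_def by blast
  have L: "(log_mod has_derivative L z) (at z)" if "z \<in> S" for z
  proof (subst has_derivative_componentwise_within, intro ballI)
    fix b :: "real ^ 'n" assume "b \<in> Basis"
    then obtain j where b: "b = axis j 1" by (auto simp: Basis_vec_def)
    have "((\<lambda>z. log_mod z $ j) has_derivative frechet_derivative (\<lambda>z. log_mod z $ j) (at z)) (at z)"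
      using C1[of j] that by (intro differentiable_onD[of S]) auto
    then show "((\<lambda>z. log_mod z \<bullet> b) has_derivative (\<lambda>v. L z v \<bullet> b)) (at z)"
      by (simp add: b inner_axis L_def)
  qed
  have lc: "continuous_on S (log_mod :: complex ^ 'n \<Rightarrow> _)"
    using L by (intro continuous_at_imp_continuous_on ballI) (auto dest: has_derivative_continuous)
  have "Ck_on (Suc 0) (\<lambda>z. decay (log_mod z)) S"
  proof (rule Ck_on_SucI[OF assms(2)])
    show "((\<lambda>z. decay (log_mod z)) has_derivative (\<lambda>v. (mom (real p) (log_mod z) - opt (log_mod z)) \<bullet> L z v)) (at z)"
      if "z \<in> S" for z
      by (rule has_derivative_compose[OF L[OF that] decay_derivative])
    show "Ck_on 0 (\<lambda>z. (mom (real p) (log_mod z) - opt (log_mod z)) \<bullet> L z v) S" for v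
    proof -
      have "continuous_on S (\<lambda>z. L z v)" unfolding L_def using C1
        by (intro continuous_on_vec_lambda) simp
      then show ?thesis
        by (simp, intro continuous_intros continuous_on_compose2[OF continuous_on_opt lc]
            continuous_on_compose2[OF continuous_on_mom lc]) auto
    qed
  qed
  moreover have "decay_fun p P z = decay (log_mod z)" if "z \<in> S" for z
    using that assms(3) by (intro decay_fun_eq[OF assms(1)]) blast
  from Ck_on_cong[OF assms(2) this] have "Ck_on 1 (decay_fun p P) S \<longleftrightarrow> Ck_on 1 (\<lambda>z. decay (log_mod z)) S" .
  ultimately show ?thesis by (simp only: One_nat_def)
qed

text \<open>The moment image of \<open>z\<close> is joined by a segment to an interior point of
  \<open>P\<close>. The path \<open>W\<close> lifts the segment to the torus by changing moduli
  only; it runs in the allowed region for positive \<open>t\<close> and ends at \<open>z\<close>.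
  Hence off the closure the moment image misses \<open>P\<close>.\<close>

lemma in_closure_allowed_region:
  fixes P :: "(real ^ 'n) set"
  assumes "moment_body (real p) P" "z \<in> ctorus" "real p *\<^sub>R moment_map z \<in> P" "interior P \<noteq> {}"
  shows "z \<in> closure (allowed_region p P)"
proof -
  interpret moment_body "real p" P by fact
  obtain i0 where i0: "i0 \<in> interior P" using assms(4) by blast
  define q where "q = real p *\<^sub>R moment_map z"
  have q: "q = mom (real p) (log_mod z)" using log_mod(3)[OF assms(2)] by (simp add: q_def)
  have qo: "q \<in> osimplex (real p)" unfolding q by (rule mom_in_osimplex[OF c])
  have int_sub: "interior P \<subseteq> osimplex (real p)"
    using interior_mono[OF P(3)] interior_csimplex by blast
  define x where "x t = q - t *\<^sub>R (q - i0)" for t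
  have xi: "x t \<in> interior P" if "0 < t" "t \<le> 1" for t
    unfolding x_def using P(2) i0 assms(3) that
    by (intro mem_interior_convex_shrink) (auto simp: q_def)
  have xo: "x t \<in> osimplex (real p)" if "0 \<le> t" "t \<le> 1" for t
    using that xi[of t] int_sub qo by (cases "t = 0") (auto simp: x_def)
  define W where "W t = exp_act ((1 / 2) *\<^sub>R (log_odds (real p) (x t) - log_mod z)) z" for t
  have Wc: "W t \<in> ctorus" for t unfolding W_def by (simp add: exp_act_ctorus assms(2))
  have lW: "log_mod (W t) = log_odds (real p) (x t)" for t
    unfolding W_def log_mod_exp_act[OF assms(2)] by simp
  have mem: "W t \<in> allowed_region p P" if "t \<in> {0<..1}" for t
  proof -
    have "real p *\<^sub>R moment_map (W t) = x t"
      using log_mod(3)[OF Wc, of p t] that xo[of t] by (simp add: lW mom_log_odds)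
    moreover have "(1 / real p) *\<^sub>R (real p *\<^sub>R moment_map (W t)) = moment_map (W t)" using c by simp
    ultimately have "moment_map (W t) = (1 / real p) *\<^sub>R x t" by simp
    then show ?thesis using xi[of t] that Wc by (auto simp: allowed_region_def)
  qed
  have cont: "continuous_on (closure {0<..1}) W"
  proof -
    have "continuous_on {0..1} (\<lambda>t. log_odds (real p) (x t))"
      by (rule continuous_on_compose2[OF continuous_on_log_odds])
        (use xo in \<open>auto simp: x_def intro!: continuous_intros\<close>)
    then show ?thesis unfolding W_def exp_act_def
      by (simp add: closure_greaterThanAtMost) (intro continuous_on_vec_lambda continuous_intros, auto)
  qed
  have "W ` closure {0<..1} \<subseteq> closure (allowed_region p P)"
    by (rule image_closure_subset[OF cont closed_closure]) (use mem closure_subset in blast)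
  moreover have "log_odds (real p) (x 0) = log_mod z" using log_odds_mom[OF c] by (simp add: x_def q)
  then have "W 0 = z" by (simp add: W_def exp_act_def vec_eq_iff)
  ultimately show ?thesis by (force simp: closure_greaterThanAtMost)
qed

theorem decay_fun_pos:
  fixes P :: "(real ^ 'n) set"
  assumes "moment_body (real p) P" "interior P \<noteq> {}" "z \<in> ctorus - closure (allowed_region p P)"
  shows "decay_fun p P z > 0"
proof -
  interpret moment_body "real p" P by fact
  have "mom (real p) (log_mod z) \<notin> P"
    using in_closure_allowed_region[OF assms(1) _ _ assms(2), of z] assms(3) log_mod(3)[of z p] by auto
  then show ?thesis using decay_pos decay_fun_eq[OF assms(1)] assms(3) by auto
qed

section \<open>A local limit theorem\<close>

lemma measurable_vec_lambda_PiM: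
  "(\<lambda>f. \<chi> j. f j) \<in> measurable (PiM UNIV (\<lambda>_::'n::finite. lborel :: real measure)) borel"
proof (rule borel_measurable_euclidean_space[THEN iffD2], intro ballI)
  fix b :: "real ^ 'n" assume "b \<in> Basis"
  then obtain i where b: "b = axis i 1" by (auto simp: Basis_vec_def)
  have "(\<lambda>f. f i) \<in> borel_measurable (PiM UNIV (\<lambda>_::'n. lborel :: real measure))"
    using measurable_component_singleton[of i UNIV "\<lambda>_::'n. lborel :: real measure"] by simp
  then show "(\<lambda>f. (\<chi> j. f j) \<bullet> b) \<in> borel_measurable (PiM UNIV (\<lambda>_::'n. lborel :: real measure))"
    by (simp add: b inner_axis)
qed

text \<open>The identification with a product measure lets integrals of products of one-variable
  functions factor, as needed for the Fourier and Gaussian integrands.\<close>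

lemma lborel_cart_eq:
  "(lborel :: (real ^ 'n) measure) = distr (PiM UNIV (\<lambda>_::'n. lborel)) borel (\<lambda>f. \<chi> j. f j)"
proof (rule lborel_eqI)
  interpret product_sigma_finite "\<lambda>_::'n. lborel :: real measure"
    by standard
  note meas = measurable_vec_lambda_PiM[where 'n = 'n]
  fix l u :: "real ^ 'n" assume le: "\<And>b. b \<in> Basis \<Longrightarrow> l \<bullet> b \<le> u \<bullet> b"
  have le': "l $ j \<le> u $ j" for j using le[of "axis j 1"] by (simp add: inner_axis)
  have "(\<lambda>f. \<chi> j. f j) -` box l u \<inter> space (PiM UNIV (\<lambda>_::'n. lborel)) = Pi\<^sub>E UNIV (\<lambda>j. {l $ j<..<u $ j})"
    by (auto simp: mem_box_cart space_PiM PiE_iff)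
  then have "emeasure (distr (PiM UNIV (\<lambda>_::'n. lborel)) borel (\<lambda>f. \<chi> j. f j)) (box l u) =
      (\<Prod>j\<in>UNIV. emeasure lborel {l $ j<..<u $ j})"
    by (subst emeasure_distr[OF meas]) (auto simp: emeasure_PiM)
  also have "\<dots> = (\<Prod>j\<in>UNIV. ennreal (u $ j - l $ j))" using le' by (intro prod.cong) auto
  also have "\<dots> = ennreal (\<Prod>j\<in>UNIV. u $ j - l $ j)" using le' by (intro prod_ennreal) simp
  also have "(\<Prod>j\<in>UNIV. u $ j - l $ j) = (\<Prod>b\<in>Basis. (u - l) \<bullet> b)"
  proof -
    have "bij_betw (\<lambda>j. axis j (1::real) :: real ^ 'n) UNIV Basis"
      by (auto simp: bij_betw_def inj_on_def axis_eq_axis Basis_vec_def)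
    from prod.reindex_bij_betw[OF this, of "\<lambda>b. (u - l) \<bullet> b"] show ?thesis by (simp add: inner_axis)
  qed
  finally show "emeasure (distr (PiM UNIV (\<lambda>_::'n. lborel)) borel (\<lambda>f. \<chi> j. f j)) (box l u) =
      (\<Prod>b\<in>Basis. (u - l) \<bullet> b)" .
qed simp

lemma
  fixes f :: "'n::finite \<Rightarrow> real \<Rightarrow> 'a::{real_normed_field,banach,second_countable_topology}"
  assumes f: "\<And>j. integrable lborel (f j)"
  shows integrable_lborel_prod: "integrable lborel (\<lambda>t :: real ^ 'n. \<Prod>j\<in>UNIV. f j (t $ j))"
    and integral_lborel_prod: "(\<integral>t. (\<Prod>j\<in>UNIV. f j ((t :: real ^ 'n) $ j)) \<partial>lborel) = (\<Prod>j\<in>UNIV. \<integral>x. f j x \<partial>lborel)"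
proof -
  interpret product_sigma_finite "\<lambda>_::'n. lborel :: real measure"
    by standard
  note meas = measurable_vec_lambda_PiM[where 'n = 'n]
  have fm: "(\<lambda>t :: real ^ 'n. \<Prod>j\<in>UNIV. f j (t $ j)) \<in> borel_measurable borel"
  proof (intro borel_measurable_prod)
    fix j
    have "f j \<in> borel_measurable borel" using borel_measurable_integrable[OF f] by simp
    then show "(\<lambda>t :: real ^ 'n. f j (t $ j)) \<in> borel_measurable borel"
      by (rule measurable_compose[rotated]) (intro borel_measurable_continuous_onI continuous_intros)
  qed
  show "integrable lborel (\<lambda>t :: real ^ 'n. \<Prod>j\<in>UNIV. f j (t $ j))"
    unfolding lborel_cart_eq using product_integrable_prod[of UNIV f] f
    by (subst integrable_distr_eq[OF meas fm]) simp
  show "(\<integral>t. (\<Prod>j\<in>UNIV. f j ((t :: real ^ 'n) $ j)) \<partial>lborel) = (\<Prod>j\<in>UNIV. \<integral>x. f j x \<partial>lborel)"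
    unfolding lborel_cart_eq using product_integral_prod[of UNIV f] f
    by (subst integral_distr[OF meas fm]) simp
qed

lemma integral_lborel_diagonal:
  fixes f :: "real ^ 'n \<Rightarrow> real" and d :: "'n \<Rightarrow> real"
  assumes d: "\<And>j. d j > 0" and f: "f \<in> borel_measurable borel"
  shows "(\<integral>t. f t \<partial>lborel) = (\<Prod>j\<in>UNIV. d j) * (\<integral>t. f (\<chi> j. d j * t $ j) \<partial>lborel)"
proof -
  define c :: "real ^ 'n \<Rightarrow> real" where "c b = (\<Sum>j\<in>UNIV. d j * b $ j)" for b
  have c: "c (axis i 1) = d i" for i
    by (simp add: c_def axis_def if_distrib sum.delta cong: if_cong)
  define T :: "real ^ 'n \<Rightarrow> real ^ 'n" where "T x = 0 + (\<Sum>b\<in>Basis. (c b * (x \<bullet> b)) *\<^sub>R b)" for x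
  have T: "T x = (\<chi> j. d j * x $ j)" for x
  proof -
    have "T x $ i = d i * x $ i" for i
    proof -
      have "T x $ i = T x \<bullet> axis i 1" by (simp add: inner_axis)
      also have "\<dots> = c (axis i 1) * (x \<bullet> axis i 1)"
        unfolding T_def by (simp add: inner_sum_left_Basis)
      finally show ?thesis by (simp add: c inner_axis)
    qed
    then show ?thesis by (simp add: vec_eq_iff)
  qed
  have "c b \<noteq> 0" if "b \<in> Basis" for b
    using that d c by (auto simp: Basis_vec_def less_imp_neq[THEN not_sym])
  then have "(lborel :: (real ^ 'n) measure) = density (distr lborel borel T) (\<lambda>_. ennreal (\<Prod>b\<in>Basis. \<bar>c b\<bar>))"
    unfolding T_def using lborel_affine_euclidean[of c 0] by simp
  moreover have "(\<Prod>b\<in>(Basis :: (real ^ 'n) set). \<bar>c b\<bar>) = (\<Prod>j\<in>UNIV. d j)"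
  proof -
    have "bij_betw (\<lambda>j. axis j (1::real) :: real ^ 'n) UNIV Basis"
      by (auto simp: bij_betw_def inj_on_def axis_eq_axis Basis_vec_def)
    from prod.reindex_bij_betw[OF this, of "\<lambda>b. \<bar>c b\<bar>"] show ?thesis using d by (simp add: c less_imp_le)
  qed
  ultimately have "(\<integral>t. f t \<partial>lborel) = (\<integral>t. f t \<partial>density (distr lborel borel T) (\<lambda>_. ennreal (\<Prod>j\<in>UNIV. d j)))"
    by simp
  also have "\<dots> = (\<integral>t. (\<Prod>j\<in>UNIV. d j) *\<^sub>R f t \<partial>distr lborel borel T)"
    using f prod_nonneg[of UNIV d] d by (intro integral_density) (auto simp: less_imp_le)
  also have "\<dots> = (\<integral>t. (\<Prod>j\<in>UNIV. d j) *\<^sub>R f (T t) \<partial>lborel)"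
  proof (rule integral_distr)
    show "T \<in> lborel \<rightarrow>\<^sub>M borel" unfolding T
      by (simp, intro borel_measurable_continuous_onI continuous_on_vec_lambda continuous_intros)
  qed (use f in simp)
  finally show ?thesis by (simp add: T)
qed

section \<open>Fourier inversion over a period box\<close>

lemma
  shows integrable_cis_period: "integrable lborel (\<lambda>x. indicator {-pi..pi} x *\<^sub>R cis (x * k))"
    and integral_cis_period: "k \<in> \<int> \<Longrightarrow> (\<integral>x. indicator {-pi..pi} x *\<^sub>R cis (x * k) \<partial>lborel) = (if k = 0 then complex_of_real (2 * pi) else 0)"
proof -
  have cont: "continuous_on {-pi..pi} (\<lambda>x. cis (x * k))" unfolding cis.ctr complex_eq[symmetric]
    by (intro continuous_intros)
  have si: "set_integrable lborel {-pi..pi} (\<lambda>x. cis (x * k))"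
    by (rule borel_integrable_atLeastAtMost'[OF cont])
  then show "integrable lborel (\<lambda>x. indicator {-pi..pi} x *\<^sub>R cis (x * k))"
    by (simp add: set_integrable_def)
  assume k: "k \<in> \<int>"
  have eq: "(\<integral>x. indicator {-pi..pi} x *\<^sub>R cis (x * k) \<partial>lborel) = integral {-pi..pi} (\<lambda>x. cis (x * k))"
    using set_borel_integral_eq_integral(2)[OF si] by (simp add: set_lebesgue_integral_def)
  show "(\<integral>x. indicator {-pi..pi} x *\<^sub>R cis (x * k) \<partial>lborel) = (if k = 0 then complex_of_real (2 * pi) else 0)"
  proof (cases "k = 0")
    case True
    then show ?thesis unfolding eq by (simp add: cis_zero scaleR_conv_of_real)
  next
    case False
    obtain l :: int where l: "k = of_int l" using k by (auto elim: Ints_cases)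
    have "((\<lambda>x. cis (x * k)) has_integral (cis (pi * k) / (\<i> * k) - cis (- pi * k) / (\<i> * k))) {-pi..pi}"
    proof (rule fundamental_theorem_of_calculus)
      fix x
      have "((\<lambda>x. exp (\<i> * (of_real x * of_real k)) / (\<i> * k)) has_vector_derivative exp (\<i> * (of_real x * of_real k))) (at x within {-pi..pi})"
      proof (rule has_vector_derivative_real_field[unfolded o_def, where f = "\<lambda>z. exp (\<i> * (z * of_real k)) / (\<i> * k)"])
        show "((\<lambda>z. exp (\<i> * (z * of_real k)) / (\<i> * k)) has_field_derivative exp (\<i> * (of_real x * of_real k))) (at (of_real x))"
          using False by (auto intro!: derivative_eq_intros simp: mult.left_commute[of \<i>])
      qed
      then show "((\<lambda>x. cis (x * k) / (\<i> * k)) has_vector_derivative cis (x * k)) (at x within {-pi..pi})"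
        by (simp add: cis_conv_exp)
    qed simp
    moreover have "cis (pi * k) = cis (- pi * k)"
      unfolding l using sin_npi_int[of l] by (simp add: complex_eq_iff mult.commute)
    ultimately show ?thesis unfolding eq using False by (auto intro!: integral_unique)
  qed
qed

definition fbox :: "(real ^ 'n) set" where "fbox = {t. \<forall>j. \<bar>t $ j\<bar> \<le> pi}"

lemma fbox_prod:
  "indicator fbox t *\<^sub>R cis (t \<bullet> k) = (\<Prod>j\<in>UNIV. indicator {-pi..pi} (t $ j) *\<^sub>R cis (t $ j * k $ j))"
proof -
  have "indicator fbox t = (\<Prod>j\<in>UNIV. indicator {-pi..pi} (t $ j) :: real)"
    by (auto simp: fbox_def indicator_def abs_le_iff prod_zero_iff minus_le_iff split: if_splits)
  moreover have "cis (t \<bullet> k) = (\<Prod>j\<in>UNIV. cis (t $ j * k $ j))"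
    by (simp add: inner_vec_def cis_conv_exp exp_sum sum_distrib_left)
  ultimately show ?thesis by (simp add: scaleR_conv_of_real prod.distrib)
qed

lemma
  fixes k :: "real ^ 'n"
  shows integrable_fbox_cos: "integrable lborel (\<lambda>t. indicator fbox t * cos (t \<bullet> k))"
    and integral_fbox_cos: "k \<in> int_vecs \<Longrightarrow> (\<integral>t. indicator fbox t * cos (t \<bullet> k) \<partial>lborel) = (if k = 0 then (2 * pi) ^ CARD('n) else 0)"
proof -
  have int: "integrable lborel (\<lambda>t. indicator fbox t *\<^sub>R cis (t \<bullet> k))"
    unfolding fbox_prod by (rule integrable_lborel_prod) (rule integrable_cis_period)
  have Re: "Re (indicator fbox t *\<^sub>R cis (t \<bullet> k)) = indicator fbox t * cos (t \<bullet> k)" for t by simp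
  show "integrable lborel (\<lambda>t. indicator fbox t * cos (t \<bullet> k))"
    using integrable_Re[OF int] unfolding Re .
  assume k: "k \<in> int_vecs"
  then have kj: "k $ j \<in> \<int>" for j by (simp add: int_vecs_def)
  have "(\<integral>t. indicator fbox t *\<^sub>R cis (t \<bullet> k) \<partial>lborel) = (\<Prod>j\<in>UNIV. if k $ j = 0 then complex_of_real (2 * pi) else 0)"
    unfolding fbox_prod by (subst integral_lborel_prod) (auto simp: integrable_cis_period integral_cis_period[OF kj])
  also have "\<dots> = of_real (if k = 0 then (2 * pi) ^ CARD('n) else 0)"
    by (auto simp: vec_eq_iff prod_zero_iff)
  finally have "Re (\<integral>t. indicator fbox t *\<^sub>R cis (t \<bullet> k) \<partial>lborel) = (if k = 0 then (2 * pi) ^ CARD('n) else 0)"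
    by (simp only: Re_complex_of_real)
  then show "(\<integral>t. indicator fbox t * cos (t \<bullet> k) \<partial>lborel) = (if k = 0 then (2 * pi) ^ CARD('n) else 0)"
    using integral_Re[OF int] unfolding Re by simp
qed

lemma integrable_exp_minus_square:
  assumes "c > (0::real)" shows "integrable lborel (\<lambda>x. exp (- (c * x\<^sup>2)))"
proof -
  define s where "s = sqrt (1 / (2 * c))"
  have s: "s > 0" "s\<^sup>2 = 1 / (2 * c)" using assms by (simp_all add: s_def)
  have "integrable lborel (\<lambda>x. sqrt (2 * pi * s\<^sup>2) * normal_density 0 s x)"
    using s by (intro integrable_mult_right integrable_normal_density)
  also have "(\<lambda>x. sqrt (2 * pi * s\<^sup>2) * normal_density 0 s x) = (\<lambda>x. exp (- (c * x\<^sup>2)))"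
    using assms by (auto simp: fun_eq_iff normal_density_def s(2) mult.commute)
  finally show ?thesis .
qed

definition proj_coords :: "'n set \<Rightarrow> real ^ 'n \<Rightarrow> real ^ 'n" where
  "proj_coords J t = (\<chi> j. if j \<in> J then t $ j else 0)"

text \<open>The limit of the rescaled boxes \<open>fbox\<close>: directions in \<open>J\<close> are
  stretched to the whole line, while padding directions keep their period.\<close>

definition slab :: "'n set \<Rightarrow> (real ^ 'n) set" where
  "slab J = {t. \<forall>j. j \<notin> J \<longrightarrow> \<bar>t $ j\<bar> \<le> pi}"

lemma slab_gaussian_prod:
  "indicator (slab J) t * exp (- (c * (norm (proj_coords J t))\<^sup>2)) =
    (\<Prod>j\<in>UNIV. if j \<in> J then exp (- (c * (t $ j)\<^sup>2)) else indicator {-pi..pi} (t $ j))"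
proof -
  have e: "(norm (proj_coords J t))\<^sup>2 = (\<Sum>j\<in>J. (t $ j)\<^sup>2)"
    by (simp add: norm_vec_def L2_set_def sum_nonneg proj_coords_def if_distrib[of "\<lambda>x. x\<^sup>2"] sum.If_cases cong: if_cong)
  have split: "(\<Prod>j\<in>UNIV. if j \<in> J then exp (- (c * (t $ j)\<^sup>2)) else indicator {-pi..pi} (t $ j)) =
      (\<Prod>j\<in>J. exp (- (c * (t $ j)\<^sup>2))) * (\<Prod>j\<in>-J. indicator {-pi..pi} (t $ j))"
    by (simp add: prod.If_cases)
  have "(\<Prod>j\<in>J. exp (- (c * (t $ j)\<^sup>2))) = exp (- (c * (norm (proj_coords J t))\<^sup>2))"
    unfolding e by (simp add: exp_sum[symmetric] sum_negf sum_distrib_left)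
  moreover have "(\<Prod>j\<in>-J. indicator {-pi..pi} (t $ j)) = (indicator (slab J) t :: real)"
  proof (cases "t \<in> slab J")
    case True
    then show ?thesis by (auto simp: slab_def indicator_def abs_le_iff intro!: prod.neutral)
  next
    case False
    then obtain j where "j \<notin> J" "\<not> \<bar>t $ j\<bar> \<le> pi" by (auto simp: slab_def)
    then have "(\<Prod>j\<in>-J. indicator {-pi..pi} (t $ j) :: real) = 0"
      by (intro prod_zero) (auto intro!: bexI[of _ j] simp: indicator_def)
    then show ?thesis using False by simp
  qed
  ultimately show ?thesis unfolding split by simp
qed

lemma integrable_slab_gaussian:
  assumes "c > 0"
  shows "integrable lborel (\<lambda>t. indicator (slab J) t * exp (- (c * (norm (proj_coords J t))\<^sup>2)))"
proof -
  have "integrable lborel (\<lambda>x. if j \<in> J then exp (- (c * x\<^sup>2)) else indicator {-pi..pi} x)" for j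
    using integrable_exp_minus_square[OF assms] by (cases "j \<in> J") auto
  from integrable_lborel_prod[of "\<lambda>j x. if j \<in> J then exp (- (c * x\<^sup>2)) else indicator {-pi..pi} x", OF this]
  show ?thesis unfolding slab_gaussian_prod .
qed

lemma closed_slab: "closed (slab J :: (real ^ 'n) set)"
proof -
  have "slab J = (\<Inter>j\<in>-J. {t :: real ^ 'n. \<bar>t $ j\<bar> \<le> pi})" by (auto simp: slab_def)
  also have "closed \<dots>" by (intro closed_INT ballI closed_Collect_le continuous_intros)
  finally show ?thesis .
qed

section \<open>Taylor estimates\<close>

lemma cos_taylor4: "\<bar>cos u - (1 - u\<^sup>2 / 2)\<bar> \<le> u ^ 4 / (24::real)"
proof -
  obtain t where t: "cos u = (\<Sum>m<4. cos_coeff m * u ^ m) + cos (t + 1/2 * real 4 * pi) / fact 4 * u ^ 4"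
    using Maclaurin_cos_expansion[of u 4] by blast
  have s: "(\<Sum>m<4. cos_coeff m * u ^ m) = 1 - u\<^sup>2 / 2"
  proof -
    have "{..<4::nat} = {0, 1, 2, 3}" by auto
    then show ?thesis by (simp add: cos_coeff_def fact_numeral power2_eq_square)
  qed
  have "\<bar>cos (t + 1/2 * real 4 * pi) / fact 4 * u ^ 4\<bar> = \<bar>cos (t + 1/2 * real 4 * pi)\<bar> * (u ^ 4 / 24)"
    by (simp add: abs_mult fact_numeral)
  also have "\<dots> \<le> 1 * (u ^ 4 / 24)" by (intro mult_right_mono abs_cos_le_one) simp
  finally show ?thesis using t s by simp
qed

lemma sin_taylor3: "\<bar>sin u - u\<bar> \<le> \<bar>u\<bar> ^ 3 / (6::real)"
proof -
  have "(\<Sum>m<3. sin_coeff m * u ^ m) = u" by (simp add: numeral_eq_Suc sin_coeff_def)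
  then show ?thesis using Maclaurin_sin_bound[of u 3] by (simp add: fact_numeral)
qed

lemma one_minus_cos_ge: "\<bar>u\<bar> \<le> 1 \<Longrightarrow> u\<^sup>2 / 4 \<le> 1 - cos (u::real)"
proof -
  assume "\<bar>u\<bar> \<le> 1"
  then have "u\<^sup>2 \<le> 1" by (simp add: abs_square_le_1)
  then have "u\<^sup>2 * u\<^sup>2 \<le> u\<^sup>2 * 1" by (intro mult_left_mono) auto
  then have "u ^ 4 \<le> u\<^sup>2" by (simp add: power_add[symmetric])
  then show ?thesis using cos_taylor4[of u] by linarith
qed

lemma exp_minus_taylor2: "0 \<le> x \<Longrightarrow> \<bar>exp (- x) - (1 - x)\<bar> \<le> x\<^sup>2 / (2::real)"
proof -
  assume x: "0 \<le> x"
  have "1 + x + x\<^sup>2 / 2 \<le> exp x" by (rule exp_lower_Taylor_quadratic[OF x])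
  then have "exp (- x) \<le> 1 / (1 + x + x\<^sup>2 / 2)"
    unfolding exp_minus inverse_eq_divide using x
    by (intro divide_left_mono mult_pos_pos) (auto intro!: add_pos_nonneg)
  also have "\<dots> \<le> 1 - x + x\<^sup>2 / 2"
  proof -
    have "(1 - x + x\<^sup>2 / 2) * (1 + x + x\<^sup>2 / 2) = 1 + (x\<^sup>2)\<^sup>2 / 4"
      by (simp add: field_simps power2_eq_square)
    then have "1 \<le> (1 - x + x\<^sup>2 / 2) * (1 + x + x\<^sup>2 / 2)" by simp
    then show ?thesis using x by (simp add: divide_le_eq add_pos_nonneg)
  qed
  finally show ?thesis using exp_ge_add_one_self[of "-x"] by simp
qed

lemma power_linearization:
  fixes x y :: complex
  assumes "norm x \<le> M" "norm y \<le> M"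
  shows "norm (x ^ n - y ^ n - of_nat n * y ^ (n - 1) * (x - y)) \<le> (real n)\<^sup>2 * M ^ (n - 2) * (norm (x - y))\<^sup>2"
proof (induction n)
  case (Suc n)
  have M: "M \<ge> 0" using assms(1) norm_ge_zero order_trans by blast
  \<comment> \<open>The exponents \<open>n - 1\<close> and \<open>n - 2\<close> are truncated, so
    the recursion for the remainder is valid only from \<open>n = 2\<close> on.\<close>
  consider "n = 0" | "n = 1" | l where "n = Suc (Suc l)" by (metis One_nat_def not0_implies_Suc)
  then show ?case
  proof cases
    case 1 then show ?thesis by simp
  next
    case 2
    have "x ^ 2 - y ^ 2 - of_nat 2 * y ^ (2 - 1) * (x - y) = (x - y)\<^sup>2"
      by (simp add: algebra_simps power2_eq_square)
    then show ?thesis using 2 by (simp add: norm_power numeral_2_eq_2 [symmetric])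
  next
    case 3
    have eq: "x ^ Suc n - y ^ Suc n - of_nat (Suc n) * y ^ (Suc n - 1) * (x - y) =
        x * (x ^ n - y ^ n - of_nat n * y ^ (n - 1) * (x - y)) + of_nat n * y ^ (n - 1) * (x - y)\<^sup>2"
      unfolding 3 by (simp add: algebra_simps power2_eq_square)
    have "norm (x ^ Suc n - y ^ Suc n - of_nat (Suc n) * y ^ (Suc n - 1) * (x - y)) \<le>
        norm x * norm (x ^ n - y ^ n - of_nat n * y ^ (n - 1) * (x - y)) + real n * norm y ^ (n - 1) * (norm (x - y))\<^sup>2"
      unfolding eq by (rule norm_triangle_le) (simp add: norm_mult norm_power)
    also have "\<dots> \<le> M * ((real n)\<^sup>2 * M ^ (n - 2) * (norm (x - y))\<^sup>2) + real n * M ^ (n - 1) * (norm (x - y))\<^sup>2"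
      using assms M Suc.IH by (intro add_mono mult_mono mult_left_mono mult_right_mono power_mono) auto
    also have "\<dots> = ((real n)\<^sup>2 + real n) * (M ^ (Suc n - 2) * (norm (x - y))\<^sup>2)"
      using 3 by (simp add: algebra_simps)
    also have "\<dots> \<le> (real (Suc n))\<^sup>2 * (M ^ (Suc n - 2) * (norm (x - y))\<^sup>2)"
      using M by (intro mult_right_mono mult_nonneg_nonneg) (auto simp: power2_eq_square algebra_simps)
    finally show ?thesis by (simp only: mult.assoc)
  qed
qed simp

text \<open>Expansion about the real number \<open>E\<close> leaves a quadratic remainder and a
  linear term. The imaginary part of \<open>w\<close>, of order \<open>x ^ 3\<close>, reaches the
  real part only through \<open>sin \<beta>\<close>; since \<beta> will be of order
  \<open>x\<close>, it counts as order \<open>x ^ 4\<close>, and this saves the half power of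
  \<open>n\<close>.\<close>

lemma rotated_power_estimate:
  fixes w :: complex and E M A X x \<beta> :: real
  assumes w: "norm w \<le> M" and E: "0 \<le> E" "E \<le> M"
    and re: "\<bar>Re w - E\<bar> \<le> A * x ^ 4" and im: "\<bar>Im w\<bar> \<le> A * x ^ 3"
    and x: "0 \<le> x" "x \<le> X" and A: "A \<ge> 0"
  shows "\<bar>Re (w ^ n * cis (- \<beta>)) - E ^ n\<bar> \<le> (real n)\<^sup>2 * M ^ (n - 2) * (A * (X + 1) * x ^ 3)\<^sup>2 +
    real n * M ^ (n - 1) * (A * x ^ 4 + A * x ^ 3 * \<bar>\<beta>\<bar>) + M ^ n * \<beta>\<^sup>2"
proof -
  let ?E = "complex_of_real E"
  define R where "R = w ^ n - ?E ^ n - of_nat n * ?E ^ (n - 1) * (w - ?E)"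
  have M: "M \<ge> 0" using E by simp
  have "norm (w - ?E) \<le> \<bar>Re (w - ?E)\<bar> + \<bar>Im (w - ?E)\<bar>" by (rule cmod_le)
  also have "\<dots> \<le> A * x ^ 4 + A * x ^ 3" using re im by simp
  also have "A * x ^ 4 = A * x ^ 3 * x" by (simp add: power_Suc[symmetric] eval_nat_numeral)
  also have "A * x ^ 3 * x + A * x ^ 3 = A * (x + 1) * x ^ 3" by (simp add: algebra_simps)
  also have "\<dots> \<le> A * (X + 1) * x ^ 3" using x A by (intro mult_right_mono mult_left_mono) auto
  finally have d: "norm (w - ?E) \<le> A * (X + 1) * x ^ 3" .
  have "norm R \<le> (real n)\<^sup>2 * M ^ (n - 2) * (norm (w - ?E))\<^sup>2"
    unfolding R_def using w E by (intro power_linearization) auto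
  also have "\<dots> \<le> (real n)\<^sup>2 * M ^ (n - 2) * (A * (X + 1) * x ^ 3)\<^sup>2"
    using d M by (intro mult_left_mono power_mono mult_nonneg_nonneg) auto
  finally have R: "norm R \<le> \<dots>" .
  have Re_scale: "Re (of_real a * z) = a * Re z" for a z by simp
  have "w ^ n * cis (- \<beta>) - ?E ^ n = R * cis (- \<beta>) + of_real (real n * E ^ (n - 1)) * ((w - ?E) * cis (- \<beta>)) +
      of_real (E ^ n) * (cis (- \<beta>) - 1)"
    by (simp add: R_def algebra_simps)
  from arg_cong[OF this, of Re] have "Re (w ^ n * cis (- \<beta>)) - E ^ n = Re (R * cis (- \<beta>)) +
      real n * E ^ (n - 1) * Re ((w - ?E) * cis (- \<beta>)) + E ^ n * (cos \<beta> - 1)"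
    by (simp only: minus_complex.sel plus_complex.sel Re_complex_of_real of_real_power[symmetric] Re_scale cis.sel
        one_complex.sel cos_minus)
  moreover have "\<bar>Re (R * cis (- \<beta>))\<bar> \<le> (real n)\<^sup>2 * M ^ (n - 2) * (A * (X + 1) * x ^ 3)\<^sup>2"
    using abs_Re_le_cmod[of "R * cis (- \<beta>)"] R by (simp add: norm_mult)
  moreover have "\<bar>real n * E ^ (n - 1) * Re ((w - ?E) * cis (- \<beta>))\<bar> \<le>
      real n * M ^ (n - 1) * (A * x ^ 4 + A * x ^ 3 * \<bar>\<beta>\<bar>)"
  proof -
    have "Re ((w - ?E) * cis (- \<beta>)) = (Re w - E) * cos \<beta> + Im w * sin \<beta>" by simp
    also have "\<bar>\<dots>\<bar> \<le> \<bar>Re w - E\<bar> * \<bar>cos \<beta>\<bar> + \<bar>Im w\<bar> * \<bar>sin \<beta>\<bar>"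
      by (metis abs_mult abs_triangle_ineq)
    also have "\<dots> \<le> (A * x ^ 4) * 1 + (A * x ^ 3) * \<bar>\<beta>\<bar>"
      using re im A x abs_sin_x_le_abs_x[of \<beta>] by (intro add_mono mult_mono) auto
    finally have "\<bar>Re ((w - ?E) * cis (- \<beta>))\<bar> \<le> A * x ^ 4 + A * x ^ 3 * \<bar>\<beta>\<bar>" by simp
    moreover have "\<bar>real n * E ^ (n - 1)\<bar> \<le> real n * M ^ (n - 1)"
      using E by (simp add: abs_mult mult_left_mono power_mono)
    ultimately show ?thesis unfolding abs_mult[of "real n * E ^ (n - 1)"]
      using M by (intro mult_mono) auto
  qed
  moreover have "\<bar>E ^ n * (cos \<beta> - 1)\<bar> \<le> M ^ n * \<beta>\<^sup>2"
  proof -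
    have "(sin (\<beta> / 2))\<^sup>2 \<le> (\<beta> / 2)\<^sup>2"
      using power_mono[OF abs_sin_x_le_abs_x[of "\<beta> / 2"], of 2] by (simp add: power_divide)
    then have "cos \<beta> \<ge> 1 - \<beta>\<^sup>2 / 2"
      using cos_double_sin[of "\<beta> / 2"] by (simp add: power_divide)
    then have "\<bar>cos \<beta> - 1\<bar> \<le> \<beta>\<^sup>2" using cos_le_one[of \<beta>] zero_le_power2[of \<beta>] by linarith
    moreover have "\<bar>E ^ n\<bar> \<le> M ^ n" using E by (simp add: power_mono)
    ultimately show ?thesis unfolding abs_mult using M by (intro mult_mono) auto
  qed
  ultimately show ?thesis by linarith
qed

section \<open>The characteristic function of one centred trial\<close>

definition charfun :: "real ^ 'n \<Rightarrow> real ^ 'n \<Rightarrow> complex" where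
  "charfun y \<xi> = of_real (1 - (\<Sum>i\<in>UNIV. y $ i)) * cis (- (\<xi> \<bullet> y)) + (\<Sum>i\<in>UNIV. of_real (y $ i) * cis (\<xi> $ i - \<xi> \<bullet> y))"

definition variance :: "real ^ 'n \<Rightarrow> real ^ 'n \<Rightarrow> real" where
  "variance y \<xi> = (\<Sum>i\<in>UNIV. y $ i * (\<xi> $ i)\<^sup>2) - (\<xi> \<bullet> y)\<^sup>2"

lemma norm_le_one_csimplex:
  fixes y :: "real ^ 'n"
  assumes "\<And>i. 0 \<le> y $ i" "(\<Sum>i\<in>UNIV. y $ i) \<le> 1"
  shows "norm y \<le> 1"
  using norm_le_l1_cart[of y] assms by simp

lemma weighted_sum_bound:
  fixes y :: "real ^ 'n"
  assumes y: "\<And>i. 0 \<le> y $ i" "(\<Sum>i\<in>UNIV. y $ i) \<le> 1" and "\<bar>f0\<bar> \<le> B" "\<And>i. \<bar>f i\<bar> \<le> (B::real)"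
  shows "\<bar>(1 - (\<Sum>i\<in>UNIV. y $ i)) * f0 + (\<Sum>i\<in>UNIV. y $ i * f i)\<bar> \<le> B"
proof -
  have "\<bar>(1 - (\<Sum>i\<in>UNIV. y $ i)) * f0 + (\<Sum>i\<in>UNIV. y $ i * f i)\<bar> \<le>
      \<bar>(1 - (\<Sum>i\<in>UNIV. y $ i)) * f0\<bar> + (\<Sum>i\<in>UNIV. \<bar>y $ i * f i\<bar>)"
    by (rule order_trans[OF abs_triangle_ineq add_left_mono[OF sum_abs]])
  also have "\<dots> \<le> (1 - (\<Sum>i\<in>UNIV. y $ i)) * B + (\<Sum>i\<in>UNIV. y $ i * B)"
    using assms by (intro add_mono sum_mono) (auto simp: abs_mult intro!: mult_left_mono)
  also have "\<dots> = B" by (simp add: algebra_simps flip: sum_distrib_left)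
  finally show ?thesis .
qed

text \<open>Centring at the mean removes the first-order terms, so the imaginary part starts at
  third order, and the second moment about the mean is \<open>variance\<close>. The constants come
  from bounding every phase by \<open>2 * norm \<xi>\<close>.\<close>

lemma charfun_expansion:
  fixes y \<xi> :: "real ^ 'n"
  assumes y: "\<And>i. 0 \<le> y $ i" "(\<Sum>i\<in>UNIV. y $ i) \<le> 1"
  shows "\<bar>Re (charfun y \<xi>) - (1 - variance y \<xi> / 2)\<bar> \<le> norm \<xi> ^ 4"
    and "\<bar>Im (charfun y \<xi>)\<bar> \<le> 2 * norm \<xi> ^ 3"
proof -
  define m where "m = \<xi> \<bullet> y"
  let ?y0 = "1 - (\<Sum>i\<in>UNIV. y $ i)"
  have m: "\<bar>m\<bar> \<le> norm \<xi>"
    using Cauchy_Schwarz_ineq2[of \<xi> y] norm_le_one_csimplex[OF y] mult_left_le[of "norm y" "norm \<xi>"] by (simp add: m_def)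
  have mi: "\<bar>\<xi> $ i - m\<bar> \<le> 2 * norm \<xi>" for i
    using m component_le_norm_cart[of \<xi> i] by linarith
  have msum: "(\<Sum>i\<in>UNIV. y $ i * \<xi> $ i) = m" by (simp add: m_def inner_vec_def mult.commute)
  have p4: "\<bar>u\<bar> \<le> 2 * norm \<xi> \<Longrightarrow> u ^ 4 / 24 \<le> norm \<xi> ^ 4" for u :: real
  proof -
    assume "\<bar>u\<bar> \<le> 2 * norm \<xi>"
    then have "u ^ 4 \<le> 16 * norm \<xi> ^ 4"
      using power_mono[of "\<bar>u\<bar>" "2 * norm \<xi>" 4] by (simp add: power_mult_distrib)
    moreover have "0 \<le> norm \<xi> ^ 4" by simp
    ultimately show ?thesis by linarith
  qed
  have p3: "\<bar>u\<bar> \<le> 2 * norm \<xi> \<Longrightarrow> \<bar>u\<bar> ^ 3 / 6 \<le> 2 * norm \<xi> ^ 3" for u :: real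
  proof -
    assume "\<bar>u\<bar> \<le> 2 * norm \<xi>"
    then have "\<bar>u\<bar> ^ 3 \<le> 8 * norm \<xi> ^ 3"
      using power_mono[of "\<bar>u\<bar>" "2 * norm \<xi>" 3] by (simp add: power_mult_distrib)
    moreover have "0 \<le> norm \<xi> ^ 3" by simp
    ultimately show ?thesis by linarith
  qed
  have Re: "Re (charfun y \<xi>) = ?y0 * cos m + (\<Sum>i\<in>UNIV. y $ i * cos (\<xi> $ i - m))"
    by (simp add: charfun_def m_def Re_sum)
  have Im: "Im (charfun y \<xi>) = ?y0 * sin (- m) + (\<Sum>i\<in>UNIV. y $ i * sin (\<xi> $ i - m))"
    by (simp add: charfun_def m_def Im_sum)
  have var: "?y0 * m\<^sup>2 + (\<Sum>i\<in>UNIV. y $ i * (\<xi> $ i - m)\<^sup>2) = variance y \<xi>"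
  proof -
    have "(\<Sum>i\<in>UNIV. y $ i * (\<xi> $ i - m)\<^sup>2) =
        (\<Sum>i\<in>UNIV. y $ i * (\<xi> $ i)\<^sup>2 - 2 * m * (y $ i * \<xi> $ i) + m\<^sup>2 * y $ i)"
      by (rule sum.cong) (simp_all add: power2_eq_square algebra_simps)
    also have "\<dots> = (\<Sum>i\<in>UNIV. y $ i * (\<xi> $ i)\<^sup>2) - 2 * m * m + m\<^sup>2 * (\<Sum>i\<in>UNIV. y $ i)"
      by (simp add: sum.distrib sum_subtractf sum_distrib_left[symmetric] msum)
    finally show ?thesis by (simp add: variance_def m_def[symmetric] power2_eq_square algebra_simps)
  qed
  have "?y0 * (cos m - (1 - m\<^sup>2 / 2)) + (\<Sum>i\<in>UNIV. y $ i * (cos (\<xi> $ i - m) - (1 - (\<xi> $ i - m)\<^sup>2 / 2))) =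
      (?y0 * cos m + (\<Sum>i\<in>UNIV. y $ i * cos (\<xi> $ i - m))) - (?y0 + (\<Sum>i\<in>UNIV. y $ i)) +
      (?y0 * m\<^sup>2 + (\<Sum>i\<in>UNIV. y $ i * (\<xi> $ i - m)\<^sup>2)) / 2"
    by (simp add: right_diff_distrib sum_subtractf sum.distrib distrib_left sum_divide_distrib add_divide_distrib)
  then have "Re (charfun y \<xi>) - (1 - variance y \<xi> / 2) =
      ?y0 * (cos m - (1 - m\<^sup>2 / 2)) + (\<Sum>i\<in>UNIV. y $ i * (cos (\<xi> $ i - m) - (1 - (\<xi> $ i - m)\<^sup>2 / 2)))"
    unfolding Re[symmetric] var by simp
  also have "\<bar>\<dots>\<bar> \<le> norm \<xi> ^ 4"
    by (intro weighted_sum_bound y order_trans[OF cos_taylor4] p4 mi) (use m in linarith)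
  finally show "\<bar>Re (charfun y \<xi>) - (1 - variance y \<xi> / 2)\<bar> \<le> norm \<xi> ^ 4" .
  have "?y0 * (sin (- m) - (- m)) + (\<Sum>i\<in>UNIV. y $ i * (sin (\<xi> $ i - m) - (\<xi> $ i - m))) =
     (?y0 * sin (- m) + (\<Sum>i\<in>UNIV. y $ i * sin (\<xi> $ i - m))) - (- ?y0 * m + ((\<Sum>i\<in>UNIV. y $ i * \<xi> $ i) - (\<Sum>i\<in>UNIV. y $ i) * m))"
    by (simp add: right_diff_distrib sum_subtractf sum.distrib distrib_left algebra_simps flip: sum_distrib_left)
  then have "Im (charfun y \<xi>) = ?y0 * (sin (- m) - (- m)) + (\<Sum>i\<in>UNIV. y $ i * (sin (\<xi> $ i - m) - (\<xi> $ i - m)))"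
    unfolding Im[symmetric] msum by (simp add: algebra_simps)
  also have "\<bar>\<dots>\<bar> \<le> 2 * norm \<xi> ^ 3"
    by (intro weighted_sum_bound y order_trans[OF sin_taylor3] p3 mi) (use m in linarith)
  finally show "\<bar>Im (charfun y \<xi>)\<bar> \<le> 2 * norm \<xi> ^ 3" .
qed

text \<open>Cauchy-Schwarz with the weights \<open>y\<close>, of total mass at most
  \<open>1 - d\<close>, leaves a proportion \<open>d\<close> of the second moment; the lower bound
  \<open>d\<close> of the single weights supplies the second factor.\<close>

lemma variance_bounds:
  fixes y \<xi> :: "real ^ 'n"
  assumes d: "0 < d" and y: "\<And>i. d \<le> y $ i" "(\<Sum>i\<in>UNIV. y $ i) \<le> 1 - d"
  shows "d\<^sup>2 * (norm \<xi>)\<^sup>2 \<le> variance y \<xi>" "variance y \<xi> \<le> (norm \<xi>)\<^sup>2"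
proof -
  have y0: "0 \<le> y $ i" for i using d y(1)[of i] by linarith
  have nx: "(norm \<xi>)\<^sup>2 = (\<Sum>i\<in>UNIV. (\<xi> $ i)\<^sup>2)" by (simp add: norm_vec_def L2_set_def sum_nonneg)
  have "(\<xi> \<bullet> y)\<^sup>2 = (\<Sum>i\<in>UNIV. sqrt (y $ i) * (sqrt (y $ i) * \<xi> $ i))\<^sup>2"
  proof -
    have "sqrt (y $ i) * (sqrt (y $ i) * \<xi> $ i) = \<xi> $ i * y $ i" for i
      using real_sqrt_mult_self[of "y $ i"] y0[of i] by (simp only: mult.assoc[symmetric]) simp
    then show ?thesis by (simp only: inner_vec_def inner_real_def)
  qed
  also have "\<dots> \<le> (\<Sum>i\<in>UNIV. (sqrt (y $ i))\<^sup>2) * (\<Sum>i\<in>UNIV. (sqrt (y $ i) * \<xi> $ i)\<^sup>2)"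
    by (rule Cauchy_Schwarz_ineq_sum)
  also have "\<dots> = (\<Sum>i\<in>UNIV. y $ i) * (\<Sum>i\<in>UNIV. y $ i * (\<xi> $ i)\<^sup>2)"
    using y0 by (simp add: power_mult_distrib)
  also have "\<dots> \<le> (1 - d) * (\<Sum>i\<in>UNIV. y $ i * (\<xi> $ i)\<^sup>2)"
    using y y0 by (intro mult_right_mono sum_nonneg mult_nonneg_nonneg) auto
  finally have "d * (\<Sum>i\<in>UNIV. y $ i * (\<xi> $ i)\<^sup>2) \<le> variance y \<xi>"
    by (simp add: variance_def algebra_simps)
  moreover have "d * (\<Sum>i\<in>UNIV. (\<xi> $ i)\<^sup>2) \<le> (\<Sum>i\<in>UNIV. y $ i * (\<xi> $ i)\<^sup>2)"
    unfolding sum_distrib_left using y(1) by (intro sum_mono mult_right_mono) auto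
  then have "d * (d * (\<Sum>i\<in>UNIV. (\<xi> $ i)\<^sup>2)) \<le> d * (\<Sum>i\<in>UNIV. y $ i * (\<xi> $ i)\<^sup>2)"
    using d by (intro mult_left_mono) auto
  ultimately show "d\<^sup>2 * (norm \<xi>)\<^sup>2 \<le> variance y \<xi>" unfolding nx power2_eq_square[of d] mult.assoc by linarith
  have "y $ i \<le> 1" for i using member_le_sum[of i UNIV "\<lambda>i. y $ i"] y0 y(2) d by simp
  then have "(\<Sum>i\<in>UNIV. y $ i * (\<xi> $ i)\<^sup>2) \<le> (\<Sum>i\<in>UNIV. 1 * (\<xi> $ i)\<^sup>2)"
    by (intro sum_mono mult_right_mono) auto
  then show "variance y \<xi> \<le> (norm \<xi>)\<^sup>2" using zero_le_power2[of "\<xi> \<bullet> y"] unfolding nx variance_def mult_1_left by linarith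
qed

text \<open>The extra cell and the cell \<open>i\<close> have masses at least \<open>d\<close> and
  relative phase \<open>\<xi> $ i\<close>, so their sum falls short of their total mass
  \<open>A\<close> by the stated amount; the other cells are bounded by the triangle inequality. The
  bound holds on the whole period box, not only near 0.\<close>

lemma norm_charfun_le:
  fixes y \<xi> :: "real ^ 'n"
  assumes d: "0 < d" and y: "\<And>i. d \<le> y $ i" "(\<Sum>i\<in>UNIV. y $ i) \<le> 1 - d"
  shows "norm (charfun y \<xi>) \<le> 1 - d\<^sup>2 * (1 - cos (\<xi> $ i))"
proof -
  define y0 where "y0 = 1 - (\<Sum>i\<in>UNIV. y $ i)"
  have y0: "d \<le> y0" using y(2) by (simp add: y0_def)
  have yn: "0 \<le> y $ k" for k using d y(1)[of k] by linarith
  define A where "A = y0 + y $ i"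
  have A: "0 < A" using y0 y(1)[of i] d by (simp add: A_def)
  have rest: "(\<Sum>k\<in>UNIV - {i}. y $ k) = 1 - A" by (simp add: A_def y0_def sum_diff1)
  have A1: "A \<le> 1" using rest sum_nonneg[of "UNIV - {i}" "\<lambda>k. y $ k"] yn by simp
  have split: "charfun y \<xi> = cis (- (\<xi> \<bullet> y)) * ((of_real y0 + of_real (y $ i) * cis (\<xi> $ i)) + (\<Sum>k\<in>UNIV - {i}. of_real (y $ k) * cis (\<xi> $ k)))"
  proof -
    have "charfun y \<xi> = cis (- (\<xi> \<bullet> y)) * (of_real y0 + (\<Sum>k\<in>UNIV. of_real (y $ k) * cis (\<xi> $ k)))"
    proof -
      have "cis (\<xi> $ i - \<xi> \<bullet> y) = cis (- (\<xi> \<bullet> y)) * cis (\<xi> $ i)" for i by (simp add: cis_mult)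
      then show ?thesis unfolding charfun_def y0_def distrib_left sum_distrib_left by (simp only: mult_ac)
    qed
    then show ?thesis by (simp add: sum.remove[of UNIV i] add.assoc)
  qed
  let ?u = "complex_of_real y0 + of_real (y $ i) * cis (\<xi> $ i)" and ?h = "y0 * y $ i * (1 - cos (\<xi> $ i)) / A"
  have "(norm ?u)\<^sup>2 = (y0 + y $ i * cos (\<xi> $ i))\<^sup>2 + (y $ i * sin (\<xi> $ i))\<^sup>2"
    by (simp add: cmod_power2)
  also have "\<dots> = A\<^sup>2 - 2 * (y0 * y $ i * (1 - cos (\<xi> $ i)))"
    using sin_cos_squared_add[of "\<xi> $ i"] unfolding A_def by (simp add: power2_eq_square) algebra
  also have "\<dots> \<le> (A - ?h)\<^sup>2" using A by (simp add: power2_diff)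
  finally have "(norm ?u)\<^sup>2 \<le> (A - ?h)\<^sup>2" .
  moreover have "0 \<le> A - ?h"
  proof -
    have "y0 * y $ i * (1 - cos (\<xi> $ i)) \<le> y0 * y $ i * 2"
      using y0 d yn[of i] cos_ge_minus_one[of "\<xi> $ i"] by (intro mult_left_mono) auto
    also have "\<dots> \<le> A * A" using zero_le_power2[of y0] zero_le_power2[of "y $ i"] by (simp add: A_def power2_eq_square algebra_simps)
    finally show ?thesis using A by (simp add: divide_le_eq)
  qed
  ultimately have u: "norm ?u \<le> A - ?h" using power2_le_imp_le by blast
  have "norm (\<Sum>k\<in>UNIV - {i}. complex_of_real (y $ k) * cis (\<xi> $ k)) \<le> (\<Sum>k\<in>UNIV - {i}. y $ k)"
    by (rule order_trans[OF norm_sum]) (simp add: norm_mult yn)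
  then have "norm (charfun y \<xi>) \<le> (A - ?h) + (1 - A)"
    unfolding split norm_mult norm_cis mult_1_left using u rest norm_triangle_ineq order_trans by (smt (verit, best))
  moreover have "d\<^sup>2 * (1 - cos (\<xi> $ i)) \<le> ?h"
  proof -
    have "d\<^sup>2 * (1 - cos (\<xi> $ i)) \<le> (y0 * y $ i) * (1 - cos (\<xi> $ i))"
      using y0 y(1)[of i] d unfolding power2_eq_square by (intro mult_right_mono mult_mono) auto
    also have "\<dots> \<le> ?h"
      using A A1 y0 d yn[of i] by (simp add: le_divide_eq mult_left_le)
    finally show ?thesis .
  qed
  ultimately show ?thesis by linarith
qed

lemma variance_scaleR: "variance y (s *\<^sub>R \<xi>) = s\<^sup>2 * variance y \<xi>"
  by (simp add: variance_def power_mult_distrib sum_distrib_left algebra_simps)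

text \<open>Half of the exponent absorbs the power. With \<open>u = c / 2 * T\<^sup>2\<close> one
  has \<open>u ^ 3 \<le> 27 * exp u\<close> and \<open>T ^ 6 = 8 / c ^ 3 * u ^ 3\<close>, whence
  216.\<close>

lemma poly_times_gaussian_le:
  fixes c T :: real
  assumes "c > 0"
  shows "(1 + T ^ 6) * exp (- (c * T\<^sup>2)) \<le> (1 + 216 / c ^ 3) * exp (- (c / 2 * T\<^sup>2))"
proof -
  define u where "u = c / 2 * T\<^sup>2"
  have u: "u \<ge> 0" using assms by (simp add: u_def)
  have "u / 3 \<le> exp (u / 3)" using exp_ge_add_one_self[of "u / 3"] by linarith
  then have "(u / 3) ^ 3 \<le> exp (u / 3) ^ 3" using u by (intro power_mono) auto
  also have "exp (u / 3) ^ 3 = exp u" by (simp add: exp_of_nat_mult[symmetric])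
  finally have u3: "u ^ 3 \<le> 27 * exp u" by (simp add: power_divide)
  have "T ^ 6 = 8 / c ^ 3 * u ^ 3"
    using assms by (simp add: u_def power_mult_distrib power_divide power_mult[symmetric])
  also have "\<dots> \<le> 8 / c ^ 3 * (27 * exp u)" using u3 assms by (intro mult_left_mono) auto
  finally have "T ^ 6 \<le> 216 / c ^ 3 * exp u" by simp
  moreover have "1 \<le> exp u" using u by simp
  ultimately have "1 + T ^ 6 \<le> exp u + 216 / c ^ 3 * exp u" by linarith
  then have "(1 + T ^ 6) * exp (- (2 * u)) \<le> (1 + 216 / c ^ 3) * exp u * exp (- (2 * u))"
    by (intro mult_right_mono) (simp_all add: algebra_simps)
  also have "\<dots> = (1 + 216 / c ^ 3) * exp (- u)" by (simp add: mult.assoc exp_add[symmetric])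
  finally show ?thesis by (simp add: u_def)
qed

lemma charfun_alt: "charfun y \<xi> = cis (- (\<xi> \<bullet> y)) * (of_real (1 - (\<Sum>i\<in>UNIV. y $ i)) + (\<Sum>i\<in>UNIV. of_real (y $ i) * cis (\<xi> $ i)))"
proof -
  have "cis (\<xi> $ i - \<xi> \<bullet> y) = cis (- (\<xi> \<bullet> y)) * cis (\<xi> $ i)" for i by (simp add: cis_mult)
  then show ?thesis unfolding charfun_def distrib_left sum_distrib_left by (simp only: mult_ac)
qed

lemma charfun_power_eq_sum:
  fixes y \<xi> \<beta> :: "real ^ 'n"
  shows "charfun y \<xi> ^ n * cis (- (\<xi> \<bullet> (\<beta> - real n *\<^sub>R y))) =
    (\<Sum>\<alpha>\<in>mexps n. of_real (mweight n y \<alpha>) * cis (\<xi> \<bullet> (rvec \<alpha> - \<beta>)))"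
proof -
  let ?\<phi> = "of_real (1 - (\<Sum>i\<in>UNIV. y $ i)) + (\<Sum>i\<in>UNIV. of_real (y $ i) * cis (\<xi> $ i))"
  have p: "(\<Prod>j\<in>UNIV. cis (\<xi> $ j) ^ \<alpha> $ j) = cis (\<xi> \<bullet> rvec \<alpha>)" for \<alpha> :: "nat ^ 'n"
    unfolding Complex.DeMoivre inner_vec_def by (simp add: cis_conv_exp exp_sum sum_distrib_left mult_ac)
  have "charfun y \<xi> ^ n * cis (- (\<xi> \<bullet> (\<beta> - real n *\<^sub>R y))) =
      (cis (real n * - (\<xi> \<bullet> y)) * cis (- (\<xi> \<bullet> (\<beta> - real n *\<^sub>R y)))) * ?\<phi> ^ n"
    unfolding charfun_alt power_mult_distrib Complex.DeMoivre[of "- (\<xi> \<bullet> y)"] by (simp only: mult_ac)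
  also have "cis (real n * - (\<xi> \<bullet> y)) * cis (- (\<xi> \<bullet> (\<beta> - real n *\<^sub>R y))) = cis (- (\<xi> \<bullet> \<beta>))"
    by (simp add: cis_mult inner_diff_right)
  also have "?\<phi> ^ n = (\<Sum>\<alpha>\<in>mexps n. of_real (mweight n y \<alpha>) * cis (\<xi> \<bullet> rvec \<alpha>))"
    unfolding mweight_generating[symmetric] p ..
  also have "cis (- (\<xi> \<bullet> \<beta>)) * \<dots> = (\<Sum>\<alpha>\<in>mexps n. of_real (mweight n y \<alpha>) * cis (\<xi> \<bullet> (rvec \<alpha> - \<beta>)))"
    unfolding sum_distrib_left by (rule sum.cong) (simp_all add: cis_mult inner_diff_right mult.left_commute[of "cis _" "of_real _"])
  finally show ?thesis .
qed

text \<open>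
  The functionals \<open>b j\<close> that are not zero are a basis of a primitive lattice; the zero ones only
  pad the index set, so that the Fourier integrals can be taken over \<open>real ^ 'n\<close> whatever the
  rank is.
\<close>

locale primitive_system =
  fixes b :: "'n \<Rightarrow> real ^ 'n"
  assumes b_int: "b j \<in> int_vecs"
    and primitive: "(\<And>i. (\<Sum>k\<in>UNIV. t $ k *\<^sub>R b k) $ i / (2 * pi) \<in> \<int>) \<Longrightarrow> b j \<noteq> 0 \<Longrightarrow> t $ j / (2 * pi) \<in> \<int>"
begin

definition J :: "'n set" where "J = {j. b j \<noteq> 0}"
definition comb :: "real ^ 'n \<Rightarrow> real ^ 'n" where "comb t = (\<Sum>k\<in>UNIV. t $ k *\<^sub>R b k)"
definition dual :: "real ^ 'n \<Rightarrow> real ^ 'n" where "dual x = (\<chi> j. b j \<bullet> x)"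
abbreviation prj :: "real ^ 'n \<Rightarrow> real ^ 'n" where "prj \<equiv> proj_coords J"

lemma comb_inner: "comb t \<bullet> x = t \<bullet> dual x"
  by (simp add: comb_def dual_def inner_sum_left inner_vec_def[of t])

lemma comb_prj: "comb (prj t) = comb t"
  unfolding comb_def by (rule sum.cong) (auto simp: proj_coords_def J_def)

lemma prj_inner_dual: "t \<bullet> dual x = prj t \<bullet> dual x"
  by (simp add: comb_inner[symmetric] comb_prj)

lemma linear_comb: "linear comb"
  by (rule linearI) (simp_all add: comb_def scaleR_add_left sum.distrib scaleR_sum_right)

lemma comb_scaleR: "comb (s *\<^sub>R t) = s *\<^sub>R comb t"
  using linear_comb by (rule linear_scale)

lemma dual_int: "x \<in> int_vecs \<Longrightarrow> dual x \<in> int_vecs"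
  using b_int by (auto simp: int_vecs_def dual_def inner_vec_def intro!: Ints_sum Ints_mult)

lemma comb_upper: "\<exists>L>0. \<forall>t. norm (comb t) \<le> L * norm (prj t)"
proof -
  obtain L where L: "L > 0" "\<And>t. norm (comb t) \<le> L * norm t"
    using linear_bounded_pos[OF linear_comb] by blast
  have "norm (comb t) \<le> L * norm (prj t)" for t using L(2)[of "prj t"] by (simp only: comb_prj)
  then show ?thesis using L(1) by blast
qed

lemma comb_lower: "\<exists>l>0. \<forall>t. l * norm (prj t) \<le> norm (comb t)"
proof -
  let ?S = "{t :: real ^ 'n. \<forall>j. j \<notin> J \<longrightarrow> t $ j = 0}"
  have sub: "subspace ?S" by (auto simp: subspace_def)
  have inj: "\<forall>t\<in>?S. comb t = 0 \<longrightarrow> t = 0"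
  proof (intro ballI impI, rule ccontr)
    fix t assume t: "t \<in> ?S" "comb t = 0" "t \<noteq> 0"
    then obtain j where j: "t $ j \<noteq> 0" by (auto simp: vec_eq_iff)
    then have bj: "b j \<noteq> 0" using t(1) by (auto simp: J_def)
    \<comment> \<open>Linear independence comes out of primitivity: a relation is rescaled so that
      its \<open>j\<close>-th coefficient divided by \<open>2 * pi\<close> is one half, which is no
      integer.\<close>
    have "comb ((pi / t $ j) *\<^sub>R t) = 0" unfolding comb_scaleR t(2) by simp
    then have int: "(\<Sum>k\<in>UNIV. ((pi / t $ j) *\<^sub>R t) $ k *\<^sub>R b k) $ i / (2 * pi) \<in> \<int>" for i
      unfolding comb_def[symmetric] by simp
    have "((pi / t $ j) *\<^sub>R t) $ j / (2 * pi) \<in> \<int>" by (rule primitive[OF int bj])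
    then have "(1/2 :: real) \<in> \<int>" using j by simp
    then obtain k :: int where "(1/2 :: real) = of_int k" by (auto elim: Ints_cases)
    then have "of_int (2 * k) = (1 :: real)" by simp
    then have "2 * k = 1" by (simp only: of_int_eq_1_iff)
    then show False by presburger
  qed
  obtain l where l: "l > 0" "\<forall>x\<in>?S. l * norm x \<le> norm (comb x)"
    using injective_imp_isometric[OF closed_subspace[OF sub] sub linear_comb[unfolded linear_conv_bounded_linear] inj]
    by blast
  have "prj t \<in> ?S" for t by (simp add: proj_coords_def)
  then have "l * norm (prj t) \<le> norm (comb (prj t))" for t using l(2) by blast
  then show ?thesis unfolding comb_prj using l(1) by blast
qed

lemma norm_prj_fbox: "t \<in> fbox \<Longrightarrow> norm (prj t) \<le> CARD('n) * pi"
proof -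
  assume t: "t \<in> fbox"
  have "norm (prj t) \<le> (\<Sum>j\<in>UNIV. \<bar>prj t $ j\<bar>)" by (rule norm_le_l1_cart)
  also have "\<dots> \<le> (\<Sum>j\<in>(UNIV :: 'n set). pi)"
    using t by (intro sum_mono) (auto simp: proj_coords_def fbox_def)
  finally show ?thesis by simp
qed

text \<open>The sum vanishes only if all entries of \<open>comb t\<close> are multiples of
  \<open>2 * pi\<close>. Primitivity passes this on to the coordinates of \<open>t\<close> in
  \<open>J\<close>, and in the box these must then be 0. Near 0 the quadratic bound for the cosine
  applies; on the remaining compact set \<open>Q\<close> the minimum is positive.\<close>

lemma cos_sum_lower:
  "\<exists>c>0. \<forall>t\<in>fbox. c * (norm (prj t))\<^sup>2 \<le> (\<Sum>i\<in>UNIV. 1 - cos (comb t $ i))"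
proof -
  obtain L where L: "L > 0" "\<And>t. norm (comb t) \<le> L * norm (prj t)" using comb_upper by blast
  obtain l where l: "l > 0" "\<And>t. l * norm (prj t) \<le> norm (comb t)" using comb_lower by blast
  define f where "f t = (\<Sum>i\<in>UNIV. 1 - cos (comb t $ i))" for t
  have fprj: "f (prj t) = f t" for t by (simp add: f_def comb_prj)
  define Q where "Q = fbox \<inter> {t. \<forall>j. j \<notin> J \<longrightarrow> t $ j = 0} \<inter> {t. 1 / L \<le> norm t}"
  have fbox: "closed (fbox :: (real ^ 'n) set)"
    using closed_slab[of "{} :: 'n set"] by (simp add: slab_def fbox_def)
  have "closed {t :: real ^ 'n. \<forall>j. j \<notin> J \<longrightarrow> t $ j = 0}"
    by (rule closed_subspace) (auto simp: subspace_def)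
  then have "closed Q" unfolding Q_def
    by (intro closed_Int fbox closed_Collect_le continuous_intros)
  moreover have "bounded Q"
  proof -
    have "norm t \<le> CARD('n) * pi" if "t \<in> Q" for t
    proof -
      have "prj t = t" using that by (auto simp: Q_def proj_coords_def vec_eq_iff)
      then show ?thesis using norm_prj_fbox[of t] that by (simp add: Q_def)
    qed
    then show ?thesis unfolding bounded_iff by blast
  qed
  ultimately have Q: "compact Q" by (simp add: compact_eq_bounded_closed)
  have fpos: "f t > 0" if "t \<in> Q" for t
  proof (rule ccontr)
    assume "\<not> f t > 0"
    moreover have nn: "1 - cos (comb t $ i) \<ge> 0" for i by simp
    ultimately have "f t = 0" using sum_nonneg[of UNIV "\<lambda>i. 1 - cos (comb t $ i)"] by (simp add: f_def)
    then have "cos (comb t $ i) = 1" for i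
      unfolding f_def using sum_nonneg_eq_0_iff[of UNIV "\<lambda>i. 1 - cos (comb t $ i)"] nn by auto
    then have "comb t $ i / (2 * pi) \<in> \<int>" for i
    proof -
      assume "\<And>i. cos (comb t $ i) = 1"
      then obtain k :: int where "comb t $ i = of_int k * 2 * pi" using cos_one_2pi_int by blast
      then show ?thesis by simp
    qed
    then have int: "t $ j / (2 * pi) \<in> \<int>" if "j \<in> J" for j
      using primitive[of t j] that by (simp add: comb_def J_def)
    have "t $ j = 0" for j
    proof (cases "j \<in> J")
      case True
      obtain k :: int where k: "t $ j / (2 * pi) = of_int k" using int[OF True] by (auto elim: Ints_cases)
      have "\<bar>t $ j\<bar> \<le> pi" using that by (auto simp: Q_def fbox_def)
      then have "\<bar>t $ j / (2 * pi)\<bar> \<le> 1 / 2" by (simp add: abs_mult field_simps)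
      then have "\<bar>of_int k :: real\<bar> < 1" unfolding k by linarith
      then have "k = 0" by linarith
      then show ?thesis using k by simp
    qed (use that in \<open>simp add: Q_def\<close>)
    then have "t = 0" by (simp add: vec_eq_iff)
    then show False using that L(1) by (simp add: Q_def)
  qed
  have "continuous_on Q f" unfolding f_def comb_def by (intro continuous_intros)
  then have "\<exists>m0>0. \<forall>t\<in>Q. m0 \<le> f t"
    using continuous_attains_inf[OF Q] fpos by (cases "Q = {}") (auto intro: exI[of _ 1])
  then obtain m0 where m0: "m0 > 0" "\<And>t. t \<in> Q \<Longrightarrow> m0 \<le> f t" by blast
  define X where "X = CARD('n) * pi"
  have X: "X > 0" by (simp add: X_def)
  define c where "c = min (l\<^sup>2 / 4) (m0 / X\<^sup>2)"
  have "c > 0" using l m0 X by (simp add: c_def)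
  moreover have "c * (norm (prj t))\<^sup>2 \<le> f t" if t: "t \<in> fbox" for t
  proof (cases "norm (prj t) < 1 / L")
    case True
    then have "norm (comb t) \<le> 1" using L(2)[of t] L(1) by (simp add: field_simps)
    then have "\<bar>comb t $ i\<bar> \<le> 1" for i using component_le_norm_cart[of "comb t" i] by simp
    then have "(\<Sum>i\<in>UNIV. (comb t $ i)\<^sup>2 / 4) \<le> f t"
      unfolding f_def by (intro sum_mono one_minus_cos_ge)
    then have "(norm (comb t))\<^sup>2 / 4 \<le> f t"
      by (simp add: norm_vec_def L2_set_def sum_nonneg sum_divide_distrib)
    moreover have "(l * norm (prj t))\<^sup>2 \<le> (norm (comb t))\<^sup>2" using l by (intro power_mono) auto
    moreover have "c * (norm (prj t))\<^sup>2 \<le> l\<^sup>2 / 4 * (norm (prj t))\<^sup>2"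
      unfolding c_def by (intro mult_right_mono min.cobounded1) simp
    ultimately show ?thesis by (simp add: power_mult_distrib)
  next
    case False
    then have "prj t \<in> Q" using t by (auto simp: Q_def fbox_def proj_coords_def)
    then have "m0 \<le> f t" using m0(2) fprj by metis
    have "c * (norm (prj t))\<^sup>2 \<le> m0 / X\<^sup>2 * X\<^sup>2"
      using norm_prj_fbox[OF t] X m0 by (intro mult_mono power_mono) (auto simp: c_def X_def)
    then show ?thesis using \<open>m0 \<le> f t\<close> X by simp
  qed
  ultimately show ?thesis unfolding f_def by blast
qed

text \<open>Deliberately unnormalised: padding directions contribute a factor \<open>2 * pi\<close>
  each, matching the factor \<open>(2 * pi) ^ CARD('n)\<close> of the Fourier formula.\<close>

definition gaussian :: "real ^ 'n \<Rightarrow> real" where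
  "gaussian y = (\<integral>t. indicator (slab J) t * exp (- (variance y (comb t) / 2)) \<partial>lborel)"

definition coset_weight :: "nat \<Rightarrow> real ^ 'n \<Rightarrow> real ^ 'n \<Rightarrow> real" where
  "coset_weight n y \<beta> = (\<Sum>\<alpha> | \<alpha> \<in> mexps n \<and> dual (rvec \<alpha> - \<beta>) = 0. mweight n y \<alpha>)"

lemma rvec_int: "rvec \<alpha> \<in> int_vecs"
  by (simp add: int_vecs_def)

text \<open>For integral \<beta> the values of \<open>dual\<close> are integral, and integration of
  the cosine over the period box detects whether they vanish.\<close>

lemma coset_weight_fourier:
  assumes \<beta>: "\<beta> \<in> int_vecs"
  shows "(2 * pi) ^ CARD('n) * coset_weight n y \<beta> =
    (\<integral>t. indicator fbox t * Re (charfun y (comb t) ^ n * cis (- (comb t \<bullet> (\<beta> - real n *\<^sub>R y)))) \<partial>lborel)"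
proof -
  have int: "dual (rvec \<alpha> - \<beta>) \<in> int_vecs" for \<alpha> by (intro dual_int int_vecs_diff rvec_int \<beta>)
  have "(2 * pi) ^ CARD('n) * coset_weight n y \<beta> =
      (\<Sum>\<alpha>\<in>mexps n. mweight n y \<alpha> * (if dual (rvec \<alpha> - \<beta>) = 0 then (2 * pi) ^ CARD('n) else 0))"
    unfolding coset_weight_def sum_distrib_left
    by (simp add: sum.inter_filter[symmetric] if_distrib mult.commute cong: if_cong)
  also have "\<dots> = (\<Sum>\<alpha>\<in>mexps n. \<integral>t. mweight n y \<alpha> * (indicator fbox t * cos (t \<bullet> dual (rvec \<alpha> - \<beta>))) \<partial>lborel)"
    by (simp add: integral_fbox_cos[OF int])
  also have "\<dots> = (\<integral>t. (\<Sum>\<alpha>\<in>mexps n. mweight n y \<alpha> * (indicator fbox t * cos (t \<bullet> dual (rvec \<alpha> - \<beta>)))) \<partial>lborel)"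
    by (rule Bochner_Integration.integral_sum[symmetric]) (intro integrable_mult_right integrable_fbox_cos)
  also have "\<dots> = (\<integral>t. indicator fbox t * Re (charfun y (comb t) ^ n * cis (- (comb t \<bullet> (\<beta> - real n *\<^sub>R y)))) \<partial>lborel)"
    unfolding charfun_power_eq_sum
    by (intro Bochner_Integration.integral_cong refl)
      (simp add: Re_sum comb_inner sum_distrib_left mult_ac)
  finally show ?thesis .
qed

lemma continuous_charfun_comb:
  "continuous_on UNIV (\<lambda>t. Re (charfun y (comb t) ^ n * cis (- (comb t \<bullet> a))))"
proof -
  have cc: "continuous_on UNIV comb" using linear_comb linear_continuous_on linear_conv_bounded_linear by blast
  have "continuous_on UNIV (charfun y)" unfolding charfun_def cis.ctr complex_eq[symmetric]
    by (intro continuous_intros)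
  then have "continuous_on UNIV (\<lambda>t. charfun y (comb t))"
    by (rule continuous_on_compose2[OF _ cc]) simp
  then show ?thesis using cc by (intro continuous_intros)
qed

lemma fbox_sets: "fbox \<in> sets (borel :: (real ^ 'n) measure)"
  using closed_slab[of "{} :: 'n set"] by (simp add: slab_def fbox_def)

text \<open>Only directions in \<open>J\<close> are rescaled, since padding directions must keep
  their period; hence the exponent \<open>card J\<close>.\<close>

lemma coset_weight_scaled:
  assumes \<beta>: "\<beta> \<in> int_vecs" and n: "n \<ge> 1"
  shows "sqrt n ^ card J * ((2 * pi) ^ CARD('n) * coset_weight n y \<beta>) =
    (\<integral>t. indicator fbox (\<chi> j. (if j \<in> J then 1 / sqrt n else 1) * t $ j) *
      Re (charfun y ((1 / sqrt n) *\<^sub>R comb t) ^ n * cis (- (((1 / sqrt n) *\<^sub>R comb t) \<bullet> (\<beta> - real n *\<^sub>R y)))) \<partial>lborel)"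
proof -
  define d where "d j = (if j \<in> J then 1 / sqrt n else 1)" for j
  have s: "sqrt n > 0" using n by simp
  have prod: "(\<Prod>j\<in>UNIV. d j) = (1 / sqrt n) ^ card J"
    by (simp add: d_def prod.If_cases)
  have comb: "comb (\<chi> j. d j * t $ j) = (1 / sqrt n) *\<^sub>R comb t" for t
    unfolding comb_def scaleR_sum_right by (rule sum.cong) (auto simp: d_def J_def)
  have "(2 * pi) ^ CARD('n) * coset_weight n y \<beta> = (1 / sqrt n) ^ card J *
    (\<integral>t. indicator fbox (\<chi> j. d j * t $ j) * Re (charfun y (comb (\<chi> j. d j * t $ j)) ^ n *
      cis (- (comb (\<chi> j. d j * t $ j) \<bullet> (\<beta> - real n *\<^sub>R y)))) \<partial>lborel)"
    unfolding coset_weight_fourier[OF \<beta>] prod[symmetric]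
  proof (rule integral_lborel_diagonal)
    show "d j > 0" for j using s by (simp add: d_def)
    show "(\<lambda>t. indicator fbox t * Re (charfun y (comb t) ^ n * cis (- (comb t \<bullet> (\<beta> - real n *\<^sub>R y))))) \<in> borel_measurable borel"
      by (intro borel_measurable_times borel_measurable_indicator fbox_sets
          borel_measurable_continuous_onI[OF continuous_charfun_comb])
  qed
  then show ?thesis using s unfolding comb by (simp add: power_one_over d_def)
qed

end

section \<open>Error terms and the limit theorem\<close>

context primitive_system
begin

text \<open>In the variable \<open>T = x * sqrt n\<close> every error term of
  \<open>rotated_power_estimate\<close> becomes \<open>1 / n\<close> times a polynomial times a
  Gaussian. The factor \<open>exp (2 * c * X\<^sup>2)\<close> pays for replacing
  \<open>M ^ (n - 1)\<close> and \<open>M ^ (n - 2)\<close> by \<open>M ^ n\<close>, as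
  \<open>M\<close> is bounded below for \<open>x \<le> X\<close>.\<close>

lemma estimate_terms:
  fixes M x X A T K :: real and n :: nat
  assumes n: "n \<ge> 1" and x: "x = T / sqrt n" "0 \<le> x" "x \<le> X" and M: "M = exp (- (c * x\<^sup>2))" and c: "c > 0"
    and A: "A \<ge> 0" and K: "K \<ge> 0" and \<beta>: "\<bar>\<beta>\<bar> \<le> x * K"
  shows "(real n)\<^sup>2 * M ^ (n - 2) * (A * (X + 1) * x ^ 3)\<^sup>2 +
    real n * M ^ (n - 1) * (A * x ^ 4 + A * x ^ 3 * \<bar>\<beta>\<bar>) + M ^ n * \<beta>\<^sup>2 \<le>
    (exp (2 * c * X\<^sup>2) * ((A * (X + 1))\<^sup>2 + 4 * A) + 2) / n * (1 + K\<^sup>2) * ((1 + T ^ 6) * exp (- (c * T\<^sup>2)))"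
proof -
  define L where "L = exp (2 * c * X\<^sup>2)"
  have n0: "real n > 0" using n by simp
  have T: "T \<ge> 0" "T = x * sqrt n" using x n by (auto simp: zero_le_divide_iff)
  have X: "X \<ge> 0" using x by simp
  have M0: "0 < M" "M \<le> 1" using c by (simp_all add: M)
  have L1: "1 \<le> L" using c by (simp add: L_def)
  have LM: "1 \<le> L * M\<^sup>2"
  proof -
    have "x\<^sup>2 \<le> X\<^sup>2" using x by (intro power_mono) auto
    then have "0 \<le> 2 * c * X\<^sup>2 - 2 * (c * x\<^sup>2)" using c by simp
    then have "1 \<le> exp (2 * c * X\<^sup>2 - 2 * (c * x\<^sup>2))" by simp
    also have "\<dots> = L * M\<^sup>2"
      unfolding L_def M power2_eq_square[of "exp _"] exp_add[symmetric] by (rule arg_cong[of _ _ exp]) simp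
    finally show ?thesis .
  qed
  have LM': "1 \<le> L * M"
  proof -
    have "L * M\<^sup>2 \<le> L * M" using M0 L1 by (intro mult_left_mono) (auto simp: power2_eq_square mult_le_cancel_left1)
    then show ?thesis using LM by linarith
  qed
  have pow: "M ^ (n - 1) \<le> L * M ^ n" "M ^ (n - 2) \<le> L * M ^ n"
  proof -
    have "M ^ n = M ^ (n - 1) * M" using n by (cases n) auto
    then show "M ^ (n - 1) \<le> L * M ^ n" using mult_left_mono[OF LM', of "M ^ (n - 1)"] M0 by (simp add: mult_ac)
    show "M ^ (n - 2) \<le> L * M ^ n"
    proof (cases "n = 1")
      case True then show ?thesis using LM' by simp
    next
      case False
      then have "n - 2 + 2 = n" using n by simp
      then have "M ^ n = M ^ (n - 2) * M\<^sup>2" using power_add[of M "n - 2" 2] by (simp only:)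
      then show ?thesis using mult_left_mono[OF LM, of "M ^ (n - 2)"] M0 by (simp add: mult_ac)
    qed
  qed
  have Mn: "M ^ n = exp (- (c * T\<^sup>2))"
    using n0 unfolding M T(2) by (simp add: exp_of_nat_mult[symmetric] power_mult_distrib mult_ac)
  have x2: "x\<^sup>2 = T\<^sup>2 / n" using n0 by (simp add: x(1) power_divide)
  have x4: "x ^ 4 = T ^ 4 / n\<^sup>2"
  proof -
    have "x ^ 4 = (x\<^sup>2)\<^sup>2" by simp
    then show ?thesis unfolding x2 by (simp add: power_divide)
  qed
  have x6: "(x ^ 3)\<^sup>2 = T ^ 6 / n ^ 3"
  proof -
    have "(x ^ 3)\<^sup>2 = (x\<^sup>2) ^ 3" by (simp add: power_mult[symmetric])
    then show ?thesis unfolding x2 by (simp add: power_divide power_mult[symmetric])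
  qed
  have T24: "T\<^sup>2 \<le> 1 + T ^ 6" "T ^ 4 \<le> 1 + T ^ 6"
  proof -
    have "T\<^sup>2 \<le> max 1 (T ^ 6)" "T ^ 4 \<le> max 1 (T ^ 6)"
      using T by (cases "T \<le> 1"; simp add: power_le_one power_increasing le_max_iff_disj)+
    then show "T\<^sup>2 \<le> 1 + T ^ 6" "T ^ 4 \<le> 1 + T ^ 6" using T zero_le_power[of T 6] by linarith+
  qed
  have K1: "1 + K \<le> 2 * (1 + K\<^sup>2)" using zero_le_power2[of "K - 1/4"] by (simp add: power2_eq_square algebra_simps)
  define G where "G = exp (- (c * T\<^sup>2))"
  have G: "G > 0" by (simp add: G_def)
  have T6: "0 \<le> 1 + T ^ 6" using T by simp
  have t1: "(real n)\<^sup>2 * M ^ (n - 2) * (A * (X + 1) * x ^ 3)\<^sup>2 \<le> L * (A * (X + 1))\<^sup>2 / n * (1 + K\<^sup>2) * ((1 + T ^ 6) * G)"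
  proof -
    have "(real n)\<^sup>2 * M ^ (n - 2) * (A * (X + 1) * x ^ 3)\<^sup>2 \<le> (real n)\<^sup>2 * (L * G) * (A * (X + 1) * x ^ 3)\<^sup>2"
      using pow(2) unfolding Mn G_def by (intro mult_right_mono mult_left_mono) auto
    also have "\<dots> = L * (A * (X + 1))\<^sup>2 / n * (1 * (T ^ 6 * G))"
      unfolding power_mult_distrib[of _ "x ^ 3"] x6 using n0 by (simp add: power2_eq_square power3_eq_cube)
    also have "\<dots> \<le> L * (A * (X + 1))\<^sup>2 / n * ((1 + K\<^sup>2) * ((1 + T ^ 6) * G))"
      using L1 n0 T G by (intro mult_left_mono mult_mono) auto
    finally show ?thesis by (simp add: mult_ac)
  qed
  have t2: "real n * M ^ (n - 1) * (A * x ^ 4 + A * x ^ 3 * \<bar>\<beta>\<bar>) \<le> L * (4 * A) / n * (1 + K\<^sup>2) * ((1 + T ^ 6) * G)"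
  proof -
    have "A * x ^ 3 * \<bar>\<beta>\<bar> \<le> A * x ^ 3 * (x * K)" using A x(2) \<beta> by (intro mult_left_mono) auto
    also have "\<dots> = A * x ^ 4 * K" by (simp add: eval_nat_numeral)
    finally have "A * x ^ 4 + A * x ^ 3 * \<bar>\<beta>\<bar> \<le> A * x ^ 4 * (1 + K)" by (simp add: algebra_simps)
    then have "real n * M ^ (n - 1) * (A * x ^ 4 + A * x ^ 3 * \<bar>\<beta>\<bar>) \<le> real n * (L * G) * (A * x ^ 4 * (1 + K))"
      using pow(1) A x(2) \<beta> n0 L1 G M0 unfolding Mn G_def by (intro mult_mono) (auto intro!: add_nonneg_nonneg mult_nonneg_nonneg)
    also have "\<dots> = L * A / n * ((1 + K) * (T ^ 4 * G))"
      unfolding x4 using n0 by (simp add: power2_eq_square)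
    also have "\<dots> \<le> L * A / n * ((2 * (1 + K\<^sup>2)) * ((1 + T ^ 6) * G))"
      using L1 n0 T G A K K1 T24 by (intro mult_left_mono mult_mono) auto
    also have "\<dots> \<le> L * (4 * A) / n * (1 + K\<^sup>2) * ((1 + T ^ 6) * G)"
    proof -
      have "0 \<le> L * A / n * ((1 + K\<^sup>2) * ((1 + T ^ 6) * G))" using L1 A n0 T6 G by (intro mult_nonneg_nonneg divide_nonneg_pos) auto
      then have "L * A / n * (2 * P * Z) \<le> L * (4 * A) / n * P * Z" if "P = 1 + K\<^sup>2" "Z = (1 + T ^ 6) * G" for P Z
      proof -
        have e: "L * A / n * (2 * P * Z) = 2 * (L * A / n * (P * Z))" "L * (4 * A) / n * P * Z = 4 * (L * A / n * (P * Z))"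
          by simp_all
        have "2 * q \<le> 4 * q" if "0 \<le> q" for q :: real using that by simp
        moreover have "0 \<le> L * A / n * (P * Z)"
          using \<open>0 \<le> L * A / n * ((1 + K\<^sup>2) * ((1 + T ^ 6) * G))\<close> unfolding that .
        ultimately show ?thesis unfolding e by blast
      qed
      then show ?thesis by blast
    qed
    finally show ?thesis .
  qed
  have t3: "M ^ n * \<beta>\<^sup>2 \<le> 2 / n * (1 + K\<^sup>2) * ((1 + T ^ 6) * G)"
  proof -
    have "\<beta>\<^sup>2 \<le> (x * K)\<^sup>2" using power_mono[OF \<beta>, of 2] by simp
    then have "M ^ n * \<beta>\<^sup>2 \<le> G * (x * K)\<^sup>2" unfolding Mn G_def by (intro mult_left_mono) auto
    also have "\<dots> = 1 / n * (K\<^sup>2 * (T\<^sup>2 * G))" by (simp add: power_mult_distrib x2)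
    also have "\<dots> \<le> 2 / n * ((1 + K\<^sup>2) * ((1 + T ^ 6) * G))"
      using n0 T24 G T6 by (intro mult_mono) (auto intro!: divide_right_mono)
    finally show ?thesis by (simp only: mult.assoc)
  qed
  have "(L * ((A * (X + 1))\<^sup>2 + 4 * A) + 2) / n * (1 + K\<^sup>2) * ((1 + T ^ 6) * G) =
      L * (A * (X + 1))\<^sup>2 / n * (1 + K\<^sup>2) * ((1 + T ^ 6) * G) + L * (4 * A) / n * (1 + K\<^sup>2) * ((1 + T ^ 6) * G) +
      2 / n * (1 + K\<^sup>2) * ((1 + T ^ 6) * G)"
    by (simp add: add_divide_distrib distrib_left distrib_right)
  then show ?thesis using t1 t2 t3 unfolding L_def[symmetric] G_def[symmetric] by linarith
qed

text \<open>The constant depends on \<open>d\<close> alone, which keeps \<open>y\<close> away from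
  the boundary of the simplex. The dependence on \<beta> is explicit and quadratic because all
  \<beta> over a cone will be summed with exponentially decaying weights.\<close>

theorem local_limit:
  assumes d: "d > 0"
  shows "\<exists>C\<ge>0. \<forall>n\<ge>1. \<forall>y \<beta>. (\<forall>i. d \<le> y $ i) \<longrightarrow> (\<Sum>i\<in>UNIV. y $ i) \<le> 1 - d \<longrightarrow> \<beta> \<in> int_vecs \<longrightarrow>
    \<bar>sqrt n ^ card J * ((2 * pi) ^ CARD('n) * coset_weight n y \<beta>) - gaussian y\<bar> \<le>
      C / n * (1 + (norm (dual (\<beta> - real n *\<^sub>R y)))\<^sup>2)"
proof -
  obtain \<Lambda> where \<Lambda>: "\<Lambda> > 0" "\<And>t. norm (comb t) \<le> \<Lambda> * norm (prj t)" using comb_upper by blast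
  obtain l where l: "l > 0" "\<And>t. l * norm (prj t) \<le> norm (comb t)" using comb_lower by blast
  obtain c2 where c2: "c2 > 0" "\<And>t. t \<in> fbox \<Longrightarrow> c2 * (norm (prj t))\<^sup>2 \<le> (\<Sum>i\<in>UNIV. 1 - cos (comb t $ i))"
    using cos_sum_lower by blast
  define m where "m = real CARD('n)"
  have m: "m > 0" by (simp add: m_def)
  \<comment> \<open>One rate for both sides of the comparison: the first entry bounds the
    characteristic function on the whole box, the second comes from the lower bound of the variance
    and bounds the Gaussian.\<close>
  define c where "c = min (d\<^sup>2 * c2 / m) (d\<^sup>2 * l\<^sup>2 / 2)"
  have c: "c > 0" using d c2 l m by (simp add: c_def)
  have cle: "c * u \<le> d\<^sup>2 * c2 / m * u" "c * u \<le> d\<^sup>2 * l\<^sup>2 / 2 * u" if "u \<ge> 0" for u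
    unfolding c_def using that by (intro mult_right_mono min.cobounded1 min.cobounded2; simp)+
  define X where "X = m * pi"
  define A where "A = 2 * (\<Lambda> ^ 4 + \<Lambda> ^ 3)"
  have A: "A \<ge> 0" using \<Lambda>(1) by (simp add: A_def)
  define C1 where "C1 = exp (2 * c * X\<^sup>2) * ((A * (X + 1))\<^sup>2 + 4 * A) + 2"
  have C1: "C1 \<ge> 1" using A by (simp add: C1_def add_increasing)
  define C2 where "C2 = C1 * (1 + 216 / c ^ 3)"
  define I where "I = (\<integral>t. indicator (slab J) t * exp (- (c / 2 * (norm (prj t))\<^sup>2)) \<partial>lborel)"
  have I: "I \<ge> 0" unfolding I_def by (intro integral_nonneg_AE AE_I2) simp
  have C2: "C2 \<ge> 0" using C1 c by (simp add: C2_def)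
  show ?thesis
  proof (intro exI[of _ "C2 * I"] conjI allI impI)
    show "C2 * I \<ge> 0" using C2 I by simp
    fix n :: nat and y \<beta> :: "real ^ 'n"
    assume n: "n \<ge> 1" and y: "\<forall>i. d \<le> y $ i" "(\<Sum>i\<in>UNIV. y $ i) \<le> 1 - d" and \<beta>: "\<beta> \<in> int_vecs"
    have n0: "real n > 0" and sn: "sqrt n > 0" using n by simp_all
    have y0: "0 \<le> y $ i" for i using d y(1) by (meson less_imp_le order_trans)
    have y1: "(\<Sum>i\<in>UNIV. y $ i) \<le> 1" using y(2) d by linarith
    define a where "a = \<beta> - real n *\<^sub>R y"
    define K where "K = norm (dual a)"
    define D where "D t = (\<chi> j. (if j \<in> J then 1 / sqrt n else 1) * t $ j)" for t :: "real ^ 'n"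
    define F where "F t = indicator fbox (D t) * Re (charfun y ((1 / sqrt n) *\<^sub>R comb t) ^ n * cis (- (((1 / sqrt n) *\<^sub>R comb t) \<bullet> a)))" for t
    define G where "G t = indicator (slab J) t * exp (- (variance y (comb t) / 2))" for t
    define H where "H t = C2 / n * (1 + K\<^sup>2) * (indicator (slab J) t * exp (- (c / 2 * (norm (prj t))\<^sup>2)))" for t
    have combD: "comb (D t) = (1 / sqrt n) *\<^sub>R comb t" for t
      unfolding comb_def scaleR_sum_right by (rule sum.cong) (auto simp: D_def J_def)
    have prjD: "prj (D t) = (1 / sqrt n) *\<^sub>R prj t" for t
      by (auto simp: D_def proj_coords_def vec_eq_iff)
    have var_lower: "exp (- (variance y (comb t) / 2)) \<le> exp (- (c * (norm (prj t))\<^sup>2))" for t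
    proof -
      have "c * (norm (prj t))\<^sup>2 \<le> d\<^sup>2 * (l * norm (prj t))\<^sup>2 / 2" using cle(2)[of "(norm (prj t))\<^sup>2"] by (simp add: power_mult_distrib)
      also have "\<dots> \<le> d\<^sup>2 * (norm (comb t))\<^sup>2 / 2"
        using l by (intro divide_right_mono mult_left_mono power_mono) auto
      also have "\<dots> \<le> variance y (comb t) / 2" using variance_bounds(1)[OF d, of y "comb t"] y by simp
      finally show ?thesis by simp
    qed
    have main: "\<bar>F t - G t\<bar> \<le> H t" for t
    proof -
      define T where "T = norm (prj t)"
      have T: "T \<ge> 0" by (simp add: T_def)
      consider "t \<notin> slab J" | "t \<in> slab J" "D t \<notin> fbox" | "D t \<in> fbox" by blast
      then show ?thesis
      proof cases
        case 1
        then have "D t \<notin> fbox" by (auto simp: slab_def fbox_def D_def)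
        then show ?thesis using 1 by (simp add: F_def G_def H_def)
      next
        \<comment> \<open>The Fourier integrand is 0 here, and the Gaussian must be small by itself:
          a rescaled coordinate exceeds \<open>pi\<close>, so \<open>T \<ge> sqrt n\<close>, and the
          factor \<open>(1 + T ^ 6) / n\<close>, being at least one, may be inserted.\<close>
        case 2
        from 2(2) obtain j where "\<not> \<bar>D t $ j\<bar> \<le> pi" unfolding fbox_def by blast
        moreover have "j \<in> J" using calculation 2(1) by (cases "j \<in> J") (auto simp: slab_def D_def)
        ultimately have j: "j \<in> J" "\<bar>t $ j / sqrt n\<bar> > pi" by (simp_all add: D_def)
        have "sqrt n * 1 \<le> sqrt n * pi" using sn pi_gt3 by (intro mult_left_mono) auto
        also have "\<dots> \<le> \<bar>t $ j\<bar>" using j(2) sn by (simp add: abs_divide field_simps)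
        also have "\<dots> = \<bar>prj t $ j\<bar>" using j(1) by (simp add: proj_coords_def)
        also have "\<dots> \<le> T" unfolding T_def by (rule component_le_norm_cart)
        finally have "sqrt n \<le> T" by simp
        then have "(sqrt n)\<^sup>2 \<le> T\<^sup>2" by (intro power_mono) auto
        then have nT: "1 \<le> (1 + T\<^sup>2) / n" using n0 by simp
        have "1 \<le> sqrt n" using n by simp
        then have T1: "1 \<le> T" using \<open>sqrt n \<le> T\<close> by linarith
        have "T\<^sup>2 \<le> T ^ 6" by (rule power_increasing[OF _ T1]) simp
        then have "(1 + T\<^sup>2) / n \<le> (1 + T ^ 6) / n" using n0 by (intro divide_right_mono) auto
        then have nT6: "1 \<le> (1 + T ^ 6) / n" using nT by linarith
        have "\<bar>F t - G t\<bar> = exp (- (variance y (comb t) / 2))" using 2 by (simp add: F_def G_def)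
        also have "\<dots> \<le> exp (- (c * T\<^sup>2))" unfolding T_def by (rule var_lower)
        also have "\<dots> \<le> (1 + T ^ 6) / n * exp (- (c * T\<^sup>2))"
          using mult_right_mono[OF nT6, of "exp (- (c * T\<^sup>2))"] by (simp only: mult_1_left exp_ge_zero simp_thms)
        also have "\<dots> = 1 / n * ((1 + T ^ 6) * exp (- (c * T\<^sup>2)))" by simp
        also have "\<dots> \<le> 1 / n * ((1 + 216 / c ^ 3) * exp (- (c / 2 * T\<^sup>2)))"
          using poly_times_gaussian_le[OF c] n0 by (intro mult_left_mono) auto
        also have "\<dots> \<le> C1 / n * ((1 + 216 / c ^ 3) * exp (- (c / 2 * T\<^sup>2)))"
          using C1 n0 c by (intro mult_right_mono divide_right_mono) auto
        also have "\<dots> \<le> C1 / n * ((1 + 216 / c ^ 3) * exp (- (c / 2 * T\<^sup>2))) * (1 + K\<^sup>2)"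
        proof -
          have "0 \<le> C1 / n * ((1 + 216 / c ^ 3) * exp (- (c / 2 * T\<^sup>2)))" using C1 n0 c by simp
          from mult_left_mono[OF _ this, of 1 "1 + K\<^sup>2"] show ?thesis by simp
        qed
        finally show ?thesis using 2 by (simp add: H_def C2_def T_def mult_ac)
      next
        case 3
        have "\<bar>t $ j\<bar> \<le> pi" if "j \<notin> J" for j
        proof -
          have "\<bar>D t $ j\<bar> \<le> pi" using 3 by (simp add: fbox_def)
          then show ?thesis using that by (simp add: D_def)
        qed
        then have tslab: "t \<in> slab J" by (simp add: slab_def)
        define x where "x = norm (prj (D t))"
        have x: "x = T / sqrt n" using sn by (simp add: x_def prjD T_def)
        have xX: "0 \<le> x" "x \<le> X" using norm_prj_fbox[OF 3] by (simp_all add: x_def X_def m_def)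
        define \<xi> where "\<xi> = comb (D t)"
        have \<xi>: "norm \<xi> \<le> \<Lambda> * x" unfolding \<xi>_def x_def by (rule \<Lambda>(2))
        define M where "M = exp (- (c * x\<^sup>2))"
        define E where "E = exp (- (variance y \<xi> / 2))"
        define bt where "bt = \<xi> \<bullet> a"
        \<comment> \<open>Averaging the bounds over all coordinates produces the sum of cosines that
          \<open>cos_sum_lower\<close> controls.\<close>
        have chi: "norm (charfun y \<xi>) \<le> M"
        proof -
          have "(\<Sum>i\<in>(UNIV :: 'n set). norm (charfun y \<xi>)) \<le> (\<Sum>i\<in>UNIV. 1 - d\<^sup>2 * (1 - cos (\<xi> $ i)))"
            using y by (intro sum_mono norm_charfun_le[OF d]) auto
          also have "\<dots> = (\<Sum>i\<in>(UNIV :: 'n set). 1) - d\<^sup>2 * (\<Sum>i\<in>UNIV. 1 - cos (\<xi> $ i))"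
            by (subst sum_subtractf) (simp only: sum_distrib_left)
          finally have "m * norm (charfun y \<xi>) \<le> m - d\<^sup>2 * (\<Sum>i\<in>UNIV. 1 - cos (\<xi> $ i))"
            by (simp add: m_def)
          also have "\<dots> \<le> m - d\<^sup>2 * (c2 * x\<^sup>2)"
            using c2(2)[OF 3] by (simp add: \<xi>_def x_def mult_left_mono)
          finally have "norm (charfun y \<xi>) \<le> 1 - d\<^sup>2 * c2 / m * x\<^sup>2" using m by (simp add: field_simps)
          also have "\<dots> \<le> 1 - c * x\<^sup>2" using cle(1)[of "x\<^sup>2"] by simp
          also have "\<dots> \<le> M" using exp_ge_add_one_self[of "- (c * x\<^sup>2)"] by (simp add: M_def)
          finally show ?thesis .
        qed
        have EM: "0 \<le> E" "E \<le> M" unfolding E_def M_def \<xi>_def x_def using var_lower[of "D t"] by auto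
        have p4: "norm \<xi> ^ 4 \<le> \<Lambda> ^ 4 * x ^ 4" and p3: "norm \<xi> ^ 3 \<le> \<Lambda> ^ 3 * x ^ 3"
          using power_mono[OF \<xi>, of 4] power_mono[OF \<xi>, of 3] by (simp_all add: power_mult_distrib)
        have v: "0 \<le> variance y \<xi>" "variance y \<xi> \<le> (norm \<xi>)\<^sup>2"
        proof -
          have "0 \<le> d\<^sup>2 * (norm \<xi>)\<^sup>2" by simp
          then show "0 \<le> variance y \<xi>" using variance_bounds(1)[OF d, of y \<xi>] y by (meson order_trans)
          show "variance y \<xi> \<le> (norm \<xi>)\<^sup>2" using variance_bounds(2)[OF d, of y \<xi>] y by blast
        qed
        have re: "\<bar>Re (charfun y \<xi>) - E\<bar> \<le> A * x ^ 4"
        proof -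
          have "\<bar>E - (1 - variance y \<xi> / 2)\<bar> \<le> (variance y \<xi> / 2)\<^sup>2 / 2"
            unfolding E_def using v by (intro exp_minus_taylor2) simp
          also have "\<dots> \<le> ((norm \<xi>)\<^sup>2)\<^sup>2"
          proof -
            have "(variance y \<xi>)\<^sup>2 \<le> ((norm \<xi>)\<^sup>2)\<^sup>2" using v by (intro power_mono) auto
            moreover have "(variance y \<xi> / 2)\<^sup>2 / 2 \<le> (variance y \<xi>)\<^sup>2" by (simp add: power_divide)
            ultimately show ?thesis by linarith
          qed
          finally have "\<bar>E - (1 - variance y \<xi> / 2)\<bar> \<le> norm \<xi> ^ 4" by simp
          then have "\<bar>Re (charfun y \<xi>) - E\<bar> \<le> 2 * norm \<xi> ^ 4" using charfun_expansion(1)[OF y0 y1, of \<xi>] by linarith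
          also have "\<dots> \<le> 2 * (\<Lambda> ^ 4 * x ^ 4)" using p4 by simp
          also have "\<dots> \<le> A * x ^ 4" unfolding A_def using \<Lambda>(1) xX by (simp add: algebra_simps)
          finally show ?thesis .
        qed
        have im: "\<bar>Im (charfun y \<xi>)\<bar> \<le> A * x ^ 3"
        proof -
          have "\<bar>Im (charfun y \<xi>)\<bar> \<le> 2 * (\<Lambda> ^ 3 * x ^ 3)" using charfun_expansion(2)[OF y0 y1, of \<xi>] p3 by linarith
          also have "\<dots> \<le> A * x ^ 3" unfolding A_def using \<Lambda>(1) xX by (simp add: algebra_simps)
          finally show ?thesis .
        qed
        have bt: "\<bar>bt\<bar> \<le> x * K"
          unfolding bt_def \<xi>_def comb_inner x_def K_def by (subst prj_inner_dual) (rule Cauchy_Schwarz_ineq2)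
        have Fe: "F t = Re (charfun y \<xi> ^ n * cis (- bt))" using 3 by (simp add: F_def \<xi>_def combD bt_def)
        have Ge: "G t = E ^ n"
          using tslab n0 by (simp add: G_def E_def \<xi>_def combD variance_scaleR power_one_over power_divide exp_of_nat_mult[symmetric])
        have "\<bar>F t - G t\<bar> \<le> (real n)\<^sup>2 * M ^ (n - 2) * (A * (X + 1) * x ^ 3)\<^sup>2 +
            real n * M ^ (n - 1) * (A * x ^ 4 + A * x ^ 3 * \<bar>bt\<bar>) + M ^ n * bt\<^sup>2"
          unfolding Fe Ge by (rule rotated_power_estimate[OF chi EM re im xX A])
        also have "\<dots> \<le> C1 / n * (1 + K\<^sup>2) * ((1 + T ^ 6) * exp (- (c * T\<^sup>2)))"
          unfolding C1_def by (rule estimate_terms[OF n x xX M_def c A _ bt]) (simp add: K_def)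
        also have "\<dots> \<le> C1 / n * (1 + K\<^sup>2) * ((1 + 216 / c ^ 3) * exp (- (c / 2 * T\<^sup>2)))"
          using C1 n0 by (intro mult_left_mono poly_times_gaussian_le[OF c] mult_nonneg_nonneg) auto
        also have "\<dots> = H t" using tslab by (simp add: H_def C2_def T_def)
        finally show ?thesis .
      qed
    qed
    have Hi: "integrable lborel H" unfolding H_def
      using c by (intro integrable_mult_right integrable_slab_gaussian) simp
    have cc: "continuous_on UNIV comb" using linear_comb linear_continuous_on linear_conv_bounded_linear by blast
    have Gm: "G \<in> borel_measurable lborel"
    proof -
      have "continuous_on UNIV (\<lambda>t. exp (- (variance y (comb t) / 2)))" unfolding variance_def using cc
        by (intro continuous_intros) auto
      then show ?thesis unfolding G_def using borel_closed[OF closed_slab]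
        by (simp, intro borel_measurable_times borel_measurable_indicator borel_measurable_continuous_onI)
    qed
    have Fm: "F \<in> borel_measurable lborel"
    proof -
      have "continuous_on UNIV D" unfolding D_def by (intro continuous_on_vec_lambda continuous_intros)
      then have "D \<in> borel_measurable borel" by (rule borel_measurable_continuous_onI)
      then have "(\<lambda>t. indicator fbox (D t) * Re (charfun y (comb (D t)) ^ n * cis (- (comb (D t) \<bullet> a)))) \<in> borel_measurable borel"
        by (rule measurable_compose) (intro borel_measurable_times borel_measurable_indicator fbox_sets
            borel_measurable_continuous_onI[OF continuous_charfun_comb])
      then show ?thesis unfolding F_def combD by simp
    qed
    have Gi: "integrable lborel G"
    proof (rule Bochner_Integration.integrable_bound[OF integrable_slab_gaussian[OF c] Gm])
      show "AE t in lborel. norm (G t) \<le> norm (indicator (slab J) t * exp (- (c * (norm (prj t))\<^sup>2)))"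
        using var_lower by (intro AE_I2) (simp add: G_def indicator_def)
    qed
    have FGi: "integrable lborel (\<lambda>t. F t - G t)"
      by (rule Bochner_Integration.integrable_bound[OF Hi])
        (use Fm Gm main in \<open>auto intro!: AE_I2 order_trans[OF _ abs_ge_self]\<close>)
    have Fi: "integrable lborel F"
      using Bochner_Integration.integrable_add[OF FGi Gi] by simp
    have "\<bar>(\<integral>t. F t \<partial>lborel) - (\<integral>t. G t \<partial>lborel)\<bar> = \<bar>\<integral>t. F t - G t \<partial>lborel\<bar>"
      using Fi Gi by simp
    also have "\<dots> \<le> (\<integral>t. H t \<partial>lborel)"
      using Bochner_Integration.integral_norm_bound_integral[OF FGi Hi] main by simp
    also have "\<dots> = C2 / n * (1 + K\<^sup>2) * I" unfolding H_def I_def by (rule integral_mult_right_zero)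
    finally show "\<bar>sqrt n ^ card J * ((2 * pi) ^ CARD('n) * coset_weight n y \<beta>) - gaussian y\<bar> \<le>
        C2 * I / n * (1 + (norm (dual (\<beta> - real n *\<^sub>R y)))\<^sup>2)"
      unfolding coset_weight_scaled[OF \<beta> n] gaussian_def F_def G_def D_def K_def a_def by (simp add: mult_ac)
  qed
qed

end

section \<open>Laplace transforms\<close>

lemma power_times_exp_bound: "(x::real) \<ge> 0 \<Longrightarrow> \<epsilon> > 0 \<Longrightarrow> x ^ k \<le> (real k / \<epsilon>) ^ k * exp (\<epsilon> * x)"
proof (cases "k = 0")
  case False
  assume x: "x \<ge> 0" and e: "\<epsilon> > 0"
  have "\<epsilon> * x / k \<le> exp (\<epsilon> * x / k)" using exp_ge_add_one_self[of "\<epsilon> * x / k"] by linarith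
  then have "(\<epsilon> * x / k) ^ k \<le> exp (\<epsilon> * x / k) ^ k" using x e by (intro power_mono) auto
  also have "\<dots> = exp (\<epsilon> * x)" using False by (simp add: exp_of_nat_mult[symmetric])
  finally have "(real k / \<epsilon>) ^ k * (\<epsilon> * x / k) ^ k \<le> (real k / \<epsilon>) ^ k * exp (\<epsilon> * x)"
    using e by (intro mult_left_mono) auto
  also have "(real k / \<epsilon>) ^ k * (\<epsilon> * x / k) ^ k = x ^ k"
    using e False by (simp add: power_mult_distrib[symmetric])
  finally show ?thesis .
qed simp

text \<open>Some coordinate carries at least the fraction \<open>1 / DIM('a)\<close> of the norm, so
  the exponential of the norm is dominated by finitely many exponentials of linear
  functionals.\<close>

lemma exp_norm_le_sum_Basis:
  fixes x :: "'a::euclidean_space"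
  assumes "\<epsilon> \<ge> 0"
  shows "exp (\<epsilon> * norm x) \<le> (\<Sum>s\<in>{-1, 1}. \<Sum>b\<in>Basis. exp (real DIM('a) * \<epsilon> * s * (b \<bullet> x)))"
proof -
  obtain b where b: "b \<in> Basis" "norm x \<le> DIM('a) * \<bar>b \<bullet> x\<bar>"
  proof -
    have "\<exists>b\<in>Basis. norm x \<le> DIM('a) * \<bar>b \<bullet> x\<bar>"
    proof (rule ccontr)
      assume "\<not> ?thesis"
      then have "(\<Sum>b\<in>(Basis :: 'a set). DIM('a) * \<bar>b \<bullet> x\<bar>) < (\<Sum>b\<in>(Basis :: 'a set). norm x)"
        by (intro sum_strict_mono) (auto simp: not_le)
      then have "DIM('a) * (\<Sum>b\<in>Basis. \<bar>x \<bullet> b\<bar>) < DIM('a) * norm x"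
        by (simp add: sum_distrib_left inner_commute)
      then show False using norm_le_l1[of x] by (simp add: mult_less_cancel_left)
    qed
    then show ?thesis using that by blast
  qed
  define s :: real where "s = (if b \<bullet> x \<ge> 0 then 1 else -1)"
  have "\<epsilon> * norm x \<le> \<epsilon> * (DIM('a) * \<bar>b \<bullet> x\<bar>)" using b assms by (intro mult_left_mono)
  also have "\<dots> = real DIM('a) * \<epsilon> * s * (b \<bullet> x)" by (simp add: s_def)
  finally have "exp (\<epsilon> * norm x) \<le> exp (real DIM('a) * \<epsilon> * s * (b \<bullet> x))" by simp
  also have "\<dots> \<le> (\<Sum>b\<in>Basis. exp (real DIM('a) * \<epsilon> * s * (b \<bullet> x)))"
    using b(1) by (intro member_le_sum[of b Basis "\<lambda>b. exp (real DIM('a) * \<epsilon> * s * (b \<bullet> x))"]) auto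
  also have "\<dots> \<le> (\<Sum>s\<in>{-1, 1}. \<Sum>b\<in>Basis. exp (real DIM('a) * \<epsilon> * s * (b \<bullet> x)))"
    by (intro member_le_sum[of s "{-1, 1}" "\<lambda>s. \<Sum>b\<in>Basis. exp (real DIM('a) * \<epsilon> * s * (b \<bullet> x))"])
      (auto simp: s_def sum_nonneg)
  finally show ?thesis .
qed

text \<open>
  Near a point of \<open>W\<close> every polynomial factor is absorbed by the exponentials at finitely many
  neighbouring points, which gives the dominating function for differentiation under the
  integral sign.
\<close>

lemma laplace_dominated:
  fixes T :: "'m \<Rightarrow> 'a::euclidean_space"
  assumes W: "open W" "w \<in> W" and T: "T \<in> borel_measurable M" and g: "g \<in> borel_measurable M"
    and int: "\<And>w. w \<in> W \<Longrightarrow> integrable M (\<lambda>x. \<bar>g x\<bar> * exp (w \<bullet> T x) :: real)"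
  shows "\<exists>e>0. \<forall>k. integrable M (\<lambda>x. \<bar>g x\<bar> * norm (T x) ^ k * exp (w \<bullet> T x + e * norm (T x)))"
proof -
  obtain r where r: "r > 0" "cball w r \<subseteq> W" using W open_contains_cball by blast
  \<comment> \<open>The dimension comes from \<open>exp_norm_le_sum_Basis\<close>; the factor 2
    leaves one copy of \<open>exp (e * norm (T x))\<close> to absorb the power and one to remain in
    the bound.\<close>
  define e where "e = r / (2 * DIM('a))"
  have e: "e > 0" using r by (simp add: e_def)
  define D where "D x = (\<Sum>s\<in>{-1, 1}. \<Sum>b\<in>(Basis :: 'a set). \<bar>g x\<bar> * exp ((w + (r * s) *\<^sub>R b) \<bullet> T x))" for x
  have D: "integrable M D" unfolding D_def
  proof (intro Bochner_Integration.integrable_sum int subsetD[OF r(2)])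
    fix s :: real and b :: 'a assume "s \<in> {-1, 1}" "b \<in> Basis"
    then show "w + (r * s) *\<^sub>R b \<in> cball w r" using r(1) by (auto simp: dist_norm)
  qed
  have Deq: "D x = \<bar>g x\<bar> * exp (w \<bullet> T x) * (\<Sum>s\<in>{-1, 1}. \<Sum>b\<in>Basis. exp (real DIM('a) * (2 * e) * s * (b \<bullet> T x)))" for x
    unfolding D_def sum_distrib_left by (intro sum.cong refl) (simp add: e_def inner_add_left exp_add mult_ac)
  show ?thesis
  proof (intro exI[of _ e] conjI allI e)
    fix k
    show "integrable M (\<lambda>x. \<bar>g x\<bar> * norm (T x) ^ k * exp (w \<bullet> T x + e * norm (T x)))"
    proof (rule Bochner_Integration.integrable_bound[OF integrable_mult_right[OF D, of "(real k / e) ^ k"]])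
      show "(\<lambda>x. \<bar>g x\<bar> * norm (T x) ^ k * exp (w \<bullet> T x + e * norm (T x))) \<in> borel_measurable M"
        using T g by measurable
      show "AE x in M. norm (\<bar>g x\<bar> * norm (T x) ^ k * exp (w \<bullet> T x + e * norm (T x))) \<le> norm ((real k / e) ^ k * D x)"
      proof (rule AE_I2)
        fix x
        have "norm (T x) ^ k * exp (e * norm (T x)) \<le> (real k / e) ^ k * exp (e * norm (T x)) * exp (e * norm (T x))"
          using e by (intro mult_right_mono power_times_exp_bound) auto
        also have "\<dots> = (real k / e) ^ k * exp (2 * e * norm (T x))" by (simp add: exp_add[symmetric] mult.assoc)
        also have "\<dots> \<le> (real k / e) ^ k * (\<Sum>s\<in>{-1, 1}. \<Sum>b\<in>Basis. exp (real DIM('a) * (2 * e) * s * (b \<bullet> T x)))"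
          using e by (intro mult_left_mono exp_norm_le_sum_Basis) auto
        finally have "\<bar>g x\<bar> * exp (w \<bullet> T x) * (norm (T x) ^ k * exp (e * norm (T x))) \<le>
            \<bar>g x\<bar> * exp (w \<bullet> T x) * ((real k / e) ^ k * (\<Sum>s\<in>{-1, 1}. \<Sum>b\<in>Basis. exp (real DIM('a) * (2 * e) * s * (b \<bullet> T x))))"
          by (intro mult_left_mono) auto
        then have "\<bar>g x\<bar> * norm (T x) ^ k * exp (w \<bullet> T x + e * norm (T x)) \<le> (real k / e) ^ k * D x"
          unfolding Deq exp_add by (simp only: mult_ac)
        moreover have "0 \<le> \<bar>g x\<bar> * norm (T x) ^ k * exp (w \<bullet> T x + e * norm (T x))" by simp
        ultimately show "norm (\<bar>g x\<bar> * norm (T x) ^ k * exp (w \<bullet> T x + e * norm (T x))) \<le> norm ((real k / e) ^ k * D x)"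
          unfolding real_norm_def by linarith
      qed
    qed
  qed
qed

lemma exp_second_order: "\<bar>exp u - 1 - u\<bar> \<le> u\<^sup>2 * exp \<bar>u::real\<bar>"
proof -
  obtain t where t: "\<bar>t\<bar> \<le> \<bar>u\<bar>" "exp u = (\<Sum>m<2. u ^ m / fact m) + exp t / fact 2 * u ^ 2"
    using Maclaurin_exp_le[of u 2] by blast
  then have "exp u - 1 - u = exp t / 2 * u\<^sup>2" by (simp add: numeral_2_eq_2)
  also have "\<bar>exp t / 2 * u\<^sup>2\<bar> \<le> exp \<bar>u\<bar> * u\<^sup>2"
  proof -
    have "exp t \<le> exp \<bar>u\<bar>" using t(1) by simp
    then have "exp t / 2 * u\<^sup>2 \<le> exp \<bar>u\<bar> * u\<^sup>2"
      using exp_gt_zero[of t] by (intro mult_right_mono) (linarith, simp)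
    then show ?thesis by (simp add: abs_mult)
  qed
  finally show ?thesis by (simp add: mult.commute)
qed

text \<open>The second-order remainder of the exponential is at most
  \<open>(norm (y - w))\<^sup>2\<close> times an integrand with finite integral \<open>K\<close>.
  The second conclusion restores the integrability hypothesis for the differentiated
  integrand.\<close>

lemma laplace_has_derivative:
  fixes T :: "'m \<Rightarrow> 'a::euclidean_space"
  assumes W: "open W" "w \<in> W" and T: "T \<in> borel_measurable M" and g: "g \<in> borel_measurable M"
    and int: "\<And>w. w \<in> W \<Longrightarrow> integrable M (\<lambda>x. \<bar>g x\<bar> * exp (w \<bullet> T x) :: real)"
  shows "((\<lambda>w. \<integral>x. g x * exp (w \<bullet> T x) \<partial>M) has_derivative (\<lambda>v. \<integral>x. (v \<bullet> T x) * g x * exp (w \<bullet> T x) \<partial>M)) (at w)"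
    and "integrable M (\<lambda>x. \<bar>(v \<bullet> T x) * g x\<bar> * exp (w \<bullet> T x))"
proof -
  obtain e where e: "e > 0" and dom: "\<And>k. integrable M (\<lambda>x. \<bar>g x\<bar> * norm (T x) ^ k * exp (w \<bullet> T x + e * norm (T x)))"
    using laplace_dominated[OF W T g int] by blast
  have absint: "integrable M (\<lambda>x. \<bar>(v \<bullet> T x) * g x\<bar> * exp (w \<bullet> T x))" for v
  proof (rule Bochner_Integration.integrable_bound[OF integrable_mult_right[OF dom[of 1], of "norm v"]])
    show "(\<lambda>x. \<bar>(v \<bullet> T x) * g x\<bar> * exp (w \<bullet> T x)) \<in> borel_measurable M" using T g by measurable
    show "AE x in M. norm (\<bar>(v \<bullet> T x) * g x\<bar> * exp (w \<bullet> T x)) \<le>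
        norm (norm v * (\<bar>g x\<bar> * norm (T x) ^ 1 * exp (w \<bullet> T x + e * norm (T x))))"
    proof (rule AE_I2)
      fix x
      have "\<bar>v \<bullet> T x\<bar> * \<bar>g x\<bar> * exp (w \<bullet> T x) \<le> (norm v * norm (T x)) * \<bar>g x\<bar> * exp (w \<bullet> T x + e * norm (T x))"
        using e by (intro mult_mono Cauchy_Schwarz_ineq2) auto
      then show "norm (\<bar>(v \<bullet> T x) * g x\<bar> * exp (w \<bullet> T x)) \<le>
        norm (norm v * (\<bar>g x\<bar> * norm (T x) ^ 1 * exp (w \<bullet> T x + e * norm (T x))))"
        by (simp add: abs_mult mult_ac)
    qed
  qed
  then show "integrable M (\<lambda>x. \<bar>(v \<bullet> T x) * g x\<bar> * exp (w \<bullet> T x))" .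
  have dint: "integrable M (\<lambda>x. (v \<bullet> T x) * g x * exp (w \<bullet> T x))" for v
    by (rule Bochner_Integration.integrable_bound[OF absint[of v]]) (use T g in \<open>measurable, auto simp: abs_mult\<close>)
  have fint: "integrable M (\<lambda>x. g x * exp (w \<bullet> T x))" if "w \<in> W" for w
    by (rule Bochner_Integration.integrable_bound[OF int[OF that]]) (use T g in \<open>measurable, auto simp: abs_mult\<close>)
  define K where "K = (\<integral>x. \<bar>g x\<bar> * norm (T x) ^ 2 * exp (w \<bullet> T x + e * norm (T x)) \<partial>M)"
  have K: "K \<ge> 0" unfolding K_def by (intro integral_nonneg_AE AE_I2) auto
  obtain r where r: "r > 0" "ball w r \<subseteq> W" using W open_contains_ball by blast
  define D where "D v = (\<integral>x. (v \<bullet> T x) * g x * exp (w \<bullet> T x) \<partial>M)" for v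
  have lin: "bounded_linear D"
  proof -
    have "linear D"
    proof (rule linearI)
      fix u v :: 'a and c :: real
      show "D (u + v) = D u + D v" unfolding D_def
        by (subst Bochner_Integration.integral_add[symmetric, OF dint dint]) (simp add: inner_add_left algebra_simps)
      show "D (c *\<^sub>R u) = c *\<^sub>R D u" unfolding D_def
        by (simp add: mult.assoc)
    qed
    then show ?thesis by (simp add: linear_conv_bounded_linear)
  qed
  have bound: "\<bar>(\<integral>x. g x * exp (y \<bullet> T x) \<partial>M) - (\<integral>x. g x * exp (w \<bullet> T x) \<partial>M) - D (y - w)\<bar> \<le> K * (norm (y - w))\<^sup>2"
    if y: "dist y w < min e r" for y
  proof -
    have yW: "y \<in> W" using y r by (auto simp: dist_commute)
    let ?h = "\<lambda>x. g x * exp (y \<bullet> T x) - g x * exp (w \<bullet> T x) - ((y - w) \<bullet> T x) * g x * exp (w \<bullet> T x)"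
    have hint: "integrable M ?h" by (intro Bochner_Integration.integrable_diff fint yW W(2) dint)
    have "(\<integral>x. g x * exp (y \<bullet> T x) \<partial>M) - (\<integral>x. g x * exp (w \<bullet> T x) \<partial>M) - D (y - w) = (\<integral>x. ?h x \<partial>M)"
      unfolding D_def using fint[OF yW] fint[OF W(2)] dint[of "y - w"] by simp
    also have "\<bar>\<integral>x. ?h x \<partial>M\<bar> \<le> (\<integral>x. (norm (y - w))\<^sup>2 * (\<bar>g x\<bar> * norm (T x) ^ 2 * exp (w \<bullet> T x + e * norm (T x))) \<partial>M)"
      unfolding real_norm_def[symmetric]
    proof (rule order_trans[OF Bochner_Integration.integral_norm_bound Bochner_Integration.integral_mono])
      show "integrable M (\<lambda>x. norm (?h x))" by (rule Bochner_Integration.integrable_norm[OF hint])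
      show "integrable M (\<lambda>x. (norm (y - w))\<^sup>2 * (norm (g x) * norm (T x) ^ 2 * exp (w \<bullet> T x + e * norm (T x))))"
        unfolding real_norm_def by (intro integrable_mult_right dom)
      fix x
      define u where "u = (y - w) \<bullet> T x"
      have u: "\<bar>u\<bar> \<le> norm (y - w) * norm (T x)" unfolding u_def by (rule Cauchy_Schwarz_ineq2)
      have "norm (y - w) * norm (T x) \<le> e * norm (T x)" using y by (intro mult_right_mono) (auto simp: dist_norm)
      then have ue: "\<bar>u\<bar> \<le> e * norm (T x)" using u by linarith
      have "?h x = g x * exp (w \<bullet> T x) * (exp u - 1 - u)"
        by (simp add: u_def inner_diff_left exp_diff algebra_simps)
      also have "\<bar>\<dots>\<bar> \<le> \<bar>g x\<bar> * exp (w \<bullet> T x) * (u\<^sup>2 * exp \<bar>u\<bar>)"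
        unfolding abs_mult by (intro mult_mono exp_second_order) auto
      also have "\<dots> \<le> \<bar>g x\<bar> * exp (w \<bullet> T x) * ((norm (y - w) * norm (T x))\<^sup>2 * exp (e * norm (T x)))"
        using power_mono[OF u, of 2] ue by (intro mult_left_mono mult_mono) auto
      finally show "norm (?h x) \<le> (norm (y - w))\<^sup>2 * (norm (g x) * norm (T x) ^ 2 * exp (w \<bullet> T x + e * norm (T x)))"
        by (simp only: exp_add power_mult_distrib mult_ac real_norm_def)
    qed
    also have "\<dots> = K * (norm (y - w))\<^sup>2" by (simp add: K_def)
    finally show ?thesis .
  qed
  show "((\<lambda>w. \<integral>x. g x * exp (w \<bullet> T x) \<partial>M) has_derivative (\<lambda>v. \<integral>x. (v \<bullet> T x) * g x * exp (w \<bullet> T x) \<partial>M)) (at w)"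
    unfolding D_def[symmetric]
  proof (rule has_derivativeI_sandwich[where e = "min e r" and H = "\<lambda>y. K * norm (y - w)"])
    show "0 < min e r" using e r by simp
    show "((\<lambda>y. K * norm (y - w)) \<longlongrightarrow> 0) (at w)"
      by (rule tendsto_eq_intros refl | simp)+
    fix y assume y: "y \<noteq> w" "dist y w < min e r"
    show "norm ((\<integral>x. g x * exp (y \<bullet> T x) \<partial>M) - (\<integral>x. g x * exp (w \<bullet> T x) \<partial>M) - D (y - w)) / norm (y - w) \<le> K * norm (y - w)"
      using bound[OF y(2)] y(1) by (simp add: divide_le_eq power2_eq_square mult.assoc)
  qed (rule lin)
qed

text \<open>Differentiation multiplies \<open>g\<close> by a linear function of \<open>T\<close>, so
  the same kind of integral returns and the induction runs over all \<open>g\<close>. The measure is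
  arbitrary: Lebesgue measure serves the Gaussian factor, counting measure the lattice sum.\<close>

theorem laplace_smooth:
  fixes T :: "'m \<Rightarrow> 'a::euclidean_space"
  assumes W: "open W" and T: "T \<in> borel_measurable M" and g: "g \<in> borel_measurable M"
    and int: "\<And>w. w \<in> W \<Longrightarrow> integrable M (\<lambda>x. \<bar>g x\<bar> * exp (w \<bullet> T x) :: real)"
  shows "smooth_on (\<lambda>w. \<integral>x. g x * exp (w \<bullet> T x) \<partial>M) W"
proof -
  have "Ck_on k (\<lambda>w. \<integral>x. g x * exp (w \<bullet> T x) \<partial>M) W" for k
    using g int
  proof (induction k arbitrary: g)
    case 0
    show ?case unfolding Ck_on.simps
    proof (rule continuous_at_imp_continuous_on, intro ballI)
      fix w assume "w \<in> W"
      from has_derivative_continuous[OF laplace_has_derivative(1)[OF W this T 0]]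
      show "isCont (\<lambda>w. \<integral>x. g x * exp (w \<bullet> T x) \<partial>M) w" .
    qed
  next
    case (Suc k)
    show ?case
    proof (rule Ck_on_SucI[OF W laplace_has_derivative(1)[OF W _ T Suc.prems]])
      fix v
      have m: "(\<lambda>x. (v \<bullet> T x) * g x) \<in> borel_measurable M" using T Suc.prems(1) by measurable
      have "Ck_on k (\<lambda>w. \<integral>x. (\<lambda>x. (v \<bullet> T x) * g x) x * exp (w \<bullet> T x) \<partial>M) W"
        by (rule Suc.IH[OF m]) (rule laplace_has_derivative(2)[OF W _ T Suc.prems])
      then show "Ck_on k (\<lambda>w. \<integral>x. (v \<bullet> T x) * g x * exp (w \<bullet> T x) \<partial>M) W" by simp
    qed
  qed
  then show ?thesis by (simp add: smooth_on_def)
qed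

section \<open>Faces and their regions\<close>

text \<open>
  The inverse of a smooth map is smooth as soon as it is continuous: its derivative is given by
  Cramer's rule in terms of the inverse itself, so the differentiability class bootstraps.
\<close>

lemma smooth_on_implicit_inverse:
  fixes x \<Phi> :: "real ^ 'n \<Rightarrow> real ^ 'n" and M :: "real ^ 'n \<Rightarrow> real ^ 'n ^ 'n"
  assumes S: "open S" and U: "open U" "x ` S \<subseteq> U" and cont: "continuous_on S x"
    and inv: "\<And>r. r \<in> S \<Longrightarrow> \<Phi> (x r) = r"
    and der: "\<And>w. w \<in> U \<Longrightarrow> (\<Phi> has_derivative (\<lambda>h. M w *v h)) (at w)"
    and det: "\<And>w. w \<in> U \<Longrightarrow> det (M w) \<noteq> 0"
    and M: "\<And>i j. smooth_on (\<lambda>w. M w $ i $ j) U"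
  shows "smooth_on (\<lambda>r. x r $ k) S"
proof -
  define G where "G v w = (\<chi> k. det (\<chi> i j. if j = k then v $ i else M w $ i $ j) / det (M w))" for v w
  have G: "M w *v h = v \<longleftrightarrow> h = G v w" if "w \<in> U" for w h v
    unfolding G_def by (rule cramer[OF det[OF that]])
  have smoothG: "smooth_on (\<lambda>w. G v w $ k) U" for v k
  proof -
    have "smooth_on (\<lambda>w. (if j = k then v $ i else M w $ i $ j)) U" for i j
      using M by (cases "j = k") (simp_all add: smooth_on_const)
    then have "smooth_on (\<lambda>w. det (\<chi> i j. if j = k then v $ i else M w $ i $ j)) U"
      by (intro smooth_on_det[OF U(1)]) simp
    moreover have "smooth_on (\<lambda>w. det (M w)) U" by (rule smooth_on_det[OF U(1) M])
    ultimately show ?thesis unfolding G_def using det by (simp add: smooth_on_divide[OF U(1)])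
  qed
  have dx: "(x has_derivative (\<lambda>v. G v (x r))) (at r)" if r: "r \<in> S" for r
  proof (rule has_derivative_inverse_basic[where f = \<Phi> and T = S, OF _ _ _ _ S r inv])
    have xU: "x r \<in> U" using U(2) r by blast
    show "(\<Phi> has_derivative (\<lambda>h. M (x r) *v h)) (at (x r))" by (rule der[OF xU])
    show "(\<lambda>v. G v (x r)) \<circ> (\<lambda>h. M (x r) *v h) = id"
    proof
      show "((\<lambda>v. G v (x r)) \<circ> (\<lambda>h. M (x r) *v h)) h = id h" for h
        using G[OF xU, of h "M (x r) *v h"] by simp
    qed
    have MG: "M (x r) *v G v (x r) = v" for v using G[OF xU] by blast
    have "linear (\<lambda>v. G v (x r))"
    proof (rule linearI)
      fix a b
      have "M (x r) *v (G a (x r) + G b (x r)) = a + b" by (simp add: matrix_vector_right_distrib MG)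
      then show "G (a + b) (x r) = G a (x r) + G b (x r)" using G[OF xU] by metis
    next
      fix s a
      have "M (x r) *v (s *\<^sub>R G a (x r)) = s *\<^sub>R a" by (simp add: vector_scaleR_matrix_ac MG matrix_vector_mult_scaleR)
      then show "G (s *\<^sub>R a) (x r) = s *\<^sub>R G a (x r)" using G[OF xU] by metis
    qed
    then show "bounded_linear (\<lambda>v. G v (x r))" by (simp add: linear_conv_bounded_linear)
    show "continuous (at r) x" using cont S r by (simp add: continuous_on_eq_continuous_at)
  qed
  have "\<forall>k. Ck_on n (\<lambda>r. x r $ k) S" for n
  proof (induction n)
    case 0
    show ?case using cont by (auto intro: continuous_on_component)
  next
    case (Suc n)
    show ?case
    proof
      fix k
      show "Ck_on (Suc n) (\<lambda>r. x r $ k) S"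
      proof (rule Ck_on_SucI[OF S])
        show "((\<lambda>r. x r $ k) has_derivative (\<lambda>v. G v (x r) $ k)) (at r)" if "r \<in> S" for r
          by (rule bounded_linear.has_derivative[OF bounded_linear_vec_nth dx[OF that]])
        show "Ck_on n (\<lambda>r. G v (x r) $ k) S" for v
        proof (rule Ck_on_compose[OF S U])
          show "Ck_on n (\<lambda>w. G v w $ k) U" using smoothG by (simp add: smooth_on_def)
          show "Ck_on n (\<lambda>r. x r \<bullet> i) S" if "i \<in> Basis" for i
            using that Suc.IH by (auto simp: Basis_vec_def inner_axis)
        qed
      qed
    qed
  qed
  then show ?thesis by (simp add: smooth_on_def)
qed

section \<open>Smooth dependence of the point and the multiplier\<close>

lemma orthogonal_projection_exists:
  fixes W :: "'a::euclidean_space set"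
  assumes "subspace W"
  obtains pr where "bounded_linear pr" "\<And>x. pr x \<in> W" "\<And>x u. u \<in> W \<Longrightarrow> (x - pr x) \<bullet> u = 0"
proof -
  obtain B where B: "B \<subseteq> W" "pairwise orthogonal B" "\<And>x. x \<in> B \<Longrightarrow> norm x = 1" "independent B" "span B = W"
    using orthonormal_basis_subspace[OF assms] by metis
  have fB: "finite B" using B(4) by (rule independent_imp_finite)
  define pr where "pr x = (\<Sum>b\<in>B. (x \<bullet> b) *\<^sub>R b)" for x
  have "bounded_linear pr" unfolding pr_def
    by (intro bounded_linear_sum bounded_linear_scaleR_const bounded_linear_inner_left)
  moreover have "pr x \<in> W" for x unfolding pr_def B(5)[symmetric] by (intro span_sum span_scale span_base)
  moreover have "(x - pr x) \<bullet> u = 0" if "u \<in> W" for x u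
  proof -
    have "(x - pr x) \<bullet> v = 0" if v: "v \<in> B" for v
    proof -
      have "(\<Sum>b\<in>B. (x \<bullet> b) * (b \<bullet> v)) = (\<Sum>b\<in>{v}. (x \<bullet> b) * (b \<bullet> v))"
        using B(2) v fB by (intro sum.mono_neutral_right) (auto simp: pairwise_def orthogonal_def)
      also have "\<dots> = x \<bullet> v" using B(3)[OF v] by (simp add: norm_eq_1)
      finally show ?thesis by (simp add: inner_diff_left pr_def inner_sum_left)
    qed
    moreover have "subspace {u. (x - pr x) \<bullet> u = 0}" by (auto simp: subspace_def inner_add_right)
    ultimately have "span B \<subseteq> {u. (x - pr x) \<bullet> u = 0}" by (intro span_minimal) auto
    then show ?thesis using that B(5) by blast
  qed
  ultimately show thesis by (rule that)
qed

lemma mem_span_if_orthogonal: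
  fixes u :: "'a::euclidean_space"
  assumes "\<And>d. (\<And>a. a \<in> A \<Longrightarrow> a \<bullet> d = 0) \<Longrightarrow> u \<bullet> d = 0"
  shows "u \<in> span A"
proof -
  obtain y z where yz: "y \<in> span A" "\<And>w. w \<in> span A \<Longrightarrow> orthogonal z w" "u = y + z"
    using orthogonal_subspace_decomp_exists[of A u] by metis
  have "a \<bullet> z = 0" if "a \<in> A" for a
    using yz(2)[OF span_base[OF that]] by (simp add: orthogonal_def inner_commute)
  then have "u \<bullet> z = 0" by (rule assms)
  moreover have "y \<bullet> z = 0" using yz(1,2) by (auto simp: orthogonal_def inner_commute)
  ultimately have "z = 0" using yz(3) by (simp add: inner_add_left)
  then show ?thesis using yz by simp
qed

definition log_odds_derivative :: "real \<Rightarrow> real ^ 'n \<Rightarrow> real ^ 'n \<Rightarrow> real ^ 'n" where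
  "log_odds_derivative c q h = (\<chi> j. h $ j / q $ j + (\<Sum>i\<in>UNIV. h $ i) / (c - (\<Sum>i\<in>UNIV. q $ i)))"

lemma log_odds_has_derivative:
  assumes "q \<in> osimplex c"
  shows "(log_odds c has_derivative log_odds_derivative c q) (at q)"
proof -
  have pos: "\<And>j. q $ j > 0" "c - (\<Sum>i\<in>UNIV. q $ i) > 0" using assms by (auto simp: osimplex_def)
  have "((\<lambda>q. ln (q $ j) - ln (c - (\<Sum>i\<in>UNIV. q $ i))) has_derivative
      (\<lambda>h. h $ j / q $ j + (\<Sum>i\<in>UNIV. h $ i) / (c - (\<Sum>i\<in>UNIV. q $ i)))) (at q)" for j
    using pos(1)[of j] pos(2)
    by (auto intro!: derivative_eq_intros bounded_linear_imp_has_derivative[OF bounded_linear_vec_nth]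
        simp: divide_inverse algebra_simps sum_negf)
  then show ?thesis
    unfolding log_odds_def[abs_def] log_odds_derivative_def[abs_def]
    by (subst has_derivative_componentwise_within) (auto simp: Basis_vec_def inner_axis)
qed

lemma log_odds_derivative_positive:
  assumes "q \<in> osimplex c" "log_odds_derivative c q h \<bullet> h = 0"
  shows "h = 0"
proof -
  have pos: "\<And>j. q $ j > 0" "c - (\<Sum>i\<in>UNIV. q $ i) > 0" using assms by (auto simp: osimplex_def)
  have "log_odds_derivative c q h \<bullet> h = (\<Sum>j\<in>UNIV. (h $ j)\<^sup>2 / q $ j) + (\<Sum>i\<in>UNIV. h $ i)\<^sup>2 / (c - (\<Sum>i\<in>UNIV. q $ i))"
    by (simp add: log_odds_derivative_def inner_vec_def algebra_simps sum.distrib power2_eq_square sum_distrib_left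
        sum_distrib_right sum_divide_distrib)
  moreover have "0 \<le> (\<Sum>i\<in>UNIV. h $ i)\<^sup>2 / (c - (\<Sum>i\<in>UNIV. q $ i))" using pos by simp
  moreover have n: "0 \<le> (h $ j)\<^sup>2 / q $ j" for j using pos(1)[of j] by simp
  moreover have "0 \<le> (\<Sum>j\<in>UNIV. (h $ j)\<^sup>2 / q $ j)" by (intro sum_nonneg n)
  ultimately have "(\<Sum>j\<in>UNIV. (h $ j)\<^sup>2 / q $ j) = 0" using assms(2) by linarith
  then have "(h $ j)\<^sup>2 / q $ j = 0" for j using n by (simp add: sum_nonneg_eq_0_iff)
  then show ?thesis using pos(1) by (auto simp: vec_eq_iff less_le)
qed

text \<open>
  \<open>A\<close> is the set of normals of the constraints active on the face \<open>Fc\<close>; they cut out its tangent cone.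
\<close>

locale face_body = moment_body c P + primitive_system b
  for c :: real and P :: "(real ^ 'n) set" and b :: "'n \<Rightarrow> real ^ 'n" +
  fixes A Fc :: "(real ^ 'n) set" and v0 :: "real ^ 'n"
  assumes range_comb: "range comb = span A" and v0: "v0 \<in> int_vecs"
    and Fc: "Fc \<subseteq> P" "Fc \<noteq> {}" "Fc \<subseteq> osimplex c"
    and cone: "q \<in> Fc \<Longrightarrow> normal_cone P q = {u. \<forall>d. (\<forall>a\<in>A. a \<bullet> d \<le> 0) \<longrightarrow> u \<bullet> d \<le> 0}"
    and supported: "q \<in> Fc \<Longrightarrow> y \<in> P \<Longrightarrow> a \<in> A \<Longrightarrow> a \<bullet> (y - q) \<le> 0"
    and tangent: "compact K \<Longrightarrow> K \<subseteq> Fc \<Longrightarrow> \<exists>e>0. \<forall>q\<in>K. \<forall>d. (\<forall>a\<in>A. a \<bullet> d \<le> 0) \<longrightarrow> norm d < e \<longrightarrow> q + d \<in> P"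
    and flat: "q \<in> Fc \<Longrightarrow> a \<in> A \<Longrightarrow> a \<bullet> (v0 - q) = 0"
begin

definition tcone :: "(real ^ 'n) set" where "tcone = {d. \<forall>a\<in>A. a \<bullet> d \<le> 0}"
text \<open>Taking the interior keeps the multiplier off the relative boundary of the normal cone,
  where the exponential decay along the tangent cone fails.\<close>

definition face_dom :: "(real ^ 'n) set" where "face_dom = interior {r. opt r \<in> Fc}"

lemma open_face_dom: "open face_dom" by (simp add: face_dom_def)

lemma opt_Fc: "r \<in> face_dom \<Longrightarrow> opt r \<in> Fc"
  using interior_subset by (auto simp: face_dom_def)

lemma flat_span: "q \<in> Fc \<Longrightarrow> u \<in> span A \<Longrightarrow> u \<bullet> (v0 - q) = 0"
proof -
  assume "q \<in> Fc" "u \<in> span A"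
  moreover have "subspace {u. u \<bullet> (v0 - q) = 0}" by (auto simp: subspace_def inner_add_left)
  ultimately have "span A \<subseteq> {u. u \<bullet> (v0 - q) = 0}" using flat by (intro span_minimal) auto
  then show ?thesis using \<open>u \<in> span A\<close> by blast
qed

lemma mult_span: "opt r \<in> Fc \<Longrightarrow> mult r \<in> span A"
proof (rule mem_span_if_orthogonal)
  fix d assume r: "opt r \<in> Fc" and d: "\<And>a. a \<in> A \<Longrightarrow> a \<bullet> d = 0"
  have "\<forall>d. (\<forall>a\<in>A. a \<bullet> d \<le> 0) \<longrightarrow> mult r \<bullet> d \<le> 0" using opt(3)[of r] cone[OF r] by blast
  moreover have "\<forall>a\<in>A. a \<bullet> d \<le> 0" "\<forall>a\<in>A. a \<bullet> (- d) \<le> 0" using d by auto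
  ultimately have "mult r \<bullet> d \<le> 0" "mult r \<bullet> (- d) \<le> 0" by blast+
  then show "mult r \<bullet> d = 0" by simp
qed

text \<open>The vector \<open>opt r - v0\<close> is orthogonal to \<open>span A\<close> and the
  multiplier lies in it, so the sum \<open>x r\<close> encodes both and the projection
  \<open>pr\<close> separates them. Since \<open>r\<close> is
  \<open>log_odds c (opt r) + mult r\<close>, the function \<open>x\<close> is a continuous right
  inverse of the explicit map \<Phi>.\<close>

lemma smooth_on_opt_mult: "smooth_on (\<lambda>r. opt r $ k) face_dom" "smooth_on (\<lambda>r. mult r $ k) face_dom"
proof -
  obtain pr where pr: "bounded_linear pr" "\<And>x. pr x \<in> span A" "\<And>x u. u \<in> span A \<Longrightarrow> (x - pr x) \<bullet> u = 0"
    using orthogonal_projection_exists[OF subspace_span] by metis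
  have pr_id: "pr x = x" if "x \<in> span A" for x
  proof -
    have "x - pr x \<in> span A" using that pr(2) by (intro span_diff)
    then have "(x - pr x) \<bullet> (x - pr x) = 0" by (rule pr(3))
    then show ?thesis by simp
  qed
  have pr_0: "pr x = 0" if "\<And>u. u \<in> span A \<Longrightarrow> u \<bullet> x = 0" for x
  proof -
    have "pr x \<bullet> x = 0" using that pr(2) by blast
    then have "pr x \<bullet> pr x = 0" using pr(3)[OF pr(2), of x x] by (simp add: inner_diff_left inner_diff_right inner_commute)
    then show ?thesis by simp
  qed
  define x where "x r = (opt r - v0) + mult r" for r
  have prx: "pr (x r) = mult r" if r: "opt r \<in> Fc" for r
  proof -
    have "pr (opt r - v0) = 0"
    proof (rule pr_0)
      fix u assume "u \<in> span A"
      from flat_span[OF r this] show "u \<bullet> (opt r - v0) = 0" by (simp add: inner_diff_right)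
    qed
    then show ?thesis using pr_id[OF mult_span[OF r]] linear_add[OF bounded_linear.linear[OF pr(1)]] by (simp add: x_def)
  qed
  define E where "E w = v0 + (w - pr w)" for w
  have Ex: "E (x r) = opt r" if "opt r \<in> Fc" for r using prx[OF that] by (simp add: E_def x_def)
  define U where "U = E -` osimplex c"
  have contE: "continuous_on UNIV E" unfolding E_def
    by (intro continuous_intros linear_continuous_on pr(1))
  have openU: "open U" unfolding U_def by (rule open_vimage[OF open_osimplex contE])
  define D where "D w h = log_odds_derivative c (E w) (h - pr h) + pr h" for w h
  define \<Phi> where "\<Phi> w = log_odds c (E w) + pr w" for w
  have derE: "(E has_derivative (\<lambda>h. h - pr h)) (at w)" for w
    unfolding E_def by (auto intro!: derivative_eq_intros bounded_linear_imp_has_derivative[OF pr(1)])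
  have der\<Phi>: "(\<Phi> has_derivative D w) (at w)" if "w \<in> U" for w
  proof -
    have "(log_odds c has_derivative log_odds_derivative c (E w)) (at (E w))"
      using that by (intro log_odds_has_derivative) (simp add: U_def)
    from has_derivative_compose[OF derE this]
    show ?thesis unfolding \<Phi>_def D_def
      by (intro has_derivative_add bounded_linear_imp_has_derivative[OF pr(1)])
  qed
  define M where "M w = matrix (D w)" for w
  have linD: "linear (D w)" if "w \<in> U" for w
    using has_derivative_bounded_linear[OF der\<Phi>[OF that]] by (rule bounded_linear.linear)
  have MD: "M w *v h = D w h" if "w \<in> U" for w h
    unfolding M_def using matrix_works[OF linD[OF that, unfolded linear_matrix_vector_mul_eq[symmetric]]] by simp
  have injD: "h = 0" if w: "w \<in> U" and h: "D w h = 0" for w h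
  proof -
    \<comment> \<open>Pairing with the tangential part removes \<open>pr h\<close> and leaves the
      positive definite form of the log-odds; once the tangential part is 0, only
      \<open>pr h\<close> remains of the derivative.\<close>
    have "D w h \<bullet> (h - pr h) = log_odds_derivative c (E w) (h - pr h) \<bullet> (h - pr h)"
      using pr(3)[OF pr(2), of h h] by (simp only: D_def inner_add_left inner_commute[of "pr h"] add_0_right)
    then have "h - pr h = 0" using log_odds_derivative_positive[of "E w" c "h - pr h"] w h by (simp add: U_def)
    moreover from this have "D w h = pr h" by (simp add: D_def log_odds_derivative_def vec_eq_iff)
    ultimately show ?thesis using h by simp
  qed
  have detM: "det (M w) \<noteq> 0" if w: "w \<in> U" for w
  proof -
    have "inj ((*v) (M w))"
    proof (rule injI)
      fix h h' assume "M w *v h = M w *v h'"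
      then have "D w (h - h') = 0" using MD[OF w] linear_diff[OF linD[OF w]] by simp
      then show "h = h'" using injD[OF w] by fastforce
    qed
    then show ?thesis
      using matrix_left_invertible_injective[of "M w"] invertible_left_inverse[of "M w"] invertible_det_nz by blast
  qed
  have smE: "smooth_on (\<lambda>w. E w $ i) U" for i
  proof -
    have "bounded_linear (\<lambda>w. (w - pr w) $ i)"
      by (intro bounded_linear_compose[OF bounded_linear_vec_nth] bounded_linear_sub bounded_linear_ident pr(1))
    then have "smooth_on (\<lambda>w. v0 $ i + (w - pr w) $ i) U"
      by (intro smooth_on_add smooth_on_const smooth_on_linear openU)
    then show ?thesis by (simp add: E_def)
  qed
  have smM: "smooth_on (\<lambda>w. M w $ i $ j) U" for i j
  proof -
    let ?h = "axis j 1 - pr (axis j 1)"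
    have "smooth_on (\<lambda>w. (?h $ i / E w $ i + (\<Sum>i\<in>UNIV. ?h $ i) / (c - (\<Sum>i\<in>UNIV. E w $ i))) + pr (axis j 1) $ i) U"
    proof (intro smooth_on_add smooth_on_divide smooth_on_const smooth_on_diff smooth_on_sum smE openU)
      fix w assume "w \<in> U"
      then have q: "\<And>i. E w $ i > 0" "c - (\<Sum>i\<in>UNIV. E w $ i) > 0" by (auto simp: U_def osimplex_def)
      show "E w $ i \<noteq> 0" using q(1)[of i] by simp
      show "c - (\<Sum>i\<in>UNIV. E w $ i) \<noteq> 0" using q(2) by simp
    qed
    then show ?thesis by (simp add: M_def matrix_def D_def log_odds_derivative_def)
  qed
  have smx: "smooth_on (\<lambda>r. x r $ k) face_dom" for k
  proof (rule smooth_on_implicit_inverse[OF open_face_dom openU, where \<Phi> = \<Phi> and M = M])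
    show "x ` face_dom \<subseteq> U" using Ex opt_Fc opt(2) by (auto simp: U_def)
    have "opt ` face_dom \<subseteq> osimplex c" using opt(2) by blast
    then have "continuous_on face_dom (\<lambda>r. log_odds c (opt r))"
      by (rule continuous_on_compose2[OF continuous_on_log_odds continuous_on_opt])
    then show "continuous_on face_dom x" unfolding x_def mult_def by (intro continuous_intros continuous_on_opt)
    show "\<Phi> (x r) = r" if "r \<in> face_dom" for r
      using prx[OF opt_Fc[OF that]] Ex[OF opt_Fc[OF that]] by (simp add: \<Phi>_def mult_def)
    show "(\<Phi> has_derivative (\<lambda>h. M w *v h)) (at w)" if "w \<in> U" for w
      using der\<Phi>[OF that] MD[OF that] by (simp add: fun_eq_iff[symmetric] eta_contract_eq)
  qed (use detM smM in auto)
  have sl: "smooth_on (\<lambda>r. l (x r)) face_dom" if "bounded_linear l" for l :: "real ^ 'n \<Rightarrow> real"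
    by (rule smooth_on_compose[OF open_face_dom open_UNIV])
      (auto simp: Basis_vec_def inner_axis smx smooth_on_linear[OF that])
  have "smooth_on (\<lambda>r. pr (x r) $ k) face_dom"
    by (rule sl) (intro bounded_linear_compose[OF bounded_linear_vec_nth] pr(1))
  then show "smooth_on (\<lambda>r. mult r $ k) face_dom"
    using smooth_on_cong[OF open_face_dom, of "\<lambda>r. pr (x r) $ k" "\<lambda>r. mult r $ k"] prx opt_Fc by simp
  have "smooth_on (\<lambda>r. E (x r) $ k) face_dom"
    by (rule smooth_on_compose[OF open_face_dom openU _ smE, of x]) (use Ex opt_Fc opt(2) smx in \<open>auto simp: U_def Basis_vec_def inner_axis\<close>)
  then show "smooth_on (\<lambda>r. opt r $ k) face_dom"
    using smooth_on_cong[OF open_face_dom, of "\<lambda>r. E (x r) $ k" "\<lambda>r. opt r $ k"] Ex opt_Fc by simp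
qed

text \<open>A small shift of \<open>r\<close> by a vector of \<open>span A\<close> leaves both
  maximisers on the face. Their difference is orthogonal to \<open>span A\<close> while the
  difference of their log-odds lies in it, so strong monotonicity makes them equal and the whole
  shift goes into the multiplier. The multiplier thus has room within the normal cone in every
  normal direction, uniformly over \<open>K\<close>.\<close>

lemma mult_interior_cone:
  assumes K: "compact K" "K \<subseteq> face_dom"
  shows "\<exists>\<delta>>0. \<forall>r\<in>K. \<forall>d\<in>tcone. mult r \<bullet> d \<le> - (\<delta> * norm (dual d))"
proof -
  obtain e where e: "e > 0" "(\<Union>r\<in>K. ball r e) \<subseteq> face_dom"
    using compact_subset_open_imp_ball_epsilon_subset[OF K(1) open_face_dom K(2)] by blast
  have shift: "mult r + w \<in> normal_cone P (opt r)" if r: "r \<in> K" and w: "w \<in> span A" "norm w < e" for r w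
  proof -
    have "r + w \<in> ball r e" using w by (simp add: dist_norm)
    then have F: "opt r \<in> Fc" "opt (r + w) \<in> Fc" using e(2) r K(2) opt_Fc by blast+
    let ?q = "opt r" and ?q' = "opt (r + w)"
    have "log_odds c ?q - log_odds c ?q' = mult (r + w) - mult r - w" by (simp add: mult_def)
    also have "\<dots> \<in> span A" using mult_span F w by (intro span_diff) auto
    finally have s: "log_odds c ?q - log_odds c ?q' \<in> span A" .
    have "(?q - ?q') \<bullet> (log_odds c ?q - log_odds c ?q') = 0"
      using flat_span[OF F(1) s] flat_span[OF F(2) s] by (simp add: inner_diff_right inner_diff_left inner_commute)
    then have "(norm (?q - ?q'))\<^sup>2 / c \<le> 0"
      using log_odds_strongly_monotone[OF opt(2) opt(2), of r "r + w"] by simp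
    then have "?q' = ?q" using c by (simp add: divide_le_0_iff)
    then have "mult (r + w) = mult r + w" by (simp add: mult_def)
    then show ?thesis using opt(3)[of "r + w"] \<open>?q' = ?q\<close> by simp
  qed
  obtain L where L: "L > 0" "\<And>t. norm (comb t) \<le> L * norm t" using linear_bounded_pos[OF linear_comb] by blast
  define \<delta> where "\<delta> = e / (2 * L)"
  have \<delta>: "\<delta> > 0" using e L by (simp add: \<delta>_def)
  have "mult r \<bullet> d \<le> - (\<delta> * norm (dual d))" if r: "r \<in> K" and d: "d \<in> tcone" for r d
  proof -
    have F: "opt r \<in> Fc" using r K(2) opt_Fc by blast
    \<comment> \<open>The shift is aimed along \<open>dual d\<close>, so that it pairs with
      \<open>d\<close> to \<open>\<delta> * norm (dual d)\<close>; if \<open>dual d = 0\<close> it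
      is 0.\<close>
    define t where "t = (\<delta> / norm (dual d)) *\<^sub>R dual d"
    have "norm t \<le> \<delta>" using \<delta> by (simp add: t_def)
    then have "norm (comb t) \<le> L * \<delta>" using L(2)[of t] L(1) by (meson mult_left_mono less_imp_le order_trans)
    also have "\<dots> < e" using L(1) e(1) by (simp add: \<delta>_def)
    finally have "mult r + comb t \<in> normal_cone P (opt r)" using range_comb by (intro shift r) auto
    then have "(mult r + comb t) \<bullet> d \<le> 0" using cone[OF F] d by (auto simp: tcone_def)
    moreover have "comb t \<bullet> d = \<delta> * norm (dual d)"
      by (simp add: comb_inner t_def dot_square_norm power2_eq_square)
    ultimately show ?thesis by (simp add: inner_add_left)
  qed
  then show ?thesis using \<delta> by blast
qed

end

text \<open>\<open>exp_act\<close> moves \<open>log_mod\<close> by twice its parameter; the factor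
  is absorbed because normal cones are closed under positive scaling.\<close>

lemma (in face_body) face_region_iff:
  assumes "c = real p" "z \<in> ctorus"
  shows "z \<in> face_region p P Fc \<longleftrightarrow> opt (log_mod z) \<in> Fc"
proof
  have half: "s *\<^sub>R u \<in> normal_cone P q" if "u \<in> normal_cone P q" "q \<in> Fc" "s > 0" for u q s
    using that cone[OF that(2)] by (auto simp: mult_le_0_iff)
  {
    assume "z \<in> face_region p P Fc"
    then obtain \<tau> z' q where z: "z = exp_act \<tau> z'" "z' \<in> ctorus" "real p *\<^sub>R moment_map z' \<in> Fc" "q \<in> Fc" "\<tau> \<in> normal_cone P q"
      by (auto simp: face_region_def face_cone_def)
    let ?q = "real p *\<^sub>R moment_map z'"
    have "2 *\<^sub>R \<tau> \<in> normal_cone P ?q" using half[OF z(5,4), of 2] cone z(3,4) by simp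
    moreover have "mom c (log_mod z - 2 *\<^sub>R \<tau>) = ?q" using z log_mod(3)[OF z(2)] assms(1) by (simp add: log_mod_exp_act)
    ultimately have "?q = opt (log_mod z)" using z(3) Fc(1) by (intro pair_unique) auto
    then show "opt (log_mod z) \<in> Fc" using z(3) by simp
  next
    assume F: "opt (log_mod z) \<in> Fc"
    define \<tau> where "\<tau> = (1/2) *\<^sub>R mult (log_mod z)"
    define z' where "z' = exp_act (- \<tau>) z"
    have z': "z' \<in> ctorus" using assms(2) by (simp add: z'_def exp_act_ctorus)
    have "log_mod z' = log_mod z - mult (log_mod z)" using log_mod_exp_act[OF assms(2)] by (simp add: z'_def \<tau>_def)
    then have "real p *\<^sub>R moment_map z' \<in> Fc" using log_mod(3)[OF z', of p] mom_mult[of "log_mod z"] F assms(1) by simp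
    moreover have "\<tau> \<in> face_cone P Fc" unfolding face_cone_def \<tau>_def using half[OF opt(3) F, of "1/2"] F by auto
    moreover have "z = exp_act \<tau> z'" by (simp add: z'_def exp_act_inverse)
    ultimately show "z \<in> face_region p P Fc" unfolding face_region_def using z' by blast
  }
qed

text \<open>The map \<open>g\<close> is a continuous section of \<open>log_mod\<close> through
  \<open>z\<close> that varies moduli and keeps arguments, so it pulls the open region back to an
  open set of real vectors.\<close>

lemma (in face_body) log_mod_interior_face_region:
  assumes "c = real p" "z \<in> interior (face_region p P Fc)"
  shows "z \<in> ctorus" "log_mod z \<in> face_dom"
proof -
  have zf: "z \<in> face_region p P Fc" using assms(2) interior_subset by blast
  then show z: "z \<in> ctorus" by (auto simp: face_region_def exp_act_ctorus)
  define g where "g r = exp_act ((1/2) *\<^sub>R (r - log_mod z)) z" for r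
  have "continuous_on UNIV g" unfolding g_def exp_act_def
    by (intro continuous_on_vec_lambda continuous_intros)
  then have "open (g -` interior (face_region p P Fc))" by (intro open_vimage) auto
  moreover have "g -` interior (face_region p P Fc) \<subseteq> {r. opt r \<in> Fc}"
  proof
    fix r assume "r \<in> g -` interior (face_region p P Fc)"
    then have "g r \<in> face_region p P Fc" using interior_subset by blast
    moreover have "g r \<in> ctorus" using z by (simp add: g_def exp_act_ctorus)
    moreover have "log_mod (g r) = r" using log_mod_exp_act[OF z] by (simp add: g_def)
    ultimately show "r \<in> {r. opt r \<in> Fc}" using face_region_iff[OF assms(1), of "g r"] by simp
  qed
  moreover have "log_mod z \<in> g -` interior (face_region p P Fc)"
    using assms(2) by (simp add: g_def exp_act_def)
  ultimately show "log_mod z \<in> face_dom" unfolding face_dom_def by (meson interiorI)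
qed

section \<open>Rational subspaces and bases of their lattices\<close>

definition rational_subspace :: "(real ^ 'n) set \<Rightarrow> bool" where
  "rational_subspace W \<longleftrightarrow> subspace W \<and> W = span (W \<inter> int_vecs)"

lemma inner_int_vecs: "x \<in> int_vecs \<Longrightarrow> y \<in> int_vecs \<Longrightarrow> x \<bullet> y \<in> \<int>"
  by (auto simp: int_vecs_def inner_vec_def intro!: Ints_sum Ints_mult)

text \<open>Among integral vectors of \<open>W\<close> not orthogonal to \<open>e\<close>,
  \<open>u\<close> has the least absolute pairing with \<open>e\<close>, so division with remainder
  makes every pairing a multiple of it. Subtracting multiples of \<open>u\<close> from integral
  spanning vectors shows that the slice orthogonal to \<open>e\<close> is again rational.\<close>

lemma lattice_elimination:
  fixes W :: "(real ^ 'n) set"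
  assumes W: "rational_subspace W" and e: "e \<in> int_vecs" and nz: "\<exists>w\<in>W \<inter> int_vecs. w \<bullet> e \<noteq> 0"
  shows "\<exists>u\<in>W \<inter> int_vecs. u \<bullet> e \<noteq> 0 \<and> (\<forall>w\<in>W \<inter> int_vecs. \<exists>n :: int. (w - of_int n *\<^sub>R u) \<bullet> e = 0) \<and>
    rational_subspace {w \<in> W. w \<bullet> e = 0}"
proof -
  have sub: "subspace W" and sp: "W = span (W \<inter> int_vecs)" using W by (auto simp: rational_subspace_def)
  have fl: "of_int \<lfloor>w \<bullet> e\<rfloor> = w \<bullet> e" if "w \<in> int_vecs" for w
    using inner_int_vecs[OF that e] by (auto elim: Ints_cases)
  obtain u where u: "u \<in> W \<inter> int_vecs" "u \<bullet> e \<noteq> 0"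
    and min: "\<And>w. w \<in> W \<inter> int_vecs \<Longrightarrow> w \<bullet> e \<noteq> 0 \<Longrightarrow> nat \<bar>\<lfloor>u \<bullet> e\<rfloor>\<bar> \<le> nat \<bar>\<lfloor>w \<bullet> e\<rfloor>\<bar>"
    using ex_has_least_nat[of "\<lambda>w. w \<in> W \<inter> int_vecs \<and> w \<bullet> e \<noteq> 0" _ "\<lambda>w. nat \<bar>\<lfloor>w \<bullet> e\<rfloor>\<bar>"] nz by blast
  have red: "\<exists>n :: int. (w - of_int n *\<^sub>R u) \<bullet> e = 0" if w: "w \<in> W \<inter> int_vecs" for w
  proof -
    define a where "a = \<lfloor>w \<bullet> e\<rfloor>"
    define k where "k = \<lfloor>u \<bullet> e\<rfloor>"
    have ak: "w \<bullet> e = of_int a" "u \<bullet> e = of_int k"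
      unfolding a_def k_def using w u(1) by (auto intro!: fl[symmetric])
    have k0: "k \<noteq> 0" using u(2) ak by auto
    define w' where "w' = w - of_int (a div k) *\<^sub>R u"
    have w'e: "w' \<bullet> e = of_int (a mod k)"
      by (simp add: w'_def inner_diff_left ak minus_div_mult_eq_mod[symmetric])
    have "w' \<in> W \<inter> int_vecs" unfolding w'_def using w u sub
      by (auto intro!: subspace_diff subspace_scale int_vecs_diff int_vecs_scale)
    then have "w' \<bullet> e \<noteq> 0 \<Longrightarrow> nat \<bar>k\<bar> \<le> nat \<bar>a mod k\<bar>" using min[of w'] w'e by (simp add: k_def)
    moreover have "\<bar>a mod k\<bar> < \<bar>k\<bar>" using k0 by (rule abs_mod_less)
    ultimately have "w' \<bullet> e = 0" by linarith
    then show ?thesis unfolding w'_def by blast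
  qed
  define W' where "W' = {w \<in> W. w \<bullet> e = 0}"
  have sub': "subspace W'" using sub by (auto simp: W'_def subspace_def inner_add_left)
  have "W' \<subseteq> span (W' \<inter> int_vecs)"
  proof
    fix x assume x: "x \<in> W'"
    then have "x \<in> span (W \<inter> int_vecs)" using sp by (auto simp: W'_def)
    then obtain S r where S: "finite S" "S \<subseteq> W \<inter> int_vecs" "x = (\<Sum>s\<in>S. r s *\<^sub>R s)"
      unfolding span_explicit by blast
    obtain n :: "real ^ 'n \<Rightarrow> int" where n: "\<And>s. s \<in> S \<Longrightarrow> (s - of_int (n s) *\<^sub>R u) \<bullet> e = 0"
      using red S(2) by (metis subsetD)
    define y where "y = (\<Sum>s\<in>S. r s *\<^sub>R (s - of_int (n s) *\<^sub>R u))"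
    have xy: "x = y + (\<Sum>s\<in>S. r s * of_int (n s)) *\<^sub>R u"
      by (simp add: y_def S(3) scaleR_diff_right sum_subtractf scaleR_sum_left)
    have "y \<bullet> e = 0" unfolding y_def inner_sum_left using n by (intro sum.neutral) auto
    moreover have "x \<bullet> e = 0" using x by (simp add: W'_def)
    ultimately have "(\<Sum>s\<in>S. r s * of_int (n s)) = 0" using u(2) by (simp add: xy inner_add_left)
    then have "x = y" using xy by simp
    moreover have "y \<in> span (W' \<inter> int_vecs)" unfolding y_def
    proof (intro span_sum span_scale span_base)
      fix s assume s: "s \<in> S"
      show "s - of_int (n s) *\<^sub>R u \<in> W' \<inter> int_vecs"
        using n[OF s] S(2) s u(1) sub unfolding W'_def
        by (auto intro!: subspace_diff subspace_scale int_vecs_diff int_vecs_scale)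
    qed
    ultimately show "x \<in> span (W' \<inter> int_vecs)" by simp
  qed
  moreover have "span (W' \<inter> int_vecs) \<subseteq> W'" using sub' by (intro span_minimal) auto
  ultimately have "rational_subspace W'" using sub' by (auto simp: rational_subspace_def)
  then show ?thesis using u red unfolding W'_def by blast
qed

lemma rational_subspace_UNIV: "rational_subspace (UNIV :: (real ^ 'n) set)"
proof -
  have "Basis \<subseteq> (int_vecs :: (real ^ 'n) set)" by (auto simp: Basis_vec_def int_vecs_def axis_def)
  then have "span (Basis :: (real ^ 'n) set) \<subseteq> span int_vecs" by (rule span_mono)
  then show ?thesis by (auto simp: rational_subspace_def)
qed

lemma rational_subspace_orthogonal:
  fixes D :: "(real ^ 'n) set"
  assumes "finite D" "D \<subseteq> int_vecs"
  shows "rational_subspace {w. \<forall>\<delta>\<in>D. w \<bullet> \<delta> = 0}"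
  using assms
proof (induction D)
  case empty
  then show ?case using rational_subspace_UNIV by simp
next
  case (insert e D)
  let ?W = "{w. \<forall>\<delta>\<in>D. w \<bullet> \<delta> = 0}"
  have W: "rational_subspace ?W" using insert by blast
  have eq: "{w. \<forall>\<delta>\<in>insert e D. w \<bullet> \<delta> = 0} = {w \<in> ?W. w \<bullet> e = 0}" by auto
  show ?case
  proof (cases "\<exists>w\<in>?W \<inter> int_vecs. w \<bullet> e \<noteq> 0")
    case True
    then show ?thesis unfolding eq using lattice_elimination[OF W _ True] insert.prems by blast
  next
    case False
    have "?W \<inter> int_vecs \<subseteq> {w. w \<bullet> e = 0}" using False by blast
    moreover have "subspace {w. w \<bullet> e = 0}" by (auto simp: subspace_def inner_add_left)
    ultimately have "span (?W \<inter> int_vecs) \<subseteq> {w. w \<bullet> e = 0}" by (rule span_minimal)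
    then have "{w \<in> ?W. w \<bullet> e = 0} = ?W" using W unfolding rational_subspace_def by blast
    then show ?thesis unfolding eq using W by simp
  qed
qed

text \<open>\<open>W\<close> is cut by a coordinate hyperplane that misses one of its integral
  vectors; the vector \<open>u\<close> of \<open>lattice_elimination\<close> completes an integral
  basis of the slice to one of \<open>W\<close>.\<close>

lemma lattice_basis:
  fixes W :: "(real ^ 'n) set"
  assumes "rational_subspace W"
  shows "\<exists>B. finite B \<and> B \<subseteq> W \<inter> int_vecs \<and> independent B \<and> span B = W \<and>
    (\<forall>w\<in>W \<inter> int_vecs. \<exists>c :: real ^ 'n \<Rightarrow> int. w = (\<Sum>b\<in>B. of_int (c b) *\<^sub>R b))"
  using assms
proof (induction "dim W" arbitrary: W rule: less_induct)
  case less
  have sub: "subspace W" and sp: "W = span (W \<inter> int_vecs)" using less.prems by (auto simp: rational_subspace_def)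
  show ?case
  proof (cases "W \<inter> int_vecs \<subseteq> {0}")
    case True
    moreover have "subspace {0 :: real ^ 'n}" by (simp add: subspace_def)
    ultimately have "span (W \<inter> int_vecs) \<subseteq> {0}" by (rule span_minimal)
    then have "W = {0}" using sp subspace_0[OF sub] by blast
    moreover have "independent ({} :: (real ^ 'n) set)" by (rule independent_empty)
    ultimately show ?thesis by (intro exI[of _ "{}"]) auto
  next
    case False
    then obtain w where w: "w \<in> W \<inter> int_vecs" "w \<noteq> 0" by blast
    then obtain j where j: "w $ j \<noteq> 0" by (auto simp: vec_eq_iff)
    define e :: "real ^ 'n" where "e = axis j 1"
    have e: "e \<in> int_vecs" by (auto simp: e_def int_vecs_def axis_def)
    have "w \<bullet> e \<noteq> 0" using j by (simp add: e_def inner_axis)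
    then obtain u where u: "u \<in> W \<inter> int_vecs" "u \<bullet> e \<noteq> 0"
      and red: "\<And>w. w \<in> W \<inter> int_vecs \<Longrightarrow> \<exists>n :: int. (w - of_int n *\<^sub>R u) \<bullet> e = 0"
      and rat: "rational_subspace {w \<in> W. w \<bullet> e = 0}"
      using lattice_elimination[OF less.prems e] w by blast
    let ?W' = "{w \<in> W. w \<bullet> e = 0}"
    have sub': "subspace ?W'" using rat by (simp add: rational_subspace_def)
    have "?W' \<subset> W" using u by blast
    then have "dim ?W' < dim W" using sub sub' by (intro dim_psubset) (simp add: span_eq_iff[THEN iffD2])
    from less.hyps[OF this rat] obtain B where B: "finite B" "B \<subseteq> ?W' \<inter> int_vecs" "independent B" "span B = ?W'"
      "\<And>w. w \<in> ?W' \<inter> int_vecs \<Longrightarrow> \<exists>c :: real ^ 'n \<Rightarrow> int. w = (\<Sum>b\<in>B. of_int (c b) *\<^sub>R b)" by blast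
    have uB: "u \<notin> span B" using B(4) u by simp
    then have uB': "u \<notin> B" using span_base by blast
    have rep: "\<exists>c :: real ^ 'n \<Rightarrow> int. w = (\<Sum>b\<in>insert u B. of_int (c b) *\<^sub>R b)" if w: "w \<in> W \<inter> int_vecs" for w
    proof -
      obtain n :: int where n: "(w - of_int n *\<^sub>R u) \<bullet> e = 0" using red[OF w] by blast
      have "w - of_int n *\<^sub>R u \<in> ?W' \<inter> int_vecs" using n w u sub
        by (auto intro!: subspace_diff subspace_scale int_vecs_diff int_vecs_scale)
      then obtain c :: "real ^ 'n \<Rightarrow> int" where c: "w - of_int n *\<^sub>R u = (\<Sum>b\<in>B. of_int (c b) *\<^sub>R b)" using B(5) by blast
      have "(\<Sum>b\<in>B. of_int ((c(u := n)) b) *\<^sub>R b) = (\<Sum>b\<in>B. of_int (c b) *\<^sub>R b)"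
        using uB' by (intro sum.cong) auto
      then have "w = (\<Sum>b\<in>insert u B. of_int ((c(u := n)) b) *\<^sub>R b)"
        using B(1) uB' c by (simp add: algebra_simps)
      then show ?thesis by blast
    qed
    have "span (insert u B) = W"
    proof
      show "span (insert u B) \<subseteq> W" using u B(2) sub by (intro span_minimal) auto
      have "W \<inter> int_vecs \<subseteq> span (insert u B)"
      proof
        fix w assume "w \<in> W \<inter> int_vecs"
        then obtain c :: "real ^ 'n \<Rightarrow> int" where "w = (\<Sum>b\<in>insert u B. of_int (c b) *\<^sub>R b)" using rep by blast
        then show "w \<in> span (insert u B)" by (simp only:) (intro span_sum span_scale span_base)
      qed
      then show "W \<subseteq> span (insert u B)" using sp span_minimal[OF _ subspace_span] by metis
    qed
    moreover have "independent (insert u B)" using uB B(3) by (simp add: independent_insert uB')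
    ultimately show ?thesis using B u rep by (intro exI[of _ "insert u B"]) auto
  qed
qed

text \<open>The lattice basis is placed at distinct indices by \<open>g\<close> and padded with
  zeros. Primitivity holds because an integral vector of \<open>W\<close> has integral coefficients
  in the basis, and these are unique by independence.\<close>

lemma primitive_system_exists:
  fixes W :: "(real ^ 'n) set"
  assumes "rational_subspace W"
  shows "\<exists>b :: 'n \<Rightarrow> real ^ 'n. primitive_system b \<and> range (primitive_system.comb b) = W \<and> card (primitive_system.J b) = dim W"
proof -
  obtain B where B: "finite B" "B \<subseteq> W \<inter> int_vecs" "independent B" "span B = W"
    "\<And>w. w \<in> W \<inter> int_vecs \<Longrightarrow> \<exists>c :: real ^ 'n \<Rightarrow> int. w = (\<Sum>b\<in>B. of_int (c b) *\<^sub>R b)"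
    using lattice_basis[OF assms] by blast
  have "card B \<le> CARD('n)" using independent_bound[OF B(3)] by simp
  then obtain g :: "real ^ 'n \<Rightarrow> 'n" where g: "inj_on g B"
    using card_le_inj[OF B(1) finite_class.finite_UNIV] by blast
  define b where "b j = (if j \<in> g ` B then the_inv_into B g j else 0)" for j
  have bg: "b (g v) = v" if "v \<in> B" for v using that g by (simp add: b_def the_inv_into_f_f)
  have b0: "b j = 0" if "j \<notin> g ` B" for j using that by (simp add: b_def)
  have bB: "b j \<in> insert 0 B" for j using bg b0 by (cases "j \<in> g ` B") auto
  have sum: "(\<Sum>k\<in>UNIV. t $ k *\<^sub>R b k) = (\<Sum>v\<in>B. t $ g v *\<^sub>R v)" for t :: "real ^ 'n"
  proof -
    have "(\<Sum>k\<in>UNIV. t $ k *\<^sub>R b k) = (\<Sum>k\<in>g ` B. t $ k *\<^sub>R b k)"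
      by (rule sum.mono_neutral_right) (auto simp: b0)
    also have "\<dots> = (\<Sum>v\<in>B. t $ g v *\<^sub>R v)" using g bg by (simp add: sum.reindex)
    finally show ?thesis .
  qed
  have bint: "b j \<in> int_vecs" for j using bB[of j] B(2) int_vecs_0 by auto
  interpret primitive_system b
  proof
    show "b j \<in> int_vecs" for j by (rule bint)
    fix t j assume int: "\<And>i. (\<Sum>k\<in>UNIV. t $ k *\<^sub>R b k) $ i / (2 * pi) \<in> \<int>" and bj: "b j \<noteq> 0"
    define w where "w = (1 / (2 * pi)) *\<^sub>R (\<Sum>v\<in>B. t $ g v *\<^sub>R v)"
    have "w \<in> int_vecs" using int unfolding sum by (simp add: w_def int_vecs_def)
    moreover have "w \<in> W" unfolding w_def B(4)[symmetric] by (intro span_scale span_sum span_base)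
    ultimately obtain c :: "real ^ 'n \<Rightarrow> int" where c: "w = (\<Sum>v\<in>B. of_int (c v) *\<^sub>R v)" using B(5) by blast
    have "(\<Sum>v\<in>B. (t $ g v / (2 * pi) - of_int (c v)) *\<^sub>R v) = 0"
      using c by (simp add: w_def scaleR_sum_right scaleR_diff_left sum_subtractf)
    then have z: "t $ g v / (2 * pi) - of_int (c v) = 0" if "v \<in> B" for v
      using independentD[OF B(3) B(1) order_refl, of "\<lambda>v. t $ g v / (2 * pi) - of_int (c v)" v] that by blast
    obtain v where v: "v \<in> B" "j = g v" using bj b0 by blast
    then show "t $ j / (2 * pi) \<in> \<int>" using z[OF v(1)] by (metis Ints_of_int eq_iff_diff_eq_0)
  qed
  have "0 \<notin> B" using B(3) dependent_zero by blast
  then have "b j \<noteq> 0 \<longleftrightarrow> j \<in> g ` B" for j using bg b0[of j] by auto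
  then have J: "J = g ` B" by (auto simp: J_def)
  have "range comb = W"
  proof
    show "range comb \<subseteq> W" unfolding comb_def sum B(4)[symmetric] by (auto intro: span_sum span_scale span_base)
    show "W \<subseteq> range comb"
    proof
      fix w assume "w \<in> W"
      then obtain r where r: "w = (\<Sum>v\<in>B. r v *\<^sub>R v)" using B(4) span_finite[OF B(1)] by auto
      define t :: "real ^ 'n" where "t = (\<chi> j. r (b j))"
      have "comb t = w" unfolding comb_def sum r using bg by (intro sum.cong) (auto simp: t_def)
      then show "w \<in> range comb" by blast
    qed
  qed
  moreover have "card J = dim W"
    using J g dim_eq_card_independent[OF B(3)] dim_span[of B] B(4) by (simp add: card_image)
  ultimately show ?thesis using primitive_system_axioms by blast
qed

section \<open>Faces in terms of active constraints\<close>

lemma small_multiple: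
  fixes d :: "'a::real_normed_vector"
  assumes "e > 0"
  shows "\<exists>s>0. norm (s *\<^sub>R d) < e"
proof (intro exI[of _ "e / (2 * (norm d + 1))"] conjI)
  have p: "0 < 2 * (norm d + 1)" by (simp add: add_nonneg_pos)
  then show "0 < e / (2 * (norm d + 1))" using assms by simp
  have "norm d < norm d + (norm d + 2)" by (simp add: add_nonneg_pos)
  then have "norm d < 2 * (norm d + 1)" by (simp add: algebra_simps)
  then have "e * norm d < e * (2 * (norm d + 1))" using assms by simp
  then show "norm ((e / (2 * (norm d + 1))) *\<^sub>R d) < e"
    using p assms by (simp add: divide_less_eq)
qed

text \<open>Two descriptions of \<open>P\<close> are combined. Half-spaces determine the cones and
  show that a face is the set of points with a given set of active constraints; integral vertices
  spanning the affine hull of the face show that its normal space is rational.\<close>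

lemma face_body_exists:
  fixes P :: "(real ^ 'n) set"
  assumes body: "moment_body c P" and P: "integral_polytope P" and Fc: "Fc \<in> open_faces P" "Fc \<subseteq> osimplex c"
  shows "\<exists>A b v0. face_body c P b A Fc v0 \<and> codim Fc = int (card (primitive_system.J b))"
proof -
  obtain V where V: "finite V" "\<forall>v\<in>V. \<forall>j. v $ j \<in> \<int>" "P = convex hull V"
    using P by (auto simp: integral_polytope_def)
  have Vint: "V \<subseteq> int_vecs" using V(2) by (auto simp: int_vecs_def)
  have cP: "compact P" using V by (simp add: finite_imp_compact_convex_hull)
  have "polytope P" using V unfolding polytope_def by blast
  then obtain H where H: "finite H" "P = \<Inter> H" "\<forall>h\<in>H. \<exists>a b. a \<noteq> 0 \<and> h = {x. a \<bullet> x \<le> b}"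
    using polytope_imp_polyhedron unfolding polyhedron_def by metis
  from H(3) obtain n d0 where nc: "\<And>h. h \<in> H \<Longrightarrow> n h \<noteq> 0 \<and> h = {x. n h \<bullet> x \<le> d0 h}" by metis
  have memP: "x \<in> P \<longleftrightarrow> (\<forall>h\<in>H. n h \<bullet> x \<le> d0 h)" for x
  proof -
    have "x \<in> h \<longleftrightarrow> n h \<bullet> x \<le> d0 h" if "h \<in> H" for h using nc[OF that] by blast
    then show ?thesis unfolding H(2) by blast
  qed
  define act where "act x = {h \<in> H. n h \<bullet> x = d0 h}" for x
  define Tg where "Tg x = {d. \<forall>h\<in>act x. n h \<bullet> d \<le> 0}" for x
  \<comment> \<open>On a compact set with constant active set the inactive constraints keep a
    uniform margin. Single points yield the normal cones and relative openness; general compact sets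
    yield the uniform tangent cone condition.\<close>
  have slack: "\<exists>e>0. \<forall>q\<in>K. \<forall>h\<in>H - act q. \<forall>d. norm d < e \<longrightarrow> n h \<bullet> (q + d) < d0 h"
    if K: "compact K" "K \<subseteq> P" "\<And>q. q \<in> K \<Longrightarrow> act q = S" for K S
  proof -
    have "\<exists>e>0. \<forall>q\<in>K. \<forall>d. norm d < e \<longrightarrow> n h \<bullet> (q + d) < d0 h" if h: "h \<in> H - S" for h
    proof (cases "K = {}")
      case False
      have "continuous_on K (\<lambda>q. n h \<bullet> q)" by (intro continuous_intros)
      then obtain q0 where q0: "q0 \<in> K" "\<And>q. q \<in> K \<Longrightarrow> n h \<bullet> q \<le> n h \<bullet> q0"
        using continuous_attains_sup[OF K(1) False] by blast
      have "h \<in> H" "h \<notin> act q0" using h K(3)[OF q0(1)] by auto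
      moreover have "q0 \<in> P" using q0 K by blast
      ultimately have lt: "n h \<bullet> q0 < d0 h" using memP unfolding act_def by (auto simp: less_le)
      define e where "e = (d0 h - n h \<bullet> q0) / norm (n h)"
      have nh: "norm (n h) > 0" using nc[OF \<open>h \<in> H\<close>] by simp
      have "e > 0" using lt nh by (simp add: e_def)
      moreover have "n h \<bullet> (q + d) < d0 h" if "q \<in> K" "norm d < e" for q d
      proof -
        have "n h \<bullet> d \<le> norm (n h) * norm d" by (rule norm_cauchy_schwarz)
        also have "\<dots> < norm (n h) * e" using that nh by simp
        finally have "n h \<bullet> d < d0 h - n h \<bullet> q0" using nh by (simp add: e_def)
        then show ?thesis using q0(2)[OF that(1)] by (simp add: inner_add_right)
      qed
      ultimately show ?thesis by blast
    qed (auto intro: exI[of _ 1])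
    then obtain e where e: "\<And>h. h \<in> H - S \<Longrightarrow> e h > 0 \<and> (\<forall>q\<in>K. \<forall>d. norm d < e h \<longrightarrow> n h \<bullet> (q + d) < d0 h)" by metis
    define e0 where "e0 = Min (insert 1 (e ` (H - S)))"
    have "finite (insert 1 (e ` (H - S)))" using H(1) by simp
    then have "e0 > 0" "\<And>h. h \<in> H - S \<Longrightarrow> e0 \<le> e h" unfolding e0_def using e by (auto simp: Min_gr_iff)
    then show ?thesis using e K(3) by (intro exI[of _ e0]) (metis less_le_trans)
  qed
  have cone: "u \<in> normal_cone P x \<longleftrightarrow> (\<forall>d\<in>Tg x. u \<bullet> d \<le> 0)" if x: "x \<in> P" for u x
  proof
    assume u: "u \<in> normal_cone P x"
    obtain e where e: "e > 0" "\<forall>h\<in>H - act x. \<forall>d. norm d < e \<longrightarrow> n h \<bullet> (x + d) < d0 h"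
      using slack[of "{x}" "act x"] x by auto
    show "\<forall>d\<in>Tg x. u \<bullet> d \<le> 0"
    proof
      fix d assume d: "d \<in> Tg x"
      obtain s where s: "s > 0" and sm: "norm (s *\<^sub>R d) < e" using small_multiple[OF e(1)] by blast
      have "x + s *\<^sub>R d \<in> P" unfolding memP
      proof (intro ballI)
        fix h assume h: "h \<in> H"
        show "n h \<bullet> (x + s *\<^sub>R d) \<le> d0 h"
        proof (cases "h \<in> act x")
          case True
          then have "n h \<bullet> d \<le> 0" "n h \<bullet> x = d0 h" using d by (auto simp: Tg_def act_def)
          then show ?thesis using s by (simp add: inner_add_right mult_nonneg_nonpos)
        qed (use e(2) h sm in \<open>auto intro: less_imp_le\<close>)
      qed
      then have "u \<bullet> (x + s *\<^sub>R d) \<le> u \<bullet> x" using u normal_cone_iff[OF cP x] by blast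
      then show "u \<bullet> d \<le> 0" using s by (simp add: inner_add_right mult_le_0_iff)
    qed
  next
    assume u: "\<forall>d\<in>Tg x. u \<bullet> d \<le> 0"
    have "u \<bullet> y \<le> u \<bullet> x" if y: "y \<in> P" for y
    proof -
      have "y - x \<in> Tg x" using y memP by (auto simp: Tg_def act_def inner_diff_right)
      then show ?thesis using u by (auto simp: inner_diff_right)
    qed
    then show "u \<in> normal_cone P x" using normal_cone_iff[OF cP x] by blast
  qed
  have act_cone: "act x = act y \<longleftrightarrow> normal_cone P x = normal_cone P y" if xy: "x \<in> P" "y \<in> P" for x y
  proof
    assume "act x = act y"
    then have "Tg x = Tg y" by (simp add: Tg_def)
    then show "normal_cone P x = normal_cone P y" using cone xy by blast
  next
    \<comment> \<open>The normal of a constraint active at \<open>x\<close> lies in the normal cone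
      at \<open>x\<close>. If that is also the cone at \<open>y\<close>, the functional is maximal
      at \<open>y\<close> too, so the constraint is active there.\<close>
    have *: "act x \<subseteq> act y" if "x \<in> P" "y \<in> P" "normal_cone P x = normal_cone P y" for x y
    proof
      fix h assume h: "h \<in> act x"
      then have "n h \<in> normal_cone P x" using cone[OF that(1)] by (auto simp: Tg_def)
      then have "n h \<in> normal_cone P y" using that by simp
      then have "n h \<bullet> x \<le> n h \<bullet> y" using normal_cone_iff[OF cP that(2)] that(1) by blast
      then show "h \<in> act y" using h that(2) memP by (force simp: act_def)
    qed
    assume "normal_cone P x = normal_cone P y"
    then show "act x = act y" using *[of x y] *[of y x] xy by blast
  qed
  obtain x0 where x0: "x0 \<in> P" "Fc = {y \<in> P. normal_cone P x0 = normal_cone P y}"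
    using Fc(1) by (auto simp: open_faces_def quotient_def)
  have Fc_act: "q \<in> Fc \<longleftrightarrow> q \<in> P \<and> act q = act x0" for q
    using act_cone[OF x0(1)] unfolding x0(2) by (auto simp: eq_commute)
  define A where "A = n ` act x0"
  have TgA: "Tg q = {d. \<forall>a\<in>A. a \<bullet> d \<le> 0}" if "q \<in> Fc" for q using that Fc_act by (auto simp: Tg_def A_def)
  define L where "L = {d. \<forall>a\<in>A. a \<bullet> d = 0}"
  have subL: "subspace L" by (auto simp: L_def subspace_def inner_add_right)
  have flat: "q - x0 \<in> L" if "q \<in> Fc" for q
    using that Fc_act by (auto simp: L_def A_def act_def inner_diff_right)
  have x0F: "x0 \<in> Fc" using x0 Fc_act by simp
  have open_rel: "\<exists>e>0. \<forall>d\<in>L. norm d < e \<longrightarrow> q + d \<in> Fc" if q: "q \<in> Fc" for q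
  proof -
    have qP: "q \<in> P" and aq: "act q = act x0" using q Fc_act by auto
    obtain e where e: "e > 0" "\<forall>h\<in>H - act q. \<forall>d. norm d < e \<longrightarrow> n h \<bullet> (q + d) < d0 h"
      using slack[of "{q}" "act q"] qP by auto
    have "q + d \<in> Fc" if d: "d \<in> L" "norm d < e" for d
    proof -
      have a: "n h \<bullet> (q + d) = d0 h" if "h \<in> act q" for h
        using that d aq by (auto simp: L_def A_def act_def inner_add_right)
      have i: "n h \<bullet> (q + d) < d0 h" if "h \<in> H - act q" for h using e d that by blast
      have "n h \<bullet> (q + d) \<le> d0 h" if "h \<in> H" for h using a[of h] i[of h] that by (cases "h \<in> act q") auto
      then have "q + d \<in> P" unfolding memP by blast
      moreover have "act (q + d) = act q" using a i unfolding act_def by force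
      ultimately show ?thesis using aq Fc_act by simp
    qed
    then show ?thesis using e(1) by blast
  qed
  \<comment> \<open>The vertices in the affine hull of the face. A point of the face is a convex
    combination of these alone, because an active functional attains its maximum at every vertex of
    nonzero weight.\<close>
  define VF where "VF = {v \<in> V. v - x0 \<in> L}"
  have hull: "q \<in> convex hull VF" if q: "q \<in> Fc" for q
  proof -
    have qP: "q \<in> P" using q Fc_act by auto
    then obtain l where l: "\<And>v. v \<in> V \<Longrightarrow> 0 \<le> l v" "sum l V = 1" "(\<Sum>v\<in>V. l v *\<^sub>R v) = q"
      using V(3) unfolding convex_hull_finite[OF V(1)] by blast
    have supp: "v \<in> VF" if v: "v \<in> V" "l v \<noteq> 0" for v
    proof -
      have "n h \<bullet> v = d0 h" if h: "h \<in> act x0" for h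
      proof -
        have hH: "h \<in> H" using h by (simp add: act_def)
        have le: "n h \<bullet> w \<le> d0 h" if "w \<in> V" for w
          using memP hH that V(3) hull_inc by metis
        have "n h \<bullet> q = d0 h" using h Fc_act q by (auto simp: act_def)
        then have "(\<Sum>w\<in>V. l w * (d0 h - n h \<bullet> w)) = 0"
          using l(2) unfolding l(3)[symmetric] by (simp add: inner_sum_right right_diff_distrib sum_subtractf sum_distrib_right[symmetric])
        then have "l v * (d0 h - n h \<bullet> v) = 0"
          using sum_nonneg_eq_0_iff[OF V(1), of "\<lambda>w. l w * (d0 h - n h \<bullet> w)"] l(1) le v(1) by auto
        then show ?thesis using v(2) by simp
      qed
      then have "v - x0 \<in> L" by (auto simp: L_def A_def act_def inner_diff_right)
      then show ?thesis using v by (simp add: VF_def)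
    qed
    have sub: "VF \<subseteq> V" by (auto simp: VF_def)
    have l0: "\<forall>v\<in>V - VF. l v = 0" using supp by blast
    have "sum l V = sum l VF" by (rule sum.mono_neutral_right[OF V(1) sub l0])
    moreover have "(\<Sum>v\<in>V. l v *\<^sub>R v) = (\<Sum>v\<in>VF. l v *\<^sub>R v)"
      using l0 by (intro sum.mono_neutral_right[OF V(1) sub]) simp
    ultimately have "sum l VF = 1" "(\<Sum>v\<in>VF. l v *\<^sub>R v) = q" using l(2,3) by simp_all
    then show ?thesis unfolding convex_hull_finite[OF finite_subset[OF sub V(1)]] using l(1) sub by (intro CollectI exI[of _ l]) auto
  qed
  have "VF \<noteq> {}" using hull[OF x0F] by auto
  then obtain v0 where v0: "v0 \<in> VF" by blast
  have v0int: "v0 \<in> int_vecs" using v0 Vint by (auto simp: VF_def)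
  define D where "D = (\<lambda>v. v - v0) ` VF"
  have D: "finite D" "D \<subseteq> int_vecs" using V(1) Vint v0int by (auto simp: D_def VF_def intro!: int_vecs_diff)
  have DL: "D \<subseteq> L"
  proof -
    have "(v - x0) - (v0 - x0) \<in> L" if "v \<in> VF" for v
      by (rule subspace_diff[OF subL]) (use that v0 in \<open>auto simp: VF_def\<close>)
    then show ?thesis by (auto simp: D_def)
  qed
  \<comment> \<open>A short move from \<open>x0\<close> along \<open>d\<close> stays on the face, so
    both ends lie in the affine hull of \<open>VF\<close> and their difference in
    \<open>span D\<close>.\<close>
  have LD: "L \<subseteq> span D"
  proof
    fix d assume d: "d \<in> L"
    obtain e where e: "e > 0" "\<forall>d\<in>L. norm d < e \<longrightarrow> x0 + d \<in> Fc" using open_rel[OF x0F] by blast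
    obtain s where s: "s > 0" and sm: "norm (s *\<^sub>R d) < e" using small_multiple[OF e(1)] by blast
    have "x0 + s *\<^sub>R d \<in> convex hull VF" using e(2) subspace_scale[OF subL d, of s] sm by (intro hull) blast
    moreover have "x0 \<in> convex hull VF" using hull[OF x0F] .
    moreover have "convex hull VF \<subseteq> affine hull VF" by (rule convex_hull_subset_affine_hull)
    moreover have "affine hull VF \<subseteq> (+) v0 ` span D"
    proof (rule hull_minimal)
      show "affine ((+) v0 ` span D)" by (simp only: affine_translation[symmetric] subspace_imp_affine subspace_span)
      have "v = v0 + (v - v0)" "v - v0 \<in> span D" if "v \<in> VF" for v
        using that by (auto simp: D_def intro: span_base)
      then show "VF \<subseteq> (+) v0 ` span D" by blast
    qed
    ultimately obtain y1 y2 where y: "y1 \<in> span D" "y2 \<in> span D" "x0 + s *\<^sub>R d = v0 + y1" "x0 = v0 + y2" by blast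
    then have "s *\<^sub>R d = y1 - y2" by (simp add: algebra_simps)
    then have "s *\<^sub>R d \<in> span D" using y span_diff by metis
    then have "(1 / s) *\<^sub>R (s *\<^sub>R d) \<in> span D" by (rule span_scale)
    then show "d \<in> span D" using s by simp
  qed
  have spanA: "span A = {w. \<forall>\<delta>\<in>D. w \<bullet> \<delta> = 0}"
  proof
    have "subspace {w. \<forall>\<delta>\<in>D. w \<bullet> \<delta> = 0}" by (auto simp: subspace_def inner_add_left)
    moreover have "A \<subseteq> {w. \<forall>\<delta>\<in>D. w \<bullet> \<delta> = 0}" using DL by (auto simp: L_def)
    ultimately show "span A \<subseteq> {w. \<forall>\<delta>\<in>D. w \<bullet> \<delta> = 0}" by (intro span_minimal)
    show "{w. \<forall>\<delta>\<in>D. w \<bullet> \<delta> = 0} \<subseteq> span A"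
    proof
      fix w assume w: "w \<in> {w. \<forall>\<delta>\<in>D. w \<bullet> \<delta> = 0}"
      have "subspace {x. w \<bullet> x = 0}" by (auto simp: subspace_def inner_add_right)
      then have "span D \<subseteq> {x. w \<bullet> x = 0}" using w by (intro span_minimal) auto
      then have wL: "w \<bullet> x = 0" if "x \<in> L" for x using that LD by blast
      obtain y z where yz: "y \<in> span A" "\<And>u. u \<in> span A \<Longrightarrow> orthogonal z u" "w = y + z"
        using orthogonal_subspace_decomp_exists[of A w] by metis
      have "z \<in> L" using yz(2) span_base by (auto simp: L_def orthogonal_def inner_commute)
      then have "w \<bullet> z = 0" by (rule wL)
      moreover have "y \<bullet> z = 0" using yz(1,2) by (auto simp: orthogonal_def inner_commute)
      ultimately have "z = 0" using yz(3) by (simp add: inner_add_left)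
      then show "w \<in> span A" using yz by simp
    qed
  qed
  have rat: "rational_subspace (span A)" unfolding spanA by (rule rational_subspace_orthogonal[OF D])
  obtain b :: "'n \<Rightarrow> real ^ 'n" where b: "primitive_system b" "range (primitive_system.comb b) = span A" "card (primitive_system.J b) = dim (span A)"
    using primitive_system_exists[OF rat] by blast
  have cd: "codim Fc = int (dim (span A))"
  proof -
    let ?T = "(+) x0 ` L"
    \<comment> \<open>Relative openness in the translate of \<open>L\<close> gives the face the full
      dimension of \<open>L\<close>, whose complement is \<open>span A\<close>.\<close>
    have "openin (top_of_set ?T) Fc"
      unfolding openin_euclidean_subtopology_iff
    proof (intro conjI ballI)
      show "Fc \<subseteq> ?T" using flat by (force simp: image_iff intro: bexI[of _ "_ - x0"])
      fix q assume q: "q \<in> Fc"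
      obtain e where e: "e > 0" "\<forall>d\<in>L. norm d < e \<longrightarrow> q + d \<in> Fc" using open_rel[OF q] by blast
      have "y \<in> Fc" if y: "y \<in> ?T" "dist y q < e" for y
      proof -
        have "y - x0 \<in> L" using y(1) by auto
        then have "(y - x0) - (q - x0) \<in> L" using flat[OF q] by (rule subspace_diff[OF subL])
        then show ?thesis using e(2) y(2) by (auto simp: dist_norm dest!: bspec[of _ _ "y - q"])
      qed
      then show "\<exists>e>0. \<forall>y\<in>?T. dist y q < e \<longrightarrow> y \<in> Fc" using e(1) by blast
    qed
    moreover have "affine ?T" using subL by (simp only: affine_translation[symmetric] subspace_imp_affine)
    ultimately have "aff_dim Fc = aff_dim ?T" using x0F by (intro aff_dim_openin) auto
    also have "\<dots> = int (dim L)" using subL by (simp add: aff_dim_translation_eq aff_dim_subspace)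
    finally have 1: "aff_dim Fc = int (dim L)" .
    have "L = {y \<in> UNIV. \<forall>x\<in>span A. orthogonal x y}"
    proof -
      have "x \<bullet> y = 0" if "y \<in> L" "x \<in> span A" for x y
      proof -
        have "subspace {x. x \<bullet> y = 0}" by (auto simp: subspace_def inner_add_left)
        then have "span A \<subseteq> {x. x \<bullet> y = 0}" using that(1) by (intro span_minimal) (auto simp: L_def)
        then show ?thesis using that by blast
      qed
      then show ?thesis unfolding orthogonal_def L_def using span_base by blast
    qed
    then have "dim L + dim (span A) = DIM(real ^ 'n)"
      using dim_subspace_orthogonal_to_vectors[of "span A" UNIV] by (simp add: subspace_span)
    then show ?thesis using 1 by (simp add: codim_def)
  qed
  have t1: "\<exists>e>0. \<forall>q\<in>K. \<forall>d. (\<forall>a\<in>A. a \<bullet> d \<le> 0) \<longrightarrow> norm d < e \<longrightarrow> q + d \<in> P" if K: "compact K" "K \<subseteq> Fc" for K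
  proof -
    have act: "act q = act x0" "q \<in> P" if "q \<in> K" for q using that K Fc_act by auto
    obtain e where e: "e > 0" "\<forall>q\<in>K. \<forall>h\<in>H - act q. \<forall>d. norm d < e \<longrightarrow> n h \<bullet> (q + d) < d0 h"
      using slack[OF K(1) _ act(1)] act(2) by blast
    have "q + d \<in> P" if "q \<in> K" "\<forall>a\<in>A. a \<bullet> d \<le> 0" "norm d < e" for q d
      unfolding memP
    proof
      fix h assume h: "h \<in> H"
      show "n h \<bullet> (q + d) \<le> d0 h"
      proof (cases "h \<in> act q")
        case True
        then have "n h \<bullet> d \<le> 0" "n h \<bullet> q = d0 h" using that act(1)[OF that(1)] by (auto simp: A_def act_def)
        then show ?thesis by (simp add: inner_add_right)
      qed (use e(2) h that in \<open>auto intro: less_imp_le\<close>)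
    qed
    then show ?thesis using e(1) by blast
  qed
  have t2: "normal_cone P q = {u. \<forall>d. (\<forall>a\<in>A. a \<bullet> d \<le> 0) \<longrightarrow> u \<bullet> d \<le> 0}" if "q \<in> Fc" for q
    using cone[of q] TgA[OF that] that Fc_act by auto
  have t3: "a \<bullet> (y - q) \<le> 0" if "q \<in> Fc" "y \<in> P" "a \<in> A" for a y q
  proof -
    have "a \<in> n ` act q" using that Fc_act by (simp add: A_def)
    then show ?thesis using \<open>y \<in> P\<close> memP by (auto simp: act_def inner_diff_right)
  qed
  have t4: "a \<bullet> (v0 - q) = 0" if "q \<in> Fc" "a \<in> A" for a q
  proof -
    have "(v0 - x0) - (q - x0) \<in> L"
      by (rule subspace_diff[OF subL]) (use flat[OF that(1)] v0 in \<open>auto simp: VF_def\<close>)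
    then show ?thesis using that by (simp add: L_def)
  qed
  have t5: "Fc \<subseteq> P" using Fc_act by auto
  have ne: "Fc \<noteq> {}" using x0F by blast
  have "face_body c P b A Fc v0"
    by (intro face_body.intro face_body_axioms.intro body b(1,2) v0int t5 ne Fc(2) t1 t2 t3 t4)
  moreover have "codim Fc = int (card (primitive_system.J b))" unfolding b(3) by (rule cd)
  ultimately show ?thesis by blast
qed

section \<open>Asymptotics on the region of a face\<close>

lemma osimplex_uniform:
  fixes K :: "(real ^ 'n) set"
  assumes K: "compact K" "K \<subseteq> osimplex c"
  shows "\<exists>d>0. \<forall>q\<in>K. (\<forall>i. d \<le> q $ i) \<and> (\<Sum>i\<in>UNIV. q $ i) \<le> c - d"
proof -
  obtain e where e: "e > 0" "(\<Union>q\<in>K. ball q e) \<subseteq> osimplex c"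
    using compact_subset_open_imp_ball_epsilon_subset[OF K(1) open_osimplex K(2)] by blast
  have mem: "q + s *\<^sub>R axis j 1 \<in> osimplex c" if "q \<in> K" "\<bar>s\<bar> < e" for q s j
    by (rule subsetD[OF e(2)]) (use that in \<open>auto simp: dist_norm norm_axis_1 intro!: bexI[of _ q]\<close>)
  have "e / 2 \<le> q $ j \<and> (\<Sum>i\<in>UNIV. q $ i) \<le> c - e / 2" if q: "q \<in> K" for q j
  proof
    show "e / 2 \<le> q $ j"
      using mem[OF q, of "- (e / 2)" j] e(1) by (auto simp: osimplex_def axis_def dest!: spec[of _ j])
    have "(\<Sum>i\<in>UNIV. (q + (e/2) *\<^sub>R axis j 1) $ i) = (\<Sum>i\<in>UNIV. q $ i) + e/2"
      by (simp only: vector_add_component vector_scaleR_component sum.distrib real_scaleR_def sum_distrib_left[symmetric])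
        (simp add: axis_def)
    then show "(\<Sum>i\<in>UNIV. q $ i) \<le> c - e / 2"
      using mem[OF q, of "e / 2" j] e(1) by (simp add: osimplex_def)
  qed
  then show ?thesis using e(1) by (intro exI[of _ "e/2"]) auto
qed

context primitive_system
begin

text \<open>The exponent is linear in the covariance matrix \<open>cov y\<close>: \<open>T t\<close>
  is minus one half of the outer square of \<open>comb t\<close>. The integral is therefore a
  Laplace transform on the open set \<open>W\<close> of matrices with Gaussian decay, composed with
  the quadratic map \<open>cov\<close>.\<close>

lemma smooth_on_gaussian: "smooth_on gaussian (osimplex 1)"
proof -
  define T where "T t = (\<chi> i. (- (comb t $ i) / 2) *\<^sub>R comb t)" for t :: "real ^ 'n"
  define W where "W = {w :: real ^ 'n ^ 'n. \<exists>\<delta>>0. \<forall>t. w \<bullet> T t \<le> - (\<delta> * (norm (prj t))\<^sup>2)}"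
  define cov where "cov y = (\<chi> i j. (if i = j then y $ i else 0) - y $ i * y $ j)" for y :: "real ^ 'n"
  have covT: "cov y \<bullet> T t = - (variance y (comb t) / 2)" for y t
  proof -
    let ?x = "comb t"
    have "cov y \<bullet> T t = (\<Sum>i\<in>UNIV. \<Sum>j\<in>UNIV. (if i = j then - (y $ i * (?x $ i)\<^sup>2) / 2 else 0) + (?x $ i * y $ i) * (?x $ j * y $ j) / 2)"
      unfolding inner_vec_def cov_def T_def by (intro sum.cong refl) (auto simp: power2_eq_square field_simps)
    also have "\<dots> = (\<Sum>i\<in>UNIV. \<Sum>j\<in>UNIV. (?x $ i * y $ i) * (?x $ j * y $ j)) / 2 - (\<Sum>i\<in>UNIV. y $ i * (?x $ i)\<^sup>2) / 2"
      by (simp add: sum.distrib sum_divide_distrib sum_negf sum_subtractf)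
    also have "\<dots> = - (variance y ?x / 2)"
      by (simp add: variance_def inner_vec_def power2_eq_square[of "\<Sum>i\<in>UNIV. ?x $ i * y $ i"] sum_product
          sum.distrib sum_divide_distrib[symmetric] sum_negf diff_divide_distrib)
    finally show ?thesis .
  qed
  obtain L where L: "L > 0" "\<And>t. norm (comb t) \<le> L * norm (prj t)" using comb_upper by blast
  obtain l where l: "l > 0" "\<And>t. l * norm (prj t) \<le> norm (comb t)" using comb_lower by blast
  define C where "C = real CARD('n) * L\<^sup>2"
  have C: "C > 0" using L by (simp add: C_def)
  have nT: "norm (T t) \<le> C * (norm (prj t))\<^sup>2" for t
  proof -
    have "norm (T t $ i) \<le> (norm (comb t))\<^sup>2" for i
      using component_le_norm_cart[of "comb t" i] mult_mono[of "\<bar>comb t $ i\<bar> / 2" "norm (comb t)" "norm (comb t)" "norm (comb t)"]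
      by (simp add: T_def power2_eq_square)
    then have "(\<Sum>i\<in>UNIV. norm (T t $ i)) \<le> CARD('n) * (norm (comb t))\<^sup>2"
      using sum_bounded_above[of UNIV "\<lambda>i. norm (T t $ i)" "(norm (comb t))\<^sup>2"] by simp
    moreover have "norm (T t) \<le> (\<Sum>i\<in>UNIV. norm (T t $ i))"
      unfolding norm_vec_def[of "T t"] by (rule L2_set_le_sum) simp
    moreover have "(norm (comb t))\<^sup>2 \<le> (L * norm (prj t))\<^sup>2" by (intro power_mono L(2)) simp
    then have "CARD('n) * (norm (comb t))\<^sup>2 \<le> C * (norm (prj t))\<^sup>2"
      by (simp add: C_def power_mult_distrib mult.assoc)
    ultimately show ?thesis by linarith
  qed
  have openW: "open W" unfolding open_dist
  proof
    fix w assume "w \<in> W"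
    then obtain \<delta> where \<delta>: "\<delta> > 0" "\<And>t. w \<bullet> T t \<le> - (\<delta> * (norm (prj t))\<^sup>2)" by (auto simp: W_def)
    have "w' \<in> W" if w': "dist w' w < \<delta> / (2 * C)" for w'
    proof -
      have "w' \<bullet> T t \<le> - (\<delta> / 2 * (norm (prj t))\<^sup>2)" for t
      proof -
        have "(w' - w) \<bullet> T t \<le> norm (w' - w) * norm (T t)" by (rule norm_cauchy_schwarz)
        also have "\<dots> \<le> \<delta> / (2 * C) * (C * (norm (prj t))\<^sup>2)"
          using w' nT[of t] \<delta> C by (intro mult_mono) (auto simp: dist_norm)
        also have "\<dots> = \<delta> / 2 * (norm (prj t))\<^sup>2" using C by simp
        finally show ?thesis using \<delta>(2)[of t] by (simp add: inner_diff_left)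
      qed
      then show ?thesis using \<delta>(1) unfolding W_def by (intro CollectI exI[of _ "\<delta>/2"]) auto
    qed
    then show "\<exists>e>0. \<forall>y. dist y w < e \<longrightarrow> y \<in> W" using \<delta>(1) C by (intro exI[of _ "\<delta> / (2 * C)"]) auto
  qed
  have contT: "continuous_on UNIV T"
    unfolding T_def using linear_continuous_on[of comb UNIV] linear_comb linear_conv_bounded_linear
    by (intro continuous_on_vec_lambda continuous_intros) auto
  have "smooth_on (\<lambda>w. \<integral>t. indicator (slab J) t * exp (w \<bullet> T t) \<partial>lborel) W"
  proof (rule laplace_smooth[OF openW])
    show mT: "T \<in> borel_measurable lborel" using borel_measurable_continuous_onI[OF contT] by simp
    show ms: "indicator (slab J) \<in> borel_measurable lborel" using closed_slab[of J] by simp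
    fix w assume "w \<in> W"
    then obtain \<delta> where \<delta>: "\<delta> > 0" "\<And>t. w \<bullet> T t \<le> - (\<delta> * (norm (prj t))\<^sup>2)" by (auto simp: W_def)
    show "integrable lborel (\<lambda>t. \<bar>indicator (slab J) t\<bar> * exp (w \<bullet> T t) :: real)"
    proof (rule Bochner_Integration.integrable_bound[OF integrable_slab_gaussian[OF \<delta>(1), of J]])
      show "(\<lambda>t. \<bar>indicator (slab J) t\<bar> * exp (w \<bullet> T t) :: real) \<in> borel_measurable lborel"
        using mT ms by measurable
    qed (use \<delta>(2) in \<open>auto simp: indicator_def\<close>)
  qed
  note 1 = this
  have 2: "cov ` osimplex 1 \<subseteq> W"
  proof (clarify)
    fix y :: "real ^ 'n" assume "y \<in> osimplex 1"
    then obtain d where d: "d > 0" "\<And>i. d \<le> y $ i" "(\<Sum>i\<in>UNIV. y $ i) \<le> 1 - d"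
      using osimplex_uniform[of "{y}" 1] by auto
    have "cov y \<bullet> T t \<le> - ((d * l)\<^sup>2 / 2 * (norm (prj t))\<^sup>2)" for t
    proof -
      have "(d * l)\<^sup>2 * (norm (prj t))\<^sup>2 = d\<^sup>2 * (l * norm (prj t))\<^sup>2" by (simp add: power_mult_distrib)
      also have "\<dots> \<le> d\<^sup>2 * (norm (comb t))\<^sup>2" using l by (intro mult_left_mono power_mono) auto
      also have "\<dots> \<le> variance y (comb t)" by (rule variance_bounds(1)[OF d])
      finally show ?thesis by (simp add: covT)
    qed
    then show "cov y \<in> W" unfolding W_def using d(1) l(1) by (intro CollectI exI[of _ "(d * l)\<^sup>2 / 2"]) auto
  qed
  have 3: "smooth_on (\<lambda>y. cov y \<bullet> i) (osimplex 1)" if "i \<in> Basis" for i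
  proof -
    have comp: "smooth_on (\<lambda>y. y $ k) (osimplex 1)" for k
      by (intro smooth_on_linear bounded_linear_vec_nth open_osimplex)
    have "smooth_on (\<lambda>y. if j = k then y $ j else 0) (osimplex 1)" for j k :: 'n
      using comp smooth_on_const by (cases "j = k") simp_all
    then have "smooth_on (\<lambda>y. cov y $ j $ k) (osimplex 1)" for j k
      unfolding cov_def vec_lambda_beta by (intro smooth_on_diff smooth_on_mult comp open_osimplex)
    then show ?thesis using that by (auto simp: Basis_vec_def inner_axis)
  qed
  from smooth_on_compose[OF open_osimplex openW 2 1 3]
  have "smooth_on (\<lambda>y. \<integral>t. indicator (slab J) t * exp (cov y \<bullet> T t) \<partial>lborel) (osimplex 1)" .
  then show ?thesis unfolding gaussian_def[abs_def] covT .
qed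

end

section \<open>Exponential sums over integral vectors\<close>

lemma int_exp_sum_bound:
  assumes "\<epsilon> > 0"
  shows "(\<Sum>k\<in>{-int M..int M}. exp (- (\<epsilon> * \<bar>real_of_int k\<bar>))) \<le> 2 / (1 - exp (- \<epsilon>))"
proof -
  let ?g = "\<lambda>k. exp (- (\<epsilon> * \<bar>real_of_int k\<bar>))"
  have x: "norm (exp (- \<epsilon>)) < 1" using assms by simp
  have pos: "(\<Sum>k\<in>int ` {..M}. ?g k) \<le> 1 / (1 - exp (- \<epsilon>))"
  proof -
    have "(\<Sum>k\<in>int ` {..M}. ?g k) = (\<Sum>k\<le>M. exp (- \<epsilon>) ^ k)"
      by (simp add: sum.reindex exp_of_nat_mult[symmetric] mult.commute)
    also have "\<dots> \<le> (\<Sum>k. exp (- \<epsilon>) ^ k)" by (rule sum_le_suminf[OF summable_geometric[OF x]]) auto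
    also have "\<dots> = 1 / (1 - exp (- \<epsilon>))" by (rule suminf_geometric[OF x])
    finally show ?thesis .
  qed
  have eq: "{-int M..int M} = int ` {..M} \<union> uminus ` int ` {..M}"
  proof (intro equalityI subsetI)
    fix k assume k: "k \<in> {-int M..int M}"
    show "k \<in> int ` {..M} \<union> uminus ` int ` {..M}"
    proof (cases "k \<ge> 0")
      case True
      then have "k = int (nat k)" "nat k \<in> {..M}" using k by auto
      then show ?thesis by blast
    next
      case False
      then have "k = - int (nat (- k))" "nat (- k) \<in> {..M}" using k by auto
      then show ?thesis by blast
    qed
  qed auto
  have "(\<Sum>k\<in>{-int M..int M}. ?g k) \<le> (\<Sum>k\<in>int ` {..M}. ?g k) + (\<Sum>k\<in>uminus ` int ` {..M}. ?g k)"
    unfolding eq using sum.union_inter[of "int ` {..M}" "uminus ` int ` {..M}" ?g]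
      sum_nonneg[of "int ` {..M} \<inter> uminus ` int ` {..M}" ?g] by simp
  also have "(\<Sum>k\<in>uminus ` int ` {..M}. ?g k) = (\<Sum>k\<in>int ` {..M}. ?g k)"
    by (subst sum.reindex) (auto simp: inj_on_def)
  finally show ?thesis using pos by simp
qed

text \<open>The norm dominates the average of the coordinate moduli, so finite partial sums are
  bounded by a product of two-sided geometric series.\<close>

lemma integrable_exp_norm_int_vecs:
  assumes \<delta>: "\<delta> > 0"
  shows "integrable (count_space (int_vecs :: (real ^ 'n) set)) (\<lambda>\<kappa>. exp (- (\<delta> * norm \<kappa>)))"
proof -
  define \<epsilon> where "\<epsilon> = \<delta> / CARD('n)"
  have \<epsilon>: "\<epsilon> > 0" using \<delta> by (simp add: \<epsilon>_def)
  define B where "B = (2 / (1 - exp (- \<epsilon>))) ^ CARD('n)"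
  have le: "exp (- (\<delta> * norm \<kappa>)) \<le> (\<Prod>j\<in>UNIV. exp (- (\<epsilon> * \<bar>\<kappa> $ j\<bar>)))" for \<kappa> :: "real ^ 'n"
  proof -
    have "(\<Sum>j\<in>UNIV. \<epsilon> * \<bar>\<kappa> $ j\<bar>) \<le> (\<Sum>j\<in>(UNIV :: 'n set). \<epsilon> * norm \<kappa>)"
      using \<epsilon> component_le_norm_cart by (intro sum_mono mult_left_mono) auto
    also have "\<dots> = \<delta> * norm \<kappa>" by (simp add: \<epsilon>_def)
    finally show ?thesis by (simp add: exp_sum[symmetric] sum_negf)
  qed
  have bound: "(\<Sum>\<kappa>\<in>F. exp (- (\<delta> * norm \<kappa>))) \<le> B" if F: "F \<subseteq> int_vecs" "finite F" for F :: "(real ^ 'n) set"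
  proof -
    obtain R where R: "\<And>x. x \<in> F \<Longrightarrow> norm x \<le> R" using finite_imp_bounded[OF F(2)] bounded_iff by blast
    define M where "M = nat \<lceil>\<bar>R\<bar>\<rceil>"
    define h where "h f = (\<chi> j. real_of_int (f j))" for f :: "'n \<Rightarrow> int"
    let ?B = "PiE (UNIV :: 'n set) (\<lambda>_. {-int M..int M})"
    have "F \<subseteq> h ` ?B"
    proof
      fix x assume x: "x \<in> F"
      then have xi: "\<And>j. x $ j \<in> \<int>" using F(1) by (auto simp: int_vecs_def)
      have "x = h (\<lambda>j. \<lfloor>x $ j\<rfloor>)" using xi by (auto simp: h_def vec_eq_iff elim!: Ints_cases)
      moreover have "\<lfloor>x $ j\<rfloor> \<in> {-int M..int M}" for j
      proof -
        have "\<bar>x $ j\<bar> \<le> real M" using component_le_norm_cart[of x j] R[OF x] unfolding M_def by linarith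
        moreover obtain k where "x $ j = of_int k" using xi[of j] by (auto elim: Ints_cases)
        ultimately show ?thesis by auto
      qed
      ultimately show "x \<in> h ` ?B" by (auto simp: PiE_def)
    qed
    then have "(\<Sum>\<kappa>\<in>F. exp (- (\<delta> * norm \<kappa>))) \<le> (\<Sum>\<kappa>\<in>h ` ?B. exp (- (\<delta> * norm \<kappa>)))"
      by (intro sum_mono2 finite_imageI finite_PiE) auto
    also have "\<dots> = (\<Sum>f\<in>?B. exp (- (\<delta> * norm (h f))))"
      by (subst sum.reindex) (auto simp: inj_on_def h_def vec_eq_iff fun_eq_iff)
    also have "\<dots> \<le> (\<Sum>f\<in>?B. \<Prod>j\<in>UNIV. exp (- (\<epsilon> * \<bar>real_of_int (f j)\<bar>)))"
      using le by (intro sum_mono) (metis (no_types, lifting) h_def prod.cong vec_lambda_beta)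
    also have "\<dots> = (\<Prod>j\<in>(UNIV :: 'n set). \<Sum>k\<in>{-int M..int M}. exp (- (\<epsilon> * \<bar>real_of_int k\<bar>)))"
      by (rule prod_sum_PiE[symmetric]) auto
    also have "\<dots> \<le> (\<Prod>j\<in>(UNIV :: 'n set). 2 / (1 - exp (- \<epsilon>)))"
      using int_exp_sum_bound[OF \<epsilon>] by (intro prod_mono) (auto intro: sum_nonneg)
    finally show ?thesis by (simp add: B_def)
  qed
  have "(\<lambda>\<kappa>. exp (- (\<delta> * norm \<kappa>))) summable_on (int_vecs :: (real ^ 'n) set)"
    by (rule nonneg_bdd_above_summable_on) (use bound in \<open>auto simp: bdd_above_def\<close>)
  then have "Infinite_Sum.abs_summable_on (\<lambda>\<kappa>. exp (- (\<delta> * norm \<kappa>))) (int_vecs :: (real ^ 'n) set)" by simp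
  then show ?thesis using abs_summable_equivalent Infinite_Set_Sum.abs_summable_on_def by blast
qed

lemma integrable_weighted_exp_norm:
  assumes \<delta>: "\<delta> > 0"
  shows "integrable (count_space (int_vecs :: (real ^ 'n) set)) (\<lambda>\<kappa>. (1 + (norm \<kappa>)\<^sup>2) * exp (- (\<delta> * norm \<kappa>)))"
proof (rule Bochner_Integration.integrable_bound)
  define D where "D = 1 + (real 2 / (\<delta>/2))\<^sup>2"
  show "integrable (count_space (int_vecs :: (real ^ 'n) set)) (\<lambda>\<kappa>. D * exp (- (\<delta>/2 * norm \<kappa>)))"
    using \<delta> by (intro integrable_mult_right integrable_exp_norm_int_vecs) simp
  show "AE \<kappa> in count_space (int_vecs :: (real ^ 'n) set). norm ((1 + (norm \<kappa>)\<^sup>2) * exp (- (\<delta> * norm \<kappa>))) \<le> norm (D * exp (- (\<delta>/2 * norm \<kappa>)))"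
  proof (rule AE_I2)
    fix \<kappa> :: "real ^ 'n"
    have p: "(norm \<kappa>)\<^sup>2 \<le> (real 2 / (\<delta>/2))\<^sup>2 * exp (\<delta>/2 * norm \<kappa>)" using \<delta> by (intro power_times_exp_bound) auto
    have o: "1 \<le> exp (\<delta>/2 * norm \<kappa>)" using \<delta> by (intro one_le_exp_iff[THEN iffD2]) simp
    have "1 + (norm \<kappa>)\<^sup>2 \<le> D * exp (\<delta>/2 * norm \<kappa>)" unfolding D_def distrib_right mult_1 by (rule add_mono[OF o p])
    then have "(1 + (norm \<kappa>)\<^sup>2) * exp (- (\<delta> * norm \<kappa>)) \<le> D * exp (\<delta>/2 * norm \<kappa>) * exp (- (\<delta> * norm \<kappa>))"
      by (rule mult_right_mono) simp
    also have "\<dots> = D * exp (- (\<delta>/2 * norm \<kappa>))" by (simp add: mult_exp_exp)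
    finally show "norm ((1 + (norm \<kappa>)\<^sup>2) * exp (- (\<delta> * norm \<kappa>))) \<le> norm (D * exp (- (\<delta>/2 * norm \<kappa>)))"
      by (simp add: D_def)
  qed
qed simp

lemma integrable_count_space_mono:
  fixes f :: "'a \<Rightarrow> real"
  assumes "integrable (count_space B) f" "A \<subseteq> B"
  shows "integrable (count_space A) f"
  using assms Infinite_Set_Sum.abs_summable_on_subset unfolding Infinite_Set_Sum.abs_summable_on_def by blast

text \<open>Written as an integral for counting measure so that \<open>laplace_smooth\<close>
  applies.\<close>

definition lattice_sum :: "(real ^ 'n) set \<Rightarrow> real ^ 'n \<Rightarrow> real" where
  "lattice_sum S \<sigma> = (\<integral>\<kappa>. exp (\<sigma> \<bullet> \<kappa>) \<partial>count_space S)"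

definition decaying :: "(real ^ 'n) set \<Rightarrow> (real ^ 'n) set" where
  "decaying S = {\<sigma>. \<exists>\<delta>>0. \<forall>\<kappa>\<in>S. \<sigma> \<bullet> \<kappa> \<le> - (\<delta> * norm \<kappa>)}"

lemma open_decaying: "open (decaying S)"
  unfolding open_dist
proof
  fix \<sigma> assume "\<sigma> \<in> decaying S"
  then obtain \<delta> where \<delta>: "\<delta> > 0" "\<And>\<kappa>. \<kappa> \<in> S \<Longrightarrow> \<sigma> \<bullet> \<kappa> \<le> - (\<delta> * norm \<kappa>)" by (auto simp: decaying_def)
  have "\<sigma>' \<in> decaying S" if "dist \<sigma>' \<sigma> < \<delta> / 2" for \<sigma>'
  proof -
    have "\<sigma>' \<bullet> \<kappa> \<le> - (\<delta> / 2 * norm \<kappa>)" if "\<kappa> \<in> S" for \<kappa>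
    proof -
      have "(\<sigma>' - \<sigma>) \<bullet> \<kappa> \<le> norm (\<sigma>' - \<sigma>) * norm \<kappa>" by (rule norm_cauchy_schwarz)
      also have "\<dots> \<le> \<delta> / 2 * norm \<kappa>" using \<open>dist \<sigma>' \<sigma> < \<delta> / 2\<close> by (intro mult_right_mono) (auto simp: dist_norm)
      finally show ?thesis using \<delta>(2)[OF that] by (simp add: inner_diff_left)
    qed
    then show ?thesis using \<delta>(1) unfolding decaying_def by (intro CollectI exI[of _ "\<delta>/2"]) auto
  qed
  then show "\<exists>e>0. \<forall>y. dist y \<sigma> < e \<longrightarrow> y \<in> decaying S" using \<delta>(1) by (intro exI[of _ "\<delta>/2"]) auto
qed

lemma integrable_lattice_sum:
  assumes "S \<subseteq> int_vecs" "\<sigma> \<in> decaying S"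
  shows "integrable (count_space S) (\<lambda>\<kappa>. exp (\<sigma> \<bullet> \<kappa>))"
proof -
  obtain \<delta> where \<delta>: "\<delta> > 0" "\<And>\<kappa>. \<kappa> \<in> S \<Longrightarrow> \<sigma> \<bullet> \<kappa> \<le> - (\<delta> * norm \<kappa>)" using assms by (auto simp: decaying_def)
  show ?thesis
    by (rule Bochner_Integration.integrable_bound[OF integrable_count_space_mono[OF integrable_exp_norm_int_vecs[OF \<delta>(1)] assms(1)]])
      (use \<delta>(2) in \<open>auto intro!: AE_I2\<close>)
qed

lemma smooth_on_lattice_sum:
  fixes S :: "(real ^ 'n) set"
  assumes "S \<subseteq> int_vecs"
  shows "smooth_on (lattice_sum S) (decaying S)"
proof -
  have "smooth_on (\<lambda>w. \<integral>\<kappa>. 1 * exp (w \<bullet> \<kappa>) \<partial>count_space S) (decaying S)"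
    by (rule laplace_smooth[OF open_decaying]) (use integrable_lattice_sum[OF assms] in auto)
  then show ?thesis by (simp add: lattice_sum_def[abs_def])
qed

lemma int_vecs_scale_nat: "x \<in> int_vecs \<Longrightarrow> real N *\<^sub>R x \<in> int_vecs"
  by (rule int_vecs_scale) simp

context face_body
begin

text \<open>Lattice points are translated by \<open>N\<close> times the integral point
  \<open>v0\<close> of the affine hull of the face. This makes the index set of the groups
  independent of \<open>N\<close> and of the point of the face.\<close>

definition cone_values :: "(real ^ 'n) set" where "cone_values = dual ` (tcone \<inter> int_vecs)"

text \<open>The choice is immaterial: \<open>coset_weight\<close> depends on its argument only
  through \<open>dual\<close>.\<close>

definition lift :: "real ^ 'n \<Rightarrow> real ^ 'n" where
  "lift \<kappa> = (SOME \<beta>. \<beta> \<in> tcone \<inter> int_vecs \<and> dual \<beta> = \<kappa>)"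

text \<open>A linear section of \<open>comb\<close>, fixed once, so that smoothness in the
  multiplier is inherited by its coordinates.\<close>

definition coord :: "real ^ 'n \<Rightarrow> real ^ 'n" where
  "coord = (SOME g. linear g \<and> (\<forall>w\<in>span A. comb (g w) = w))"

lemma cone_values_int: "cone_values \<subseteq> int_vecs"
  using dual_int by (auto simp: cone_values_def)

lemma lift: "\<kappa> \<in> cone_values \<Longrightarrow> lift \<kappa> \<in> tcone \<inter> int_vecs \<and> dual (lift \<kappa>) = \<kappa>"
  unfolding lift_def cone_values_def by (rule someI_ex) blast

lemma coord: "linear coord" "w \<in> span A \<Longrightarrow> comb (coord w) = w"
proof -
  have "\<exists>g. linear g \<and> (\<forall>w\<in>span A. comb (g w) = w)"
    using linear_exists_right_inverse_on[OF linear_comb subspace_UNIV] range_comb by metis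
  from someI_ex[OF this] show "linear coord" "w \<in> span A \<Longrightarrow> comb (coord w) = w" by (auto simp: coord_def)
qed

lemma linear_dual: "linear dual"
  by (rule linearI) (simp_all add: dual_def vec_eq_iff inner_add_right)

lemma dual_flat: "q \<in> Fc \<Longrightarrow> dual (v0 - q) = 0"
proof -
  assume q: "q \<in> Fc"
  have "b j \<in> span A" for j
  proof -
    have "comb (axis j 1) = b j"
      by (simp add: comb_def axis_def if_distrib[of "\<lambda>x. x *\<^sub>R _"] cong: if_cong)
    then show ?thesis using range_comb by (metis rangeI)
  qed
  then show ?thesis using flat_span[OF q] by (simp add: dual_def vec_eq_iff)
qed

text \<open>Every constraint normal is in the range of \<open>comb\<close>, so the values of
  \<open>dual\<close> decide membership; no group of lattice points is split by the boundary of the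
  cone.\<close>

lemma tcone_dual: "d \<in> tcone \<Longrightarrow> dual d' = dual d \<Longrightarrow> d' \<in> tcone"
proof -
  assume d: "d \<in> tcone" "dual d' = dual d"
  have "a \<bullet> d' \<le> 0" if a: "a \<in> A" for a
  proof -
    obtain t where "a = comb t" using range_comb span_base[OF a] by blast
    then have "a \<bullet> d' = a \<bullet> d" by (simp add: comb_inner d(2))
    then show ?thesis using d(1) a by (simp add: tcone_def)
  qed
  then show ?thesis by (simp add: tcone_def)
qed

lemma coord_decaying:
  assumes K: "compact K" "K \<subseteq> face_dom"
  shows "\<exists>\<delta>>0. \<forall>r\<in>K. \<forall>\<kappa>\<in>cone_values. coord (mult r) \<bullet> \<kappa> \<le> - (\<delta> * norm \<kappa>)"
proof -
  obtain \<delta> where \<delta>: "\<delta> > 0" "\<And>r d. r \<in> K \<Longrightarrow> d \<in> tcone \<Longrightarrow> mult r \<bullet> d \<le> - (\<delta> * norm (dual d))"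
    using mult_interior_cone[OF K] by blast
  have "coord (mult r) \<bullet> \<kappa> \<le> - (\<delta> * norm \<kappa>)" if r: "r \<in> K" and \<kappa>: "\<kappa> \<in> cone_values" for r \<kappa>
  proof -
    have "comb (coord (mult r)) = mult r" using r K(2) by (intro coord(2) mult_span opt_Fc) auto
    then show ?thesis using \<delta>(2)[OF r, of "lift \<kappa>"] lift[OF \<kappa>] comb_inner[of "coord (mult r)" "lift \<kappa>"] by simp
  qed
  then show ?thesis using \<delta>(1) by blast
qed

text \<open>For \<open>u\<close> in \<open>span A\<close> the exponent depends on \<alpha> only
  through \<open>dual\<close>, and \<open>v0 - q\<close> has dual 0, so the sum is grouped by the
  fibres of \<open>dual\<close>. The integral over the infinite index set has finite support, as
  only finitely many \<alpha> occur.\<close>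

lemma cone_sum_eq:
  assumes q: "q \<in> Fc" and u: "u \<in> span A"
  shows "(\<Sum>\<alpha> | \<alpha> \<in> mexps n \<and> rvec \<alpha> - real N *\<^sub>R v0 \<in> tcone. mweight n y \<alpha> * exp ((rvec \<alpha> - real N *\<^sub>R q) \<bullet> u)) =
    (\<integral>\<kappa>. exp (coord u \<bullet> \<kappa>) * coset_weight n y (real N *\<^sub>R v0 + lift \<kappa>) \<partial>count_space cone_values)"
proof -
  define T where "T = {\<alpha> \<in> mexps n. rvec \<alpha> - real N *\<^sub>R v0 \<in> tcone}"
  define k where "k \<alpha> = dual (rvec \<alpha> - real N *\<^sub>R v0)" for \<alpha>
  have finT: "finite T" using finite_mexps by (simp add: T_def)
  have kT: "k ` T \<subseteq> cone_values"
    using v0 by (auto simp: k_def T_def cone_values_def intro!: imageI int_vecs_diff rvec_int int_vecs_scale_nat)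
  have w: "exp ((rvec \<alpha> - real N *\<^sub>R q) \<bullet> u) = exp (coord u \<bullet> k \<alpha>)" for \<alpha>
  proof -
    have "k \<alpha> = dual (rvec \<alpha> - real N *\<^sub>R q) - real N *\<^sub>R dual (v0 - q)"
      by (simp add: k_def linear_diff[OF linear_dual, symmetric] linear_scale[OF linear_dual, symmetric] algebra_simps)
    then have "coord u \<bullet> k \<alpha> = comb (coord u) \<bullet> (rvec \<alpha> - real N *\<^sub>R q)"
      using dual_flat[OF q] by (simp add: comb_inner)
    then show ?thesis using coord(2)[OF u] by (simp add: inner_commute)
  qed
  have cw: "coset_weight n y (real N *\<^sub>R v0 + lift \<kappa>) = (\<Sum>\<alpha> | \<alpha> \<in> T \<and> k \<alpha> = \<kappa>. mweight n y \<alpha>)" if \<kappa>: "\<kappa> \<in> cone_values" for \<kappa>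
  proof -
    have "dual (rvec \<alpha> - (real N *\<^sub>R v0 + lift \<kappa>)) = k \<alpha> - \<kappa>" for \<alpha>
      using lift[OF \<kappa>] by (simp add: k_def linear_diff[OF linear_dual] linear_add[OF linear_dual])
    moreover have "rvec \<alpha> - real N *\<^sub>R v0 \<in> tcone" if "k \<alpha> = \<kappa>" for \<alpha>
      using tcone_dual[of "lift \<kappa>"] lift[OF \<kappa>] that by (simp add: k_def)
    ultimately have "{\<alpha>. \<alpha> \<in> mexps n \<and> dual (rvec \<alpha> - (real N *\<^sub>R v0 + lift \<kappa>)) = 0} = {\<alpha>. \<alpha> \<in> T \<and> k \<alpha> = \<kappa>}"
      by (auto simp: T_def)
    then show ?thesis by (simp add: coset_weight_def)
  qed
  let ?f = "\<lambda>\<kappa>. exp (coord u \<bullet> \<kappa>) * coset_weight n y (real N *\<^sub>R v0 + lift \<kappa>)"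
  have zero: "?f \<kappa> = 0" if "\<kappa> \<in> cone_values - k ` T" for \<kappa>
  proof -
    have "{\<alpha>. \<alpha> \<in> T \<and> k \<alpha> = \<kappa>} = {}" using that by blast
    then show ?thesis using cw[of \<kappa>] that by (simp only: sum.empty) simp
  qed
  have supp: "{\<kappa> \<in> cone_values. ?f \<kappa> \<noteq> 0} \<subseteq> k ` T" using zero by blast
  have "(\<integral>\<kappa>. ?f \<kappa> \<partial>count_space cone_values) = (\<Sum>\<kappa> | \<kappa> \<in> cone_values \<and> ?f \<kappa> \<noteq> 0. ?f \<kappa>)"
    by (rule lebesgue_integral_count_space_finite_support) (rule finite_subset[OF supp finite_imageI[OF finT]])
  also have "\<dots> = (\<Sum>\<kappa>\<in>k ` T. ?f \<kappa>)"
    by (rule sum.mono_neutral_left) (use finT supp kT in auto)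
  also have "\<dots> = (\<Sum>\<kappa>\<in>k ` T. \<Sum>\<alpha> | \<alpha> \<in> T \<and> k \<alpha> = \<kappa>. mweight n y \<alpha> * exp (coord u \<bullet> k \<alpha>))"
  proof (rule sum.cong[OF refl])
    fix \<kappa> assume "\<kappa> \<in> k ` T"
    then have "\<kappa> \<in> cone_values" using kT by blast
    then show "?f \<kappa> = (\<Sum>\<alpha> | \<alpha> \<in> T \<and> k \<alpha> = \<kappa>. mweight n y \<alpha> * exp (coord u \<bullet> k \<alpha>))"
      by (simp add: cw sum_distrib_left mult.commute)
  qed
  also have "\<dots> = (\<Sum>\<alpha>\<in>T. mweight n y \<alpha> * exp (coord u \<bullet> k \<alpha>))"
    by (rule sum.group[OF finT finite_imageI[OF finT] order_refl])
  finally show ?thesis by (simp add: T_def w)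
qed

text \<open>What is left of the mass after the exponential factor is extracted: the law is recentred
  at \<open>opt r\<close>, and the last factor is at most one because \<open>mult r\<close> is
  normal to \<open>P\<close> at \<open>opt r\<close>.\<close>

definition tilted_sum :: "nat \<Rightarrow> nat \<Rightarrow> real ^ 'n \<Rightarrow> real" where
  "tilted_sum p N r = (\<Sum>\<alpha>\<in>exponents N P. mweight (N * p) ((1 / c) *\<^sub>R opt r) \<alpha> *
     exp ((rvec \<alpha> - real N *\<^sub>R opt r) \<bullet> mult r))"

lemma mem_exponents_iff: "N > 0 \<Longrightarrow> \<alpha> \<in> exponents N P \<longleftrightarrow> (1 / real N) *\<^sub>R rvec \<alpha> \<in> P"
  unfolding exponents_def rvec_def[symmetric] by (auto simp: image_iff intro!: bexI[of _ "(1 / real N) *\<^sub>R rvec \<alpha>"])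

lemma exponents_tcone:
  assumes "\<alpha> \<in> exponents N P"
  shows "rvec \<alpha> - real N *\<^sub>R v0 \<in> tcone"
proof -
  obtain x where x: "x \<in> P" "rvec \<alpha> = real N *\<^sub>R x" using assms by (auto simp: exponents_def rvec_def[symmetric])
  obtain q where q: "q \<in> Fc" using Fc(2) by blast
  have "a \<bullet> (rvec \<alpha> - real N *\<^sub>R v0) \<le> 0" if a: "a \<in> A" for a
  proof -
    have "a \<bullet> (rvec \<alpha> - real N *\<^sub>R v0) = real N * (a \<bullet> (x - q) - a \<bullet> (v0 - q))"
      by (simp add: x(2) inner_diff_right algebra_simps)
    also have "\<dots> \<le> 0" using supported[OF q x(1) a] flat[OF q a] by (simp add: mult_nonneg_nonpos)
    finally show ?thesis .
  qed
  then show ?thesis by (simp add: tcone_def)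
qed

text \<open>Near \<open>opt r\<close> the polytope contains the translated tangent cone, so lattice
  points of the cone outside \<open>N P\<close> lie at distance of order \<open>N\<close> from the
  mean. The tilt is at most one on the cone, and the multinomial tail bound finishes.\<close>

lemma tilted_sum_cone:
  assumes p: "p > 0" "c = real p" and K: "compact K" "K \<subseteq> face_dom"
  shows "\<exists>\<epsilon>>0. \<forall>N>0. \<forall>r\<in>K.
    \<bar>tilted_sum p N r - (\<Sum>\<alpha> | \<alpha> \<in> mexps (N * p) \<and> rvec \<alpha> - real N *\<^sub>R v0 \<in> tcone.
      mweight (N * p) ((1 / c) *\<^sub>R opt r) \<alpha> * exp ((rvec \<alpha> - real N *\<^sub>R opt r) \<bullet> mult r))\<bar>
    \<le> 2 * CARD('n) * exp (- (\<epsilon> * real (N * p)))"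
proof -
  have "compact (opt ` K)" using K(1) by (intro compact_continuous_image continuous_on_opt)
  moreover have "opt ` K \<subseteq> Fc" using K(2) opt_Fc by blast
  ultimately obtain e where e: "e > 0" "\<And>r d. r \<in> K \<Longrightarrow> d \<in> tcone \<Longrightarrow> norm d < e \<Longrightarrow> opt r + d \<in> P"
    using tangent[of "opt ` K"] unfolding tcone_def by blast
  \<comment> \<open>The distance \<open>e * N\<close> is the relative deviation \<open>e / p\<close>
    of \<open>N * p\<close> trials; \<open>mweight_tail\<close> asks for a value of at most
    one.\<close>
  define \<eta> where "\<eta> = min 1 (e / real p)"
  have \<eta>: "0 < \<eta>" "\<eta> \<le> 1" using e p by (auto simp: \<eta>_def)
  define \<epsilon> where "\<epsilon> = (\<eta> / CARD('n))\<^sup>2 / 4"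
  have PS: "P \<subseteq> scaled_simplex p" unfolding scaled_simplex_eq[OF p(1)] using P(3) p(2) by simp
  have "\<bar>tilted_sum p N r - (\<Sum>\<alpha> | \<alpha> \<in> mexps (N * p) \<and> rvec \<alpha> - real N *\<^sub>R v0 \<in> tcone.
      mweight (N * p) ((1 / c) *\<^sub>R opt r) \<alpha> * exp ((rvec \<alpha> - real N *\<^sub>R opt r) \<bullet> mult r))\<bar>
    \<le> 2 * CARD('n) * exp (- (\<epsilon> * real (N * p)))" if N: "N > 0" and r: "r \<in> K" for N r
  proof -
    let ?n = "N * p" and ?y = "(1 / c) *\<^sub>R opt r"
    let ?T = "{\<alpha>. \<alpha> \<in> mexps ?n \<and> rvec \<alpha> - real N *\<^sub>R v0 \<in> tcone}"
    let ?h = "\<lambda>\<alpha>. mweight ?n ?y \<alpha> * exp ((rvec \<alpha> - real N *\<^sub>R opt r) \<bullet> mult r)"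
    let ?B = "{\<alpha>. \<alpha> \<in> mexps ?n \<and> norm (rvec \<alpha> - real ?n *\<^sub>R ?y) \<ge> \<eta> * real ?n}"
    have q: "opt r \<in> Fc" using r K(2) opt_Fc by blast
    have y0: "?y $ j \<ge> 0" for j using opt(2)[of r] c by (auto simp: osimplex_def less_imp_le)
    have y1: "(\<Sum>j\<in>UNIV. ?y $ j) \<le> 1" using opt(2)[of r] c by (simp add: osimplex_def sum_divide_distrib[symmetric])
    have ny: "real ?n *\<^sub>R ?y = real N *\<^sub>R opt r" using p by simp
    have finT: "finite ?T" using finite_mexps by simp
    have ET: "exponents N P \<subseteq> ?T" using finite_exponents(1)[OF PS] exponents_tcone by blast
    have tc: "rvec \<alpha> - real N *\<^sub>R opt r \<in> tcone" if "\<alpha> \<in> ?T" for \<alpha>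
    proof -
      have "dual (rvec \<alpha> - real N *\<^sub>R opt r) = dual (rvec \<alpha> - real N *\<^sub>R v0)"
      proof -
        have "dual (rvec \<alpha> - real N *\<^sub>R opt r) = dual (rvec \<alpha> - real N *\<^sub>R v0) + real N *\<^sub>R dual (v0 - opt r)"
          by (simp add: linear_add[OF linear_dual, symmetric] linear_scale[OF linear_dual, symmetric] algebra_simps)
        then show ?thesis using dual_flat[OF q] by simp
      qed
      then show ?thesis using that tcone_dual by blast
    qed
    have e1: "exp ((rvec \<alpha> - real N *\<^sub>R opt r) \<bullet> mult r) \<le> 1" if "\<alpha> \<in> ?T" for \<alpha>
    proof -
      have "mult r \<bullet> (rvec \<alpha> - real N *\<^sub>R opt r) \<le> 0"
        using tc[OF that] opt(3)[of r] unfolding cone[OF q] tcone_def by blast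
      then show ?thesis by (simp add: inner_commute)
    qed
    have far: "?T - exponents N P \<subseteq> ?B"
    proof
      fix \<alpha> assume \<alpha>: "\<alpha> \<in> ?T - exponents N P"
      let ?d = "(1 / real N) *\<^sub>R (rvec \<alpha> - real N *\<^sub>R opt r)"
      have "?d \<in> tcone" using tc[of \<alpha>] \<alpha> by (auto simp: tcone_def divide_nonpos_nonneg)
      moreover have "opt r + ?d \<notin> P" using \<alpha> N mem_exponents_iff[OF N, of \<alpha>] by (simp add: scaleR_diff_right)
      ultimately have "norm ?d \<ge> e" using e(2)[OF r] by (meson not_le)
      then have "e \<le> norm (rvec \<alpha> - real N *\<^sub>R opt r) / real N" unfolding norm_scaleR by simp
      then have "e * real N \<le> norm (rvec \<alpha> - real N *\<^sub>R opt r)" using N by (simp add: pos_le_divide_eq)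
      moreover have "\<eta> * real ?n \<le> e / real p * real ?n" unfolding \<eta>_def by (intro mult_right_mono) auto
      moreover have "e / real p * real ?n = e * real N" using p(1) by simp
      ultimately show "\<alpha> \<in> ?B" using \<alpha> unfolding ny by auto
    qed
    have mw: "0 \<le> mweight ?n ?y \<alpha>" for \<alpha> using y0 y1 by (intro mweight_nonneg)
    have "(\<Sum>\<alpha>\<in>?T. ?h \<alpha>) - tilted_sum p N r = (\<Sum>\<alpha>\<in>?T - exponents N P. ?h \<alpha>)"
      unfolding tilted_sum_def using sum_diff[OF finT ET, of ?h] by simp
    moreover have "0 \<le> (\<Sum>\<alpha>\<in>?T - exponents N P. ?h \<alpha>)" using mw by (intro sum_nonneg) simp
    moreover have "(\<Sum>\<alpha>\<in>?T - exponents N P. ?h \<alpha>) \<le> (\<Sum>\<alpha>\<in>?T - exponents N P. mweight ?n ?y \<alpha>)"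
      using mw e1 by (intro sum_mono) (simp add: mult_left_le)
    moreover have "(\<Sum>\<alpha>\<in>?T - exponents N P. mweight ?n ?y \<alpha>) \<le> (\<Sum>\<alpha>\<in>?B. mweight ?n ?y \<alpha>)"
      using far mw finite_mexps by (intro sum_mono2) auto
    moreover have "(\<Sum>\<alpha>\<in>?B. mweight ?n ?y \<alpha>) \<le> 2 * CARD('n) * exp (- (\<epsilon> * real ?n))"
      using mweight_tail[of ?y \<eta> ?n, OF y0 y1 \<eta>] by (simp add: \<epsilon>_def mult.commute)
    ultimately show ?thesis by linarith
  qed
  moreover have "\<epsilon> > 0" using \<eta> by (simp add: \<epsilon>_def)
  ultimately show ?thesis by blast
qed

definition face_amplitude :: "real ^ 'n \<Rightarrow> real" where
  "face_amplitude r = gaussian ((1 / c) *\<^sub>R opt r) * lattice_sum cone_values (coord (mult r))"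

text \<open>The local limit theorem is applied to each group and multiplied by its tilt. Its error,
  quadratic in \<kappa>, is summable against the decay of \<open>coord_decaying\<close>, with bounds
  uniform over \<open>K\<close>; the limit factors because the Gaussian does not depend on the
  group.\<close>

lemma tilted_sum_limit:
  assumes p: "p > 0" "c = real p" and K: "compact K" "K \<subseteq> face_dom"
  shows "\<exists>C. \<forall>N>0. \<forall>r\<in>K. \<bar>sqrt (real (N * p)) ^ card J * ((2 * pi) ^ CARD('n) * tilted_sum p N r) - face_amplitude r\<bar> \<le> C / real (N * p)"
proof -
  have "compact (opt ` K)" using K(1) by (intro compact_continuous_image continuous_on_opt)
  moreover have "opt ` K \<subseteq> osimplex c" using opt(2) by blast
  ultimately obtain d0 where d0: "d0 > 0" "\<And>r i. r \<in> K \<Longrightarrow> d0 \<le> opt r $ i" "\<And>r. r \<in> K \<Longrightarrow> (\<Sum>i\<in>UNIV. opt r $ i) \<le> c - d0"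
    using osimplex_uniform[of "opt ` K" c] by blast
  define d where "d = d0 / c"
  have d: "d > 0" using d0 c by (simp add: d_def)
  obtain C1 where C1: "C1 \<ge> 0" and limit: "\<And>n y \<beta>. n \<ge> 1 \<Longrightarrow> (\<forall>i. d \<le> y $ i) \<Longrightarrow> (\<Sum>i\<in>UNIV. y $ i) \<le> 1 - d \<Longrightarrow> \<beta> \<in> int_vecs \<Longrightarrow>
    \<bar>sqrt (real n) ^ card J * ((2 * pi) ^ CARD('n) * coset_weight n y \<beta>) - gaussian y\<bar> \<le>
      C1 / real n * (1 + (norm (dual (\<beta> - real n *\<^sub>R y)))\<^sup>2)"
    using local_limit[OF d] by blast
  obtain \<delta> where \<delta>: "\<delta> > 0" "\<And>r \<kappa>. r \<in> K \<Longrightarrow> \<kappa> \<in> cone_values \<Longrightarrow> coord (mult r) \<bullet> \<kappa> \<le> - (\<delta> * norm \<kappa>)"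
    using coord_decaying[OF K] by blast
  obtain \<epsilon> where \<epsilon>: "\<epsilon> > 0" and trunc: "\<And>N r. N > 0 \<Longrightarrow> r \<in> K \<Longrightarrow>
    \<bar>tilted_sum p N r - (\<Sum>\<alpha> | \<alpha> \<in> mexps (N * p) \<and> rvec \<alpha> - real N *\<^sub>R v0 \<in> tcone.
      mweight (N * p) ((1 / c) *\<^sub>R opt r) \<alpha> * exp ((rvec \<alpha> - real N *\<^sub>R opt r) \<bullet> mult r))\<bar>
    \<le> 2 * CARD('n) * exp (- (\<epsilon> * real (N * p)))"
    using tilted_sum_cone[OF p K] by blast
  define g where "g \<kappa> = (1 + (norm \<kappa>)\<^sup>2) * exp (- (\<delta> * norm \<kappa>))" for \<kappa> :: "real ^ 'n"
  have intg: "integrable (count_space cone_values) g"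
    unfolding g_def by (rule integrable_count_space_mono[OF integrable_weighted_exp_norm[OF \<delta>(1)] cone_values_int])
  define C2 where "C2 = C1 * (\<integral>\<kappa>. g \<kappa> \<partial>count_space cone_values)"
  define D where "D = (real (card J + 1) / \<epsilon>) ^ (card J + 1)"
  define C3 where "C3 = (2 * pi) ^ CARD('n) * (2 * CARD('n)) * D"
  have "\<bar>sqrt (real (N * p)) ^ card J * ((2 * pi) ^ CARD('n) * tilted_sum p N r) - face_amplitude r\<bar> \<le> (C2 + C3) / real (N * p)"
    if N: "N > 0" and r: "r \<in> K" for N r
  proof -
    let ?n = "N * p" and ?y = "(1 / c) *\<^sub>R opt r"
    define S where "S = (\<Sum>\<alpha> | \<alpha> \<in> mexps ?n \<and> rvec \<alpha> - real N *\<^sub>R v0 \<in> tcone.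
      mweight ?n ?y \<alpha> * exp ((rvec \<alpha> - real N *\<^sub>R opt r) \<bullet> mult r))"
    define W where "W = sqrt (real ?n) ^ card J * (2 * pi) ^ CARD('n)"
    define cw where "cw \<kappa> = coset_weight ?n ?y (real N *\<^sub>R v0 + lift \<kappa>)" for \<kappa>
    define e where "e \<kappa> = exp (coord (mult r) \<bullet> \<kappa>)" for \<kappa>
    have n1: "?n \<ge> 1" using N p(1) by (simp add: Suc_leI)
    have W0: "W \<ge> 0" by (simp add: W_def)
    have q: "opt r \<in> Fc" using r K(2) opt_Fc by blast
    have y: "\<forall>i. d \<le> ?y $ i" "(\<Sum>i\<in>UNIV. ?y $ i) \<le> 1 - d"
      using d0(2,3)[OF r] c by (auto simp: d_def divide_right_mono sum_divide_distrib[symmetric] field_simps)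
    have ny: "real ?n *\<^sub>R ?y = real N *\<^sub>R opt r" using p by simp
    have S: "S = (\<integral>\<kappa>. e \<kappa> * cw \<kappa> \<partial>count_space cone_values)"
      unfolding S_def e_def cw_def by (rule cone_sum_eq[OF q mult_span[OF q]])
    have pw: "\<bar>W * cw \<kappa> - gaussian ?y\<bar> \<le> C1 / real ?n * (1 + (norm \<kappa>)\<^sup>2)" if \<kappa>: "\<kappa> \<in> cone_values" for \<kappa>
    proof -
      have \<beta>: "real N *\<^sub>R v0 + lift \<kappa> \<in> int_vecs"
        using lift[OF \<kappa>] v0 by (intro int_vecs_add int_vecs_scale_nat) auto
      \<comment> \<open>In normal coordinates the distance of the group from the mean is \<kappa>
        itself, free of \<open>N\<close> and \<open>r\<close>, since \<open>v0 - opt r\<close> has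
        dual 0.\<close>
      have "dual (real N *\<^sub>R v0 + lift \<kappa> - real N *\<^sub>R opt r) = real N *\<^sub>R dual (v0 - opt r) + dual (lift \<kappa>)"
        by (simp add: linear_add[OF linear_dual, symmetric] linear_scale[OF linear_dual, symmetric] algebra_simps)
      then have "dual (real N *\<^sub>R v0 + lift \<kappa> - real ?n *\<^sub>R ?y) = \<kappa>"
        unfolding ny using dual_flat[OF q] lift[OF \<kappa>] by simp
      then show ?thesis using limit[OF n1 y \<beta>] by (simp add: W_def cw_def mult.assoc)
    qed
    have eg: "e \<kappa> * (1 + (norm \<kappa>)\<^sup>2) \<le> g \<kappa>" if "\<kappa> \<in> cone_values" for \<kappa>
      unfolding e_def g_def mult.commute[of "exp _"]
      by (rule mult_left_mono) (use \<delta>(2)[OF r that] in auto)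
    have mem: "coord (mult r) \<in> decaying cone_values" using \<delta> r by (auto simp: decaying_def)
    have inte: "integrable (count_space cone_values) e" unfolding e_def by (rule integrable_lattice_sum[OF cone_values_int mem])
    have diffb: "\<bar>e \<kappa> * (W * cw \<kappa> - gaussian ?y)\<bar> \<le> C1 / real ?n * g \<kappa>" if \<kappa>: "\<kappa> \<in> cone_values" for \<kappa>
    proof -
      have "\<bar>e \<kappa> * (W * cw \<kappa> - gaussian ?y)\<bar> = e \<kappa> * \<bar>W * cw \<kappa> - gaussian ?y\<bar>" by (simp add: abs_mult e_def)
      also have "\<dots> \<le> e \<kappa> * (C1 / real ?n * (1 + (norm \<kappa>)\<^sup>2))" by (intro mult_left_mono pw \<kappa>) (simp add: e_def)
      also have "\<dots> = C1 / real ?n * (e \<kappa> * (1 + (norm \<kappa>)\<^sup>2))" by simp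
      also have "\<dots> \<le> C1 / real ?n * g \<kappa>" using C1 by (intro mult_left_mono eg \<kappa>) simp
      finally show ?thesis .
    qed
    have intd: "integrable (count_space cone_values) (\<lambda>\<kappa>. e \<kappa> * (W * cw \<kappa> - gaussian ?y))"
    proof (rule Bochner_Integration.integrable_bound[OF integrable_mult_right[OF intg, of "C1 / real ?n"]])
      have "norm (e \<kappa> * (W * cw \<kappa> - gaussian ?y)) \<le> norm (C1 / real ?n * g \<kappa>)" if "\<kappa> \<in> cone_values" for \<kappa>
        unfolding real_norm_def by (rule order_trans[OF diffb[OF that] abs_ge_self])
      then show "AE \<kappa> in count_space cone_values. norm (e \<kappa> * (W * cw \<kappa> - gaussian ?y)) \<le> norm (C1 / real ?n * g \<kappa>)"
        by (intro AE_I2) simp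
    qed simp
    have "(\<integral>\<kappa>. e \<kappa> * (W * cw \<kappa> - gaussian ?y) \<partial>count_space cone_values) + gaussian ?y * (\<integral>\<kappa>. e \<kappa> \<partial>count_space cone_values)
        = (\<integral>\<kappa>. e \<kappa> * (W * cw \<kappa> - gaussian ?y) + gaussian ?y * e \<kappa> \<partial>count_space cone_values)"
      using intd inte by simp
    also have "\<dots> = (\<integral>\<kappa>. W * (e \<kappa> * cw \<kappa>) \<partial>count_space cone_values)" by (simp add: algebra_simps)
    also have "\<dots> = W * S" by (simp add: S)
    finally have eq: "W * S - face_amplitude r = (\<integral>\<kappa>. e \<kappa> * (W * cw \<kappa> - gaussian ?y) \<partial>count_space cone_values)"
      by (simp add: face_amplitude_def lattice_sum_def e_def)
    have "\<bar>W * S - face_amplitude r\<bar> \<le> (\<integral>\<kappa>. \<bar>e \<kappa> * (W * cw \<kappa> - gaussian ?y)\<bar> \<partial>count_space cone_values)"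
      unfolding eq by (rule integral_abs_bound)
    also have "\<dots> \<le> (\<integral>\<kappa>. C1 / real ?n * g \<kappa> \<partial>count_space cone_values)"
      by (rule integral_mono[OF integrable_abs[OF intd] integrable_mult_right[OF intg]]) (use diffb in auto)
    also have "\<dots> = C2 / real ?n" by (simp add: C2_def)
    finally have A: "\<bar>W * S - face_amplitude r\<bar> \<le> C2 / real ?n" .
    have "\<bar>W * tilted_sum p N r - W * S\<bar> = W * \<bar>tilted_sum p N r - S\<bar>" using W0 by (simp add: abs_mult right_diff_distrib[symmetric])
    also have "\<dots> \<le> W * (2 * CARD('n) * exp (- (\<epsilon> * real ?n)))"
      using W0 trunc[OF N r] unfolding S_def by (intro mult_left_mono)
    also have "\<dots> \<le> C3 / real ?n"
    proof -
      have "real 1 \<le> real ?n" using n1 by (rule of_nat_mono)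
      then have "real ?n * 1 \<le> real ?n * real ?n" by (intro mult_left_mono) auto
      then have "sqrt (real ?n) \<le> real ?n" by (intro real_le_lsqrt) (simp_all only: power2_eq_square mult_1_right of_nat_0_le_iff)
      then have "sqrt (real ?n) ^ card J \<le> real ?n ^ card J" by (intro power_mono real_sqrt_ge_zero of_nat_0_le_iff)
      then have "sqrt (real ?n) ^ card J * real ?n \<le> real ?n ^ (card J + 1)"
        unfolding power_add power_one_right by (rule mult_right_mono) simp
      also have "\<dots> \<le> D * exp (\<epsilon> * real ?n)" unfolding D_def by (rule power_times_exp_bound) (use \<epsilon> in auto)
      finally have "sqrt (real ?n) ^ card J * exp (- (\<epsilon> * real ?n)) \<le> D / real ?n"
        using n1 by (simp add: exp_minus field_simps)
      then have "(2 * pi) ^ CARD('n) * (2 * CARD('n)) * (sqrt (real ?n) ^ card J * exp (- (\<epsilon> * real ?n))) \<le> (2 * pi) ^ CARD('n) * (2 * CARD('n)) * (D / real ?n)"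
        by (rule mult_left_mono) simp
      then show ?thesis by (simp add: W_def C3_def mult_ac)
    qed
    finally have B: "\<bar>W * tilted_sum p N r - W * S\<bar> \<le> C3 / real ?n" .
    have "sqrt (real ?n) ^ card J * ((2 * pi) ^ CARD('n) * tilted_sum p N r) = W * tilted_sum p N r"
      unfolding W_def by (simp only: mult.assoc)
    then show ?thesis using A B unfolding add_divide_distrib by linarith
  qed
  then show ?thesis by blast
qed

lemma smooth_on_face_amplitude: "smooth_on face_amplitude face_dom"
proof -
  have "(\<lambda>r. (1 / c) *\<^sub>R opt r) ` face_dom \<subseteq> osimplex 1"
    using opt(2) c by (auto simp: osimplex_def sum_divide_distrib[symmetric])
  moreover have "smooth_on (\<lambda>r. ((1 / c) *\<^sub>R opt r) \<bullet> i) face_dom" if "i \<in> Basis" for i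
  proof -
    have "\<exists>k. i = axis k 1" using that by (auto simp: Basis_vec_def)
    then obtain k where "i = axis k 1" by blast
    then have "(\<lambda>r. ((1 / c) *\<^sub>R opt r) \<bullet> i) = (\<lambda>r. (1 / c) * opt r $ k)" by (simp add: inner_axis fun_eq_iff)
    then show ?thesis by (simp only:) (intro smooth_on_mult smooth_on_const open_face_dom smooth_on_opt_mult)
  qed
  ultimately have 1: "smooth_on (\<lambda>r. gaussian ((1 / c) *\<^sub>R opt r)) face_dom"
    by (rule smooth_on_compose[OF open_face_dom open_osimplex _ smooth_on_gaussian])
  have im: "(\<lambda>r. coord (mult r)) ` face_dom \<subseteq> decaying cone_values"
  proof (clarify)
    fix r assume "r \<in> face_dom"
    then obtain \<delta> where "\<delta> > 0" "\<forall>\<kappa>\<in>cone_values. coord (mult r) \<bullet> \<kappa> \<le> - (\<delta> * norm \<kappa>)" using coord_decaying[of "{r}"] by auto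
    then show "coord (mult r) \<in> decaying cone_values" by (auto simp: decaying_def)
  qed
  have sc: "smooth_on (\<lambda>r. coord (mult r) \<bullet> i) face_dom" for i
  proof (rule smooth_on_compose[OF open_face_dom open_UNIV, of mult "\<lambda>u. coord u \<bullet> i"])
    have "bounded_linear coord" using coord(1) linear_conv_bounded_linear by blast
    then show "smooth_on (\<lambda>u. coord u \<bullet> i) UNIV"
      by (intro smooth_on_linear open_UNIV bounded_linear_compose[OF bounded_linear_inner_left])
    show "smooth_on (\<lambda>r. mult r \<bullet> j) face_dom" if "j \<in> Basis" for j
      using that smooth_on_opt_mult(2) by (auto simp: Basis_vec_def inner_axis)
  qed auto
  have "smooth_on (\<lambda>r. lattice_sum cone_values (coord (mult r))) face_dom"
    by (rule smooth_on_compose[OF open_face_dom open_decaying im smooth_on_lattice_sum[OF cone_values_int] sc])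
  then show ?thesis unfolding face_amplitude_def[abs_def] by (intro smooth_on_mult open_face_dom 1)
qed

end

section \<open>Exponential tilting of the multinomial law\<close>

lemma mweight_mom:
  fixes r :: "real ^ 'n"
  assumes "\<alpha> \<in> mexps n"
  shows "mweight n (mom 1 r) \<alpha> = mcoef n \<alpha> * exp (r \<bullet> rvec \<alpha> - real n * log_partition r)"
proof -
  let ?Z = "partition_fun r" and ?s = "\<Sum>j\<in>UNIV. \<alpha> $ j"
  have Z: "?Z > 0" by (rule partition_fun_pos)
  have le: "?s \<le> n" using assms by (simp add: mexps_def)
  have "(\<Prod>j\<in>UNIV. mom 1 r $ j ^ \<alpha> $ j) = (\<Prod>j\<in>UNIV. exp (r $ j * real (\<alpha> $ j)) / ?Z ^ \<alpha> $ j)"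
    by (simp add: mom_def power_divide exp_of_nat_mult[symmetric] mult.commute)
  also have "\<dots> = exp (r \<bullet> rvec \<alpha>) / ?Z ^ ?s"
    by (simp add: prod_dividef power_sum exp_sum[symmetric] inner_vec_def)
  finally have 1: "(\<Prod>j\<in>UNIV. mom 1 r $ j ^ \<alpha> $ j) = exp (r \<bullet> rvec \<alpha>) / ?Z ^ ?s" .
  have "(\<Sum>j\<in>UNIV. mom 1 r $ j) = (?Z - 1) / ?Z"
    by (simp add: mom_def partition_fun_def sum_divide_distrib[symmetric])
  then have 2: "1 - (\<Sum>j\<in>UNIV. mom 1 r $ j) = 1 / ?Z" using Z by (simp add: field_simps)
  have "?Z ^ ?s * ?Z ^ (n - ?s) = ?Z ^ n" using le by (simp flip: power_add)
  moreover have "?Z ^ n = exp (real n * log_partition r)"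
    using Z by (simp add: log_partition_def exp_of_nat_mult)
  ultimately show ?thesis unfolding mweight_def 1 2
    by (simp add: power_one_over exp_diff)
qed

lemma mom_scaled: "(1 / c) *\<^sub>R mom c s = mom 1 s" if "c \<noteq> 0"
  using that by (simp add: mom_def vec_eq_iff)

context face_body
begin

text \<open>The weights form an exponential family with parameter \<open>r\<close>, so passing to
  \<open>r - mult r\<close> multiplies each of them by an exponential affine in \<alpha>. Centring
  its linear part at \<open>N\<close> times \<open>opt r\<close> leaves precisely the factor with
  \<open>decay\<close>.\<close>

lemma mass_tilt:
  assumes p: "p > 0" "c = real p" and z: "z \<in> ctorus"
  shows "(\<Sum>\<alpha>\<in>exponents N P. mweight (N * p) (moment_map z) \<alpha>) =
    exp (- (real N * decay (log_mod z))) * tilted_sum p N (log_mod z)"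
proof -
  let ?r = "log_mod z" and ?n = "N * p"
  have PS: "P \<subseteq> scaled_simplex p" unfolding scaled_simplex_eq[OF p(1)] using P(3) p(2) by simp
  have 1: "moment_map z = mom 1 ?r" using log_mod(3)[OF z, of 1] by simp
  have 2: "(1 / c) *\<^sub>R opt ?r = mom 1 (?r - mult ?r)"
    using mom_scaled[of c "?r - mult ?r"] mom_mult[of ?r] c by simp
  have "mweight ?n (mom 1 ?r) \<alpha> = exp (- (real N * decay ?r)) *
      (mweight ?n (mom 1 (?r - mult ?r)) \<alpha> * exp ((rvec \<alpha> - real N *\<^sub>R opt ?r) \<bullet> mult ?r))"
    if "\<alpha> \<in> exponents N P" for \<alpha>
  proof -
    have n: "real ?n = real N * c" using p(2) by simp
    have m: "\<alpha> \<in> mexps ?n" using finite_exponents(1)[OF PS] that by blast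
    have "exp (- (real N * decay ?r)) * (exp ((?r - mult ?r) \<bullet> rvec \<alpha> - real ?n * log_partition (?r - mult ?r)) * exp ((rvec \<alpha> - real N *\<^sub>R opt ?r) \<bullet> mult ?r))
      = exp (?r \<bullet> rvec \<alpha> - real ?n * log_partition ?r)"
      unfolding mult_exp_exp decay_def n
      by (rule arg_cong[of _ _ exp]) (simp add: inner_diff_left inner_commute[of "mult ?r"] algebra_simps)
    then show ?thesis unfolding mweight_mom[OF m] by (simp add: mult_ac)
  qed
  then show ?thesis unfolding tilted_sum_def 1 2 sum_distrib_left by (intro sum.cong) auto
qed

theorem face_region_asymptotics:
  assumes p: "p > 0" "c = real p"
    and ratio: "\<forall>\<^sub>F N in sequentially. exponents N P \<noteq> {} \<and>
      \<bar>fact (N * p + CARD('n)) / fact (N * p) / card (exponents N P) - c0\<bar> \<le> C0 / real N"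
  shows "\<exists>cF :: complex ^ 'n \<Rightarrow> real. smooth_on cF (interior (face_region p P Fc)) \<and>
    (\<forall>K. compact K \<longrightarrow> K \<subseteq> interior (face_region p P Fc) \<longrightarrow>
      (\<exists>C. \<forall>\<^sub>F N in sequentially. \<forall>z\<in>K. \<exists>r. \<bar>r\<bar> \<le> C / real N \<and>
        expected_mass p N P z = real N powr (- (real (card J) / 2)) *
          exp (- (real N * decay_fun p P z)) * (cF z + r)))"
proof -
  \<comment> \<open>Collects the factors left over once the power of \<open>N\<close> is split off:
    the powers of \<open>p\<close> from \<open>sqrt (N * p)\<close> and the Fourier
    normalisation.\<close>
  define k where "k = 1 / (sqrt (real p) ^ card J * (2 * pi) ^ CARD('n))"
  have k: "k > 0" using p by (simp add: k_def)
  define cF where "cF z = c0 * k * face_amplitude (log_mod z)" for z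
  let ?I = "interior (face_region p P Fc)"
  have I: "?I \<subseteq> ctorus" "log_mod ` ?I \<subseteq> face_dom" using log_mod_interior_face_region[OF p(2)] by blast+
  have smlog: "smooth_on (\<lambda>z. log_mod z \<bullet> i) ?I" if "i \<in> Basis" for i
    using that smooth_on_subset[OF smooth_on_log_mod I(1)] by (auto simp: Basis_vec_def inner_axis)
  have "smooth_on (\<lambda>z. face_amplitude (log_mod z)) ?I"
    by (rule smooth_on_compose[OF open_interior open_face_dom I(2) smooth_on_face_amplitude smlog])
  then have sm: "smooth_on cF ?I" unfolding cF_def by (intro smooth_on_mult smooth_on_const open_interior)
  have contlog: "continuous_on ?I log_mod"
  proof -
    have "continuous_on ?I (\<lambda>z. log_mod z $ j)" for j
      using smooth_on_subset[OF smooth_on_log_mod I(1), of j] Ck_on_imp_continuous unfolding smooth_on_def by blast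
    then have "continuous_on ?I (\<lambda>z. \<chi> j. log_mod z $ j)" by (rule continuous_on_vec_lambda)
    then show ?thesis by simp
  qed
  have PS: "P \<subseteq> scaled_simplex p" unfolding scaled_simplex_eq[OF p(1)] using P(3) p(2) by simp
  have mb: "moment_body (real p) P" using moment_body_axioms p(2) by simp
  have "\<exists>C. \<forall>\<^sub>F N in sequentially. \<forall>z\<in>K. \<exists>r. \<bar>r\<bar> \<le> C / real N \<and>
        expected_mass p N P z = real N powr (- (real (card J) / 2)) *
          exp (- (real N * decay_fun p P z)) * (cF z + r)"
    if K: "compact K" "K \<subseteq> ?I" for K
  proof -
    let ?L = "log_mod ` K"
    have L: "compact ?L" "?L \<subseteq> face_dom"
      using K I(2) continuous_on_subset[OF contlog K(2)] by (auto intro: compact_continuous_image)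
    obtain C1 where C1: "\<And>N r. N > 0 \<Longrightarrow> r \<in> ?L \<Longrightarrow>
        \<bar>sqrt (real (N * p)) ^ card J * ((2 * pi) ^ CARD('n) * tilted_sum p N r) - face_amplitude r\<bar> \<le> C1 / real (N * p)"
      using tilted_sum_limit[OF p L] by blast
    have "continuous_on face_dom face_amplitude"
      using smooth_on_face_amplitude Ck_on_imp_continuous unfolding smooth_on_def by blast
    then have "compact (face_amplitude ` ?L)"
      by (intro compact_continuous_image L(1)) (rule continuous_on_subset[OF _ L(2)])
    then obtain B where B: "\<And>r. r \<in> ?L \<Longrightarrow> \<bar>face_amplitude r\<bar> \<le> B"
      using compact_imp_bounded[THEN bounded_iff[THEN iffD1]] by (metis image_eqI real_norm_def)
    define C where "C = k * (\<bar>C0\<bar> * (\<bar>B\<bar> + \<bar>C1\<bar>) + \<bar>c0\<bar> * \<bar>C1\<bar>)"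
    have "\<forall>\<^sub>F N in sequentially. \<forall>z\<in>K. \<exists>r. \<bar>r\<bar> \<le> C / real N \<and>
        expected_mass p N P z = real N powr (- (real (card J) / 2)) *
          exp (- (real N * decay_fun p P z)) * (cF z + r)"
      using ratio eventually_gt_at_top[of 0]
    proof eventually_elim
      case (elim N)
      define \<rho> where "\<rho> = fact (N * p + CARD('n)) / fact (N * p) / real (card (exponents N P))"
      have N: "N > 0" "real N \<ge> 1" and ne: "exponents N P \<noteq> {}" and \<rho>: "\<bar>\<rho> - c0\<bar> \<le> C0 / real N"
        using elim by (auto simp: \<rho>_def)
      show ?case
      proof
        fix z assume z: "z \<in> K"
        let ?r = "log_mod z"
        have zt: "z \<in> ctorus" using z K(2) I(1) by blast
        have rL: "?r \<in> ?L" using z by blast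
        define X where "X = sqrt (real (N * p)) ^ card J * ((2 * pi) ^ CARD('n) * tilted_sum p N ?r)"
        let ?F = "face_amplitude ?r"
        have "C1 / real (N * p) \<le> \<bar>C1\<bar> / real N"
          using N(1) p(1) by (intro frac_le) (auto simp: Suc_leI)
        then have XF: "\<bar>X - ?F\<bar> \<le> \<bar>C1\<bar> / real N" using C1[OF N(1) rL] by (simp add: X_def)
        have C1N: "\<bar>C1\<bar> / real N \<le> \<bar>C1\<bar>" using N(2) by (simp add: divide_le_eq mult_le_cancel_left1)
        have Xb: "\<bar>X\<bar> \<le> \<bar>B\<bar> + \<bar>C1\<bar>" using XF C1N B[OF rL] by linarith
        \<comment> \<open>Two errors of order \<open>1 / N\<close> enter: that of the ratio \<rho>,
          against the bounded \<open>X\<close>, and that of \<open>X\<close>, against the constant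
          \<open>c0\<close>.\<close>
        define e where "e = k * (\<rho> * X - c0 * ?F)"
        have "\<rho> * X - c0 * ?F = (\<rho> - c0) * X + c0 * (X - ?F)" by (simp add: algebra_simps)
        then have "\<bar>\<rho> * X - c0 * ?F\<bar> \<le> \<bar>\<rho> - c0\<bar> * \<bar>X\<bar> + \<bar>c0\<bar> * \<bar>X - ?F\<bar>"
          using abs_triangle_ineq[of "(\<rho> - c0) * X" "c0 * (X - ?F)"] by (simp add: abs_mult)
        also have "\<dots> \<le> (\<bar>C0\<bar> / real N) * (\<bar>B\<bar> + \<bar>C1\<bar>) + \<bar>c0\<bar> * (\<bar>C1\<bar> / real N)"
        proof (intro add_mono mult_mono mult_left_mono Xb XF)
          show "\<bar>\<rho> - c0\<bar> \<le> \<bar>C0\<bar> / real N" by (rule order_trans[OF \<rho>]) (simp add: divide_right_mono)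
        qed auto
        also have "\<dots> = (\<bar>C0\<bar> * (\<bar>B\<bar> + \<bar>C1\<bar>) + \<bar>c0\<bar> * \<bar>C1\<bar>) / real N" by (simp add: add_divide_distrib)
        finally have "k * \<bar>\<rho> * X - c0 * ?F\<bar> \<le> k * ((\<bar>C0\<bar> * (\<bar>B\<bar> + \<bar>C1\<bar>) + \<bar>c0\<bar> * \<bar>C1\<bar>) / real N)"
          using k by (intro mult_left_mono) auto
        then have eb: "\<bar>e\<bar> \<le> C / real N" using k by (simp add: e_def C_def abs_mult)
        have sN: "sqrt (real N) ^ card J = real N powr (real (card J) / 2)"
          using N(1) by (simp add: powr_half_sqrt[symmetric] powr_realpow[symmetric] powr_powr)
        have "X = real N powr (real (card J) / 2) * tilted_sum p N ?r / k"
          using p(1) by (simp add: X_def k_def real_sqrt_mult power_mult_distrib sN)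
        then have T: "tilted_sum p N ?r = real N powr (- (real (card J) / 2)) * (k * X)"
          using k N(1) by (simp add: powr_minus field_simps)
        have "expected_mass p N P z = \<rho> * (exp (- (real N * decay ?r)) * tilted_sum p N ?r)"
          using expected_mass_eq_mweight[OF PS ne] mass_tilt[OF p zt] by (simp add: \<rho>_def)
        also have "\<dots> = real N powr (- (real (card J) / 2)) * exp (- (real N * decay ?r)) * (cF z + e)"
          unfolding T by (simp add: cF_def e_def algebra_simps)
        also have "decay ?r = decay_fun p P z" using decay_fun_eq[OF mb zt] p(2) by simp
        finally show "\<exists>r. \<bar>r\<bar> \<le> C / real N \<and>
          expected_mass p N P z = real N powr (- (real (card J) / 2)) *
            exp (- (real N * decay_fun p P z)) * (cF z + r)" using eb by blast
      qed
    qed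
    then show ?thesis by blast
  qed
  then show ?thesis using sm by blast
qed

end

section \<open>Asymptotics on the allowed region\<close>

lemma card_exponents:
  fixes P :: "(real ^ 'n) set"
  assumes "P \<subseteq> scaled_simplex p"
  shows "card (exponents N P) = card (int_vecs \<inter> (\<lambda>x. real N *\<^sub>R x) ` P)"
proof (rule bij_betw_same_card[of rvec])
  show "bij_betw rvec (exponents N P) (int_vecs \<inter> (\<lambda>x. real N *\<^sub>R x) ` P)"
    unfolding bij_betw_def
  proof
    show "inj_on rvec (exponents N P)" by (rule inj_onI) (simp add: vec_eq_iff)
    show "rvec ` exponents N P = int_vecs \<inter> (\<lambda>x. real N *\<^sub>R x) ` P"
    proof (intro equalityI subsetI)
      fix x assume "x \<in> rvec ` exponents N P"
      then obtain \<alpha> where "x = rvec \<alpha>" "\<alpha> \<in> exponents N P" by blast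
      then show "x \<in> int_vecs \<inter> (\<lambda>x. real N *\<^sub>R x) ` P"
        by (simp add: exponents_def rvec_def[symmetric]) (simp add: int_vecs_def)
    next
      fix x assume x: "x \<in> int_vecs \<inter> (\<lambda>x. real N *\<^sub>R x) ` P"
      then obtain u where u: "u \<in> P" "x = real N *\<^sub>R u" by blast
      have nn: "0 \<le> x $ j" for j
        using u assms by (auto simp: scaled_simplex_def std_simplex_def)
      have "x = rvec (\<chi> j. nat \<lfloor>x $ j\<rfloor>)"
        using x nn by (auto simp: vec_eq_iff int_vecs_def elim!: Ints_cases)
      moreover from this have "(\<chi> j. nat \<lfloor>x $ j\<rfloor>) \<in> exponents N P"
        using x unfolding exponents_def rvec_def by simp
      ultimately show "x \<in> rvec ` exponents N P" by blast
    qed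
  qed
qed

lemma measure_pos_of_interior:
  fixes P :: "(real ^ 'n) set"
  assumes "compact P" "interior P \<noteq> {}"
  shows "measure lebesgue P > 0"
proof -
  have "\<not> negligible P"
    using open_not_negligible[OF open_interior assms(2)] negligible_subset[OF _ interior_subset] by blast
  then have "measure lebesgue P \<noteq> 0" using lmeasurable_compact[OF assms(1)] negligible_iff_measure by blast
  then show ?thesis using measure_nonneg[of lebesgue P] by linarith
qed

lemma fact_ratio: "fact (n + m) / fact n = (\<Prod>i<m. real (n + i + 1) :: real)"
  by (induction m) (simp_all add: field_simps)

text \<open>The quotient of factorials is a product of \<open>CARD('n)\<close> linear factors in
  \<open>N\<close>. The lattice count is eventually a polynomial, and positive volume, which follows
  from nonempty interior, fixes its degree as \<open>CARD('n)\<close> and its leading coefficient as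
  the volume.\<close>

lemma mass_ratio_expansion:
  fixes P :: "(real ^ 'n) set"
  assumes "p > 0" "integral_polytope P" "P \<subseteq> scaled_simplex p" "interior P \<noteq> {}"
  shows "\<exists>c :: nat \<Rightarrow> real. c 0 = real p ^ CARD('n) / measure lebesgue P \<and>
    (\<forall>k. \<exists>C. \<forall>\<^sub>F N in sequentially.
      \<bar>fact (N * p + CARD('n)) / fact (N * p) / card (exponents N P) - (\<Sum>j\<le>k. c j / real N ^ j)\<bar> \<le> C / real N ^ (k + 1))"
    and "\<forall>\<^sub>F N in sequentially. exponents N P \<noteq> {}"
proof -
  obtain V where V: "finite V" "\<forall>v\<in>V. \<forall>j. v $ j \<in> \<int>" "P = convex hull V"
    using assms(2) by (auto simp: integral_polytope_def)
  have cP: "compact P" "convex P" using V by (auto simp: finite_imp_compact_convex_hull)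
  define v where "v = measure lebesgue P"
  have v: "v > 0" unfolding v_def by (rule measure_pos_of_interior[OF cP(1) assms(4)])
  have "V \<subseteq> int_vecs" using V(2) by (auto simp: int_vecs_def)
  from lattice_points_eventually_poly[OF V(1) this] obtain Q where
    Q: "\<forall>\<^sub>F N in sequentially. real (card (exponents N P)) = poly Q (real N)"
    unfolding eventually_poly_def V(3)[symmetric] card_exponents[OF assms(3)] by blast
  have lim: "(\<lambda>N. real (card (exponents N P)) / real N ^ CARD('n)) \<longlonglongrightarrow> v"
    unfolding card_exponents[OF assms(3)] v_def by (rule lattice_count_tendsto_volume[OF cP])
  moreover have "\<forall>\<^sub>F N in sequentially. real (card (exponents N P)) / real N ^ CARD('n) = poly Q (real N) / real N ^ CARD('n)"
    using Q by eventually_elim simp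
  ultimately have "(\<lambda>N. poly Q (real N) / real N ^ CARD('n)) \<longlonglongrightarrow> v" by (rule Lim_transform_eventually)
  then have dQ: "degree Q = CARD('n)" "lead_coeff Q = v" using poly_over_power_tendsto v by blast+
  define R where "R = (\<Prod>i<CARD('n). [:real (i + 1), real p:])"
  have R: "poly R (real N) = fact (N * p + CARD('n)) / fact (N * p)" for N
    unfolding fact_ratio R_def poly_prod by (intro prod.cong) (auto simp: algebra_simps)
  have "(\<lambda>N. \<Prod>i<CARD('n). (real (i + 1) / real N + real p)) \<longlonglongrightarrow> (\<Prod>i<CARD('n). (0 + real p))"
    by (intro tendsto_prod tendsto_add tendsto_const lim_const_over_n)
  moreover have "\<forall>\<^sub>F N in sequentially. (\<Prod>i<CARD('n). (real (i + 1) / real N + real p)) = poly R (real N) / real N ^ CARD('n)"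
    using eventually_gt_at_top[of 0]
  proof eventually_elim
    case (elim N)
    have "poly R (real N) / real N ^ CARD('n) = (\<Prod>i<CARD('n). poly [:real (i + 1), real p:] (real N) / real N)"
      by (simp only: R_def poly_prod prod_dividef prod_constant card_lessThan)
    then show ?case using elim by (simp add: field_simps)
  qed
  ultimately have "(\<lambda>N. poly R (real N) / real N ^ CARD('n)) \<longlonglongrightarrow> (\<Prod>i<CARD('n). (0 + real p))" by (rule Lim_transform_eventually)
  then have "(\<lambda>N. poly R (real N) / real N ^ CARD('n)) \<longlonglongrightarrow> real p ^ CARD('n)" by simp
  then have dR: "degree R = CARD('n)" "lead_coeff R = real p ^ CARD('n)"
    using poly_over_power_tendsto[of R "CARD('n)" "real p ^ CARD('n)"] assms(1) by auto
  have "Q \<noteq> 0" using dQ(2) v by auto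
  then obtain c where c: "c 0 = lead_coeff R / lead_coeff Q"
    "\<And>k. \<exists>C. \<forall>\<^sub>F N in sequentially.
      \<bar>poly R (real N) / poly Q (real N) - (\<Sum>j\<le>k. c j / real N ^ j)\<bar> \<le> C / real N ^ (k + 1)"
    using poly_ratio_expansion[of R Q] dR(1) dQ(1) by auto
  have "\<exists>C. \<forall>\<^sub>F N in sequentially.
      \<bar>fact (N * p + CARD('n)) / fact (N * p) / card (exponents N P) - (\<Sum>j\<le>k. c j / real N ^ j)\<bar> \<le> C / real N ^ (k + 1)" for k
  proof -
    obtain C where "\<forall>\<^sub>F N in sequentially.
      \<bar>poly R (real N) / poly Q (real N) - (\<Sum>j\<le>k. c j / real N ^ j)\<bar> \<le> C / real N ^ (k + 1)" using c(2) by blast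
    with Q have "\<forall>\<^sub>F N in sequentially.
      \<bar>fact (N * p + CARD('n)) / fact (N * p) / card (exponents N P) - (\<Sum>j\<le>k. c j / real N ^ j)\<bar> \<le> C / real N ^ (k + 1)"
      by eventually_elim (simp add: R)
    then show ?thesis by blast
  qed
  then show "\<exists>c :: nat \<Rightarrow> real. c 0 = real p ^ CARD('n) / measure lebesgue P \<and>
    (\<forall>k. \<exists>C. \<forall>\<^sub>F N in sequentially.
      \<bar>fact (N * p + CARD('n)) / fact (N * p) / card (exponents N P) - (\<Sum>j\<le>k. c j / real N ^ j)\<bar> \<le> C / real N ^ (k + 1))"
    using c(1) by (intro exI[of _ c] conjI allI) (simp_all only: dR(2) dQ(2) v_def)
  have "\<forall>\<^sub>F N in sequentially. 0 < real (card (exponents N P)) / real N ^ CARD('n)"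
    using order_tendstoD(1)[OF lim v] .
  then show "\<forall>\<^sub>F N in sequentially. exponents N P \<noteq> {}" by eventually_elim auto
qed

lemma continuous_on_moment_map: "continuous_on S moment_map"
  unfolding moment_map_def
  by (intro continuous_on_vec_lambda continuous_intros) (metis add_pos_nonneg less_irrefl zero_le_power2 zero_less_one)

lemma moment_map_simplex: "0 \<le> moment_map z $ j" "(\<Sum>j\<in>UNIV. moment_map z $ j) \<le> 1"
proof -
  have p: "1 + (norm z)\<^sup>2 > 0" by (simp add: add_pos_nonneg)
  show "0 \<le> moment_map z $ j" using p by (simp add: moment_map_def)
  have "(\<Sum>j\<in>UNIV. moment_map z $ j) = (norm z)\<^sup>2 / (1 + (norm z)\<^sup>2)"
    by (simp add: moment_map_def sum_divide_distrib[symmetric] norm_vec_def L2_set_def sum_nonneg)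
  then show "(\<Sum>j\<in>UNIV. moment_map z $ j) \<le> 1" using p by simp
qed

lemma allowed_region_mass:
  fixes P :: "(real ^ 'n) set"
  assumes p: "p > 0" and P: "P \<subseteq> scaled_simplex p" and K: "compact K" "K \<subseteq> allowed_region p P"
  shows "\<exists>\<epsilon>>0. \<forall>N>0. \<forall>z\<in>K. \<bar>(\<Sum>\<alpha>\<in>exponents N P. mweight (N * p) (moment_map z) \<alpha>) - 1\<bar>
    \<le> 2 * CARD('n) * exp (- (\<epsilon> * real (N * p)))"
proof -
  let ?m = "\<lambda>z. real p *\<^sub>R moment_map z"
  have "compact (?m ` K)"
    by (intro compact_continuous_image K(1) continuous_intros continuous_on_moment_map)
  moreover have "?m ` K \<subseteq> interior P" using K(2) p by (auto simp: allowed_region_def)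
  ultimately obtain e where e: "e > 0" "(\<Union>x\<in>?m ` K. ball x e) \<subseteq> interior P"
    using compact_subset_open_imp_ball_epsilon_subset[OF _ open_interior] by metis
  define \<eta> where "\<eta> = min 1 (e / real p)"
  have \<eta>: "0 < \<eta>" "\<eta> \<le> 1" using e p by (auto simp: \<eta>_def)
  define \<epsilon> where "\<epsilon> = (\<eta> / CARD('n))\<^sup>2 / 4"
  have "\<bar>(\<Sum>\<alpha>\<in>exponents N P. mweight (N * p) (moment_map z) \<alpha>) - 1\<bar> \<le> 2 * CARD('n) * exp (- (\<epsilon> * real (N * p)))"
    if N: "N > 0" and z: "z \<in> K" for N z
  proof -
    let ?n = "N * p" and ?y = "moment_map z"
    let ?B = "{\<alpha>. \<alpha> \<in> mexps ?n \<and> norm (rvec \<alpha> - real ?n *\<^sub>R ?y) \<ge> \<eta> * real ?n}"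
    have mw: "0 \<le> mweight ?n ?y \<alpha>" for \<alpha> using moment_map_simplex by (intro mweight_nonneg)
    have far: "mexps ?n - exponents N P \<subseteq> ?B"
    proof
      fix \<alpha> assume \<alpha>: "\<alpha> \<in> mexps ?n - exponents N P"
      have "(1 / real N) *\<^sub>R rvec \<alpha> \<notin> P"
      proof
        assume "(1 / real N) *\<^sub>R rvec \<alpha> \<in> P"
        then have "real N *\<^sub>R ((1 / real N) *\<^sub>R rvec \<alpha>) \<in> (\<lambda>x. real N *\<^sub>R x) ` P" by blast
        then show False using \<alpha> N by (simp add: exponents_def rvec_def)
      qed
      then have "(1 / real N) *\<^sub>R rvec \<alpha> \<notin> ball (?m z) e" using e(2) z interior_subset by blast
      then have "e \<le> norm ((1 / real N) *\<^sub>R rvec \<alpha> - ?m z)" by (simp add: dist_norm norm_minus_commute)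
      also have "(1 / real N) *\<^sub>R rvec \<alpha> - ?m z = (1 / real N) *\<^sub>R (rvec \<alpha> - real ?n *\<^sub>R ?y)"
        using N by (simp add: scaleR_diff_right)
      finally have "e \<le> norm (rvec \<alpha> - real ?n *\<^sub>R ?y) / real N" unfolding norm_scaleR by simp
      then have "e * real N \<le> norm (rvec \<alpha> - real ?n *\<^sub>R ?y)" using N by (simp add: pos_le_divide_eq)
      moreover have "\<eta> * real ?n \<le> e / real p * real ?n" unfolding \<eta>_def by (intro mult_right_mono) auto
      moreover have "e / real p * real ?n = e * real N" using p by simp
      ultimately show "\<alpha> \<in> ?B" using \<alpha> by auto
    qed
    have "(\<Sum>\<alpha>\<in>mexps ?n - exponents N P. mweight ?n ?y \<alpha>) = 1 - (\<Sum>\<alpha>\<in>exponents N P. mweight ?n ?y \<alpha>)"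
      using sum_diff[OF finite_mexps finite_exponents(1)[OF P], of "mweight ?n ?y"] mweight_sum[of ?n ?y] by simp
    moreover have "0 \<le> (\<Sum>\<alpha>\<in>mexps ?n - exponents N P. mweight ?n ?y \<alpha>)" using mw by (intro sum_nonneg)
    moreover have "(\<Sum>\<alpha>\<in>mexps ?n - exponents N P. mweight ?n ?y \<alpha>) \<le> (\<Sum>\<alpha>\<in>?B. mweight ?n ?y \<alpha>)"
      using far mw finite_mexps by (intro sum_mono2) auto
    moreover have "(\<Sum>\<alpha>\<in>?B. mweight ?n ?y \<alpha>) \<le> 2 * CARD('n) * exp (- (\<epsilon> * real ?n))"
      using mweight_tail[of ?y \<eta> ?n, OF moment_map_simplex \<eta>] by (simp add: \<epsilon>_def mult.commute)
    ultimately show ?thesis by linarith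
  qed
  moreover have "\<epsilon> > 0" using \<eta> by (simp add: \<epsilon>_def)
  ultimately show ?thesis by blast
qed

theorem allowed_region_expansion:
  fixes P :: "(real ^ 'n) set" and c :: "nat \<Rightarrow> real"
  assumes p: "p > 0" and P: "P \<subseteq> scaled_simplex p" and K: "compact K" "K \<subseteq> allowed_region p P"
    and ne: "\<forall>\<^sub>F N in sequentially. exponents N P \<noteq> {}"
    and ratio: "\<And>k. \<exists>C. \<forall>\<^sub>F N in sequentially.
      \<bar>fact (N * p + CARD('n)) / fact (N * p) / card (exponents N P) - (\<Sum>j\<le>k. c j / real N ^ j)\<bar> \<le> C / real N ^ (k + 1)"
  shows "\<exists>C. \<forall>\<^sub>F N in sequentially. \<forall>z\<in>K.
    \<bar>expected_mass p N P z - (\<Sum>j\<le>k. c j / real N ^ j)\<bar> \<le> C / real N ^ (k + 1)"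
proof -
  define \<rho> where "\<rho> N = fact (N * p + CARD('n)) / fact (N * p) / real (card (exponents N P))" for N
  obtain C0 where C0: "\<forall>\<^sub>F N in sequentially. \<bar>\<rho> N - c 0\<bar> \<le> C0 / real N"
    using ratio[of 0] by (auto simp: \<rho>_def)
  obtain Ck where Ck: "\<forall>\<^sub>F N in sequentially. \<bar>\<rho> N - (\<Sum>j\<le>k. c j / real N ^ j)\<bar> \<le> Ck / real N ^ (k + 1)"
    using ratio[of k] by (auto simp: \<rho>_def)
  obtain \<epsilon> where \<epsilon>: "\<epsilon> > 0" "\<And>N z. N > 0 \<Longrightarrow> z \<in> K \<Longrightarrow> \<bar>(\<Sum>\<alpha>\<in>exponents N P. mweight (N * p) (moment_map z) \<alpha>) - 1\<bar>
    \<le> 2 * CARD('n) * exp (- (\<epsilon> * real (N * p)))"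
    using allowed_region_mass[OF p P K] by blast
  \<comment> \<open>Chosen by \<open>power_times_exp_bound\<close>, so that the exponentially small
    defect of the mass is below the required power of \<open>1 / N\<close>.\<close>
  define D where "D = (real (k + 1) / \<epsilon>) ^ (k + 1)"
  define B where "B = \<bar>c 0\<bar> + \<bar>C0\<bar>"
  have "\<forall>\<^sub>F N in sequentially. \<forall>z\<in>K.
    \<bar>expected_mass p N P z - (\<Sum>j\<le>k. c j / real N ^ j)\<bar> \<le> (Ck + B * (2 * CARD('n) * D)) / real N ^ (k + 1)"
    using C0 Ck ne eventually_gt_at_top[of 0]
  proof eventually_elim
    case (elim N)
    show ?case
    proof
      fix z assume z: "z \<in> K"
      let ?S = "\<Sum>\<alpha>\<in>exponents N P. mweight (N * p) (moment_map z) \<alpha>"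
      have N: "real N \<ge> 1" using elim(4) by simp
      have "C0 / real N \<le> \<bar>C0\<bar> / 1" using N by (intro frac_le) auto
      then have \<rho>B: "\<bar>\<rho> N\<bar> \<le> B" using elim(1) unfolding B_def by linarith
      have "N \<le> N * p" using p by simp
      then have "real N ^ (k + 1) \<le> real (N * p) ^ (k + 1)" by (intro power_mono of_nat_mono) auto
      also have "\<dots> \<le> D * exp (\<epsilon> * real (N * p))" unfolding D_def by (rule power_times_exp_bound) (use \<epsilon> in auto)
      finally have ex: "exp (- (\<epsilon> * real (N * p))) \<le> D / real N ^ (k + 1)"
        using N by (simp add: exp_minus field_simps)
      have "\<bar>\<rho> N * ?S - \<rho> N\<bar> = \<bar>\<rho> N\<bar> * \<bar>?S - 1\<bar>" by (simp add: abs_mult[symmetric] algebra_simps)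
      also have "\<dots> \<le> B * (2 * CARD('n) * (D / real N ^ (k + 1)))"
      proof (intro mult_mono \<rho>B)
        have "\<bar>?S - 1\<bar> \<le> 2 * CARD('n) * exp (- (\<epsilon> * real (N * p)))" by (rule \<epsilon>(2)[OF elim(4) z])
        also have "\<dots> \<le> 2 * CARD('n) * (D / real N ^ (k + 1))" by (intro mult_left_mono ex) simp
        finally show "\<bar>?S - 1\<bar> \<le> 2 * CARD('n) * (D / real N ^ (k + 1))" .
      qed (auto simp: B_def)
      finally have "\<bar>\<rho> N * ?S - \<rho> N\<bar> \<le> B * (2 * CARD('n) * D) / real N ^ (k + 1)" by simp
      moreover have "expected_mass p N P z = \<rho> N * ?S"
        using expected_mass_eq_mweight[OF P elim(3)] by (simp add: \<rho>_def)
      ultimately show "\<bar>expected_mass p N P z - (\<Sum>j\<le>k. c j / real N ^ j)\<bar> \<le> (Ck + B * (2 * CARD('n) * D)) / real N ^ (k + 1)"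
        using elim(2) unfolding add_divide_distrib by linarith
    qed
  qed
  then show ?thesis by blast
qed

theorem theorem1p2:
  fixes P :: "(real ^ 'n) set" and p :: nat
  assumes "p > 0"
    and "integral_polytope P"
    and "P \<subseteq> scaled_simplex p"
    and "\<not> P \<subseteq> frontier (scaled_simplex p)"
  shows
    "(\<exists>c :: nat \<Rightarrow> real. c 0 = real p ^ CARD('n) / measure lebesgue P \<and>
        (\<forall>K k. compact K \<longrightarrow> K \<subseteq> allowed_region p P \<longrightarrow>
           (\<exists>C. \<forall>\<^sub>F N in sequentially. \<forall>z\<in>K.
              \<bar>expected_mass p N P z - (\<Sum>j\<le>k. c j / real N ^ j)\<bar> \<le> C / real N ^ (k + 1)))) \<and>
     (interior P \<noteq> {} \<longrightarrow>
        (\<forall>F\<in>open_faces P. F \<subseteq> interior (scaled_simplex p) \<longrightarrow>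
           (\<exists>cF :: complex ^ 'n \<Rightarrow> real. smooth_on cF (interior (face_region p P F)) \<and>
              (\<forall>K. compact K \<longrightarrow> K \<subseteq> interior (face_region p P F) \<longrightarrow>
                 (\<exists>C. \<forall>\<^sub>F N in sequentially. \<forall>z\<in>K. \<exists>r. \<bar>r\<bar> \<le> C / real N \<and>
                    expected_mass p N P z =
                      real N powr (- (real_of_int (codim F) / 2)) *
                      exp (- (real N * decay_fun p P z)) * (cF z + r)))))) \<and>
     Ck_on 1 (decay_fun p P) (ctorus - closure (allowed_region p P)) \<and>
     (interior P \<noteq> {} \<longrightarrow>
        (\<forall>z \<in> ctorus - closure (allowed_region p P). decay_fun p P z > 0))"
proof (intro conjI impI ballI)
  have body: "moment_body (real p) P" by (rule body_moment_body[OF assms])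
  show "\<exists>c :: nat \<Rightarrow> real. c 0 = real p ^ CARD('n) / measure lebesgue P \<and>
        (\<forall>K k. compact K \<longrightarrow> K \<subseteq> allowed_region p P \<longrightarrow>
           (\<exists>C. \<forall>\<^sub>F N in sequentially. \<forall>z\<in>K.
              \<bar>expected_mass p N P z - (\<Sum>j\<le>k. c j / real N ^ j)\<bar> \<le> C / real N ^ (k + 1)))"
  proof (cases "interior P = {}")
    \<comment> \<open>No compact set other than the empty one is tested, and a constant sequence
      supplies the prescribed value of \<open>c 0\<close>.\<close>
    case True
    then have "allowed_region p P = {}" by (simp add: allowed_region_def)
    then show ?thesis
      by (intro exI[of _ "\<lambda>_. real p ^ CARD('n) / measure lebesgue P"]) simp
  next
    case False
    obtain c :: "nat \<Rightarrow> real" where c: "c 0 = real p ^ CARD('n) / measure lebesgue P"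
      "\<And>k. \<exists>C. \<forall>\<^sub>F N in sequentially.
        \<bar>fact (N * p + CARD('n)) / fact (N * p) / card (exponents N P) - (\<Sum>j\<le>k. c j / real N ^ j)\<bar> \<le> C / real N ^ (k + 1)"
      using mass_ratio_expansion(1)[OF assms(1-3) False] by blast
    show ?thesis
      using c(1) allowed_region_expansion[OF assms(1,3) _ _ mass_ratio_expansion(2)[OF assms(1-3) False] c(2)]
      by (intro exI[of _ c]) blast
  qed
  show "Ck_on 1 (decay_fun p P) (ctorus - closure (allowed_region p P))"
    by (rule decay_fun_C1[OF body]) (auto intro: open_Diff open_ctorus)
  show "decay_fun p P z > 0" if "interior P \<noteq> {}" "z \<in> ctorus - closure (allowed_region p P)" for z
    by (rule decay_fun_pos[OF body that])
  fix F assume int: "interior P \<noteq> {}" and F: "F \<in> open_faces P" "F \<subseteq> interior (scaled_simplex p)"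
  obtain c :: "nat \<Rightarrow> real" where c: "\<And>k. \<exists>C. \<forall>\<^sub>F N in sequentially.
        \<bar>fact (N * p + CARD('n)) / fact (N * p) / card (exponents N P) - (\<Sum>j\<le>k. c j / real N ^ j)\<bar> \<le> C / real N ^ (k + 1)"
    using mass_ratio_expansion(1)[OF assms(1-3) int] by blast
  obtain C0 where C0: "\<forall>\<^sub>F N in sequentially.
        \<bar>fact (N * p + CARD('n)) / fact (N * p) / card (exponents N P) - c 0\<bar> \<le> C0 / real N"
    using c[of 0] by auto
  have ratio: "\<forall>\<^sub>F N in sequentially. exponents N P \<noteq> {} \<and>
        \<bar>fact (N * p + CARD('n)) / fact (N * p) / card (exponents N P) - c 0\<bar> \<le> C0 / real N"
    using C0 mass_ratio_expansion(2)[OF assms(1-3) int] by eventually_elim blast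
  have osF: "F \<subseteq> osimplex (real p)" using F(2) unfolding scaled_simplex_eq[OF assms(1)] interior_csimplex .
  obtain A b v0 where f: "face_body (real p) P b A F v0" "codim F = int (card (primitive_system.J b))"
    using face_body_exists[OF body assms(2) F(1) osF] by blast
  interpret face_body "real p" P b A F v0 by (rule f(1))
  show "\<exists>cF :: complex ^ 'n \<Rightarrow> real. smooth_on cF (interior (face_region p P F)) \<and>
              (\<forall>K. compact K \<longrightarrow> K \<subseteq> interior (face_region p P F) \<longrightarrow>
                 (\<exists>C. \<forall>\<^sub>F N in sequentially. \<forall>z\<in>K. \<exists>r. \<bar>r\<bar> \<le> C / real N \<and>
                    expected_mass p N P z =
                      real N powr (- (real_of_int (codim F) / 2)) *
                      exp (- (real N * decay_fun p P z)) * (cF z + r)))"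
    using face_region_asymptotics[OF assms(1) refl ratio] f(2) by simp
qed

end
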